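(* Let $M$ be a Kähler manifold (with real analytic metric), $p\in M$ and $Z\in T_pM$, and let $\theta$ be the Kähler normal potential with critical part $\theta^{\mathrm{crit}}$ and part $\theta^{\mathrm{free}}$. The directional derivative $Z\lrcorner\theta^{\mathrm{crit}}$ of $\theta^{\mathrm{crit}}$ at $p$ in direction $Z$ decomposes as $$Z\lrcorner\theta^{\mathrm{crit}}=\mathrm{pr}_{[1]}(Z\lrcorner\theta^{\mathrm{crit}})+\mathrm{pr}_{\ge(2,2)}(Z\lrcorner\theta^{\mathrm{crit}}),$$ where $\mathrm{pr}_{\ge(2,2)}(Z\lrcorner\theta^{\mathrm{crit}})\in\overline{\mathrm{Sym}}^{\ge(2,2)}T_p^*M$, and $\mathrm{pr}_{[1]}(Z\lrcorner\theta^{\mathrm{crit}})\in\overline{\mathrm{Sym}}_{[1]}T_p^*M$ is the closure of the real part of a holomorphic vector field which determines the (Taylor series in $0$ of the) holomorphically extended vector field $Z^{\mathrm{knc}}$ via $$Z^{\mathrm{knc}}=Z-\tfrac12\,\mathrm{cl}^{-1}\big(\mathrm{pr}_{[1]}(Z\lrcorner\theta^{\mathrm{crit}})\big).$$ Moreover the covariant derivative of the Kähler normal potential is $$\nabla_Z\theta=\mathrm{pr}_{\ge(2,2)}\big(Z\lrcorner\theta^{\mathrm{free}}\big)-\tfrac12\,\mathrm{cl}^{-1}\big(\mathrm{pr}_{[1]}(Z\lrcorner\theta^{\mathrm{crit}})\big)\,\theta^{\mathrm{free}},$$ where in the last term the formal vector field $\mathrm{cl}^{-1}(\ldots)$ on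 $T_pM$ acts on the power series $\theta^{\mathrm{free}}$ as a derivation.
   Context: A Kähler manifold is a smooth manifold $M$ with a Riemannian metric $g$ and an orthogonal almost complex structure $I$ with $\nabla I=0$ for the Levi-Civita connection $\nabla$; $\omega(X,Y)=g(IX,Y)$. A local potential is a real function $\theta^{\mathrm{loc}}$ on an open set with $\omega=\frac i2\partial\overline\partial\theta^{\mathrm{loc}}$. Bidegrees: $\mathrm{Sym}^{\kappa,\overline\kappa}T_p^*M$ is the space of complex valued polynomials $\eta$ on $T_pM$, homogeneous of degree $\kappa+\overline\kappa$, with $\frac d{dt}|_0\eta(X+tI_pX)=i(\kappa-\overline\kappa)\eta(X)$ (degree $\kappa$ in holomorphic, $\overline\kappa$ in antiholomorphic linear coordinates). Every real formal power series on $T_pM$ (element of $\overline{\mathrm{Sym}}\,T_p^*M$) decomposes into bihomogeneous components. $\overline{\mathrm{Sym}}^{\ge(2,2)}T_p^*M$ is the space of real formal power series with only components with $\kappa,\overline\kappa\ge2$, and $\overline{\mathrm{Sym}}_{[1]}T_p^*M$ that of real formal power series with only components with $\kappa=1$ or $\overline\kappa=1$. $\mathrm{pr}_{\ge(2,2)}$ and $\mathrm{pr}_{[1]}$ are the corresponding projections discarding all other bihomogeneous components. $Z\lrcorner\eta$ is the directional derivative of $\eta$ in the constant direction $Z$. Anchored coordinates centered in $p$ are a smooth map $\varphi$ from a neighborhood of $0\in T_pM$ to $M$, diffeomorphic onto a neighborhood of $p$, with $\varphi(0)=p$ and differential $\mathrm{id}_{T_pM}$ at $0$. Kähler normal coordinates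 (Bochner): there are unique (as germs) anchored coordinates $\mathrm{knc}_p$ centered in $p$, holomorphic with respect to $I_p$ on $T_pM$ and $I$ on $M$, and a unique local potential $\theta_p^{\mathrm{loc}}$ near $p$ such that the Taylor series $\theta_p$ of $\theta_p^{\mathrm{loc}}\circ\mathrm{knc}_p$ in $0$ satisfies $\theta_p(X)\equiv g_p(X,X)$ modulo $\overline{\mathrm{Sym}}^{\ge(2,2)}T_p^*M$. The Kähler normal potential $\theta$ is the section $p\mapsto\theta_p$ of the bundle $\overline{\mathrm{Sym}}\,T^*M$ of formal power series; $\nabla_Z\theta$ is its componentwise Levi-Civita covariant derivative, an element of $\overline{\mathrm{Sym}}\,T_p^*M$. Write $\theta_p(X)=g_p(X,X)+\theta_p^{\mathrm{free}}(X)$ with $\theta_p^{\mathrm{free}}=\theta_p^{\mathrm{crit}}+\theta_p^{\mathrm{rest}}$, where $\theta_p^{\mathrm{rest}}$ comprises all bihomogeneous components with $\kappa,\overline\kappa\ge3$ and $\theta_p^{\mathrm{crit}}$ all those components of $\theta_p^{\mathrm{free}}$ with $\kappa=2$ or $\overline\kappa=2$ (and both $\ge2$). Holomorphically extended vector field: for a curve $\gamma$ in $M$ with $\gamma(0)=p$, $\dot\gamma(0)=Z$ and parallel transport $\mathrm{PT}^\nabla_\gamma(t):T_pM\to T_{\gamma(t)}M$, $$Z^{\mathrm{knc}}:=\frac d{dt}\Big|_0\Big(\mathrm{knc}_p^{-1}\circ\mathrm{knc}_{\gamma(t)}\circ\mathrm{PT}^\nabla_\gamma(t)\Big),$$ a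 vector field on a neighborhood of $0$ in $T_pM$, independent of the choice of $\gamma$. Closure: for a formal vector field $W$ on $T_pM$ (power series with values in $T_pM$) put $(\mathrm{cl}\,W)(X):=g_p(W(X),X)$. Let $\mathcal H^n$ be the space of $T_pM$-valued polynomials, homogeneous of degree $n$, that are holomorphic for $I_p$ (the real parts of holomorphic polynomial vector fields). For $n\ge2$ the map $\mathrm{cl}$ restricts to an isomorphism from $\mathcal H^n$ onto the homogeneous part of degree $n+1$ of $\overline{\mathrm{Sym}}_{[1]}T_p^*M$; $\mathrm{cl}^{-1}$ denotes the inverse (applied to power series with components of degree at least $3$). *)

theory Defs
  imports "HOL-Analysis.Analysis"
begin

section \<open>Smooth and real analytic functions\<close>

abbreviation dird ::
  "('a::euclidean_space \<Rightarrow> 'b::real_normed_vector) \<Rightarrow> 'a \<Rightarrow> 'a \<Rightarrow> 'b"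
  where "dird f x u \<equiv> frechet_derivative f (at x) u"

text \<open>Only used on open sets.\<close>

fun Ck_on :: "nat \<Rightarrow> ('a::euclidean_space \<Rightarrow> 'b::real_normed_vector) \<Rightarrow> 'a set \<Rightarrow> bool" where
  "Ck_on 0 f S \<longleftrightarrow> continuous_on S f"
| "Ck_on (Suc k) f S \<longleftrightarrow>
     (\<forall>x\<in>S. f differentiable (at x)) \<and> (\<forall>u. Ck_on k (\<lambda>x. dird f x u) S)"

definition smooth_on :: "('a::euclidean_space \<Rightarrow> 'b::real_normed_vector) \<Rightarrow> 'a set \<Rightarrow> bool"
  where "smooth_on f S \<longleftrightarrow> (\<forall>k. Ck_on k f S)"

inductive hom_poly :: "nat \<Rightarrow> ('a::euclidean_space \<Rightarrow> 'b::real_vector) \<Rightarrow> bool" where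
  const: "hom_poly 0 (\<lambda>_. c)"
| mult: "linear (l :: 'a \<Rightarrow> real) \<Longrightarrow> hom_poly n f \<Longrightarrow> hom_poly (Suc n) (\<lambda>x. l x *\<^sub>R f x)"
| add: "hom_poly n f \<Longrightarrow> hom_poly n h \<Longrightarrow> hom_poly n (\<lambda>x. f x + h x)"

text \<open>A formal power series on \<open>'a\<close> with values in \<open>'b\<close> is the sequence of its homogeneous
  components, the \<open>n\<close>-th one being a homogeneous polynomial of degree \<open>n\<close>.\<close>

type_synonym ('a, 'b) formal_series = "nat \<Rightarrow> 'a \<Rightarrow> 'b"

definition is_formal_series ::
  "('a::euclidean_space, 'b::real_vector) formal_series \<Rightarrow> bool"
  where "is_formal_series \<eta> \<longleftrightarrow> (\<forall>n. hom_poly n (\<eta> n))"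

text \<open>Taylor series in \<open>0\<close>: the component of degree \<open>n\<close> at \<open>X\<close> is
  \<open>(1/n!) (d/dt)^n f(t X)\<close> at \<open>t = 0\<close>.\<close>

definition taylor ::
  "('a::real_vector \<Rightarrow> 'b::real_normed_vector) \<Rightarrow> ('a, 'b) formal_series"
  where "taylor f n X =
    (1 / fact n) *\<^sub>R ((\<lambda>h t. vector_derivative h (at t)) ^^ n) (\<lambda>t. f (t *\<^sub>R X)) 0"

definition real_analytic_on :: "('a::euclidean_space \<Rightarrow> real) \<Rightarrow> 'a set \<Rightarrow> bool"
  where "real_analytic_on f S \<longleftrightarrow>
    (\<forall>x\<in>S. \<exists>\<eta> r. is_formal_series \<eta> \<and> 0 < r \<and>
       (\<forall>h. norm h < r \<longrightarrow> (\<lambda>n. \<eta> n h) sums f (x + h)))"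

definition diffeo :: "'a::euclidean_space set \<Rightarrow> ('a \<Rightarrow> 'a) \<Rightarrow> bool"
  where "diffeo B f \<longleftrightarrow> open B \<and> open (f ` B) \<and> inj_on f B \<and>
    smooth_on f B \<and> smooth_on (inv_into B f) (f ` B)"


section \<open>Kaehler manifolds\<close>

text \<open>A chart is a domain together with a coordinate map into a model space \<open>'a\<close> of the
  dimension of the manifold. The tangent space at a point of the domain is identified with
  \<open>'a\<close> by the differential of the coordinate map. A tensor field is a family of coordinate
  expressions, one for each chart, which obeys the transformation law; its expression in a
  chart is relevant only on the image of that chart.\<close>

type_synonym ('m, 'a) chart = "'m set \<times> ('m \<Rightarrow> 'a)"

definition smooth_manifold :: "'m topology \<Rightarrow> ('m, 'a::euclidean_space) chart set \<Rightarrow> bool"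
  where "smooth_manifold M A \<longleftrightarrow>
    Hausdorff_space M \<and> second_countable M \<and> (\<Union>(U, \<phi>)\<in>A. U) = topspace M \<and>
    (\<forall>(U, \<phi>)\<in>A. openin M U \<and> open (\<phi> ` U) \<and>
       homeomorphic_map (subtopology M U) (top_of_set (\<phi> ` U)) \<phi>) \<and>
    (\<forall>(U, \<phi>)\<in>A. \<forall>(V, \<psi>)\<in>A. smooth_on (\<psi> \<circ> inv_into U \<phi>) (\<phi> ` (U \<inter> V)))"

definition riemannian_metric_on ::
  "'a::euclidean_space set \<Rightarrow> ('a \<Rightarrow> 'a \<Rightarrow> 'a \<Rightarrow> real) \<Rightarrow> bool"
  where "riemannian_metric_on S g \<longleftrightarrow>
    (\<forall>u v. smooth_on (\<lambda>x. g x u v) S) \<and>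
    (\<forall>x\<in>S. bilinear (g x) \<and> (\<forall>u v. g x u v = g x v u) \<and> (\<forall>u. u \<noteq> 0 \<longrightarrow> 0 < g x u u))"

definition orthogonal_almost_complex_on ::
  "'a::euclidean_space set \<Rightarrow> ('a \<Rightarrow> 'a \<Rightarrow> 'a \<Rightarrow> real) \<Rightarrow> ('a \<Rightarrow> 'a \<Rightarrow> 'a) \<Rightarrow> bool"
  where "orthogonal_almost_complex_on S g J \<longleftrightarrow>
    (\<forall>u. smooth_on (\<lambda>x. J x u) S) \<and>
    (\<forall>x\<in>S. linear (J x) \<and> (\<forall>u. J x (J x u) = - u) \<and>
       (\<forall>u v. g x (J x u) (J x v) = g x u v))"

text \<open>\<open>christoffel g x u v\<close> is the Levi-Civita derivative at \<open>x\<close> in direction \<open>u\<close> of the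
  vector field that is constant equal to \<open>v\<close> in the chart, given by the Koszul formula.\<close>

definition christoffel ::
  "('a::euclidean_space \<Rightarrow> 'a \<Rightarrow> 'a \<Rightarrow> real) \<Rightarrow> 'a \<Rightarrow> 'a \<Rightarrow> 'a \<Rightarrow> 'a"
  where "christoffel g x u v =
    (THE w. \<forall>z. 2 * g x w z =
       dird (\<lambda>y. g y v z) x u + dird (\<lambda>y. g y u z) x v - dird (\<lambda>y. g y u v) x z)"

definition parallel_endomorphism_on ::
  "'a::euclidean_space set \<Rightarrow> ('a \<Rightarrow> 'a \<Rightarrow> 'a \<Rightarrow> real) \<Rightarrow> ('a \<Rightarrow> 'a \<Rightarrow> 'a) \<Rightarrow> bool"
  where "parallel_endomorphism_on S g J \<longleftrightarrow>
    (\<forall>x\<in>S. \<forall>u v. dird (\<lambda>y. J y v) x u + christoffel g x u (J x v)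
                     - J x (christoffel g x u v) = 0)"

definition kaehler_manifold ::
  "'m topology \<Rightarrow> ('m, 'a::euclidean_space) chart set \<Rightarrow>
   (('m, 'a) chart \<Rightarrow> 'a \<Rightarrow> 'a \<Rightarrow> 'a \<Rightarrow> real) \<Rightarrow> (('m, 'a) chart \<Rightarrow> 'a \<Rightarrow> 'a \<Rightarrow> 'a) \<Rightarrow> bool"
  where "kaehler_manifold M A g J \<longleftrightarrow>
    smooth_manifold M A \<and>
    (\<forall>(U, \<phi>)\<in>A. riemannian_metric_on (\<phi> ` U) (g (U, \<phi>)) \<and>
       orthogonal_almost_complex_on (\<phi> ` U) (g (U, \<phi>)) (J (U, \<phi>)) \<and>
       parallel_endomorphism_on (\<phi> ` U) (g (U, \<phi>)) (J (U, \<phi>))) \<and>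
    (\<forall>(U, \<phi>)\<in>A. \<forall>(V, \<psi>)\<in>A. \<forall>q\<in>U \<inter> V. \<forall>u v.
       let D = frechet_derivative (\<psi> \<circ> inv_into U \<phi>) (at (\<phi> q)) in
         g (V, \<psi>) (\<psi> q) (D u) (D v) = g (U, \<phi>) (\<phi> q) u v \<and>
         J (V, \<psi>) (\<psi> q) (D u) = D (J (U, \<phi>) (\<phi> q) u))"

text \<open>Holomorphic anchored coordinates \<open>k\<close> centered in \<open>q\<close>, defined on \<open>B\<close>. The tangent space
  at \<open>q\<close> carries the constant complex structure \<open>J (\<phi> q)\<close>. Since only germs in \<open>0\<close> matter,
  \<open>B\<close> is taken so small that \<open>k\<close> maps it into the domain of the chart.\<close>

definition holomorphic_anchored ::
  "('m, 'a::euclidean_space) chart \<Rightarrow> ('a \<Rightarrow> 'a \<Rightarrow> 'a) \<Rightarrow> 'm \<Rightarrow> 'a set \<Rightarrow> ('a \<Rightarrow> 'm) \<Rightarrow> bool"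
  where "holomorphic_anchored c J q B k \<longleftrightarrow>
    (case c of (U, \<phi>) \<Rightarrow>
       0 \<in> B \<and> k ` B \<subseteq> U \<and> diffeo B (\<phi> \<circ> k) \<and>
       k 0 = q \<and> ((\<phi> \<circ> k) has_derivative id) (at 0) \<and>
       (\<forall>X\<in>B. \<forall>u. dird (\<phi> \<circ> k) X (J (\<phi> q) u) = J (\<phi> (k X)) (dird (\<phi> \<circ> k) X u)))"

text \<open>Real analyticity refers to the real analytic structure underlying the complex manifold
  \<open>(M, J)\<close>: near every point the components of the metric in some holomorphic coordinates
  (equivalently, in all of them) are real analytic.\<close>

definition real_analytic_metric ::
  "('m, 'a::euclidean_space) chart set \<Rightarrow>
   (('m, 'a) chart \<Rightarrow> 'a \<Rightarrow> 'a \<Rightarrow> 'a \<Rightarrow> real) \<Rightarrow> (('m, 'a) chart \<Rightarrow> 'a \<Rightarrow> 'a \<Rightarrow> 'a) \<Rightarrow> bool"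
  where "real_analytic_metric A g J \<longleftrightarrow>
    (\<forall>(U, \<phi>)\<in>A. \<forall>q\<in>U. \<exists>B k. holomorphic_anchored (U, \<phi>) (J (U, \<phi>)) q B k \<and>
       (\<forall>u v. real_analytic_on
          (\<lambda>X. g (U, \<phi>) (\<phi> (k X)) (dird (\<phi> \<circ> k) X u) (dird (\<phi> \<circ> k) X v)) B))"


section \<open>Local potentials\<close>

text \<open>Forms are given by their values on vector fields that are constant in the chart.
  \<open>delbar J f\<close> is the \<open>(0,1)\<close>-part of \<open>df\<close>, and \<open>del_delbar J f\<close> is the \<open>(1,1)\<close>-part of
  \<open>d (delbar J f)\<close>.\<close>

definition delbar ::
  "('a::euclidean_space \<Rightarrow> 'a \<Rightarrow> 'a) \<Rightarrow> ('a \<Rightarrow> real) \<Rightarrow> 'a \<Rightarrow> 'a \<Rightarrow> complex"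
  where "delbar J f x u = (complex_of_real (dird f x u) + \<i> * complex_of_real (dird f x (J x u))) / 2"

definition ext_d :: "('a::euclidean_space \<Rightarrow> 'a \<Rightarrow> complex) \<Rightarrow> 'a \<Rightarrow> 'a \<Rightarrow> 'a \<Rightarrow> complex"
  where "ext_d \<alpha> x u v = dird (\<lambda>y. \<alpha> y v) x u - dird (\<lambda>y. \<alpha> y u) x v"

definition del_delbar ::
  "('a::euclidean_space \<Rightarrow> 'a \<Rightarrow> 'a) \<Rightarrow> ('a \<Rightarrow> real) \<Rightarrow> 'a \<Rightarrow> 'a \<Rightarrow> 'a \<Rightarrow> complex"
  where "del_delbar J f x u v =
    (ext_d (delbar J f) x u v + ext_d (delbar J f) x (J x u) (J x v)) / 2"

definition local_potential_on ::
  "'a::euclidean_space set \<Rightarrow> ('a \<Rightarrow> 'a \<Rightarrow> 'a \<Rightarrow> real) \<Rightarrow> ('a \<Rightarrow> 'a \<Rightarrow> 'a) \<Rightarrow> ('a \<Rightarrow> real) \<Rightarrow> bool"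
  where "local_potential_on S g J f \<longleftrightarrow> smooth_on f S \<and>
    (\<forall>x\<in>S. \<forall>u v. complex_of_real (g x (J x u) v) = (\<i> / 2) * del_delbar J f x u v)"


section \<open>Bidegrees\<close>

text \<open>In this section \<open>J\<close> is a complex structure on a single tangent space.\<close>

definition bihom ::
  "('a::euclidean_space \<Rightarrow> 'a) \<Rightarrow> nat \<Rightarrow> nat \<Rightarrow> ('a \<Rightarrow> complex) \<Rightarrow> bool"
  where "bihom J a b \<eta> \<longleftrightarrow> hom_poly (a + b) \<eta> \<and>
    (\<forall>X. ((\<lambda>t. \<eta> (X + t *\<^sub>R J X)) has_vector_derivative
            \<i> * of_int (int a - int b) * \<eta> X) (at 0))"

text \<open>\<open>bihom_parts J n f a\<close> is the component of bidegree \<open>(a, n - a)\<close> of a real homogeneous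
  polynomial \<open>f\<close> of degree \<open>n\<close>.\<close>

definition bihom_parts ::
  "('a::euclidean_space \<Rightarrow> 'a) \<Rightarrow> nat \<Rightarrow> ('a \<Rightarrow> real) \<Rightarrow> nat \<Rightarrow> 'a \<Rightarrow> complex"
  where "bihom_parts J n f =
    (THE e. (\<forall>a\<le>n. bihom J a (n - a) (e a)) \<and> (\<forall>a>n. e a = (\<lambda>_. 0)) \<and>
            (\<forall>X. complex_of_real (f X) = (\<Sum>a\<le>n. e a X)))"

definition only_bidegrees ::
  "('a::euclidean_space \<Rightarrow> 'a) \<Rightarrow> (nat \<Rightarrow> nat \<Rightarrow> bool) \<Rightarrow> ('a, real) formal_series \<Rightarrow> bool"
  where "only_bidegrees J P \<eta> \<longleftrightarrow> is_formal_series \<eta> \<and>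
    (\<forall>n. \<forall>a\<le>n. \<not> P a (n - a) \<longrightarrow> bihom_parts J n (\<eta> n) a = (\<lambda>_. 0))"

text \<open>For symmetric \<open>P\<close> the sum below is real, because the components of bidegrees \<open>(a, b)\<close>
  and \<open>(b, a)\<close> of a real polynomial are complex conjugate.\<close>

definition pr_bidegrees ::
  "('a::euclidean_space \<Rightarrow> 'a) \<Rightarrow> (nat \<Rightarrow> nat \<Rightarrow> bool) \<Rightarrow>
   ('a, real) formal_series \<Rightarrow> ('a, real) formal_series"
  where "pr_bidegrees J P \<eta> n X = Re (\<Sum>a | a \<le> n \<and> P a (n - a). bihom_parts J n (\<eta> n) a X)"

definition ge22 :: "nat \<Rightarrow> nat \<Rightarrow> bool"
  where "ge22 a b \<longleftrightarrow> 2 \<le> a \<and> 2 \<le> b"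

definition some1 :: "nat \<Rightarrow> nat \<Rightarrow> bool"
  where "some1 a b \<longleftrightarrow> a = 1 \<or> b = 1"

definition critical :: "nat \<Rightarrow> nat \<Rightarrow> bool"
  where "critical a b \<longleftrightarrow> 2 \<le> a \<and> 2 \<le> b \<and> (a = 2 \<or> b = 2)"


section \<open>Formal vector fields and closure\<close>

text \<open>Here \<open>g\<close> and \<open>J\<close> are the metric and the complex structure on a single tangent space.\<close>

definition contract ::
  "'a::euclidean_space \<Rightarrow> ('a, real) formal_series \<Rightarrow> ('a, real) formal_series"
  where "contract Z \<eta> n X = dird (\<eta> (Suc n)) X Z"

definition derivation ::
  "('a::euclidean_space, 'a) formal_series \<Rightarrow> ('a, real) formal_series \<Rightarrow> ('a, real) formal_series"
  where "derivation W \<eta> n X = (\<Sum>k\<le>Suc n. dird (\<eta> (Suc n - k)) X (W k X))"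

definition constant_field :: "'a::real_vector \<Rightarrow> ('a, 'a) formal_series"
  where "constant_field Z n X = (if n = 0 then Z else 0)"

definition hol_poly_fields ::
  "('a::euclidean_space \<Rightarrow> 'a) \<Rightarrow> nat \<Rightarrow> ('a \<Rightarrow> 'a) set"
  where "hol_poly_fields J n = {w. hom_poly n w \<and> (\<forall>X u. dird w X (J u) = J (dird w X u))}"

definition closure_series ::
  "('a::euclidean_space \<Rightarrow> 'a \<Rightarrow> real) \<Rightarrow> ('a, 'a) formal_series \<Rightarrow> ('a, real) formal_series"
  where "closure_series g W n X = (case n of 0 \<Rightarrow> 0 | Suc m \<Rightarrow> g (W m X) X)"

definition closure_inverse ::
  "('a::euclidean_space \<Rightarrow> 'a \<Rightarrow> real) \<Rightarrow> ('a \<Rightarrow> 'a) \<Rightarrow>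
   ('a, real) formal_series \<Rightarrow> ('a, 'a) formal_series"
  where "closure_inverse g J \<eta> n =
    (if n < 2 then (\<lambda>_. 0)
     else the_inv_into (hol_poly_fields J n) (\<lambda>w X. g (w X) X) (\<eta> (Suc n)))"


section \<open>Kaehler normal coordinates and potential\<close>

text \<open>\<open>k\<close> and \<open>f\<close> represent the germs of the Kaehler normal coordinates centered in \<open>q\<close> and of
  the local potential near \<open>q\<close>. The degree 2 component of the normalization is
  \<open>g\<^sub>q(X, X)\<close>; no assumption is made on how the domains of the representatives vary
  with \<open>q\<close>.\<close>

definition kaehler_normal ::
  "('m, 'a::euclidean_space) chart \<Rightarrow> ('a \<Rightarrow> 'a \<Rightarrow> 'a \<Rightarrow> real) \<Rightarrow> ('a \<Rightarrow> 'a \<Rightarrow> 'a) \<Rightarrow>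
   'm \<Rightarrow> ('a \<Rightarrow> 'm) \<Rightarrow> ('m \<Rightarrow> real) \<Rightarrow> bool"
  where "kaehler_normal c g J q k f \<longleftrightarrow>
    (case c of (U, \<phi>) \<Rightarrow>
       \<exists>B. holomorphic_anchored (U, \<phi>) J q B k \<and>
           local_potential_on (\<phi> ` k ` B) g J (f \<circ> inv_into U \<phi>) \<and>
           only_bidegrees (J (\<phi> q)) ge22
             (\<lambda>n X. taylor (f \<circ> k) n X - (if n = 2 then g (\<phi> q) X X else 0)))"

text \<open>Componentwise Levi-Civita derivative at \<open>q\<close> in direction \<open>Z\<close> of a section \<open>\<eta>\<close> of the
  bundle of formal power series. The second term is the Leibniz rule for the induced connection
  on symmetric powers of the cotangent bundle.\<close>

definition has_covariant_derivative ::
  "('m, 'a::euclidean_space) chart \<Rightarrow> ('a \<Rightarrow> 'a \<Rightarrow> 'a \<Rightarrow> real) \<Rightarrow> 'm \<Rightarrow> 'a \<Rightarrow>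
   ('m \<Rightarrow> ('a, real) formal_series) \<Rightarrow> ('a, real) formal_series \<Rightarrow> bool"
  where "has_covariant_derivative c g q Z \<eta> \<xi> \<longleftrightarrow>
    (case c of (U, \<phi>) \<Rightarrow>
       \<forall>n X. \<exists>D. ((\<lambda>x. \<eta> (inv_into U \<phi> x) n X) has_derivative D) (at (\<phi> q)) \<and>
         \<xi> n X = D Z - dird (\<eta> q n) X (christoffel g (\<phi> q) Z X))"

definition curve_with_transport ::
  "('m, 'a::euclidean_space) chart \<Rightarrow> ('a \<Rightarrow> 'a \<Rightarrow> 'a \<Rightarrow> real) \<Rightarrow> 'm \<Rightarrow> 'a \<Rightarrow>
   (real \<Rightarrow> 'm) \<Rightarrow> (real \<Rightarrow> 'a \<Rightarrow> 'a) \<Rightarrow> bool"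
  where "curve_with_transport c g p Z \<gamma> PT \<longleftrightarrow>
    (case c of (U, \<phi>) \<Rightarrow>
       \<exists>\<epsilon>>0. \<gamma> ` {-\<epsilon><..<\<epsilon>} \<subseteq> U \<and> smooth_on (\<phi> \<circ> \<gamma>) {-\<epsilon><..<\<epsilon>} \<and> \<gamma> 0 = p \<and>
         ((\<phi> \<circ> \<gamma>) has_vector_derivative Z) (at 0) \<and>
         (\<forall>X. PT 0 X = X \<and>
            (\<forall>t\<in>{-\<epsilon><..<\<epsilon>}. ((\<lambda>s. PT s X) has_vector_derivative
               - christoffel g (\<phi> (\<gamma> t)) (vector_derivative (\<phi> \<circ> \<gamma>) (at t)) (PT t X)) (at t))))"

text \<open>The inverse of \<open>knc p\<close> on \<open>B\<close>, composed with \<open>knc (\<gamma> t)\<close> and the parallel transport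
  \<open>PT t\<close>. For small \<open>t\<close> it is a well-defined germ at \<open>0\<close>.\<close>

definition knc_shift ::
  "('m \<Rightarrow> 'a \<Rightarrow> 'm) \<Rightarrow> 'm \<Rightarrow> 'a set \<Rightarrow> (real \<Rightarrow> 'm) \<Rightarrow> (real \<Rightarrow> 'a \<Rightarrow> 'a) \<Rightarrow> real \<Rightarrow> 'a \<Rightarrow> 'a"
  where "knc_shift knc p B \<gamma> PT t X = inv_into B (knc p) (knc (\<gamma> t) (PT t X))"

text \<open>The holomorphically extended vector field. As \<open>knc q\<close> is determined only as a germ for
  each \<open>q\<close>, the germs of \<open>knc_shift\<close> at \<open>0\<close> are represented by a family \<open>F\<close> that is smooth near
  \<open>(0, 0)\<close>, and the derivative with respect to \<open>t\<close> is taken for this family.\<close>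

definition hol_extended_field ::
  "('m \<Rightarrow> 'a::euclidean_space \<Rightarrow> 'm) \<Rightarrow> 'm \<Rightarrow> 'a set \<Rightarrow> (real \<Rightarrow> 'm) \<Rightarrow> (real \<Rightarrow> 'a \<Rightarrow> 'a) \<Rightarrow>
   ('a \<Rightarrow> 'a) \<Rightarrow> bool"
  where "hol_extended_field knc p B \<gamma> PT W \<longleftrightarrow>
    (\<exists>F N. open N \<and> (0, 0) \<in> N \<and> smooth_on F N \<and>
       (\<forall>\<^sub>F t in nhds 0. \<forall>\<^sub>F X in nhds 0. F (t, X) = knc_shift knc p B \<gamma> PT t X) \<and>
       (\<forall>\<^sub>F X in nhds 0. ((\<lambda>t. F (t, X)) has_vector_derivative W X) (at 0)))"

text \<open>The same at the level of Taylor series in \<open>0\<close>: differentiation of each homogeneous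
  component with respect to \<open>t\<close>, which needs no choice of representatives.\<close>

definition hol_extended_series ::
  "('m \<Rightarrow> 'a::euclidean_space \<Rightarrow> 'm) \<Rightarrow> 'm \<Rightarrow> 'a set \<Rightarrow> (real \<Rightarrow> 'm) \<Rightarrow> (real \<Rightarrow> 'a \<Rightarrow> 'a) \<Rightarrow>
   ('a, 'a) formal_series \<Rightarrow> bool"
  where "hol_extended_series knc p B \<gamma> PT \<zeta> \<longleftrightarrow>
    (\<forall>n X. ((\<lambda>t. taylor (knc_shift knc p B \<gamma> PT t) n X) has_vector_derivative \<zeta> n X) (at 0))"

end

theory Submission
  imports Defs
begin

text \<open>In the normal coordinates centered at \<open>p\<close> write \<open>F\<close> for the local potential and, for a
  nearby point with coordinate \<open>x\<close>, let \<open>\<psi>\<^sub>x(Y) = x + Y + H\<^sub>x(Y)\<close> be the normal coordinates at that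
  point, reparametrized to have derivative \<open>id\<close> at \<open>0\<close>, and \<open>f\<^sub>x\<close> the normal potential. Then
  \<open>f\<^sub>x - F \<circ> \<psi>\<^sub>x\<close> is pluriharmonic, so the components of \<open>F \<circ> \<psi>\<^sub>x\<close> of bidegrees \<open>(1, b)\<close>, \<open>b \<ge> 2\<close>,
  vanish. Since those of \<open>F\<close> vanish too, this determines \<open>H\<^sub>x\<close> to first order in \<open>x\<close>, degree by
  degree: \<open>2 g(H'(Y), Y)\<close> cancels the part of \<open>Z\<lrcorner>F\<close> with a bidegree \<open>1\<close>. In particular the Taylor
  coefficients of \<open>\<psi>\<^sub>x\<close> and \<open>f\<^sub>x\<close> are differentiable at \<open>x = 0\<close>, which no hypothesis provides. The
  components of bidegrees \<open>\<ge> (2, 2)\<close> then give the derivative of \<open>f\<^sub>x\<close>, and since the Christoffel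
  symbols vanish at the center of normal coordinates, ordinary derivatives there are covariant ones.\<close>

section \<open>Smooth functions\<close>

text \<open>The normal coordinates at different points are unrelated germs, so the only objects that
  can be differentiated in \<open>x\<close> are their Taylor components, one degree at a time. These
  are homogeneous polynomials, and the linear operations applied to them (projection to bidegrees,
  recovery of a field from its closure) are finite combinations of point values; this carries
  differentiability from values to everything else. The delicate point is that \<open>dF\<close>
  does not vanish away from the center. Hence the component of degree \<open>b + 1\<close> of
  \<open>F \<circ> \<psi>\<^sub>x\<close> contains two unknown coefficients of
  \<open>\<psi>\<^sub>x\<close>, those of degrees \<open>b\<close> and \<open>b + 1\<close>. The
  latter enters as \<open>dF\<close> of a holomorphic polynomial, so only in bidegrees
  \<open>(b + 1, 0)\<close> and \<open>(0, b + 1)\<close>, and is removed by the projection. What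
  remains is \<open>2 h\<^sub>x(H\<^sub>x(Y), Y)\<close> with the metric \<open>h\<^sub>x\<close> at
  the moving point; continuity of \<open>h\<^sub>x\<close> at the center is enough to solve for
  \<open>H\<^sub>x\<close>, because \<open>H\<^sub>0 = 0\<close>. The constant \<open>1/2\<close> in
  the formula is the inverse of the \<open>2\<close> in the derivative of
  \<open>g(X, X)\<close>.\<close>

lemma dird_eqI: "(f has_derivative f') (at x) \<Longrightarrow> dird f x u = f' u"
  by (metis frechet_derivative_at)

lemma dird_cong:
  assumes "open S" "x \<in> S" "\<And>y. y \<in> S \<Longrightarrow> f y = g y" "f differentiable (at x)"
  shows "dird f x = dird g x" "g differentiable (at x)"
proof -
  have "(g has_derivative dird f x) (at x)"
    using has_derivative_transform_within_open[of f "dird f x" x UNIV S g] assms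
    by (metis frechet_derivative_works)
  then show "dird f x = dird g x" "g differentiable (at x)"
    by (auto simp: frechet_derivative_at differentiable_def)
qed

lemma dird_compose:
  assumes "f differentiable (at (g x))" "g differentiable (at x)"
  shows "dird (\<lambda>x. f (g x)) x u = dird f (g x) (dird g x u)"
        "(\<lambda>x. f (g x)) differentiable (at x)"
proof -
  have "((\<lambda>x. f (g x)) has_derivative (\<lambda>u. dird f (g x) (dird g x u))) (at x)"
    using has_derivative_compose[of g "dird g x" x UNIV f "dird f (g x)"] assms
    by (auto simp: frechet_derivative_works)
  then show "dird (\<lambda>x. f (g x)) x u = dird f (g x) (dird g x u)"
    "(\<lambda>x. f (g x)) differentiable (at x)"
    by (auto simp: dird_eqI differentiable_def)
qed

lemma dird_bounded_linear:
  assumes "bounded_linear h" "f differentiable (at x)"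
  shows "dird (\<lambda>x. h (f x)) x u = h (dird f x u)"
        "(\<lambda>x. h (f x)) differentiable (at x)"
proof -
  have "((\<lambda>x. h (f x)) has_derivative (\<lambda>u. h (dird f x u))) (at x)"
    using bounded_linear.has_derivative[OF assms(1)] assms(2)
    by (auto simp: frechet_derivative_works)
  then show "dird (\<lambda>x. h (f x)) x u = h (dird f x u)"
    "(\<lambda>x. h (f x)) differentiable (at x)"
    by (auto simp: dird_eqI differentiable_def)
qed

lemma dird_add:
  assumes "f differentiable (at x)" "g differentiable (at x)"
  shows "dird (\<lambda>x. f x + g x) x u = dird f x u + dird g x u"
  by (rule dird_eqI) (use assms in \<open>auto simp: frechet_derivative_works intro!: has_derivative_add\<close>)

lemma dird_diff:
  assumes "f differentiable (at x)" "g differentiable (at x)"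
  shows "dird (\<lambda>x. f x - g x) x u = dird f x u - dird g x u"
  by (rule dird_eqI) (use assms in \<open>auto simp: frechet_derivative_works intro!: has_derivative_diff\<close>)

lemma dird_sum:
  assumes "\<And>i. i \<in> I \<Longrightarrow> f i differentiable (at x)"
  shows "dird (\<lambda>x. \<Sum>i\<in>I. f i x) x u = (\<Sum>i\<in>I. dird (f i) x u)"
  by (rule dird_eqI) (use assms in \<open>auto simp: frechet_derivative_works intro!: has_derivative_sum\<close>)

lemma dird_bilinear:
  assumes "bounded_bilinear bp" "f differentiable (at x)" "g differentiable (at x)"
  shows "dird (\<lambda>x. bp (f x) (g x)) x u = bp (f x) (dird g x u) + bp (dird f x u) (g x)"
        "(\<lambda>x. bp (f x) (g x)) differentiable (at x)"
proof -
  have "((\<lambda>x. bp (f x) (g x)) has_derivative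
      (\<lambda>u. bp (f x) (dird g x u) + bp (dird f x u) (g x))) (at x)"
    using bounded_bilinear.FDERIV[OF assms(1)] assms(2,3)
    by (auto simp: frechet_derivative_works)
  then show "dird (\<lambda>x. bp (f x) (g x)) x u = bp (f x) (dird g x u) + bp (dird f x u) (g x)"
    "(\<lambda>x. bp (f x) (g x)) differentiable (at x)"
    by (auto simp: dird_eqI differentiable_def)
qed

lemma linear_dird: "f differentiable (at x) \<Longrightarrow> linear (dird f x)"
  by (rule linear_frechet_derivative)

lemma linear_basis_expansion:
  fixes h :: "'a::euclidean_space \<Rightarrow> 'b::real_vector"
  assumes "linear h"
  shows "h u = (\<Sum>i\<in>Basis. (u \<bullet> i) *\<^sub>R h i)"
proof -
  have "h u = h (\<Sum>i\<in>Basis. (u \<bullet> i) *\<^sub>R i)" by (simp add: euclidean_representation)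
  also have "\<dots> = (\<Sum>i\<in>Basis. (u \<bullet> i) *\<^sub>R h i)"
    using assms by (simp add: linear_sum linear_scale)
  finally show ?thesis .
qed

lemma dird_basis_expansion:
  fixes f :: "'a::euclidean_space \<Rightarrow> 'b::real_normed_vector"
  assumes "f differentiable (at x)"
  shows "dird f x u = (\<Sum>i\<in>Basis. (u \<bullet> i) *\<^sub>R dird f x i)"
  by (rule linear_basis_expansion[OF linear_dird[OF assms]])

section \<open>Closure properties of the classes C^k and of smooth maps\<close>

lemma Ck_on_subset: "Ck_on k f S \<Longrightarrow> T \<subseteq> S \<Longrightarrow> Ck_on k f T"
  by (induction k arbitrary: f) (auto intro: continuous_on_subset)

lemma Ck_on_cong:
  assumes "open S" "\<And>x. x \<in> S \<Longrightarrow> f x = g x" "Ck_on k f S"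
  shows "Ck_on k g S"
  using assms(2,3)
proof (induction k arbitrary: f g)
  case 0
  then show ?case by (metis Ck_on.simps(1) continuous_on_cong)
next
  case (Suc k)
  have d: "\<And>x. x \<in> S \<Longrightarrow> f differentiable (at x)" using Suc.prems by simp
  have "Ck_on k (\<lambda>x. dird g x u) S" for u
    using Suc.IH[of "\<lambda>x. dird f x u" "\<lambda>x. dird g x u"] Suc.prems
      dird_cong(1)[OF assms(1) _ Suc.prems(1) d] by auto
  moreover have "\<forall>x\<in>S. g differentiable (at x)"
    using dird_cong(2)[OF assms(1) _ Suc.prems(1) d] by auto
  ultimately show ?case by simp
qed

lemma Ck_on_Suc_imp: "Ck_on (Suc k) f S \<Longrightarrow> Ck_on k f S"
proof (induction k arbitrary: f)
  case 0
  then show ?case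
    by (auto intro!: continuous_at_imp_continuous_on differentiable_imp_continuous_within)
next
  case (Suc k)
  then show ?case by (metis Ck_on.simps(2))
qed

lemma Ck_on_const [simp]: "Ck_on k (\<lambda>_. c) S"
  by (induction k arbitrary: c) auto

lemma Ck_on_bounded_linear:
  assumes "open S" "bounded_linear h" "Ck_on k f S"
  shows "Ck_on k (\<lambda>x. h (f x)) S"
  using assms(3)
proof (induction k arbitrary: f)
  case 0
  then show ?case using assms(2) by (simp add: bounded_linear.continuous_on)
next
  case (Suc k)
  have "Ck_on k (\<lambda>x. dird (\<lambda>x. h (f x)) x u) S" for u
    by (rule Ck_on_cong[OF assms(1) dird_bounded_linear(1)[OF assms(2), symmetric]])
      (use Suc in auto)
  then show ?case using Suc.prems by (auto intro!: dird_bounded_linear(2)[OF assms(2)])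
qed

lemma Ck_on_linear:
  assumes "bounded_linear h"
  shows "Ck_on k h S"
proof -
  have d: "dird h x u = h u" for x u
    by (rule dird_eqI[OF bounded_linear_imp_has_derivative[OF assms]])
  show ?thesis
    using assms
    by (cases k) (auto simp: d linear_continuous_on bounded_linear_imp_differentiable)
qed

lemma Ck_on_add:
  assumes "open S" "Ck_on k f S" "Ck_on k g S"
  shows "Ck_on k (\<lambda>x. f x + g x) S"
  using assms(2,3)
proof (induction k arbitrary: f g)
  case 0
  then show ?case by (auto intro: continuous_intros)
next
  case (Suc k)
  have "Ck_on k (\<lambda>x. dird (\<lambda>x. f x + g x) x u) S" for u
    by (rule Ck_on_cong[OF assms(1) dird_add[symmetric]]) (use Suc in auto)
  then show ?case using Suc by (auto intro: differentiable_add)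
qed

lemma Ck_on_sum:
  assumes "open S" "\<And>i. i \<in> I \<Longrightarrow> Ck_on k (f i) S"
  shows "Ck_on k (\<lambda>x. \<Sum>i\<in>I. f i x) S"
  using assms(2)
  by (induction I rule: infinite_finite_induct) (auto intro: Ck_on_add assms(1))

lemma Ck_on_bilinear:
  assumes "open S" "bounded_bilinear bp" "Ck_on k f S" "Ck_on k g S"
  shows "Ck_on k (\<lambda>x. bp (f x) (g x)) S"
  using assms(3,4)
proof (induction k arbitrary: f g)
  case 0
  then show ?case using assms(2) by (simp add: bounded_bilinear.continuous_on)
next
  case (Suc k)
  have "Ck_on k (\<lambda>x. dird (\<lambda>x. bp (f x) (g x)) x u) S" for u
  proof (rule Ck_on_cong[OF assms(1) dird_bilinear(1)[OF assms(2), symmetric]])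
    have "Ck_on k f S" "Ck_on k g S"
      using Suc.prems by (simp_all only: Ck_on_Suc_imp)
    then show "Ck_on k (\<lambda>x. bp (f x) (dird g x u) + bp (dird f x u) (g x)) S"
      using Suc.prems by (intro Ck_on_add[OF assms(1)] Suc.IH) auto
  qed (use Suc.prems in auto)
  then show ?case using Suc.prems by (auto intro!: dird_bilinear(2)[OF assms(2)])
qed

text \<open>The direction \<open>dird g x u\<close> in the chain rule varies with \<open>x\<close>,
  whereas \<open>Ck_on\<close> speaks of derivatives in fixed directions. Expanding it in
  \<open>Basis\<close> leaves partial derivatives of \<open>f\<close> composed with
  \<open>g\<close>, so the induction generalizes \<open>f\<close> and keeps
  \<open>g\<close>.\<close>

lemma Ck_on_compose:
  fixes f :: "'b::euclidean_space \<Rightarrow> 'c::real_normed_vector" and g :: "'a::euclidean_space \<Rightarrow> 'b"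
  assumes "open S" "Ck_on k f T" "Ck_on k g S" "g ` S \<subseteq> T"
  shows "Ck_on k (\<lambda>x. f (g x)) S"
  using assms(2,3)
proof (induction k arbitrary: f)
  case 0
  then show ?case using assms(4) by (auto intro: continuous_on_compose2)
next
  case (Suc k)
  have d: "x \<in> S \<Longrightarrow> f differentiable (at (g x))" "x \<in> S \<Longrightarrow> g differentiable (at x)" for x
    using Suc.prems assms(4) by auto
  have "Ck_on k (\<lambda>x. dird (\<lambda>x. f (g x)) x u) S" for u
  proof (rule Ck_on_cong[OF assms(1)])
    show "Ck_on k (\<lambda>x. \<Sum>i\<in>Basis. (dird g x u \<bullet> i) *\<^sub>R dird f (g x) i) S"
    proof (intro Ck_on_sum[OF assms(1)] Ck_on_bilinear[OF assms(1) bounded_bilinear_scaleR])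
      fix i :: 'b
      show "Ck_on k (\<lambda>x. dird g x u \<bullet> i) S"
        using Suc.prems(2) by (auto intro: Ck_on_bounded_linear[OF assms(1) bounded_linear_inner_left])
      show "Ck_on k (\<lambda>x. dird f (g x) i) S"
        using Suc.prems(1) Ck_on_Suc_imp[OF Suc.prems(2)] by (intro Suc.IH) auto
    qed
    show "(\<Sum>i\<in>Basis. (dird g x u \<bullet> i) *\<^sub>R dird f (g x) i) = dird (\<lambda>x. f (g x)) x u" if "x \<in> S" for x
      using dird_compose(1)[where f=f and g=g and x=x and u=u] dird_basis_expansion[where f=f and x="g x" and u="dird g x u"] d[OF that] by simp
  qed
  then show ?case using dird_compose(2)[of f g] d by auto
qed

lemma smooth_on_subset: "smooth_on f S \<Longrightarrow> T \<subseteq> S \<Longrightarrow> smooth_on f T"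
  by (auto simp: smooth_on_def intro: Ck_on_subset)

lemma smooth_on_cong:
  "open S \<Longrightarrow> smooth_on f S \<Longrightarrow> (\<And>x. x \<in> S \<Longrightarrow> f x = g x) \<Longrightarrow> smooth_on g S"
  unfolding smooth_on_def by (metis Ck_on_cong)

lemma smooth_on_const [simp]: "smooth_on (\<lambda>_. c) S"
  by (auto simp: smooth_on_def)

lemma smooth_on_bounded_linear:
  "open S \<Longrightarrow> bounded_linear h \<Longrightarrow> smooth_on f S \<Longrightarrow> smooth_on (\<lambda>x. h (f x)) S"
  by (auto simp: smooth_on_def intro: Ck_on_bounded_linear)

lemma smooth_on_linear: "bounded_linear h \<Longrightarrow> smooth_on h S"
  by (auto simp: smooth_on_def intro: Ck_on_linear)

lemma smooth_on_add:
  "open S \<Longrightarrow> smooth_on f S \<Longrightarrow> smooth_on g S \<Longrightarrow> smooth_on (\<lambda>x. f x + g x) S"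
  by (auto simp: smooth_on_def intro: Ck_on_add)

lemma smooth_on_sum:
  "open S \<Longrightarrow> (\<And>i. i \<in> I \<Longrightarrow> smooth_on (f i) S) \<Longrightarrow> smooth_on (\<lambda>x. \<Sum>i\<in>I. f i x) S"
  by (auto simp: smooth_on_def intro: Ck_on_sum)

lemma smooth_on_bilinear:
  "open S \<Longrightarrow> bounded_bilinear bp \<Longrightarrow> smooth_on f S \<Longrightarrow> smooth_on g S \<Longrightarrow>
    smooth_on (\<lambda>x. bp (f x) (g x)) S"
  by (auto simp: smooth_on_def intro: Ck_on_bilinear)

lemmas smooth_on_scaleR = smooth_on_bilinear[OF _ bounded_bilinear_scaleR]
lemmas smooth_on_inner_left = smooth_on_bounded_linear[OF _ bounded_linear_inner_left]

lemma smooth_on_diff: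
  assumes "open S" "smooth_on f S" "smooth_on g S"
  shows "smooth_on (\<lambda>x. f x - g x) S"
  using smooth_on_add[OF assms(1,2) smooth_on_bounded_linear[OF assms(1) bounded_linear_minus[OF bounded_linear_ident] assms(3)]]
  by simp

lemma smooth_on_compose:
  fixes f :: "'b::euclidean_space \<Rightarrow> 'c::real_normed_vector" and g :: "'a::euclidean_space \<Rightarrow> 'b"
  shows "open S \<Longrightarrow> smooth_on f T \<Longrightarrow> smooth_on g S \<Longrightarrow> g ` S \<subseteq> T \<Longrightarrow> smooth_on (\<lambda>x. f (g x)) S"
  by (auto simp: smooth_on_def intro: Ck_on_compose)

lemma smooth_on_imp_differentiable: "smooth_on f S \<Longrightarrow> x \<in> S \<Longrightarrow> f differentiable (at x)"
  unfolding smooth_on_def by (metis Ck_on.simps(2))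

lemma smooth_on_dird: "smooth_on f S \<Longrightarrow> smooth_on (\<lambda>x. dird f x u) S"
  unfolding smooth_on_def by (metis Ck_on.simps(2))

lemma smooth_on_continuous_on: "smooth_on f S \<Longrightarrow> continuous_on S f"
  unfolding smooth_on_def by (metis Ck_on.simps(1))

lemma smooth_on_dird_field:
  fixes f :: "'a::euclidean_space \<Rightarrow> 'b::real_normed_vector"
  assumes "open S" "smooth_on f S" "smooth_on w S"
  shows "smooth_on (\<lambda>x. dird f x (w x)) S"
proof (rule smooth_on_cong[OF assms(1)])
  show "smooth_on (\<lambda>x. \<Sum>i\<in>Basis. (w x \<bullet> i) *\<^sub>R dird f x i) S"
    by (intro smooth_on_sum smooth_on_scaleR smooth_on_inner_left smooth_on_dird assms)
  show "(\<Sum>i\<in>Basis. (w x \<bullet> i) *\<^sub>R dird f x i) = dird f x (w x)" if "x \<in> S" for x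
    using dird_basis_expansion[OF smooth_on_imp_differentiable[OF assms(2) that]] by metis
qed

lemma has_vector_derivative_line:
  assumes "f differentiable (at (x + t *\<^sub>R v))"
  shows "((\<lambda>t. f (x + t *\<^sub>R v)) has_vector_derivative dird f (x + t *\<^sub>R v) v) (at t)"
proof -
  have "((\<lambda>t. x + t *\<^sub>R v) has_derivative (\<lambda>h. h *\<^sub>R v)) (at t)"
    by (auto intro!: derivative_eq_intros)
  from has_derivative_compose[OF this] assms
  have "((\<lambda>t. f (x + t *\<^sub>R v)) has_derivative (\<lambda>h. dird f (x + t *\<^sub>R v) (h *\<^sub>R v))) (at t)"
    by (auto simp: frechet_derivative_works)
  then show ?thesis
    by (simp add: has_vector_derivative_def linear_scale[OF linear_dird[OF assms]])
qed

section \<open>Symmetry of second derivatives\<close>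

lemma norm_increment_bound:
  fixes h :: "real \<Rightarrow> 'b::real_normed_vector"
  assumes "0 \<le> s" "\<And>b. b \<in> {0..s} \<Longrightarrow> (h has_vector_derivative h' b) (at b)"
    "\<And>b. b \<in> {0..s} \<Longrightarrow> norm (h' b) \<le> K"
  shows "norm (h s - h 0) \<le> K * s"
proof -
  have "norm (h s - h 0) \<le> K * norm (s - 0)"
  proof (rule differentiable_bound[where S="{0..s}" and f'="\<lambda>b t. t *\<^sub>R h' b"])
    show "(h has_derivative (\<lambda>t. t *\<^sub>R h' b)) (at b within {0..s})" if "b \<in> {0..s}" for b
      using assms(2)[OF that] by (auto simp: has_vector_derivative_def intro: has_derivative_at_withinI)
    show "onorm (\<lambda>t. t *\<^sub>R h' b) \<le> K" if "b \<in> {0..s}" for b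
      using assms(3)[OF that] by (auto simp: onorm_scaleR_left_lemma onorm_scaleR_left onorm_id intro!: onorm_bound)
  qed (use assms(1) in auto)
  then show ?thesis using assms(1) by simp
qed

text \<open>The mean value inequality is applied twice: to \<open>g\<close> in direction
  \<open>u\<close>, whose derivative \<open>G\<close> is a difference in direction \<open>v\<close>,
  and to that difference via \<open>h\<close>. Both times the main term with \<open>D x\<close> is
  subtracted beforehand, so only the oscillation of the continuous function \<open>D\<close> near
  \<open>x\<close> remains.\<close>

lemma second_difference_bound:
  fixes f :: "'a::euclidean_space \<Rightarrow> 'b::real_normed_vector"
  assumes S: "open S" "smooth_on f S" "x \<in> S" and e: "0 < e"
  shows "\<exists>\<delta>>0. \<forall>s. 0 < s \<and> s < \<delta> \<longrightarrow>
    norm (f (x + s *\<^sub>R u + s *\<^sub>R v) - f (x + s *\<^sub>R u) - f (x + s *\<^sub>R v) + f x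
       - (s * s) *\<^sub>R dird (\<lambda>y. dird f y u) x v) \<le> e * (s * s)"
proof -
  define D where "D y = dird (\<lambda>y. dird f y u) y v" for y
  have "continuous_on S D"
    unfolding D_def by (intro smooth_on_continuous_on smooth_on_dird S)
  then have "isCont D x" using S continuous_on_eq_continuous_at by blast
  then obtain r1 where r1: "r1 > 0" "\<And>y. dist y x < r1 \<Longrightarrow> dist (D y) (D x) < e"
    using e unfolding continuous_at_eps_delta by blast
  obtain r2 where r2: "r2 > 0" "ball x r2 \<subseteq> S"
    using S openE by blast
  define r where "r = min r1 r2"
  define \<delta> where "\<delta> = r / (norm u + norm v + 1)"
  have pos: "norm u + norm v + 1 > 0" by (smt (verit) norm_ge_zero)
  have "r > 0" using r1 r2 by (simp add: r_def)
  have inS: "x + a *\<^sub>R u + b *\<^sub>R v \<in> S \<and> norm (D (x + a *\<^sub>R u + b *\<^sub>R v) - D x) \<le> e"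
    if "s < \<delta>" "a \<in> {0..s}" "b \<in> {0..s}" for a b s
  proof -
    have "norm (a *\<^sub>R u + b *\<^sub>R v) \<le> a * norm u + b * norm v"
      using that norm_triangle_ineq[of "a *\<^sub>R u" "b *\<^sub>R v"] by simp
    also have "\<dots> \<le> s * norm u + s * norm v"
      using that by (intro add_mono mult_right_mono) auto
    also have "\<dots> \<le> s * (norm u + norm v + 1)"
      using that by (simp add: algebra_simps)
    also have "\<dots> < r"
      using \<open>s < \<delta>\<close> pos unfolding \<delta>_def by (simp add: pos_less_divide_eq)
    finally have "dist (x + a *\<^sub>R u + b *\<^sub>R v) x < r"
      by (simp add: dist_norm add.assoc)
    then have "dist (x + a *\<^sub>R u + b *\<^sub>R v) x < r1" "x + a *\<^sub>R u + b *\<^sub>R v \<in> ball x r2"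
      by (simp_all add: r_def dist_commute)
    then show ?thesis
      using r1(2)[of "x + a *\<^sub>R u + b *\<^sub>R v"] r2(2) by (auto simp: dist_norm)
  qed
  have "norm (f (x + s *\<^sub>R u + s *\<^sub>R v) - f (x + s *\<^sub>R u) - f (x + s *\<^sub>R v) + f x
       - (s * s) *\<^sub>R D x) \<le> e * (s * s)" if s: "0 < s" "s < \<delta>" for s
  proof -
    define G where "G a = dird f (x + a *\<^sub>R u + s *\<^sub>R v) u - dird f (x + a *\<^sub>R u) u - s *\<^sub>R D x" for a
    define g where "g a = f (x + s *\<^sub>R v + a *\<^sub>R u) - f (x + a *\<^sub>R u) - (a * s) *\<^sub>R D x" for a
    have G: "norm (G a) \<le> e * s" if a: "a \<in> {0..s}" for a
    proof -
      define h where "h b = dird f (x + a *\<^sub>R u + b *\<^sub>R v) u - b *\<^sub>R D x" for b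
      have "norm (h s - h 0) \<le> e * s"
      proof (rule norm_increment_bound)
        fix b assume b: "b \<in> {0..s}"
        have "(\<lambda>y. dird f y u) differentiable (at (x + a *\<^sub>R u + b *\<^sub>R v))"
          using smooth_on_imp_differentiable[OF smooth_on_dird[OF S(2)]] inS[OF s(2) a b] by blast
        from has_vector_derivative_line[OF this]
        have "((\<lambda>b. dird f (x + a *\<^sub>R u + b *\<^sub>R v) u) has_vector_derivative D (x + a *\<^sub>R u + b *\<^sub>R v)) (at b)"
          by (simp add: D_def)
        then show "(h has_vector_derivative D (x + a *\<^sub>R u + b *\<^sub>R v) - D x) (at b)"
          unfolding h_def by (auto intro!: derivative_eq_intros)
        show "norm (D (x + a *\<^sub>R u + b *\<^sub>R v) - D x) \<le> e"
          using inS[OF s(2) a b] by blast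
      qed (use s in auto)
      then show ?thesis by (simp add: h_def G_def algebra_simps)
    qed
    have "norm (g s - g 0) \<le> e * s * s"
    proof (rule norm_increment_bound)
      fix a assume a: "a \<in> {0..s}"
      have d1: "f differentiable (at (x + s *\<^sub>R v + a *\<^sub>R u))"
        using smooth_on_imp_differentiable[OF S(2)] inS[OF s(2) a, of s] s by (auto simp: algebra_simps)
      have d2: "f differentiable (at (x + a *\<^sub>R u))"
        using smooth_on_imp_differentiable[OF S(2)] inS[OF s(2) a, of 0] s by (auto simp: algebra_simps)
      show "(g has_vector_derivative G a) (at a)"
        using has_vector_derivative_line[OF d1] has_vector_derivative_line[OF d2]
        unfolding g_def G_def
        by (auto intro!: derivative_eq_intros simp: algebra_simps)
    qed (use s G in auto)
    then show ?thesis by (simp add: g_def algebra_simps)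
  qed
  moreover have "\<delta> > 0" using \<open>r > 0\<close> pos by (simp add: \<delta>_def)
  ultimately show ?thesis unfolding D_def by blast
qed

text \<open>The second difference is symmetric in \<open>u\<close> and \<open>v\<close>, and both
  mixed derivatives approximate it after division by \<open>s * s\<close>. Were they at distance
  \<open>3 e\<close>, two approximations with error \<open>e\<close> would be incompatible.\<close>

lemma dird_commute:
  fixes f :: "'a::euclidean_space \<Rightarrow> 'b::real_normed_vector"
  assumes S: "open S" "smooth_on f S" "x \<in> S"
  shows "dird (\<lambda>y. dird f y u) x v = dird (\<lambda>y. dird f y v) x u"
proof (rule ccontr)
  let ?A = "dird (\<lambda>y. dird f y u) x v" and ?B = "dird (\<lambda>y. dird f y v) x u"
  assume "?A \<noteq> ?B"
  define e where "e = norm (?A - ?B) / 3"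
  have e: "e > 0" using \<open>?A \<noteq> ?B\<close> by (simp add: e_def)
  obtain d1 where d1: "d1 > 0" "\<And>s. 0 < s \<Longrightarrow> s < d1 \<Longrightarrow>
    norm (f (x + s *\<^sub>R u + s *\<^sub>R v) - f (x + s *\<^sub>R u) - f (x + s *\<^sub>R v) + f x - (s * s) *\<^sub>R ?A) \<le> e * (s * s)"
    using second_difference_bound[OF S e, of u v] by blast
  obtain d2 where d2: "d2 > 0" "\<And>s. 0 < s \<Longrightarrow> s < d2 \<Longrightarrow>
    norm (f (x + s *\<^sub>R v + s *\<^sub>R u) - f (x + s *\<^sub>R v) - f (x + s *\<^sub>R u) + f x - (s * s) *\<^sub>R ?B) \<le> e * (s * s)"
    using second_difference_bound[OF S e, of v u] by blast
  define s where "s = min d1 d2 / 2"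
  have s: "0 < s" "s < d1" "s < d2" using d1 d2 by (auto simp: s_def)
  define P where "P = f (x + s *\<^sub>R u + s *\<^sub>R v) - f (x + s *\<^sub>R u) - f (x + s *\<^sub>R v) + f x"
  have "norm (P - (s * s) *\<^sub>R ?A) \<le> e * (s * s)" "norm (P - (s * s) *\<^sub>R ?B) \<le> e * (s * s)"
    using d1(2)[OF s(1,2)] d2(2)[OF s(1,3)] by (simp_all add: P_def algebra_simps)
  then have "norm ((P - (s * s) *\<^sub>R ?B) - (P - (s * s) *\<^sub>R ?A)) \<le> 2 * e * (s * s)"
    using norm_triangle_ineq4[of "P - (s * s) *\<^sub>R ?B" "P - (s * s) *\<^sub>R ?A"] by linarith
  moreover have "(P - (s * s) *\<^sub>R ?B) - (P - (s * s) *\<^sub>R ?A) = (s * s) *\<^sub>R (?A - ?B)"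
    by (simp add: algebra_simps)
  ultimately have "(s * s) * (3 * e) \<le> (s * s) * (2 * e)"
    by (simp add: e_def mult.commute)
  then show False using s e by (auto simp: mult_le_cancel_left)
qed

section \<open>Germs of smooth functions\<close>

text \<open>Coordinates and potentials matter only as germs, so the neighbourhood is left unnamed
  and can shrink silently under sums and compositions.\<close>

definition smooth_at :: "'a::euclidean_space \<Rightarrow> ('a \<Rightarrow> 'b::real_normed_vector) \<Rightarrow> bool"
  where "smooth_at x f \<longleftrightarrow> (\<exists>S. open S \<and> x \<in> S \<and> smooth_on f S)"

lemma smooth_on_imp_smooth_at: "open S \<Longrightarrow> smooth_on f S \<Longrightarrow> x \<in> S \<Longrightarrow> smooth_at x f"
  by (auto simp: smooth_at_def)

lemma smooth_at_differentiable: "smooth_at x f \<Longrightarrow> f differentiable (at x)"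
  by (auto simp: smooth_at_def intro: smooth_on_imp_differentiable)

lemma smooth_at_has_derivative: "smooth_at x f \<Longrightarrow> (f has_derivative dird f x) (at x)"
  using smooth_at_differentiable frechet_derivative_works by blast

lemma smooth_at_isCont: "smooth_at x f \<Longrightarrow> isCont f x"
  using smooth_at_differentiable differentiable_imp_continuous_within by blast

lemma smooth_at_eventually: "smooth_at x f \<Longrightarrow> \<forall>\<^sub>F y in nhds x. smooth_at y f"
  unfolding smooth_at_def eventually_nhds by blast

lemma smooth_at_dird: "smooth_at x f \<Longrightarrow> smooth_at x (\<lambda>y. dird f y u)"
  by (auto simp: smooth_at_def intro: smooth_on_dird)

lemma smooth_at_dird_commute:
  "smooth_at x f \<Longrightarrow> dird (\<lambda>y. dird f y u) x v = dird (\<lambda>y. dird f y v) x u"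
  by (auto simp: smooth_at_def intro: dird_commute)

lemma smooth_at_cong:
  assumes "smooth_at x f" "\<forall>\<^sub>F y in nhds x. f y = g y"
  shows "smooth_at x g"
proof -
  obtain S T where "open S" "x \<in> S" "smooth_on f S" "open T" "x \<in> T" "\<forall>y\<in>T. f y = g y"
    using assms by (auto simp: smooth_at_def eventually_nhds)
  have "smooth_on g (S \<inter> T)"
  proof (rule smooth_on_cong)
    show "smooth_on f (S \<inter> T)" by (rule smooth_on_subset[OF \<open>smooth_on f S\<close>]) simp
  qed (use \<open>open S\<close> \<open>open T\<close> \<open>\<forall>y\<in>T. f y = g y\<close> in auto)
  then show ?thesis
    by (rule smooth_on_imp_smooth_at[rotated]) (use \<open>open S\<close> \<open>x \<in> S\<close> \<open>open T\<close> \<open>x \<in> T\<close> in auto)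
qed

lemma dird_cong_eventually:
  assumes "\<forall>\<^sub>F y in nhds x. f y = g y" "f differentiable (at x)"
  shows "dird f x = dird g x"
  using assms by (auto simp: eventually_nhds intro: dird_cong)

lemma dird_cong_eventually2:
  assumes "\<forall>\<^sub>F y in nhds x. f y = g y" "smooth_at x f"
  shows "\<forall>\<^sub>F y in nhds x. dird f y = dird g y"
proof -
  obtain S where "open S" "x \<in> S" "\<And>y. y \<in> S \<Longrightarrow> f y = g y"
    using assms(1) by (auto simp: eventually_nhds)
  then have "\<forall>\<^sub>F y in nhds x. y \<in> S" by (auto intro: eventually_nhds_in_open)
  with smooth_at_eventually[OF assms(2)] show ?thesis
    by eventually_elim (metis dird_cong(1) \<open>open S\<close> \<open>\<And>y. y \<in> S \<Longrightarrow> f y = g y\<close> smooth_at_differentiable)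
qed

lemma smooth_at_const [simp]: "smooth_at x (\<lambda>_. c)"
  by (auto simp: smooth_at_def)

lemma smooth_at_linear: "bounded_linear h \<Longrightarrow> smooth_at x h"
  unfolding smooth_at_def using smooth_on_linear open_UNIV by blast

lemma smooth_at_ident [simp]: "smooth_at x (\<lambda>x. x)"
  by (rule smooth_at_linear[OF bounded_linear_ident])

lemma smooth_at_obtain2:
  assumes "smooth_at x f" "smooth_at x g"
  obtains S where "open S" "x \<in> S" "smooth_on f S" "smooth_on g S"
proof -
  obtain S T where "open S" "x \<in> S" "smooth_on f S" "open T" "x \<in> T" "smooth_on g T"
    using assms by (auto simp: smooth_at_def)
  moreover from this have "smooth_on f (S \<inter> T)" "smooth_on g (S \<inter> T)"
    by (meson smooth_on_subset Int_lower1 Int_lower2)+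
  ultimately show ?thesis by (intro that[of "S \<inter> T"]) auto
qed

lemma smooth_at_add: "smooth_at x f \<Longrightarrow> smooth_at x g \<Longrightarrow> smooth_at x (\<lambda>x. f x + g x)"
  by (metis smooth_at_obtain2 smooth_on_add smooth_at_def)

lemma smooth_at_diff: "smooth_at x f \<Longrightarrow> smooth_at x g \<Longrightarrow> smooth_at x (\<lambda>x. f x - g x)"
  by (metis smooth_at_obtain2 smooth_on_diff smooth_at_def)

lemma smooth_at_bilinear:
  "bounded_bilinear bp \<Longrightarrow> smooth_at x f \<Longrightarrow> smooth_at x g \<Longrightarrow> smooth_at x (\<lambda>x. bp (f x) (g x))"
  by (metis smooth_at_obtain2 smooth_on_bilinear smooth_at_def)

lemmas smooth_at_scaleR = smooth_at_bilinear[OF bounded_bilinear_scaleR]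

lemma smooth_at_bounded_linear: "bounded_linear h \<Longrightarrow> smooth_at x f \<Longrightarrow> smooth_at x (\<lambda>x. h (f x))"
  by (metis smooth_on_bounded_linear smooth_at_def)

lemma smooth_at_sum:
  "(\<And>i. i \<in> I \<Longrightarrow> smooth_at x (f i)) \<Longrightarrow> smooth_at x (\<lambda>x. \<Sum>i\<in>I. f i x)"
  by (induction I rule: infinite_finite_induct) (auto intro: smooth_at_add)

lemma smooth_at_compose:
  fixes f :: "'b::euclidean_space \<Rightarrow> 'c::real_normed_vector" and g :: "'a::euclidean_space \<Rightarrow> 'b"
  assumes "smooth_at (g x) f" "smooth_at x g"
  shows "smooth_at x (\<lambda>x. f (g x))"
proof -
  obtain S T where ST: "open S" "x \<in> S" "smooth_on g S" "open T" "g x \<in> T" "smooth_on f T"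
    using assms by (auto simp: smooth_at_def)
  have o: "open (S \<inter> g -` T)"
    using continuous_open_preimage[OF smooth_on_continuous_on[OF ST(3)] ST(1,4)] by simp
  have "smooth_on (\<lambda>x. f (g x)) (S \<inter> g -` T)"
    by (rule smooth_on_compose[OF o ST(6) smooth_on_subset[OF ST(3)]]) auto
  then show ?thesis
    by (rule smooth_on_imp_smooth_at[OF o]) (use ST in auto)
qed

lemma smooth_at_dird_field:
  fixes f :: "'a::euclidean_space \<Rightarrow> 'b::real_normed_vector"
  assumes "smooth_at x f" "smooth_at x w"
  shows "smooth_at x (\<lambda>x. dird f x (w x))"
  using smooth_at_obtain2[OF assms] smooth_on_dird_field smooth_at_def by metis

lemma smooth_at_compose_eventually:
  fixes g :: "'a::euclidean_space \<Rightarrow> 'b::euclidean_space"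
  assumes "smooth_at x g" "\<forall>\<^sub>F y in nhds (g x). P y"
  shows "\<forall>\<^sub>F y in nhds x. P (g y)"
  using assms(2) smooth_at_isCont[OF assms(1)]
  by (simp add: continuous_at eventually_compose_filterlim tendsto_at_iff_tendsto_nhds)

section \<open>Taylor coefficients of curves\<close>

text \<open>\<open>taylor f n X\<close> is the coefficient of the curve along the ray through
  \<open>X\<close>. Working with arbitrary curves also covers lines with a moving base point and
  truncated Taylor polynomials, which are not of the form \<open>f (t *\<^sub>R X)\<close> for a
  fixed \<open>f\<close>.\<close>

definition tc :: "nat \<Rightarrow> (real \<Rightarrow> 'b::real_normed_vector) \<Rightarrow> 'b"
  where "tc n c = (1 / fact n) *\<^sub>R ((\<lambda>h t. vector_derivative h (at t)) ^^ n) c 0"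

lemma taylor_eq_tc: "taylor f n X = tc n (\<lambda>t. f (t *\<^sub>R X))"
  by (simp add: taylor_def tc_def)

lemma vector_derivative_cong_eventually:
  assumes "\<forall>\<^sub>F y in nhds t. c y = d y"
  shows "vector_derivative c (at t) = vector_derivative d (at t)"
  by (rule vector_derivative_cong_eq) (use assms in auto)

lemma tc_0 [simp]: "tc 0 c = c 0"
  by (simp add: tc_def)

lemma tc_Suc: "real (Suc n) *\<^sub>R tc (Suc n) c = tc n (\<lambda>t. vector_derivative c (at t))"
  unfolding tc_def funpow_Suc_right by (simp add: field_simps del: of_nat_Suc)

lemma tc_cong:
  assumes "\<forall>\<^sub>F t in nhds 0. c t = d t"
  shows "tc n c = tc n d"
  using assms
proof (induction n arbitrary: c d)
  case 0
  then show ?case using eventually_nhds_x_imp_x by auto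
next
  case (Suc n)
  have "\<forall>\<^sub>F t in nhds 0. vector_derivative c (at t) = vector_derivative d (at t)"
    using Suc.prems[THEN eventually_eventually[THEN iffD2]]
    by eventually_elim (rule vector_derivative_cong_eventually)
  from Suc.IH[OF this] have "real (Suc n) *\<^sub>R tc (Suc n) c = real (Suc n) *\<^sub>R tc (Suc n) d"
    by (simp only: tc_Suc)
  then show ?case by (simp del: of_nat_Suc)
qed

lemma tc_Suc_derivative:
  assumes "\<forall>\<^sub>F t in nhds 0. (c has_vector_derivative c' t) (at t)"
  shows "real (Suc n) *\<^sub>R tc (Suc n) c = tc n c'"
  unfolding tc_Suc
  by (rule tc_cong) (use assms in eventually_elim, rule vector_derivative_at)

lemma smooth_at_vector_derivative:
  fixes c :: "real \<Rightarrow> 'b::real_normed_vector"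
  assumes "smooth_at t c"
  shows "(c has_vector_derivative dird c t 1) (at t)"
proof -
  have "dird c t = (\<lambda>s. s *\<^sub>R dird c t 1)"
  proof
    fix s show "dird c t s = s *\<^sub>R dird c t 1"
      using linear_scale[OF linear_dird[OF smooth_at_differentiable[OF assms]], of s 1] by simp
  qed
  then show ?thesis
    using smooth_at_has_derivative[OF assms] by (metis has_vector_derivative_def)
qed

lemma tc_Suc_smooth:
  assumes "smooth_at 0 c"
  shows "real (Suc n) *\<^sub>R tc (Suc n) c = tc n (\<lambda>t. dird c t 1)"
  by (rule tc_Suc_derivative) (use smooth_at_eventually[OF assms] in eventually_elim, rule smooth_at_vector_derivative)

lemma tc_bounded_linear:
  assumes "bounded_linear h" "smooth_at 0 c"
  shows "tc n (\<lambda>t. h (c t)) = h (tc n c)"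
  using assms(2)
proof (induction n arbitrary: c)
  case (Suc n)
  have "real (Suc n) *\<^sub>R tc (Suc n) (\<lambda>t. h (c t)) = tc n (\<lambda>t. h (dird c t 1))"
  proof (rule tc_Suc_derivative)
    show "\<forall>\<^sub>F t in nhds 0. ((\<lambda>t. h (c t)) has_vector_derivative h (dird c t 1)) (at t)"
      using smooth_at_eventually[OF Suc.prems]
      by eventually_elim (rule bounded_linear.has_vector_derivative[OF assms(1) smooth_at_vector_derivative])
  qed
  also have "\<dots> = h (real (Suc n) *\<^sub>R tc (Suc n) c)"
    using Suc.IH[OF smooth_at_dird[OF Suc.prems]] tc_Suc_smooth[OF Suc.prems] by metis
  also have "\<dots> = real (Suc n) *\<^sub>R h (tc (Suc n) c)"
    by (simp only: linear_scale[OF bounded_linear.linear[OF assms(1)]])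
  finally show ?case by (simp del: of_nat_Suc)
qed simp

lemma tc_add:
  assumes "smooth_at 0 c" "smooth_at 0 d"
  shows "tc n (\<lambda>t. c t + d t) = tc n c + tc n d"
  using assms
proof (induction n arbitrary: c d)
  case (Suc n)
  have "real (Suc n) *\<^sub>R tc (Suc n) (\<lambda>t. c t + d t) = tc n (\<lambda>t. dird c t 1 + dird d t 1)"
  proof (rule tc_Suc_derivative)
    show "\<forall>\<^sub>F t in nhds 0. ((\<lambda>t. c t + d t) has_vector_derivative dird c t 1 + dird d t 1) (at t)"
      using smooth_at_eventually[OF Suc.prems(1)] smooth_at_eventually[OF Suc.prems(2)]
      by eventually_elim (intro has_vector_derivative_add smooth_at_vector_derivative)
  qed
  also have "\<dots> = real (Suc n) *\<^sub>R (tc (Suc n) c + tc (Suc n) d)"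
    using Suc.IH[OF smooth_at_dird[OF Suc.prems(1)] smooth_at_dird[OF Suc.prems(2)]]
      tc_Suc_smooth[OF Suc.prems(1)] tc_Suc_smooth[OF Suc.prems(2)] by (metis scaleR_add_right)
  finally show ?case by (simp del: of_nat_Suc)
qed simp

lemma tc_const: "tc n (\<lambda>t. c) = (if n = 0 then c else 0)"
proof (cases n)
  case (Suc m)
  have "tc k (\<lambda>t. 0::'a) = 0" for k
    using tc_bounded_linear[OF bounded_linear_zero, of "\<lambda>_. 0::'a" k] by simp
  then have "real (Suc m) *\<^sub>R tc (Suc m) (\<lambda>t. c) = 0"
    by (subst tc_Suc) simp
  then show ?thesis using Suc by simp
qed simp

lemma tc_diff:
  assumes "smooth_at 0 c" "smooth_at 0 d"
  shows "tc n (\<lambda>t. c t - d t) = tc n c - tc n d"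
  using tc_add[OF assms(1) smooth_at_bounded_linear[OF bounded_linear_minus[OF bounded_linear_ident] assms(2)], of n]
    tc_bounded_linear[OF bounded_linear_minus[OF bounded_linear_ident] assms(2), of n] by simp

lemma tc_sum:
  assumes "\<And>i. i \<in> I \<Longrightarrow> smooth_at 0 (c i)"
  shows "tc n (\<lambda>t. \<Sum>i\<in>I. c i t) = (\<Sum>i\<in>I. tc n (c i))"
  using assms
  by (induction I rule: infinite_finite_induct) (auto simp: tc_const tc_add smooth_at_sum)

text \<open>The factor \<open>1 / fact n\<close> in \<open>tc\<close> turns the Leibniz rule into a
  Cauchy product. In the induction the two halves of the product rule carry the weights
  \<open>Suc n - j\<close> and \<open>j\<close>, which add up to \<open>Suc n\<close>.\<close>

lemma tc_bilinear:
  assumes "bounded_bilinear bp" "smooth_at 0 c" "smooth_at 0 d"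
  shows "tc n (\<lambda>t. bp (c t) (d t)) = (\<Sum>j\<le>n. bp (tc j c) (tc (n - j) d))"
  using assms(2,3)
proof (induction n arbitrary: c d)
  case (Suc n)
  interpret bounded_bilinear bp by fact
  let ?c' = "\<lambda>t. dird c t 1" and ?d' = "\<lambda>t. dird d t 1"
  note sm = Suc.prems smooth_at_dird[OF Suc.prems(1), of 1] smooth_at_dird[OF Suc.prems(2), of 1]
  have "real (Suc n) *\<^sub>R tc (Suc n) (\<lambda>t. bp (c t) (d t)) = tc n (\<lambda>t. bp (c t) (?d' t) + bp (?c' t) (d t))"
  proof (rule tc_Suc_derivative)
    show "\<forall>\<^sub>F t in nhds 0. ((\<lambda>t. bp (c t) (d t)) has_vector_derivative bp (c t) (?d' t) + bp (?c' t) (d t)) (at t)"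
      using smooth_at_eventually[OF Suc.prems(1)] smooth_at_eventually[OF Suc.prems(2)]
      by eventually_elim (intro has_vector_derivative smooth_at_vector_derivative)
  qed
  also have "\<dots> = (\<Sum>j\<le>n. bp (tc j c) (tc (n - j) ?d')) + (\<Sum>j\<le>n. bp (tc j ?c') (tc (n - j) d))"
    using sm by (simp add: tc_add smooth_at_bilinear[OF assms(1)] Suc.IH)
  also have "(\<Sum>j\<le>n. bp (tc j c) (tc (n - j) ?d')) = (\<Sum>j\<le>n. real (Suc n - j) *\<^sub>R bp (tc j c) (tc (Suc n - j) d))"
    by (rule sum.cong[OF refl]) (simp add: tc_Suc_smooth[OF Suc.prems(2), symmetric] Suc_diff_le scaleR_right)
  also have "\<dots> = (\<Sum>j\<le>Suc n. real (Suc n - j) *\<^sub>R bp (tc j c) (tc (Suc n - j) d))"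
    by simp
  also have "(\<Sum>j\<le>n. bp (tc j ?c') (tc (n - j) d)) = (\<Sum>j\<le>n. real (Suc j) *\<^sub>R bp (tc (Suc j) c) (tc (n - j) d))"
    by (rule sum.cong[OF refl]) (simp only: tc_Suc_smooth[OF Suc.prems(1), symmetric] scaleR_left)
  also have "\<dots> = (\<Sum>j\<le>Suc n. real j *\<^sub>R bp (tc j c) (tc (Suc n - j) d))"
    by (simp add: sum.atMost_Suc_shift del: sum.atMost_Suc of_nat_Suc)
  also have "(\<Sum>j\<le>Suc n. real (Suc n - j) *\<^sub>R bp (tc j c) (tc (Suc n - j) d)) + (\<Sum>j\<le>Suc n. real j *\<^sub>R bp (tc j c) (tc (Suc n - j) d))
     = real (Suc n) *\<^sub>R (\<Sum>j\<le>Suc n. bp (tc j c) (tc (Suc n - j) d))"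
    unfolding sum.distrib[symmetric] scaleR_sum_right
    by (rule sum.cong[OF refl]) (simp add: scaleR_add_left[symmetric] of_nat_diff del: of_nat_Suc)
  finally show ?case by (simp del: of_nat_Suc)
qed simp

text \<open>This recursion takes the place of an explicit formula for higher derivatives of a
  composition: on the right only coefficients of order at most \<open>n\<close> of partial
  derivatives of \<open>F\<close> along \<open>c\<close> occur. Statements about compositions follow
  from it by strong induction on the order with \<open>F\<close> generalized.\<close>

lemma tc_compose_Suc:
  fixes F :: "'a::euclidean_space \<Rightarrow> 'b::real_normed_vector"
  assumes "smooth_at (c 0) F" "smooth_at 0 c"
  shows "real (Suc n) *\<^sub>R tc (Suc n) (\<lambda>t. F (c t)) =
    (\<Sum>i\<in>Basis. \<Sum>j\<le>n. (real (Suc n - j) * (tc (Suc n - j) c \<bullet> i)) *\<^sub>R tc j (\<lambda>t. dird F (c t) i))"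
proof -
  have "real (Suc n) *\<^sub>R tc (Suc n) (\<lambda>t. F (c t)) = tc n (\<lambda>t. \<Sum>i\<in>Basis. (dird c t 1 \<bullet> i) *\<^sub>R dird F (c t) i)"
  proof (rule tc_Suc_derivative)
    show "\<forall>\<^sub>F t in nhds 0. ((\<lambda>t. F (c t)) has_vector_derivative (\<Sum>i\<in>Basis. (dird c t 1 \<bullet> i) *\<^sub>R dird F (c t) i)) (at t)"
      using smooth_at_eventually[OF assms(2)] smooth_at_compose_eventually[OF assms(2) smooth_at_eventually[OF assms(1)]]
    proof eventually_elim
      case (elim t)
      have "dird (\<lambda>t. F (c t)) t 1 = (\<Sum>i\<in>Basis. (dird c t 1 \<bullet> i) *\<^sub>R dird F (c t) i)"
        using elim dird_compose(1)[of F c t 1] dird_basis_expansion[of F "c t" "dird c t 1"]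
        by (simp add: smooth_at_differentiable)
      then show ?case
        using smooth_at_vector_derivative[of t "\<lambda>t. F (c t)"] smooth_at_compose[OF elim(2,1)] by simp
    qed
  qed
  also have "\<dots> = (\<Sum>i\<in>Basis. \<Sum>j\<le>n. (tc j (\<lambda>t. dird c t 1) \<bullet> i) *\<^sub>R tc (n - j) (\<lambda>t. dird F (c t) i))"
    using assms
    by (simp add: tc_sum tc_bilinear[OF bounded_bilinear_scaleR] tc_bounded_linear[OF bounded_linear_inner_left]
      smooth_at_scaleR smooth_at_dird smooth_at_bounded_linear[OF bounded_linear_inner_left]
      smooth_at_compose[where f="\<lambda>y. dird F y _"])
  also have "\<dots> = (\<Sum>i\<in>Basis. \<Sum>j\<le>n. (tc (n - j) (\<lambda>t. dird c t 1) \<bullet> i) *\<^sub>R tc j (\<lambda>t. dird F (c t) i))"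
    by (intro sum.cong[OF refl] sum.reindex_bij_witness[of _ "\<lambda>j. n - j" "\<lambda>j. n - j"]) auto
  also have "\<dots> = (\<Sum>i\<in>Basis. \<Sum>j\<le>n. (real (Suc n - j) * (tc (Suc n - j) c \<bullet> i)) *\<^sub>R tc j (\<lambda>t. dird F (c t) i))"
    by (intro sum.cong[OF refl]) (simp add: tc_Suc_smooth[OF assms(2), symmetric] Suc_diff_le)
  finally show ?thesis .
qed

lemma has_derivative_cong_nhds:
  assumes "(f has_derivative f') (at x)" "\<forall>\<^sub>F y in nhds x. f y = h y"
  shows "(h has_derivative f') (at x)"
  using assms has_derivative_transform_within_open[of f f' x UNIV _ h]
  unfolding eventually_nhds by metis

section \<open>Polynomial curves, rays, and Taylor components in several variables\<close>

lemma tc_power: "tc m (\<lambda>t. t ^ n *\<^sub>R c) = (if m = n then c else 0)"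
proof (induction m arbitrary: n c)
  case 0
  then show ?case by (simp add: power_0_left)
next
  case (Suc m)
  have "real (Suc m) *\<^sub>R tc (Suc m) (\<lambda>t. t ^ n *\<^sub>R c) = tc m (\<lambda>t. t ^ (n - 1) *\<^sub>R (real n *\<^sub>R c))"
    by (rule tc_Suc_derivative) (auto intro!: always_eventually derivative_eq_intros simp: mult.commute)
  also have "\<dots> = (if m = n - 1 then real n *\<^sub>R c else 0)" by (rule Suc.IH)
  also have "\<dots> = real (Suc m) *\<^sub>R (if Suc m = n then c else 0)" by (cases n) auto
  finally show ?case by (simp del: of_nat_Suc)
qed

lemma smooth_at_power: "smooth_at x (\<lambda>t::real. t ^ n *\<^sub>R c)"
proof (induction n)
  case (Suc n)
  show ?case using smooth_at_scaleR[OF smooth_at_ident Suc] by simp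
qed simp

lemma smooth_at_polynomial: "smooth_at x (\<lambda>t::real. \<Sum>k\<le>n. t ^ k *\<^sub>R a k)"
  by (intro smooth_at_sum smooth_at_power)

lemma tc_polynomial: "tc m (\<lambda>t. \<Sum>k\<le>n. t ^ k *\<^sub>R a k) = (if m \<le> n then a m else 0)"
  by (simp add: tc_sum smooth_at_power tc_power)

lemma smooth_at_ray: "smooth_at 0 (\<lambda>t::real. t *\<^sub>R (X::'a::euclidean_space))"
  by (rule smooth_at_linear) (rule bounded_linear_scaleR_left)

lemma smooth_at_line: "smooth_at t (\<lambda>t::real. x + t *\<^sub>R (X::'a::euclidean_space))"
  by (intro smooth_at_add smooth_at_linear bounded_linear_scaleR_left smooth_at_const)

lemma smooth_at_on_ray:
  fixes f :: "'a::euclidean_space \<Rightarrow> 'b::real_normed_vector"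
  assumes "smooth_at 0 f"
  shows "smooth_at 0 (\<lambda>t::real. f (t *\<^sub>R X))"
  by (rule smooth_at_compose) (simp_all add: assms smooth_at_ray)

lemma eventually_on_ray:
  fixes X :: "'a::euclidean_space"
  assumes "\<forall>\<^sub>F y in nhds 0. P y"
  shows "\<forall>\<^sub>F t in nhds (0::real). P (t *\<^sub>R X)"
  using smooth_at_compose_eventually[OF smooth_at_ray, of P X] assms by simp

lemma taylor_0 [simp]: "taylor f 0 X = f 0"
  by (simp add: taylor_eq_tc)

lemma taylor_cong:
  fixes f :: "'a::euclidean_space \<Rightarrow> 'b::real_normed_vector"
  assumes "\<forall>\<^sub>F y in nhds 0. f y = h y"
  shows "taylor f n X = taylor h n X"
  unfolding taylor_eq_tc by (rule tc_cong) (rule eventually_on_ray[OF assms])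

lemma taylor_diff:
  "smooth_at 0 f \<Longrightarrow> smooth_at 0 h \<Longrightarrow> taylor (\<lambda>x. f x - h x) n X = taylor f n X - taylor h n X"
  by (simp add: taylor_eq_tc tc_diff smooth_at_on_ray)

lemma taylor_sum:
  "(\<And>i. i \<in> I \<Longrightarrow> smooth_at 0 (f i)) \<Longrightarrow> taylor (\<lambda>x. \<Sum>i\<in>I. f i x) n X = (\<Sum>i\<in>I. taylor (f i) n X)"
  by (simp add: taylor_eq_tc tc_sum smooth_at_on_ray)

lemma taylor_bounded_linear:
  "bounded_linear h \<Longrightarrow> smooth_at 0 f \<Longrightarrow> taylor (\<lambda>x. h (f x)) n X = h (taylor f n X)"
  unfolding taylor_eq_tc by (rule tc_bounded_linear) (auto intro: smooth_at_on_ray)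

lemma taylor_linear_subst:
  "linear h \<Longrightarrow> taylor (\<lambda>x. f (h x)) n X = taylor f n (h X)"
  by (simp add: taylor_eq_tc linear_scale)

lemma taylor_Suc:
  assumes "smooth_at 0 f"
  shows "real (Suc n) *\<^sub>R taylor f (Suc n) X = taylor (\<lambda>Y. dird f Y X) n X"
  unfolding taylor_eq_tc
proof (rule tc_Suc_derivative)
  show "\<forall>\<^sub>F t in nhds 0. ((\<lambda>t. f (t *\<^sub>R X)) has_vector_derivative dird f (t *\<^sub>R X) X) (at t)"
    using eventually_on_ray[OF smooth_at_eventually[OF assms], of X]
  proof eventually_elim
    case (elim t)
    then show ?case
      using has_vector_derivative_line[of f 0 t X] by (simp add: smooth_at_differentiable)
  qed
qed

lemma taylor_Suc_basis:
  assumes "smooth_at 0 f"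
  shows "real (Suc n) *\<^sub>R taylor f (Suc n) X = (\<Sum>i\<in>Basis. (X \<bullet> i) *\<^sub>R taylor (\<lambda>Y. dird f Y i) n X)"
proof -
  have "taylor (\<lambda>Y. dird f Y X) n X = taylor (\<lambda>Y. \<Sum>i\<in>Basis. (X \<bullet> i) *\<^sub>R dird f Y i) n X"
    by (rule taylor_cong, use smooth_at_eventually[OF assms] in eventually_elim)
      (intro dird_basis_expansion smooth_at_differentiable)
  also have "\<dots> = (\<Sum>i\<in>Basis. (X \<bullet> i) *\<^sub>R taylor (\<lambda>Y. dird f Y i) n X)"
    by (simp add: taylor_sum taylor_bounded_linear[OF bounded_linear_scaleR_right] smooth_at_dird[OF assms]
      smooth_at_bounded_linear[OF bounded_linear_scaleR_right])
  finally show ?thesis using taylor_Suc[OF assms] by metis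
qed

section \<open>Homogeneous polynomials\<close>

lemma hom_poly_zero [simp]: "hom_poly n (\<lambda>_. 0)"
proof (induction n)
  case (Suc n)
  show ?case using hom_poly.mult[OF linear_zero Suc] by simp
qed (rule hom_poly.const)

lemma hom_poly_sum: "(\<And>i. i \<in> I \<Longrightarrow> hom_poly n (f i)) \<Longrightarrow> hom_poly n (\<lambda>x. \<Sum>i\<in>I. f i x)"
  by (induction I rule: infinite_finite_induct) (auto intro: hom_poly.add)

lemma hom_poly_linear_image:
  assumes "hom_poly n f" "linear h"
  shows "hom_poly n (\<lambda>x. h (f x))"
  using assms(1)
proof induction
  case (const c)
  show ?case by (rule hom_poly.const)
next
  case (mult l n f)
  then show ?case by (simp add: linear_scale[OF assms(2)] hom_poly.mult)
next
  case (add n f h)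
  then show ?case by (simp add: linear_add[OF assms(2)] hom_poly.add)
qed

lemma hom_poly_scaleR: "hom_poly n f \<Longrightarrow> hom_poly n (\<lambda>x. c *\<^sub>R f x)"
  by (rule hom_poly_linear_image) (simp_all add: linear_scaleR)

lemma hom_poly_diff: "hom_poly n f \<Longrightarrow> hom_poly n h \<Longrightarrow> hom_poly n (\<lambda>x. f x - h x)"
  using hom_poly.add[of n f "\<lambda>x. (-1) *\<^sub>R h x"] hom_poly_scaleR[of n h "-1"] by simp

lemma hom_poly_linear_subst:
  assumes "hom_poly n f" "linear h"
  shows "hom_poly n (\<lambda>x. f (h x))"
  using assms(1)
proof induction
  case (const c)
  show ?case by (rule hom_poly.const)
next
  case (mult l n f)
  then show ?case using hom_poly.mult[of "\<lambda>x. l (h x)"] linear_compose[OF assms(2) mult(1)]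
    by (simp add: o_def)
next
  case (add n f h)
  then show ?case by (simp add: hom_poly.add)
qed

lemma hom_poly_linear:
  fixes l :: "'a::euclidean_space \<Rightarrow> 'b::real_vector"
  assumes "linear l"
  shows "hom_poly 1 l"
proof -
  have "hom_poly (Suc 0) (\<lambda>x. \<Sum>i\<in>Basis. (x \<bullet> i) *\<^sub>R l i)"
    by (intro hom_poly_sum hom_poly.mult hom_poly.const bounded_linear.linear[OF bounded_linear_inner_left])
  moreover have "l = (\<lambda>x. \<Sum>i\<in>Basis. (x \<bullet> i) *\<^sub>R l i)"
    by (rule ext) (rule linear_basis_expansion[OF assms])
  ultimately show ?thesis by (metis One_nat_def)
qed

lemma hom_poly_scaleR_mult:
  assumes "hom_poly m h" "hom_poly n f"
  shows "hom_poly (m + n) (\<lambda>x. h x *\<^sub>R f x)"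
  using assms(1)
proof induction
  case (const c)
  then show ?case using hom_poly_scaleR[OF assms(2)] by simp
next
  case (mult l n h)
  then show ?case using hom_poly.mult[OF mult(1,3)] by simp
next
  case (add n h h')
  then show ?case by (simp add: scaleR_add_left hom_poly.add)
qed

lemma hom_poly_bilinear:
  fixes b :: "'b::euclidean_space \<Rightarrow> 'c::euclidean_space \<Rightarrow> 'd::real_vector"
  assumes "bilinear b" "hom_poly m f" "hom_poly n h"
  shows "hom_poly (m + n) (\<lambda>x. b (f x) (h x))"
proof -
  have "hom_poly (m + n) (\<lambda>x. \<Sum>i\<in>Basis. \<Sum>j\<in>Basis. (f x \<bullet> i) *\<^sub>R ((h x \<bullet> j) *\<^sub>R b i j))"
    using assms by (intro hom_poly_sum hom_poly_scaleR_mult hom_poly_linear_image[of _ _ "\<lambda>y. y \<bullet> _"]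
        hom_poly_linear_image[of _ _ "\<lambda>y. (y \<bullet> _) *\<^sub>R _"])
      (auto intro!: linearI simp: inner_add_left scaleR_add_left)
  moreover have "b (f x) (h x) = (\<Sum>i\<in>Basis. \<Sum>j\<in>Basis. (f x \<bullet> i) *\<^sub>R ((h x \<bullet> j) *\<^sub>R b i j))" for x
  proof -
    have "b (f x) (h x) = (\<Sum>i\<in>Basis. (f x \<bullet> i) *\<^sub>R b i (h x))"
      using assms(1) by (intro linear_basis_expansion[where h="\<lambda>y. b y (h x)"]) (simp add: bilinear_def)
    moreover have "b i (h x) = (\<Sum>j\<in>Basis. (h x \<bullet> j) *\<^sub>R b i j)" for i
      using assms(1) by (intro linear_basis_expansion) (simp add: bilinear_def)
    ultimately show ?thesis by (simp only: scaleR_sum_right)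
  qed
  ultimately show ?thesis by simp
qed

lemma hom_poly_smooth:
  fixes f :: "'a::euclidean_space \<Rightarrow> 'b::real_normed_vector"
  assumes "hom_poly n f"
  shows "smooth_on f UNIV"
  using assms
proof induction
  case (mult l n f)
  from mult(1) have "smooth_on l UNIV"
    by (intro smooth_on_linear) (simp add: linear_conv_bounded_linear)
  with mult show ?case
    by (intro smooth_on_scaleR) auto
qed (auto intro: smooth_on_add)

lemma hom_poly_smooth_at:
  fixes f :: "'a::euclidean_space \<Rightarrow> 'b::real_normed_vector"
  shows "hom_poly n f \<Longrightarrow> smooth_at x f"
  using hom_poly_smooth smooth_on_imp_smooth_at open_UNIV UNIV_I by metis

lemma hom_poly_differentiable:
  fixes f :: "'a::euclidean_space \<Rightarrow> 'b::real_normed_vector"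
  shows "hom_poly n f \<Longrightarrow> f differentiable (at x)"
  using hom_poly_smooth_at smooth_at_differentiable by metis

lemma hom_poly_homogeneous:
  assumes "hom_poly n f"
  shows "f (t *\<^sub>R x) = t ^ n *\<^sub>R f x"
  using assms by induction (auto simp: linear_scale scaleR_add_right)

lemma hom_poly_0_const: "hom_poly 0 f \<Longrightarrow> f x = f y"
  using hom_poly_homogeneous[of 0 f 0 x] hom_poly_homogeneous[of 0 f 0 y] by simp

text \<open>By \<open>taylor_Suc_basis\<close> the component of degree \<open>Suc n\<close> is a sum
  of linear forms times components of degree \<open>n\<close> of the partial derivatives, which is
  the shape of the inductive rules of \<open>hom_poly\<close>.\<close>

lemma hom_poly_taylor:
  fixes f :: "'a::euclidean_space \<Rightarrow> 'b::real_normed_vector"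
  assumes "smooth_at 0 f"
  shows "hom_poly n (taylor f n)"
  using assms
proof (induction n arbitrary: f)
  case 0
  show ?case using hom_poly.const[of "f 0"] by simp
next
  case (Suc n)
  have "taylor f (Suc n) = (\<lambda>X. (1 / real (Suc n)) *\<^sub>R (\<Sum>i\<in>Basis. (X \<bullet> i) *\<^sub>R taylor (\<lambda>Y. dird f Y i) n X))"
    by (subst taylor_Suc_basis[OF Suc.prems, symmetric]) (simp del: of_nat_Suc)
  moreover have "hom_poly (Suc n) \<dots>"
    by (intro hom_poly_scaleR hom_poly_sum hom_poly.mult Suc smooth_at_dird
      bounded_linear.linear[OF bounded_linear_inner_left])
  ultimately show ?case by simp
qed

lemma taylor_hom_poly:
  assumes "hom_poly n f"
  shows "taylor f m X = (if m = n then f X else 0)"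
  unfolding taylor_eq_tc hom_poly_homogeneous[OF assms] by (rule tc_power)

text \<open>Differentiating the recursion \<open>taylor_Suc_basis\<close> yields the wanted value
  once from the linear forms and, after exchanging second derivatives, \<open>Suc m\<close> times
  from the other factors; the recursion itself carries the factor
  \<open>Suc (Suc m)\<close>.\<close>

lemma dird_taylor:
  fixes F :: "'a::euclidean_space \<Rightarrow> 'b::real_normed_vector"
  assumes "smooth_at 0 F"
  shows "dird (taylor F (Suc m)) Y u = taylor (\<lambda>Y. dird F Y u) m Y"
  using assms
proof (induction m arbitrary: F u)
  case 0
  have "taylor F (Suc 0) = dird F 0"
    using taylor_Suc[OF 0, of 0] by auto
  moreover have "(dird F 0 has_derivative dird F 0) (at Y)"
    using linear_dird[OF smooth_at_differentiable[OF 0]]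
    by (simp add: linear_conv_bounded_linear bounded_linear_imp_has_derivative)
  ultimately show ?case by (simp add: dird_eqI)
next
  case (Suc m)
  note sm = smooth_at_dird[OF Suc.prems]
  have dT: "(taylor (\<lambda>Y. dird F Y i) (Suc m) has_derivative
      (\<lambda>u. taylor (\<lambda>Y. dird (\<lambda>Y. dird F Y i) Y u) m Y)) (at Y)" for i
  proof -
    have "dird (taylor (\<lambda>Y. dird F Y i) (Suc m)) Y = (\<lambda>u. taylor (\<lambda>Y. dird (\<lambda>Y. dird F Y i) Y u) m Y)"
      by (rule ext) (rule Suc.IH[OF sm])
    with smooth_at_has_derivative[OF hom_poly_smooth_at[OF hom_poly_taylor[OF sm, of "Suc m" i]], of Y]
    show ?thesis by metis
  qed
  have comm: "taylor (\<lambda>Y. dird (\<lambda>Y. dird F Y i) Y u) m Y = taylor (\<lambda>Y. dird (\<lambda>Y. dird F Y u) Y i) m Y" for i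
    by (rule taylor_cong, use smooth_at_eventually[OF Suc.prems] in eventually_elim) (rule smooth_at_dird_commute)
  have "((\<lambda>X. real (Suc (Suc m)) *\<^sub>R taylor F (Suc (Suc m)) X) has_derivative
      (\<lambda>u. \<Sum>i\<in>Basis. (Y \<bullet> i) *\<^sub>R taylor (\<lambda>Y. dird (\<lambda>Y. dird F Y i) Y u) m Y
         + (u \<bullet> i) *\<^sub>R taylor (\<lambda>Y. dird F Y i) (Suc m) Y)) (at Y)"
    unfolding taylor_Suc_basis[OF Suc.prems]
    by (intro has_derivative_sum has_derivative_scaleR dT derivative_intros)
  from dird_eqI[OF this, of u]
  have "real (Suc (Suc m)) *\<^sub>R dird (taylor F (Suc (Suc m))) Y u =
      (\<Sum>i\<in>Basis. (Y \<bullet> i) *\<^sub>R taylor (\<lambda>Y. dird (\<lambda>Y. dird F Y u) Y i) m Y)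
       + (\<Sum>i\<in>Basis. (u \<bullet> i) *\<^sub>R taylor (\<lambda>Y. dird F Y i) (Suc m) Y)"
    by (simp add: dird_bounded_linear[OF bounded_linear_scaleR_right hom_poly_differentiable[OF hom_poly_taylor[OF Suc.prems]]]
       comm sum.distrib del: of_nat_Suc)
  also have "(\<Sum>i\<in>Basis. (u \<bullet> i) *\<^sub>R taylor (\<lambda>Y. dird F Y i) (Suc m) Y) = taylor (\<lambda>Y. \<Sum>i\<in>Basis. (u \<bullet> i) *\<^sub>R dird F Y i) (Suc m) Y"
    by (simp add: taylor_sum taylor_bounded_linear[OF bounded_linear_scaleR_right] sm
      smooth_at_bounded_linear[OF bounded_linear_scaleR_right])
  also have "\<dots> = taylor (\<lambda>Y. dird F Y u) (Suc m) Y"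
    by (rule taylor_cong, use smooth_at_eventually[OF Suc.prems] in eventually_elim)
      (intro dird_basis_expansion[symmetric] smooth_at_differentiable)
  also have "(\<Sum>i\<in>Basis. (Y \<bullet> i) *\<^sub>R taylor (\<lambda>Y. dird (\<lambda>Y. dird F Y u) Y i) m Y) = real (Suc m) *\<^sub>R taylor (\<lambda>Y. dird F Y u) (Suc m) Y"
    by (rule taylor_Suc_basis[OF sm, symmetric])
  finally have "real (Suc (Suc m)) *\<^sub>R dird (taylor F (Suc (Suc m))) Y u = real (Suc (Suc m)) *\<^sub>R taylor (\<lambda>Y. dird F Y u) (Suc m) Y"
    by (simp only: of_nat_Suc[of "Suc m"] scaleR_left_distrib scaleR_one add.commute)
  then show ?case by (simp del: of_nat_Suc)
qed

text \<open>A homogeneous polynomial is its own Taylor component, so its derivative is a Taylor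
  component by \<open>dird_taylor\<close>.\<close>

lemma hom_poly_dird:
  fixes f :: "'a::euclidean_space \<Rightarrow> 'b::real_normed_vector"
  assumes "hom_poly (Suc n) f"
  shows "hom_poly n (\<lambda>X. dird f X u)"
proof -
  have f: "f = taylor f (Suc n)" using taylor_hom_poly[OF assms] by auto
  have "(\<lambda>X. dird f X u) = taylor (\<lambda>Y. dird f Y u) n"
    using dird_taylor[OF hom_poly_smooth_at[OF assms], of n _ u] f by (intro ext) metis
  then show ?thesis
    using hom_poly_taylor[OF smooth_at_dird[OF hom_poly_smooth_at[OF assms]], of n u] by metis
qed

lemma dird_hom_poly_0:
  fixes f :: "'a::euclidean_space \<Rightarrow> 'b::real_normed_vector"
  assumes "hom_poly 0 f"
  shows "dird f X u = 0"
proof -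
  have "f = (\<lambda>_. f 0)" using hom_poly_0_const[OF assms] by blast
  then show ?thesis by (metis frechet_derivative_const)
qed

lemma dird_euler:
  fixes f :: "'a::euclidean_space \<Rightarrow> 'b::real_normed_vector"
  assumes "hom_poly n f"
  shows "dird f X X = real n *\<^sub>R f X"
proof (cases n)
  case 0
  then show ?thesis using dird_hom_poly_0 assms by auto
next
  case (Suc m)
  show ?thesis
    using taylor_Suc[OF hom_poly_smooth_at[OF assms], of m X] taylor_hom_poly[OF assms, of n X]
      taylor_hom_poly[OF hom_poly_dird[of m f X], of m X] assms Suc by simp
qed

text \<open>Differentiation in the base point commutes with differentiation along the line, because
  second derivatives commute. With base point and direction in a product space this is the exchange
  of the time derivative with the Taylor components of a jointly smooth family.\<close>

lemma tc_line_derivative: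
  fixes F :: "'a::euclidean_space \<Rightarrow> 'b::real_normed_vector"
  assumes "smooth_at x F"
  shows "((\<lambda>y. tc n (\<lambda>s. F (y + s *\<^sub>R v))) has_derivative (\<lambda>u. tc n (\<lambda>s. dird F (x + s *\<^sub>R v) u))) (at x)"
  using assms
proof (induction n arbitrary: F)
  case 0
  then show ?case by (simp add: smooth_at_has_derivative)
next
  case (Suc n)
  have ln: "smooth_at 0 (\<lambda>s. G (y + s *\<^sub>R v))" if "smooth_at y G" for y and G :: "'a \<Rightarrow> 'b"
    by (rule smooth_at_compose) (simp_all add: that smooth_at_line)
  have ev: "\<forall>\<^sub>F s in nhds 0. smooth_at (y + s *\<^sub>R v) G" if "smooth_at y G" for y and G :: "'a \<Rightarrow> 'b"
    using smooth_at_compose_eventually[OF smooth_at_line, of "\<lambda>y. smooth_at y G" y 0 v] smooth_at_eventually[OF that] by simp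
  have step: "real (Suc n) *\<^sub>R tc (Suc n) (\<lambda>s. G (y + s *\<^sub>R v)) = tc n (\<lambda>s. dird G (y + s *\<^sub>R v) v)"
    if "smooth_at y G" for y and G :: "'a \<Rightarrow> 'b"
    by (rule tc_Suc_derivative, use ev[OF that] in eventually_elim)
      (rule has_vector_derivative_line[OF smooth_at_differentiable])
  have "((\<lambda>y. (1 / real (Suc n)) *\<^sub>R tc n (\<lambda>s. dird F (y + s *\<^sub>R v) v)) has_derivative
      (\<lambda>u. (1 / real (Suc n)) *\<^sub>R tc n (\<lambda>s. dird (\<lambda>y. dird F y v) (x + s *\<^sub>R v) u))) (at x)"
    by (intro has_derivative_scaleR_right Suc.IH smooth_at_dird Suc.prems)
  moreover have "\<forall>\<^sub>F y in nhds x. (1 / real (Suc n)) *\<^sub>R tc n (\<lambda>s. dird F (y + s *\<^sub>R v) v) = tc (Suc n) (\<lambda>s. F (y + s *\<^sub>R v))"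
    using smooth_at_eventually[OF Suc.prems] by eventually_elim (simp add: step[symmetric] del: of_nat_Suc)
  moreover have "(1 / real (Suc n)) *\<^sub>R tc n (\<lambda>s. dird (\<lambda>y. dird F y v) (x + s *\<^sub>R v) u) = tc (Suc n) (\<lambda>s. dird F (x + s *\<^sub>R v) u)" for u
  proof -
    have "tc n (\<lambda>s. dird (\<lambda>y. dird F y v) (x + s *\<^sub>R v) u) = tc n (\<lambda>s. dird (\<lambda>y. dird F y u) (x + s *\<^sub>R v) v)"
      by (rule tc_cong, use ev[OF Suc.prems] in eventually_elim) (rule smooth_at_dird_commute)
    then show ?thesis by (simp add: step[OF smooth_at_dird[OF Suc.prems], symmetric] del: of_nat_Suc)
  qed
  ultimately show ?case
    by (simp only: has_derivative_cong_nhds)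
qed

section \<open>Interpolation of homogeneous polynomials\<close>

lemma hom_poly_on_line:
  assumes "hom_poly n f"
  shows "\<exists>a. \<forall>t. f (w + t *\<^sub>R u) = (\<Sum>k\<le>n. t ^ k *\<^sub>R a k)"
  using assms
proof induction
  case (const c)
  show ?case by (intro exI[of _ "\<lambda>_. c"]) simp
next
  case (mult l n f)
  then obtain a where a: "\<And>t. f (w + t *\<^sub>R u) = (\<Sum>k\<le>n. t ^ k *\<^sub>R a k)" by blast
  \<comment> \<open>On the line \<open>l\<close> equals \<open>l w + t * l u\<close>: the first
    summand keeps the power of \<open>t\<close>, the second raises it by one.\<close>
  define a' where "a' k = (if k \<le> n then l w *\<^sub>R a k else 0) + (if k = 0 then 0 else l u *\<^sub>R a (k - 1))" for k
  have "l (w + t *\<^sub>R u) *\<^sub>R f (w + t *\<^sub>R u) = (\<Sum>k\<le>Suc n. t ^ k *\<^sub>R a' k)" for t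
  proof -
    have "l (w + t *\<^sub>R u) *\<^sub>R f (w + t *\<^sub>R u) =
      (\<Sum>k\<le>n. t ^ k *\<^sub>R (l w *\<^sub>R a k)) + (\<Sum>k\<le>n. t ^ Suc k *\<^sub>R (l u *\<^sub>R a k))"
      using mult(1) by (simp add: a linear_add linear_scale scaleR_add_left scaleR_sum_right sum.distrib mult_ac)
    also have "(\<Sum>k\<le>n. t ^ k *\<^sub>R (l w *\<^sub>R a k)) = (\<Sum>k\<le>Suc n. t ^ k *\<^sub>R (if k \<le> n then l w *\<^sub>R a k else 0))"
      by simp
    also have "(\<Sum>k\<le>n. t ^ Suc k *\<^sub>R (l u *\<^sub>R a k)) = (\<Sum>k\<le>Suc n. t ^ k *\<^sub>R (if k = 0 then 0 else l u *\<^sub>R a (k - 1)))"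
      by (simp add: sum.atMost_Suc_shift del: sum.atMost_Suc)
    finally show ?thesis by (simp add: a'_def scaleR_add_right sum.distrib)
  qed
  then show ?case by blast
next
  case (add n f h)
  then obtain a b where "\<And>t. f (w + t *\<^sub>R u) = (\<Sum>k\<le>n. t ^ k *\<^sub>R a k)"
    "\<And>t. h (w + t *\<^sub>R u) = (\<Sum>k\<le>n. t ^ k *\<^sub>R b k)" by blast
  then show ?case by (intro exI[of _ "\<lambda>k. a k + b k"]) (simp add: scaleR_add_right sum.distrib)
qed

lemma sum_list_concat_map:
  "sum_list (map f (concat (map h xs))) = (\<Sum>x\<leftarrow>xs. sum_list (map f (h x)))"
  for f :: "_ \<Rightarrow> 'b::comm_monoid_add"
  by (induction xs) auto

lemma sum_list_scaleR: "c *\<^sub>R sum_list xs = (\<Sum>x\<leftarrow>xs. c *\<^sub>R x)"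
  for xs :: "'b::real_vector list"
  by (induction xs) (auto simp: scaleR_add_right)

lemma sum_list_cong: "(\<And>x. x \<in> set xs \<Longrightarrow> f x = h x) \<Longrightarrow> (\<Sum>x\<leftarrow>xs. f x) = (\<Sum>x\<leftarrow>xs. h x)"
  by (metis map_eq_conv)

text \<open>Passing from \<open>q(t)\<close> to \<open>q(2t) - 2\<^sup>d q(t)\<close> removes the top coefficient.\<close>

lemma linear_coefficient_from_values:
  "\<exists>cs::(real \<times> real) list. \<forall>a::nat \<Rightarrow> 'b::real_vector.
     (\<Sum>(c, t)\<leftarrow>cs. c *\<^sub>R (\<Sum>k\<le>Suc n. t ^ k *\<^sub>R a k)) = a 1"
proof (induction n)
  case 0
  show ?case by (intro exI[of _ "[(1, 1), (-1, 0)]"]) simp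
next
  case (Suc n)
  then obtain cs :: "(real \<times> real) list" where cs: "\<And>a::nat \<Rightarrow> 'b. (\<Sum>(c, t)\<leftarrow>cs. c *\<^sub>R (\<Sum>k\<le>Suc n. t ^ k *\<^sub>R a k)) = a 1"
    by blast
  define d where "d = (2::real) ^ Suc (Suc n)"
  have "d = 4 * 2 ^ n" "(2::real) ^ n \<ge> 1" by (simp_all add: d_def)
  then have d: "2 - d \<noteq> 0" by linarith
  \<comment> \<open>The combination multiplies the coefficient of \<open>t ^ k\<close> by
    \<open>2 ^ k - d\<close>. This vanishes for the top power and is \<open>2 - d\<close> for
    \<open>k = 1\<close>, whence the division.\<close>
  define cs' where "cs' = concat (map (\<lambda>(c, t). [(c / (2 - d), 2 * t), (- c * d / (2 - d), t)]) cs)"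
  have "(\<Sum>(c, t)\<leftarrow>cs'. c *\<^sub>R (\<Sum>k\<le>Suc (Suc n). t ^ k *\<^sub>R a k)) = a 1" for a :: "nat \<Rightarrow> 'b"
  proof -
    define b where "b k = ((2 ^ k - d) / (2 - d)) *\<^sub>R a k" for k
    have q: "(c / (2 - d)) *\<^sub>R (\<Sum>k\<le>Suc (Suc n). (2 * t) ^ k *\<^sub>R a k) + (- c * d / (2 - d)) *\<^sub>R (\<Sum>k\<le>Suc (Suc n). t ^ k *\<^sub>R a k)
      = c *\<^sub>R (\<Sum>k\<le>Suc n. t ^ k *\<^sub>R b k)" for c t
    proof -
      have "(c / (2 - d)) *\<^sub>R (\<Sum>k\<le>Suc (Suc n). (2 * t) ^ k *\<^sub>R a k) + (- c * d / (2 - d)) *\<^sub>R (\<Sum>k\<le>Suc (Suc n). t ^ k *\<^sub>R a k)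
        = c *\<^sub>R (\<Sum>k\<le>Suc (Suc n). t ^ k *\<^sub>R b k)"
        unfolding scaleR_sum_right sum.distrib[symmetric] b_def
        by (rule sum.cong[OF refl])
          (simp add: power_mult_distrib scaleR_add_left[symmetric] diff_divide_distrib algebra_simps)
      also have "b (Suc (Suc n)) = 0" by (simp add: b_def d_def)
      ultimately show ?thesis by simp
    qed
    have "(\<Sum>(c, t)\<leftarrow>cs'. c *\<^sub>R (\<Sum>k\<le>Suc (Suc n). t ^ k *\<^sub>R a k)) =
       (\<Sum>(c, t)\<leftarrow>cs. (c / (2 - d)) *\<^sub>R (\<Sum>k\<le>Suc (Suc n). (2 * t) ^ k *\<^sub>R a k) + (- c * d / (2 - d)) *\<^sub>R (\<Sum>k\<le>Suc (Suc n). t ^ k *\<^sub>R a k))"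
      unfolding cs'_def sum_list_concat_map
      by (rule sum_list_cong) (simp add: case_prod_unfold del: sum.atMost_Suc)
    also have "\<dots> = b 1" unfolding q by (rule cs)
    finally show ?thesis using d by (simp add: b_def)
  qed
  then show ?case by blast
qed

text \<open>On the line through \<open>w\<close> in direction \<open>u\<close> the polynomial has
  degree at most \<open>Suc n\<close>, so a difference formula that depends only on \<open>n\<close>
  is exact for the linear coefficient.\<close>

lemma hom_poly_dird_from_values:
  "\<exists>cs::(real \<times> real) list. \<forall>(P :: 'a::euclidean_space \<Rightarrow> 'b::real_normed_vector) w u. hom_poly (Suc n) P \<longrightarrow>
     dird P w u = (\<Sum>(c, t)\<leftarrow>cs. c *\<^sub>R P (w + t *\<^sub>R u))"
proof -
  obtain cs :: "(real \<times> real) list" where cs: "\<And>a::nat \<Rightarrow> 'b. (\<Sum>(c, t)\<leftarrow>cs. c *\<^sub>R (\<Sum>k\<le>Suc n. t ^ k *\<^sub>R a k)) = a 1"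
    using linear_coefficient_from_values[where 'b='b, of n] by blast
  have "dird P w u = (\<Sum>(c, t)\<leftarrow>cs. c *\<^sub>R P (w + t *\<^sub>R u))" if P: "hom_poly (Suc n) P" for P :: "'a \<Rightarrow> 'b" and w u
  proof -
    obtain a where a: "\<And>t. P (w + t *\<^sub>R u) = (\<Sum>k\<le>Suc n. t ^ k *\<^sub>R a k)"
      using hom_poly_on_line[OF P] by blast
    have "((\<lambda>t. P (w + t *\<^sub>R u)) has_vector_derivative dird P w u) (at 0)"
      using has_vector_derivative_line[of P w 0 u] hom_poly_differentiable[OF P] by simp
    then have "dird P w u = tc 1 (\<lambda>t. P (w + t *\<^sub>R u))"
      by (simp add: tc_def vector_derivative_at)
    also have "(\<lambda>t. P (w + t *\<^sub>R u)) = (\<lambda>t. \<Sum>k\<le>Suc n. t ^ k *\<^sub>R a k)"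
      by (rule ext) (rule a)
    also have "tc 1 \<dots> = a 1" by (simp only: tc_polynomial) simp
    finally have "dird P w u = a 1" .
    then show ?thesis by (simp only: a cs)
  qed
  then show ?thesis by blast
qed

text \<open>Euler's relation writes \<open>P\<close> as linear forms times first derivatives. These
  have lower degree and are interpolated by induction, and their values are in turn combinations of
  values of \<open>P\<close>. The nodes and weights depend on the degree only, not on
  \<open>P\<close>.\<close>

lemma hom_poly_interpolation:
  "\<exists>ls::(('a::euclidean_space \<Rightarrow> real) \<times> 'a) list. (\<forall>(L, w)\<in>set ls. hom_poly n L) \<and>
     (\<forall>P :: 'a \<Rightarrow> 'b::real_normed_vector. hom_poly n P \<longrightarrow> (\<forall>v. P v = (\<Sum>(L, w)\<leftarrow>ls. L v *\<^sub>R P w)))"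
proof (induction n)
  case 0
  show ?case
    by (intro exI[of _ "[(\<lambda>_. 1, 0)]"]) (auto intro: hom_poly.const hom_poly_0_const)
next
  case (Suc n)
  then obtain ls :: "(('a \<Rightarrow> real) \<times> 'a) list" where ls: "\<And>L w. (L, w) \<in> set ls \<Longrightarrow> hom_poly n L"
    "\<And>(P :: 'a \<Rightarrow> 'b) v. hom_poly n P \<Longrightarrow> P v = (\<Sum>(L, w)\<leftarrow>ls. L v *\<^sub>R P w)" by blast
  obtain cs :: "(real \<times> real) list" where cs: "\<And>(P :: 'a \<Rightarrow> 'b) w u. hom_poly (Suc n) P \<Longrightarrow>
     dird P w u = (\<Sum>(c, t)\<leftarrow>cs. c *\<^sub>R P (w + t *\<^sub>R u))"
    using hom_poly_dird_from_values[where 'a='a and 'b='b, of n] by blast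
  obtain bs :: "'a list" where bs: "set bs = Basis" "distinct bs"
    using finite_distinct_list[OF finite_Basis] by blast
  define ls' where "ls' = concat (map (\<lambda>i. concat (map (\<lambda>(L, w). map (\<lambda>(c, t).
      (\<lambda>v. (v \<bullet> i) *\<^sub>R ((c / real (Suc n)) *\<^sub>R L v), w + t *\<^sub>R i)) cs) ls)) bs)"
  have "hom_poly (Suc n) (\<lambda>v. (v \<bullet> i) *\<^sub>R ((c / real (Suc n)) *\<^sub>R L v))" if "(L, w) \<in> set ls" for i L w c
    by (intro hom_poly.mult hom_poly_scaleR ls(1)[OF that] bounded_linear.linear[OF bounded_linear_inner_left])
  then have "\<forall>(L, w)\<in>set ls'. hom_poly (Suc n) L"
    unfolding ls'_def by fastforce
  moreover have "P v = (\<Sum>(L, w)\<leftarrow>ls'. L v *\<^sub>R P w)" if P: "hom_poly (Suc n) P" for P :: "'a \<Rightarrow> 'b" and v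
  proof -
    have "real (Suc n) *\<^sub>R P v = (\<Sum>i\<in>Basis. (v \<bullet> i) *\<^sub>R dird P v i)"
      using dird_euler[OF P, of v] dird_basis_expansion[OF hom_poly_differentiable[OF P], of v v] by simp
    then have "P v = (1 / real (Suc n)) *\<^sub>R (\<Sum>i\<in>Basis. (v \<bullet> i) *\<^sub>R dird P v i)"
      by (metis (no_types) divide_self of_nat_neq_0 scaleR_one scaleR_scaleR times_divide_eq_left mult_1)
    also have "\<dots> = (\<Sum>i\<leftarrow>bs. (1 / real (Suc n)) *\<^sub>R ((v \<bullet> i) *\<^sub>R dird P v i))"
      by (simp add: scaleR_sum_right sum.distinct_set_conv_list[OF bs(2), symmetric] bs(1))
    also have "\<dots> = (\<Sum>i\<leftarrow>bs. \<Sum>(L, w)\<leftarrow>ls. \<Sum>(c, t)\<leftarrow>cs. ((v \<bullet> i) *\<^sub>R ((c / real (Suc n)) *\<^sub>R L v)) *\<^sub>R P (w + t *\<^sub>R i))"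
    proof (rule sum_list_cong)
      fix i
      have "dird P v i = (\<Sum>(L, w)\<leftarrow>ls. L v *\<^sub>R dird P w i)"
        by (rule ls(2)[OF hom_poly_dird[OF P]])
      also have "\<dots> = (\<Sum>(L, w)\<leftarrow>ls. L v *\<^sub>R (\<Sum>(c, t)\<leftarrow>cs. c *\<^sub>R P (w + t *\<^sub>R i)))"
        by (simp only: cs[OF P])
      finally show "(1 / real (Suc n)) *\<^sub>R ((v \<bullet> i) *\<^sub>R dird P v i) =
        (\<Sum>(L, w)\<leftarrow>ls. \<Sum>(c, t)\<leftarrow>cs. ((v \<bullet> i) *\<^sub>R ((c / real (Suc n)) *\<^sub>R L v)) *\<^sub>R P (w + t *\<^sub>R i))"
        by (simp add: sum_list_scaleR case_prod_unfold o_def mult_ac)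
    qed
    also have "\<dots> = (\<Sum>(L, w)\<leftarrow>ls'. L v *\<^sub>R P w)"
      unfolding ls'_def sum_list_concat_map
      by (simp add: case_prod_unfold o_def sum_list_concat_map)
    finally show ?thesis .
  qed
  ultimately show ?case by blast
qed

text \<open>By interpolation a linear operation on homogeneous polynomials is a combination of point
  evaluations, so it preserves pointwise properties of families such as differentiability in a
  parameter.\<close>

lemma hom_poly_functional:
  fixes \<Lambda> :: "('a::euclidean_space \<Rightarrow> real) \<Rightarrow> real"
  assumes add: "\<And>f h. hom_poly n f \<Longrightarrow> hom_poly n h \<Longrightarrow> \<Lambda> (\<lambda>v. f v + h v) = \<Lambda> f + \<Lambda> h"
    and scale: "\<And>c f. hom_poly n f \<Longrightarrow> \<Lambda> (\<lambda>v. c * f v) = c * \<Lambda> f"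
  shows "\<exists>cs::(real \<times> 'a) list. \<forall>P. hom_poly n P \<longrightarrow> \<Lambda> P = (\<Sum>(c, w)\<leftarrow>cs. c * P w)"
proof -
  obtain ls :: "(('a \<Rightarrow> real) \<times> 'a) list" where ls: "\<forall>(L, w)\<in>set ls. hom_poly n L"
    "\<And>(P :: 'a \<Rightarrow> real) v. hom_poly n P \<Longrightarrow> P v = (\<Sum>(L, w)\<leftarrow>ls. L v *\<^sub>R P w)"
    using hom_poly_interpolation[where 'a='a and 'b=real, of n] by blast
  have z: "\<Lambda> (\<lambda>_. 0) = 0" using scale[of "\<lambda>_. 0" 0] by simp
  have "hom_poly n (\<lambda>v. \<Sum>(L, w)\<leftarrow>xs. P w * L v) \<and> \<Lambda> (\<lambda>v. \<Sum>(L, w)\<leftarrow>xs. P w * L v) = (\<Sum>(L, w)\<leftarrow>xs. P w * \<Lambda> L)"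
    if "\<forall>(L, w)\<in>set xs. hom_poly n L" for xs and P :: "'a \<Rightarrow> real"
    using that
  proof (induction xs)
    case (Cons y ys)
    obtain L w where y: "y = (L, w)" by force
    have "hom_poly n (\<lambda>v. P w * L v)" using Cons.prems y hom_poly_scaleR[of n L "P w"] by auto
    then show ?case using Cons y by (auto simp: add scale intro: hom_poly.add)
  qed (simp add: z)
  note L = conjunct2[OF this[OF ls(1)]]
  have "\<Lambda> P = (\<Sum>(L, w)\<leftarrow>ls. P w * \<Lambda> L)" if "hom_poly n P" for P
  proof -
    have "P = (\<lambda>v. \<Sum>(L, w)\<leftarrow>ls. P w * L v)"
    proof
      fix v show "P v = (\<Sum>(L, w)\<leftarrow>ls. P w * L v)"
        using ls(2)[OF that, of v] by (simp add: mult.commute)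
    qed
    then show ?thesis using L[of P] by metis
  qed
  then show ?thesis
    by (intro exI[of _ "map (\<lambda>(L, w). (\<Lambda> L, w)) ls"]) (auto simp: case_prod_unfold o_def mult.commute)
qed

lemma has_derivative_sum_list:
  "(\<And>y. y \<in> set ys \<Longrightarrow> (f y has_derivative f' y) F) \<Longrightarrow>
    ((\<lambda>x. \<Sum>y\<leftarrow>ys. f y x) has_derivative (\<lambda>Z. \<Sum>y\<leftarrow>ys. f' y Z)) F"
  by (induction ys) (auto intro!: has_derivative_add)

text \<open>Polynomial and argument move simultaneously, with no joint regularity assumed.
  Interpolation separates the two: the polynomial enters through its values at finitely many fixed
  nodes, the argument through fixed polynomials \<open>L\<close>, and the product rule
  applies.\<close>

lemma has_derivative_hom_poly_family:
  fixes P :: "'c::real_normed_vector \<Rightarrow> 'a::euclidean_space \<Rightarrow> 'b::real_normed_vector"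
  assumes N: "open N" "x0 \<in> N" and P: "\<And>x. x \<in> N \<Longrightarrow> hom_poly n (P x)"
    and P': "\<And>w. ((\<lambda>x. P x w) has_derivative (\<lambda>Z. P' Z w)) (at x0)"
    and v: "(v has_derivative v') (at x0)"
  shows "((\<lambda>x. P x (v x)) has_derivative (\<lambda>Z. P' Z (v x0) + dird (P x0) (v x0) (v' Z))) (at x0)"
proof -
  obtain ls :: "(('a \<Rightarrow> real) \<times> 'a) list" where ls: "\<And>L w. (L, w) \<in> set ls \<Longrightarrow> hom_poly n L"
    "\<And>(P :: 'a \<Rightarrow> 'b) v. hom_poly n P \<Longrightarrow> P v = (\<Sum>(L, w)\<leftarrow>ls. L v *\<^sub>R P w)"
    using hom_poly_interpolation[where 'a='a and 'b='b, of n] by blast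
  have ev: "\<forall>\<^sub>F x in nhds x0. x \<in> N" using N by (rule eventually_nhds_in_open)
  have dL: "(L has_derivative dird L y) (at y)" if "(L, w) \<in> set ls" for L w y
    by (rule smooth_at_has_derivative[OF hom_poly_smooth_at[OF ls(1)[OF that]]])
  \<comment> \<open>Nothing says that \<open>P' Z\<close> is a polynomial, but differentiating the
    interpolation formula shows that it obeys the same formula, by uniqueness of
    derivatives.\<close>
  have P'_ls: "P' Z u = (\<Sum>(L, w)\<leftarrow>ls. L u *\<^sub>R P' Z w)" for Z u
  proof -
    have "((\<lambda>x. \<Sum>y\<leftarrow>ls. fst y u *\<^sub>R P x (snd y)) has_derivative (\<lambda>Z. \<Sum>y\<leftarrow>ls. fst y u *\<^sub>R P' Z (snd y))) (at x0)"
      by (intro has_derivative_sum_list has_derivative_scaleR_right P')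
    then have "((\<lambda>x. P x u) has_derivative (\<lambda>Z. \<Sum>y\<leftarrow>ls. fst y u *\<^sub>R P' Z (snd y))) (at x0)"
    proof (rule has_derivative_cong_nhds, use ev in eventually_elim)
      case (elim x)
      show ?case using ls(2)[OF P[OF elim], of u] by (simp add: case_prod_unfold)
    qed
    from fun_cong[OF has_derivative_unique[OF P' this], of Z] show ?thesis
      by (simp add: case_prod_unfold)
  qed
  have dP_ls: "dird (P x0) u h = (\<Sum>(L, w)\<leftarrow>ls. dird L u h *\<^sub>R P x0 w)" for u h
  proof -
    have "((\<lambda>u. \<Sum>y\<leftarrow>ls. fst y u *\<^sub>R P x0 (snd y)) has_derivative (\<lambda>h. \<Sum>y\<leftarrow>ls. dird (fst y) u h *\<^sub>R P x0 (snd y))) (at u)"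
      by (intro has_derivative_sum_list has_derivative_scaleR_left) (metis dL prod.collapse)
    moreover have "P x0 = (\<lambda>u. \<Sum>y\<leftarrow>ls. fst y u *\<^sub>R P x0 (snd y))"
    proof
      fix u show "P x0 u = (\<Sum>y\<leftarrow>ls. fst y u *\<^sub>R P x0 (snd y))"
        using ls(2)[OF P[OF N(2)], of u] by (simp add: case_prod_unfold)
    qed
    ultimately have "(P x0 has_derivative (\<lambda>h. \<Sum>y\<leftarrow>ls. dird (fst y) u h *\<^sub>R P x0 (snd y))) (at u)"
      by (simp only:)
    from dird_eqI[OF this, of h] show ?thesis by (simp only: case_prod_unfold)
  qed
  have "((\<lambda>x. \<Sum>y\<leftarrow>ls. fst y (v x) *\<^sub>R P x (snd y)) has_derivative
      (\<lambda>Z. \<Sum>y\<leftarrow>ls. fst y (v x0) *\<^sub>R P' Z (snd y) + dird (fst y) (v x0) (v' Z) *\<^sub>R P x0 (snd y))) (at x0)"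
    by (intro has_derivative_sum_list has_derivative_scaleR P' has_derivative_compose[OF v])
      (metis dL prod.collapse)
  then have "((\<lambda>x. P x (v x)) has_derivative
      (\<lambda>Z. \<Sum>y\<leftarrow>ls. fst y (v x0) *\<^sub>R P' Z (snd y) + dird (fst y) (v x0) (v' Z) *\<^sub>R P x0 (snd y))) (at x0)"
  proof (rule has_derivative_cong_nhds, use ev in eventually_elim)
    case (elim x)
    show ?case using ls(2)[OF P[OF elim], of "v x"] by (simp add: case_prod_unfold)
  qed
  moreover have "(\<lambda>Z. \<Sum>y\<leftarrow>ls. fst y (v x0) *\<^sub>R P' Z (snd y) + dird (fst y) (v x0) (v' Z) *\<^sub>R P x0 (snd y))
     = (\<lambda>Z. P' Z (v x0) + dird (P x0) (v x0) (v' Z))"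
    by (rule ext) (simp only: P'_ls[of _ "v x0"] dP_ls sum_list_addf case_prod_unfold)
  ultimately show ?thesis by simp
qed

section \<open>Bidegrees\<close>

lemma hom_poly_dird_field:
  fixes f :: "'a::euclidean_space \<Rightarrow> 'b::real_normed_vector"
  assumes "hom_poly (Suc m) f" "hom_poly k w"
  shows "hom_poly (m + k) (\<lambda>X. dird f X (w X))"
proof -
  have "hom_poly (k + m) (\<lambda>X. \<Sum>i\<in>Basis. (w X \<bullet> i) *\<^sub>R dird f X i)"
    by (intro hom_poly_sum hom_poly_scaleR_mult hom_poly_dird assms(1)
      hom_poly_linear_image[OF assms(2) bounded_linear.linear[OF bounded_linear_inner_left]])
  moreover have "(\<lambda>X. dird f X (w X)) = (\<lambda>X. \<Sum>i\<in>Basis. (w X \<bullet> i) *\<^sub>R dird f X i)"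
    by (rule ext) (rule dird_basis_expansion[OF hom_poly_differentiable[OF assms(1)]])
  ultimately show ?thesis by (simp add: add.commute)
qed

lemma hom_poly_dird_linear_field:
  fixes f :: "'a::euclidean_space \<Rightarrow> 'b::real_normed_vector"
  assumes "hom_poly n f" "linear h"
  shows "hom_poly n (\<lambda>X. dird f X (h X))"
proof (cases n)
  case 0
  then have "(\<lambda>X. dird f X (h X)) = (\<lambda>_. 0)" using dird_hom_poly_0[of f] assms(1) by auto
  then show ?thesis by simp
next
  case (Suc m)
  then show ?thesis using hom_poly_dird_field[of m f 1 h] hom_poly_linear[OF assms(2)] assms(1) by simp
qed

text \<open>The bidegree \<open>(a, b)\<close> is encoded by the degree \<open>n = a + b\<close> and
  the eigenvalue \<open>\<mu> = a - b\<close> of the rotation field \<open>X \<mapsto> J X\<close>.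
  An integer \<open>\<mu>\<close> avoids truncated subtraction and may lie outside the range that
  can occur in degree \<open>n\<close>, which is used to prove vanishing.\<close>

definition weight :: "('a::euclidean_space \<Rightarrow> 'a) \<Rightarrow> nat \<Rightarrow> int \<Rightarrow> ('a \<Rightarrow> complex) \<Rightarrow> bool"
  where "weight J n \<mu> \<eta> \<longleftrightarrow> hom_poly n \<eta> \<and> (\<forall>X. dird \<eta> X (J X) = \<i> * of_int \<mu> * \<eta> X)"

lemma bihom_iff_wt: "bihom J a b \<eta> \<longleftrightarrow> weight J (a + b) (int a - int b) \<eta>"
proof -
  have "((\<lambda>t. \<eta> (X + t *\<^sub>R J X)) has_vector_derivative z) (at 0) \<longleftrightarrow> dird \<eta> X (J X) = z"
    if "hom_poly (a + b) \<eta>" for X z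
  proof -
    have "((\<lambda>t. \<eta> (X + t *\<^sub>R J X)) has_vector_derivative dird \<eta> X (J X)) (at 0)"
      using has_vector_derivative_line[of \<eta> X 0 "J X"] hom_poly_differentiable[OF that] by simp
    then show ?thesis using vector_derivative_unique_at by blast
  qed
  then show ?thesis unfolding bihom_def weight_def by blast
qed

lemma weight_hom_poly: "weight J n \<mu> e \<Longrightarrow> hom_poly n e"
  by (simp add: weight_def)

lemma weight_zero: "weight J n \<mu> (\<lambda>_. 0)"
  by (simp add: weight_def)

lemma weight_add:
  assumes "weight J n \<mu> e" "weight J n \<mu> f"
  shows "weight J n \<mu> (\<lambda>X. e X + f X)"
  using assms by (auto simp: weight_def dird_add hom_poly_differentiable algebra_simps intro: hom_poly.add)

lemma weight_cmult:
  assumes "weight J n \<mu> e"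
  shows "weight J n \<mu> (\<lambda>X. c * e X)"
proof -
  have "hom_poly n (\<lambda>X. c * e X)"
    using weight_hom_poly[OF assms] by (rule hom_poly_linear_image) (rule bounded_linear.linear[OF bounded_linear_mult_right])
  then show ?thesis
    using assms dird_bounded_linear(1)[OF bounded_linear_mult_right, of e _ c] hom_poly_differentiable[OF weight_hom_poly[OF assms]]
    by (simp add: weight_def)
qed

lemma weight_cnj:
  assumes "weight J n \<mu> e"
  shows "weight J n (- \<mu>) (\<lambda>X. cnj (e X))"
proof -
  have "hom_poly n (\<lambda>X. cnj (e X))"
    using weight_hom_poly[OF assms] by (rule hom_poly_linear_image) (rule bounded_linear.linear[OF bounded_linear_cnj])
  then show ?thesis
    using assms dird_bounded_linear(1)[OF bounded_linear_cnj, of e] hom_poly_differentiable[OF weight_hom_poly[OF assms]]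
    by (simp add: weight_def)
qed

text \<open>Eigenfunctions for different eigenvalues are independent: apply the rotation to the
  relation and subtract \<open>\<i> * \<nu>\<close> times the relation, so that the summand with
  eigenvalue \<open>\<nu>\<close> disappears.\<close>

lemma weight_independent:
  assumes "finite A" "\<And>\<mu>. \<mu> \<in> A \<Longrightarrow> weight J n \<mu> (e \<mu>)" "\<And>X. (\<Sum>\<mu>\<in>A. e \<mu> X) = 0" "\<mu> \<in> A"
  shows "e \<mu> X = 0"
  using assms
proof (induction A arbitrary: e \<mu> X rule: finite_induct)
  case (insert \<nu> B)
  have d: "e \<mu> differentiable (at X)" if "\<mu> \<in> insert \<nu> B" for \<mu> X
    using hom_poly_differentiable[OF weight_hom_poly[OF insert.prems(1)[OF that]]] .
  have "(\<Sum>\<mu>\<in>B. \<i> * of_int (\<mu> - \<nu>) * e \<mu> X) = 0" for X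
  proof -
    have "(\<Sum>\<mu>\<in>insert \<nu> B. dird (e \<mu>) X (J X)) = dird (\<lambda>X. \<Sum>\<mu>\<in>insert \<nu> B. e \<mu> X) X (J X)"
      by (rule dird_sum[symmetric]) (rule d)
    also have "\<dots> = 0" by (simp add: insert.prems(2))
    finally have "(\<Sum>\<mu>\<in>insert \<nu> B. \<i> * of_int \<mu> * e \<mu> X) = 0"
      using insert.prems(1) by (simp add: weight_def insert.hyps)
    moreover have "(\<Sum>\<mu>\<in>insert \<nu> B. \<i> * of_int \<nu> * e \<mu> X) = 0"
      using insert.prems(2)[of X] by (simp only: sum_distrib_left[symmetric] mult_zero_right)
    ultimately have "(\<Sum>\<mu>\<in>insert \<nu> B. \<i> * of_int \<mu> * e \<mu> X - \<i> * of_int \<nu> * e \<mu> X) = 0"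
      by (simp only: sum_subtractf diff_self)
    then show ?thesis using insert.hyps by (simp add: algebra_simps)
  qed
  then have "\<i> * of_int (\<mu> - \<nu>) * e \<mu> X = 0" if "\<mu> \<in> B" for \<mu> X
    by (rule insert.IH[where e="\<lambda>\<mu> X. \<i> * of_int (\<mu> - \<nu>) * e \<mu> X", rotated])
      (use insert.prems(1) that in \<open>auto intro!: weight_cmult\<close>)
  then have B: "e \<mu> X = 0" if "\<mu> \<in> B" for \<mu> X
    using that insert.hyps(2) by (metis complex_i_not_zero eq_iff_diff_eq_0 mult_eq_0_iff of_int_eq_0_iff)
  have "e \<nu> X = 0" for X
    using insert.prems(2)[of X] insert.hyps B by simp
  then show ?case using B insert.prems(3) by auto
qed simp

definition sym_bidegrees :: "(nat \<Rightarrow> nat \<Rightarrow> bool) \<Rightarrow> bool"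
  where "sym_bidegrees P \<longleftrightarrow> (\<forall>a b. P a b \<longrightarrow> P b a)"

locale cstruct =
  fixes J :: "'a::euclidean_space \<Rightarrow> 'a"
  assumes linJ: "linear J" and JJ [simp]: "J (J u) = - u"
begin

lemma J_simps [simp]:
  "J (- u) = - J u" "J (u + v) = J u + J v" "J (c *\<^sub>R u) = c *\<^sub>R J u" "J 0 = 0" "J (u - v) = J u - J v"
  using linJ by (simp_all add: linear_neg linear_add linear_scale linear_0 linear_diff)

lemma blJ: "bounded_linear J"
  using linJ linear_conv_bounded_linear by blast

text \<open>The multiplier is the (1,0)-part of the real form \<open>l\<close> for
  \<open>s = 1\<close> and its (0,1)-part for \<open>s = -1\<close>, an eigenfunction of the
  rotation with eigenvalue \<open>s\<close>.\<close>

lemma weight_mult_linear: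
  assumes e: "weight J n \<mu> e" and l: "linear (l :: 'a \<Rightarrow> real)" and s: "s = 1 \<or> s = (-1::int)"
  shows "weight J (Suc n) (\<mu> + s) (\<lambda>X. (of_real (l X) - of_int s * \<i> * of_real (l (J X))) / 2 * e X)"
proof -
  define h where "h X = (complex_of_real (l X) - of_int s * \<i> * of_real (l (J X))) / 2" for X
  have lJ: "linear (\<lambda>X. l (J X))" using linear_compose[OF linJ l] by (simp add: o_def)
  have ls: "linear h"
    by (rule linearI) (simp_all add: h_def linear_add[OF l] linear_scale[OF l] scaleR_conv_of_real field_simps)
  have "hom_poly (Suc n) (\<lambda>X. l X *\<^sub>R (1/2 * e X) + l (J X) *\<^sub>R ((- of_int s * \<i> / 2) * e X))"
    using weight_hom_poly[OF weight_cmult[OF e]] by (intro hom_poly.add hom_poly.mult l lJ)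
  also have "(\<lambda>X. l X *\<^sub>R (1/2 * e X) + l (J X) *\<^sub>R ((- of_int s * \<i> / 2) * e X)) = (\<lambda>X. h X * e X)"
    by (rule ext) (simp add: h_def scaleR_conv_of_real field_simps)
  finally have hp: "hom_poly (Suc n) (\<lambda>X. h X * e X)" .
  have dh: "h differentiable (at X)" "dird h X u = h u" for X u
    using ls by (auto simp: linear_conv_bounded_linear bounded_linear_imp_differentiable
      intro!: dird_eqI bounded_linear_imp_has_derivative)
  have "h (J X) = \<i> * of_int s * h X" for X
    using s by (auto simp: h_def linear_neg[OF l] field_simps)
  then have "dird (\<lambda>X. h X * e X) X (J X) = \<i> * of_int (\<mu> + s) * (h X * e X)" for X
    using e by (simp add: dird_bilinear[OF bounded_bilinear_mult] dh hom_poly_differentiable[OF weight_hom_poly[OF e]]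
       weight_def algebra_simps)
  with hp show ?thesis by (simp add: weight_def h_def)
qed

text \<open>Induction along the generation of polynomials: a real linear form is the sum of its
  (1,0)- and (0,1)-parts, and multiplication by either maps eigenfunctions to
  eigenfunctions.\<close>

lemma weight_decomposition:
  assumes "hom_poly n (f :: 'a \<Rightarrow> complex)"
  shows "\<exists>e. (\<forall>a\<le>n. weight J n (2 * int a - int n) (e a)) \<and> (\<forall>X. f X = (\<Sum>a\<le>n. e a X))"
  using assms
proof induction
  case (const c)
  show ?case
    by (intro exI[of _ "\<lambda>_ _. c"]) (auto simp: weight_def intro: hom_poly.const)
next
  case (mult l n f)
  then obtain e where e: "\<And>a. a \<le> n \<Longrightarrow> weight J n (2 * int a - int n) (e a)" "\<And>X. f X = (\<Sum>a\<le>n. e a X)"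
    by blast
  define l10 where "l10 X = (complex_of_real (l X) - of_int 1 * \<i> * of_real (l (J X))) / 2" for X
  define l01 where "l01 X = (complex_of_real (l X) - of_int (-1) * \<i> * of_real (l (J X))) / 2" for X
  \<comment> \<open>The index \<open>a\<close> counts holomorphic factors: \<open>l01\<close>
    preserves it, \<open>l10\<close> raises it by one. The conditions cut off the two ends of the
    index range.\<close>
  define e' where "e' a X = (if a \<le> n then l01 X * e a X else 0) + (if a = 0 then 0 else l10 X * e (a - 1) X)" for a X
  have "weight J (Suc n) (2 * int a - int (Suc n)) (e' a)" if "a \<le> Suc n" for a
    unfolding e'_def
  proof (rule weight_add)
    show "weight J (Suc n) (2 * int a - int (Suc n)) (\<lambda>X. if a \<le> n then l01 X * e a X else 0)"
      using weight_mult_linear[OF e(1)[of a] mult(1), of "-1"] unfolding l01_def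
      by (cases "a \<le> n") (auto simp: weight_zero algebra_simps)
    show "weight J (Suc n) (2 * int a - int (Suc n)) (\<lambda>X. if a = 0 then 0 else l10 X * e (a - 1) X)"
    proof (cases "a = 0")
      case False
      then have "2 * int a - int (Suc n) = 2 * int (a - 1) - int n + 1" "a - 1 \<le> n" using that by auto
      then show ?thesis
        using weight_mult_linear[OF e(1)[of "a - 1"] mult(1), of 1] False unfolding l10_def
        by (simp only: if_False) simp
    qed (simp add: weight_zero)
  qed
  moreover have "l X *\<^sub>R f X = (\<Sum>a\<le>Suc n. e' a X)" for X
  proof -
    have "(\<Sum>a\<le>Suc n. e' a X) = (\<Sum>a\<le>n. l01 X * e a X) + (\<Sum>a\<le>n. l10 X * e a X)"
      unfolding e'_def sum.distrib by (subst (2) sum.atMost_Suc_shift) simp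
    also have "\<dots> = (l01 X + l10 X) * f X"
      by (simp only: e(2) sum_distrib_left distrib_right sum.distrib)
    also have "l01 X + l10 X = of_real (l X)"
      by (simp add: l10_def l01_def field_simps)
    also have "of_real (l X) * f X = l X *\<^sub>R f X"
      by (simp add: scaleR_conv_of_real)
    finally show ?thesis by simp
  qed
  ultimately show ?case by blast
next
  case (add n f h)
  then obtain e e' where e: "\<And>a. a \<le> n \<Longrightarrow> weight J n (2 * int a - int n) (e a)" "\<And>X. f X = (\<Sum>a\<le>n. e a X)"
    "\<And>a. a \<le> n \<Longrightarrow> weight J n (2 * int a - int n) (e' a)" "\<And>X. h X = (\<Sum>a\<le>n. e' a X)"
    by blast
  then show ?case by (intro exI[of _ "\<lambda>a X. e a X + e' a X"]) (auto intro: weight_add simp: sum.distrib)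
qed

lemma weight_parts_unique:
  assumes "\<And>a. a \<le> n \<Longrightarrow> weight J n (2 * int a - int n) (e a)" "\<And>X. (\<Sum>a\<le>n. e a X) = 0" "a \<le> n"
  shows "e a X = 0"
proof -
  have inj: "inj_on (\<lambda>a. 2 * int a - int n) {..n}" by (auto simp: inj_on_def)
  \<comment> \<open>\<open>weight_independent\<close> is indexed by eigenvalues, so the map
    \<open>a \<mapsto> 2 * a - n\<close> is inverted.\<close>
  define e' where "e' \<mu> = e (nat ((\<mu> + int n) div 2))" for \<mu>
  have e': "e' (2 * int a - int n) = e a" for a by (simp add: e'_def)
  have "(\<Sum>\<mu>\<in>(\<lambda>a. 2 * int a - int n) ` {..n}. e' \<mu> X) = 0" for X
    by (simp add: sum.reindex[OF inj] o_def e' assms(2))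
  then have "e' (2 * int a - int n) X = 0"
    by (rule weight_independent[where J=J and n=n, rotated 2]) (use assms(1,3) e' in auto)
  then show ?thesis by (simp add: e')
qed

text \<open>Decompose \<open>e\<close> into eigenfunctions with eigenvalues in the range and move
  \<open>e\<close> to the other side: this is a relation between different eigenvalues, so
  \<open>e\<close> vanishes.\<close>

lemma weight_out_of_range:
  assumes e: "weight J n \<mu> e" and r: "\<And>a. a \<le> n \<Longrightarrow> \<mu> \<noteq> 2 * int a - int n"
  shows "e X = 0"
proof -
  obtain f where f: "\<And>a. a \<le> n \<Longrightarrow> weight J n (2 * int a - int n) (f a)" "\<And>X. e X = (\<Sum>a\<le>n. f a X)"
    using weight_decomposition[OF weight_hom_poly[OF e]] by blast
  have inj: "inj_on (\<lambda>a. 2 * int a - int n) {..n}" by (auto simp: inj_on_def)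
  define e' where "e' \<nu> = (if \<nu> = \<mu> then (\<lambda>X. (-1) * e X) else f (nat ((\<nu> + int n) div 2)))" for \<nu>
  have e': "e' (2 * int a - int n) = f a" if "a \<le> n" for a using r[OF that] by (auto simp: e'_def)
  have ni: "\<mu> \<notin> (\<lambda>a. 2 * int a - int n) ` {..n}" using r by auto
  have "(\<Sum>\<mu>\<in>insert \<mu> ((\<lambda>a. 2 * int a - int n) ` {..n}). e' \<mu> X) = 0" for X
  proof -
    have "(\<Sum>\<mu>\<in>(\<lambda>a. 2 * int a - int n) ` {..n}. e' \<mu> X) = (\<Sum>a\<le>n. f a X)"
      by (simp add: sum.reindex[OF inj] o_def e' del: sum.atMost_Suc)
    then show ?thesis using ni f(2)[of X] by (simp add: e'_def[of \<mu>])
  qed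
  then have "e' \<mu> X = 0"
    by (rule weight_independent[where J=J and n=n, rotated 2])
      (use f(1) e' weight_cmult[OF e, of "-1"] in \<open>auto simp: e'_def[of \<mu>]\<close>)
  then show ?thesis by (simp add: e'_def)
qed

lemma bihom_iff_wt': "a \<le> n \<Longrightarrow> bihom J a (n - a) e \<longleftrightarrow> weight J n (2 * int a - int n) e"
  by (simp add: bihom_iff_wt of_nat_diff algebra_simps)

lemma bihom_parts_unique:
  assumes "\<forall>a\<le>n. bihom J a (n - a) (e a)" "\<forall>a>n. e a = (\<lambda>_. 0)" "\<forall>X. complex_of_real (f X) = (\<Sum>a\<le>n. e a X)"
    "\<forall>a\<le>n. bihom J a (n - a) (e' a)" "\<forall>a>n. e' a = (\<lambda>_. 0)" "\<forall>X. complex_of_real (f X) = (\<Sum>a\<le>n. e' a X)"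
  shows "e = e'"
proof (rule ext)
  fix a show "e a = e' a"
  proof (cases "a \<le> n")
    case True
    have "e a X + (-1) * e' a X = 0" for X
    proof (rule weight_parts_unique[of n "\<lambda>a X. e a X + (-1) * e' a X"])
      show "weight J n (2 * int a - int n) (\<lambda>X. e a X + (-1) * e' a X)" if "a \<le> n" for a
        using assms(1,4) that by (intro weight_add weight_cmult) (auto simp: bihom_iff_wt')
      show "(\<Sum>a\<le>n. e a X + (-1) * e' a X) = 0" for X
        unfolding sum.distrib sum_distrib_left[symmetric] using assms(3,6) by simp
    qed (rule True)
    then show ?thesis by (simp add: fun_eq_iff)
  next
    case False
    then show ?thesis using assms(2,5) by simp
  qed
qed

lemma bihom_parts_eqI:
  assumes "\<And>a. a \<le> n \<Longrightarrow> weight J n (2 * int a - int n) (e a)" "\<And>X. complex_of_real (f X) = (\<Sum>a\<le>n. e a X)" "a \<le> n"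
  shows "bihom_parts J n f a = e a"
proof -
  define e' where "e' a = (if a \<le> n then e a else (\<lambda>_. 0))" for a
  have "bihom_parts J n f = e'"
    unfolding bihom_parts_def
  proof (rule the_equality)
    show "(\<forall>a\<le>n. bihom J a (n - a) (e' a)) \<and> (\<forall>a>n. e' a = (\<lambda>_. 0)) \<and> (\<forall>X. complex_of_real (f X) = (\<Sum>a\<le>n. e' a X))"
      using assms(1,2) by (auto simp: e'_def bihom_iff_wt')
  qed (use assms(1,2) in \<open>auto simp: e'_def bihom_iff_wt' intro!: bihom_parts_unique\<close>)
  then show ?thesis using assms(3) by (simp add: e'_def)
qed

lemma bihom_parts_works:
  assumes "hom_poly n (f :: 'a \<Rightarrow> real)"
  shows "a \<le> n \<Longrightarrow> weight J n (2 * int a - int n) (bihom_parts J n f a)"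
    "complex_of_real (f X) = (\<Sum>a\<le>n. bihom_parts J n f a X)"
proof -
  have "hom_poly n (\<lambda>X. complex_of_real (f X))"
    using assms by (rule hom_poly_linear_image) (rule bounded_linear.linear[OF bounded_linear_of_real])
  then obtain e where e: "\<And>a. a \<le> n \<Longrightarrow> weight J n (2 * int a - int n) (e a)" "\<And>X. complex_of_real (f X) = (\<Sum>a\<le>n. e a X)"
    using weight_decomposition by blast
  then have "a \<le> n \<Longrightarrow> bihom_parts J n f a = e a" for a by (rule bihom_parts_eqI)
  then show "a \<le> n \<Longrightarrow> weight J n (2 * int a - int n) (bihom_parts J n f a)"
    "complex_of_real (f X) = (\<Sum>a\<le>n. bihom_parts J n f a X)"
    using e by auto
qed

lemma bihom_parts_add:
  assumes "hom_poly n (f :: 'a \<Rightarrow> real)" "hom_poly n h" "a \<le> n"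
  shows "bihom_parts J n (\<lambda>X. f X + h X) a = (\<lambda>X. bihom_parts J n f a X + bihom_parts J n h a X)"
  by (rule bihom_parts_eqI[OF _ _ assms(3)])
    (auto intro!: weight_add simp: bihom_parts_works[OF assms(1)] bihom_parts_works[OF assms(2)] sum.distrib)

lemma bihom_parts_scaleR:
  assumes "hom_poly n (f :: 'a \<Rightarrow> real)" "a \<le> n"
  shows "bihom_parts J n (\<lambda>X. c * f X) a = (\<lambda>X. of_real c * bihom_parts J n f a X)"
  by (rule bihom_parts_eqI[OF _ _ assms(2)])
    (auto intro!: weight_cmult simp: bihom_parts_works[OF assms(1)] sum_distrib_left)

section \<open>Real polynomials with prescribed bidegrees and the projections onto them\<close>

definition bideg :: "(nat \<Rightarrow> nat \<Rightarrow> bool) \<Rightarrow> nat \<Rightarrow> ('a \<Rightarrow> real) \<Rightarrow> bool"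
  where "bideg P n f \<longleftrightarrow> hom_poly n f \<and> (\<forall>a\<le>n. \<not> P a (n - a) \<longrightarrow> bihom_parts J n f a = (\<lambda>_. 0))"

lemma only_bidegrees_iff_sp: "only_bidegrees J P \<eta> \<longleftrightarrow> (\<forall>n. bideg P n (\<eta> n))"
  by (auto simp: only_bidegrees_def bideg_def is_formal_series_def)

lemma bideg_hom_poly: "bideg P n f \<Longrightarrow> hom_poly n f"
  by (simp add: bideg_def)

lemma bideg_mono: "bideg P n f \<Longrightarrow> (\<And>a b. a + b = n \<Longrightarrow> P a b \<Longrightarrow> Q a b) \<Longrightarrow> bideg Q n f"
  unfolding bideg_def by (metis le_add_diff_inverse)

lemma bideg_zero: "bideg P n (\<lambda>_. 0)"
  unfolding bideg_def by (auto intro!: bihom_parts_eqI weight_zero)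

lemma bideg_add: "bideg P n f \<Longrightarrow> bideg P n h \<Longrightarrow> bideg P n (\<lambda>X. f X + h X)"
  unfolding bideg_def by (auto simp: bihom_parts_add intro: hom_poly.add)

lemma bideg_scale: "bideg P n f \<Longrightarrow> bideg P n (\<lambda>X. c * f X)"
  unfolding bideg_def using hom_poly_scaleR[of n f c] by (auto simp: bihom_parts_scaleR)

lemma bideg_diff: "bideg P n f \<Longrightarrow> bideg P n h \<Longrightarrow> bideg P n (\<lambda>X. f X - h X)"
  using bideg_add[of P n f "\<lambda>X. (-1) * h X"] bideg_scale[of P n h "-1"] by simp

lemma bideg_sum: "(\<And>i. i \<in> I \<Longrightarrow> bideg P n (f i)) \<Longrightarrow> bideg P n (\<lambda>X. \<Sum>i\<in>I. f i X)"
  by (induction I rule: infinite_finite_induct) (auto intro: bideg_add bideg_zero)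

text \<open>The real part is half the sum of \<open>e\<close> and its conjugate, of bidegrees
  \<open>(a, b)\<close> and \<open>(b, a)\<close>; symmetry of \<open>P\<close> admits both.\<close>

lemma bideg_Re:
  assumes P: "sym_bidegrees P" and e: "weight J n \<mu> e" and \<mu>: "\<mu> = int a - int b" "a + b = n" "P a b"
  shows "bideg P n (\<lambda>X. Re (e X))"
proof -
  have hp: "hom_poly n (\<lambda>X. Re (e X))"
    using weight_hom_poly[OF e] by (rule hom_poly_linear_image) (rule bounded_linear.linear[OF bounded_linear_Re])
  \<comment> \<open>Two conditional summands instead of a case distinction, since for
    \<open>a = b\<close> both halves fall on the same component.\<close>
  define e' where "e' c X = (if c = a then 1/2 * e X else 0) + (if c = b then 1/2 * cnj (e X) else 0)" for c X
  have "bihom_parts J n (\<lambda>X. Re (e X)) c = e' c" if "c \<le> n" for c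
  proof (rule bihom_parts_eqI[OF _ _ that])
    show "weight J n (2 * int c - int n) (e' c)" if "c \<le> n" for c
    proof -
      have "weight J n (2 * int c - int n) (\<lambda>X. if c = a then 1/2 * e X else 0)"
      proof (cases "c = a")
        case True
        then have "2 * int c - int n = \<mu>" using \<mu> by simp
        then show ?thesis using weight_cmult[OF e, of "1/2"] True by simp
      qed (simp add: weight_zero)
      moreover have "weight J n (2 * int c - int n) (\<lambda>X. if c = b then 1/2 * cnj (e X) else 0)"
      proof (cases "c = b")
        case True
        then have "2 * int c - int n = - \<mu>" using \<mu> by simp
        then show ?thesis using weight_cmult[OF weight_cnj[OF e], of "1/2"] True by simp
      qed (simp add: weight_zero)
      ultimately show ?thesis unfolding e'_def by (rule weight_add)
    qed
    have "a \<le> n" "b \<le> n" using \<mu> by auto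
    then show "complex_of_real (Re (e X)) = (\<Sum>c\<le>n. e' c X)" for X
      by (simp add: e'_def sum.distrib sum.delta complex_eq_iff)
  qed
  moreover have "P b a" using P \<mu> by (simp add: sym_bidegrees_def)
  ultimately show ?thesis
    using hp \<mu> by (auto simp: bideg_def e'_def fun_eq_iff)
qed

definition bideg_proj :: "(nat \<Rightarrow> nat \<Rightarrow> bool) \<Rightarrow> nat \<Rightarrow> ('a \<Rightarrow> real) \<Rightarrow> 'a \<Rightarrow> real"
  where "bideg_proj P n f X = Re (\<Sum>a | a \<le> n \<and> P a (n - a). bihom_parts J n f a X)"

lemma pr_bidegrees_eq_prj: "pr_bidegrees J P \<eta> n = bideg_proj P n (\<eta> n)"
  by (rule ext) (simp add: pr_bidegrees_def bideg_proj_def)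

lemma bideg_proj_sum: "bideg_proj P n f X = (\<Sum>a | a \<le> n \<and> P a (n - a). Re (bihom_parts J n f a X))"
  by (simp add: bideg_proj_def)

lemma bideg_proj_add:
  "hom_poly n f \<Longrightarrow> hom_poly n h \<Longrightarrow> bideg_proj P n (\<lambda>X. f X + h X) X = bideg_proj P n f X + bideg_proj P n h X"
  by (simp add: bideg_proj_sum bihom_parts_add sum.distrib)

lemma bideg_proj_scale: "hom_poly n f \<Longrightarrow> bideg_proj P n (\<lambda>X. c * f X) X = c * bideg_proj P n f X"
  by (simp add: bideg_proj_sum bihom_parts_scaleR sum_distrib_left)

lemma bideg_proj_diff:
  assumes "hom_poly n f" "hom_poly n h"
  shows "bideg_proj P n (\<lambda>X. f X - h X) X = bideg_proj P n f X - bideg_proj P n h X"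
  using bideg_proj_add[OF assms(1), of "\<lambda>X. (-1) * h X" P X] bideg_proj_scale[OF assms(2), of P "-1" X] hom_poly_scaleR[OF assms(2), of "-1"]
  by simp

lemma bideg_expand:
  assumes "bideg P n f"
  shows "f X = (\<Sum>a | a \<le> n \<and> P a (n - a). Re (bihom_parts J n f a X))"
proof -
  have "f X = Re (\<Sum>a\<le>n. bihom_parts J n f a X)"
    using bihom_parts_works(2)[OF bideg_hom_poly[OF assms], of X] by (metis Re_complex_of_real)
  also have "\<dots> = (\<Sum>a\<le>n. Re (bihom_parts J n f a X))" by simp
  also have "\<dots> = (\<Sum>a | a \<le> n \<and> P a (n - a). Re (bihom_parts J n f a X))"
    by (rule sum.mono_neutral_right) (use assms in \<open>auto simp: bideg_def\<close>)
  finally show ?thesis .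
qed

lemma bideg_proj_id: "bideg P n f \<Longrightarrow> bideg_proj P n f X = f X"
  using bideg_expand bideg_proj_sum by metis

lemma bideg_prj:
  assumes "sym_bidegrees P" "hom_poly n f"
  shows "bideg P n (bideg_proj P n f)"
proof -
  have "bideg P n (\<lambda>X. \<Sum>a | a \<le> n \<and> P a (n - a). Re (bihom_parts J n f a X))"
  proof (rule bideg_sum)
    fix a assume "a \<in> {a. a \<le> n \<and> P a (n - a)}"
    then show "bideg P n (\<lambda>X. Re (bihom_parts J n f a X))"
      by (intro bideg_Re[OF assms(1) bihom_parts_works(1)[OF assms(2), of a], where a=a and b="n - a"]) auto
  qed
  then show ?thesis by (simp add: bideg_proj_sum[abs_def])
qed

lemma bideg_proj_disjoint:
  assumes "bideg Q n f" "\<And>a b. a + b = n \<Longrightarrow> P a b \<Longrightarrow> \<not> Q a b"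
  shows "bideg_proj P n f X = 0"
proof -
  have "bihom_parts J n f a = (\<lambda>_. 0)" if "a \<le> n" "P a (n - a)" for a
    using assms that by (auto simp: bideg_def)
  then show ?thesis by (simp add: bideg_proj_sum)
qed

lemma bideg_proj_split:
  assumes f: "bideg (\<lambda>a b. P a b \<or> Q a b) n f" and "\<And>a b. a + b = n \<Longrightarrow> P a b \<Longrightarrow> \<not> Q a b"
  shows "f X = bideg_proj P n f X + bideg_proj Q n f X"
proof -
  have "{a. a \<le> n \<and> (P a (n - a) \<or> Q a (n - a))} = {a. a \<le> n \<and> P a (n - a)} \<union> {a. a \<le> n \<and> Q a (n - a)}" by auto
  moreover have "{a. a \<le> n \<and> P a (n - a)} \<inter> {a. a \<le> n \<and> Q a (n - a)} = {}" using assms(2) by force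
  ultimately show ?thesis unfolding bideg_proj_sum using bideg_expand[OF f, of X] by (simp add: sum.union_disjoint)
qed

lemma bideg_disjoint_zero:
  assumes "bideg P n f" "bideg Q n f" "\<And>a b. a + b = n \<Longrightarrow> P a b \<Longrightarrow> \<not> Q a b"
  shows "f X = 0"
  using bideg_proj_id[OF assms(1)] bideg_proj_disjoint[OF assms(2,3)] by metis

text \<open>Through this form a projection of a family is differentiable in a parameter as soon as
  all values of the family are.\<close>

lemma bideg_proj_values:
  "\<exists>cs::(real \<times> 'a) list. \<forall>f. hom_poly n f \<longrightarrow> bideg_proj P n f X = (\<Sum>(c, w)\<leftarrow>cs. c * f w)"
  by (rule hom_poly_functional) (auto simp: bideg_proj_add bideg_proj_scale)

end

lemma dird_dird_field:
  fixes f :: "'a::euclidean_space \<Rightarrow> 'b::real_normed_vector"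
  assumes f: "smooth_at x f" and w: "w differentiable (at x)"
  shows "dird (\<lambda>x. dird f x (w x)) x u = dird (\<lambda>y. dird f y (w x)) x u + dird f x (dird w x u)"
proof -
  have ex: "\<forall>\<^sub>F y in nhds x. \<forall>v. dird f y v = (\<Sum>i\<in>Basis. (v \<bullet> i) *\<^sub>R dird f y i)"
    using smooth_at_eventually[OF f] by eventually_elim (metis dird_basis_expansion smooth_at_differentiable)
  have dw: "((\<lambda>y. w y \<bullet> i) has_derivative (\<lambda>u. dird w x u \<bullet> i)) (at x)" for i
    using w by (auto intro!: has_derivative_inner_left simp: frechet_derivative_works)
  have df: "((\<lambda>y. dird f y i) has_derivative dird (\<lambda>y. dird f y i) x) (at x)" for i
    by (rule smooth_at_has_derivative[OF smooth_at_dird[OF f]])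
  have "((\<lambda>y. \<Sum>i\<in>Basis. (w y \<bullet> i) *\<^sub>R dird f y i) has_derivative
      (\<lambda>u. \<Sum>i\<in>Basis. (w x \<bullet> i) *\<^sub>R dird (\<lambda>y. dird f y i) x u + (dird w x u \<bullet> i) *\<^sub>R dird f x i)) (at x)"
    by (intro has_derivative_sum has_derivative_scaleR dw df)
  then have 1: "((\<lambda>y. dird f y (w y)) has_derivative
      (\<lambda>u. \<Sum>i\<in>Basis. (w x \<bullet> i) *\<^sub>R dird (\<lambda>y. dird f y i) x u + (dird w x u \<bullet> i) *\<^sub>R dird f x i)) (at x)"
    by (rule has_derivative_cong_nhds, use ex in eventually_elim) (erule allE, erule sym)
  have "((\<lambda>y. \<Sum>i\<in>Basis. (w x \<bullet> i) *\<^sub>R dird f y i) has_derivative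
      (\<lambda>u. \<Sum>i\<in>Basis. (w x \<bullet> i) *\<^sub>R dird (\<lambda>y. dird f y i) x u)) (at x)"
    by (intro has_derivative_sum has_derivative_scaleR_right df)
  then have 2: "((\<lambda>y. dird f y (w x)) has_derivative
      (\<lambda>u. \<Sum>i\<in>Basis. (w x \<bullet> i) *\<^sub>R dird (\<lambda>y. dird f y i) x u)) (at x)"
    by (rule has_derivative_cong_nhds, use ex in eventually_elim) (erule allE, erule sym)
  have "dird f x (dird w x u) = (\<Sum>i\<in>Basis. (dird w x u \<bullet> i) *\<^sub>R dird f x i)"
    using eventually_nhds_x_imp_x[OF ex] by blast
  then show ?thesis by (simp only: dird_eqI[OF 1] dird_eqI[OF 2] sum.distrib)
qed

lemma dird_scale:
  fixes f :: "'a::euclidean_space \<Rightarrow> 'b::real_normed_vector"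
  shows "f differentiable (at x) \<Longrightarrow> dird f x (c *\<^sub>R u) = c *\<^sub>R dird f x u"
  by (rule linear_scale[OF linear_dird])

lemma dird_uminus:
  fixes f :: "'a::euclidean_space \<Rightarrow> 'b::real_normed_vector"
  shows "f differentiable (at x) \<Longrightarrow> dird f x (- u) = - dird f x u"
  by (rule linear_neg[OF linear_dird])

lemma bilinear_imp_bounded:
  fixes b :: "'a::euclidean_space \<Rightarrow> 'b::euclidean_space \<Rightarrow> 'c::real_normed_vector"
  shows "bilinear b \<Longrightarrow> bounded_bilinear b"
  by (simp add: bilinear_conv_bounded_bilinear)

section \<open>Holomorphic vector fields and their effect on bidegrees\<close>

context cstruct
begin

lemma hol_hom_poly: "w \<in> hol_poly_fields J k \<Longrightarrow> hom_poly k w"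
  by (simp add: hol_poly_fields_def)

lemma hol_dird: "w \<in> hol_poly_fields J k \<Longrightarrow> dird w X (J u) = J (dird w X u)"
  by (simp add: hol_poly_fields_def)

lemma hol_rot: "w \<in> hol_poly_fields J k \<Longrightarrow> dird w X (J X) = real k *\<^sub>R J (w X)"
  using hol_dird dird_euler[OF hol_hom_poly] by simp

lemma hol_differentiable: "w \<in> hol_poly_fields J k \<Longrightarrow> w differentiable (at X)"
  using hom_poly_differentiable hol_hom_poly by blast

lemma hol_const: "(\<lambda>_. Z) \<in> hol_poly_fields J 0"
  by (simp add: hol_poly_fields_def hom_poly.const)

lemma hol_zero: "(\<lambda>_. 0) \<in> hol_poly_fields J k"
  by (simp add: hol_poly_fields_def)

lemma hol_ident: "(\<lambda>X. X) \<in> hol_poly_fields J 1"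
  using hom_poly_linear[of "\<lambda>X::'a. X"] by (simp add: hol_poly_fields_def linear_ident)

lemma hol_J:
  assumes "w \<in> hol_poly_fields J k"
  shows "(\<lambda>X. J (w X)) \<in> hol_poly_fields J k"
  using assms hol_dird[OF assms] hom_poly_linear_image[OF hol_hom_poly[OF assms] linJ]
    dird_bounded_linear(1)[OF blJ hol_differentiable[OF assms]]
  by (simp add: hol_poly_fields_def)

lemma hol_add:
  assumes "w \<in> hol_poly_fields J k" "v \<in> hol_poly_fields J k"
  shows "(\<lambda>X. w X + v X) \<in> hol_poly_fields J k"
  using assms hol_dird[OF assms(1)] hol_dird[OF assms(2)]
  by (simp add: hol_poly_fields_def hom_poly.add dird_add[OF hol_differentiable[OF assms(1)] hol_differentiable[OF assms(2)]])

lemma hol_scale: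
  assumes "w \<in> hol_poly_fields J k"
  shows "(\<lambda>X. c *\<^sub>R w X) \<in> hol_poly_fields J k"
  using hol_dird[OF assms] hom_poly_scaleR[OF hol_hom_poly[OF assms]]
    dird_bounded_linear(1)[OF bounded_linear_scaleR_right hol_differentiable[OF assms], of c]
  by (simp add: hol_poly_fields_def)

text \<open>The rotation and the derivation along \<open>w\<close> are interchanged by symmetry of
  second derivatives. Differentiating the field \<open>X \<mapsto> J X\<close> in the eigenvalue
  equation contributes \<open>-1\<close>, and the rotation of the holomorphic field \<open>w\<close>
  of degree \<open>k\<close> contributes \<open>k\<close> to the coefficient of the term with
  \<open>J (w X)\<close>.\<close>

lemma weight_rot_dird:
  assumes e: "weight J n \<mu> e" and w: "w \<in> hol_poly_fields J k"
  shows "dird (\<lambda>X. dird e X (w X)) X (J X) = \<i> * of_int \<mu> * dird e X (w X) + (of_nat k - 1) * dird e X (J (w X))"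
proof -
  have sm: "smooth_at X e" by (rule hom_poly_smooth_at[OF weight_hom_poly[OF e]])
  have d: "e differentiable (at X)" by (rule smooth_at_differentiable[OF sm])
  have Jd: "J differentiable (at X)" "dird J X u = J u" for u
    using blJ by (auto intro!: bounded_linear_imp_differentiable dird_eqI bounded_linear_imp_has_derivative)
  let ?u = "w X"
  have "(\<lambda>X. dird e X (J X)) = (\<lambda>X. \<i> * of_int \<mu> * e X)" using e by (simp add: weight_def fun_eq_iff)
  then have "dird (\<lambda>X. dird e X (J X)) X ?u = dird (\<lambda>X. \<i> * of_int \<mu> * e X) X ?u" by simp
  then have "dird (\<lambda>Y. dird e Y (J X)) X ?u + dird e X (J ?u) = \<i> * of_int \<mu> * dird e X ?u"
    using dird_dird_field[OF sm Jd(1), of ?u] dird_bounded_linear(1)[OF bounded_linear_mult_right d, of "\<i> * of_int \<mu>"]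
    by (simp add: Jd(2))
  then have "dird (\<lambda>Y. dird e Y ?u) X (J X) = \<i> * of_int \<mu> * dird e X ?u - dird e X (J ?u)"
    using smooth_at_dird_commute[OF sm, of "J X" ?u] by (simp add: algebra_simps)
  then show ?thesis
    using dird_dird_field[OF sm hol_differentiable[OF w], of "J X"]
    by (simp add: hol_rot[OF w] dird_scale[OF d] scaleR_conv_of_real algebra_simps)
qed

text \<open>The derivations along \<open>w\<close> and \<open>J w\<close> are mixed by the rotation,
  and these combinations diagonalize it. For \<open>s = 1\<close> the derivation is along the
  (1,0)-part of \<open>w\<close>, which replaces a holomorphic factor by one of degree
  \<open>k\<close>; \<open>s = -1\<close> is the conjugate case.\<close>

lemma weight_dird_field:
  assumes e: "weight J (Suc n) \<mu> e" and w: "w \<in> hol_poly_fields J k" and s: "s = 1 \<or> s = (-1::int)"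
  shows "weight J (n + k) (\<mu> + s * (int k - 1)) (\<lambda>X. (dird e X (w X) - of_int s * \<i> * dird e X (J (w X))) / 2)"
proof -
  have hp: "hom_poly (n + k) (\<lambda>X. dird e X (w X))" "hom_poly (n + k) (\<lambda>X. dird e X (J (w X)))"
    using hom_poly_dird_field[OF weight_hom_poly[OF e]] hol_hom_poly[OF w] hol_hom_poly[OF hol_J[OF w]] by auto
  let ?E = "\<lambda>X. (1/2) * dird e X (w X) + (- of_int s * \<i> / 2) * dird e X (J (w X))"
  have E: "(\<lambda>X. (dird e X (w X) - of_int s * \<i> * dird e X (J (w X))) / 2) = ?E"
    by (simp add: field_simps)
  have "hom_poly (n + k) ?E"
    by (intro hom_poly.add hom_poly_linear_image[OF hp(1) bounded_linear.linear[OF bounded_linear_mult_right]]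
      hom_poly_linear_image[OF hp(2) bounded_linear.linear[OF bounded_linear_mult_right]])
  moreover have "dird ?E X (J X) = \<i> * of_int (\<mu> + s * (int k - 1)) * ?E X" for X
  proof -
    have "dird ?E X (J X) = (1/2) * dird (\<lambda>X. dird e X (w X)) X (J X) + (- of_int s * \<i> / 2) * dird (\<lambda>X. dird e X (J (w X))) X (J X)"
      by (subst dird_add)
        (auto intro!: dird_bounded_linear(2)[OF bounded_linear_mult_right] hom_poly_differentiable[OF hp(1)] hom_poly_differentiable[OF hp(2)]
         simp only: dird_bounded_linear(1)[OF bounded_linear_mult_right hom_poly_differentiable[OF hp(1)]]
          dird_bounded_linear(1)[OF bounded_linear_mult_right hom_poly_differentiable[OF hp(2)]])
    also have "\<dots> = \<i> * of_int (\<mu> + s * (int k - 1)) * ?E X"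
      unfolding weight_rot_dird[OF e w] weight_rot_dird[OF e hol_J[OF w]]
      using s by (auto simp: dird_uminus[OF hom_poly_differentiable[OF weight_hom_poly[OF e]]] field_simps)
    finally show ?thesis .
  qed
  ultimately show ?thesis unfolding E weight_def by blast
qed

text \<open>A purely antiholomorphic polynomial has no derivative in (1,0)-directions, and
  conversely: the eigenvalue of the result would lie outside the range for degree
  \<open>n\<close>.\<close>

lemma weight_extreme_dird:
  assumes e: "weight J (Suc n) \<mu> e" and s: "s = 1 \<or> s = (-1::int)" and \<mu>: "\<mu> = - s * int (Suc n)"
  shows "dird e X u - of_int s * \<i> * dird e X (J u) = 0"
proof -
  have "weight J (n + 0) (\<mu> + s * (int 0 - 1)) (\<lambda>X. (dird e X u - of_int s * \<i> * dird e X (J u)) / 2)"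
    by (rule weight_dird_field[OF e hol_const s])
  from weight_out_of_range[OF this, of X] show ?thesis
    using \<mu> s by auto
qed

text \<open>Each component splits into the derivations along the (1,0)- and the (0,1)-part of
  \<open>w\<close>, taking bidegree \<open>(a + 1, b)\<close> to \<open>(a + k, b)\<close> and
  \<open>(a, b + 1)\<close> to \<open>(a, b + k)\<close>. The pure components \<open>a = 0\<close>
  and \<open>a = Suc n\<close> lack the factor to be differentiated in one of the two cases.\<close>

lemma bideg_dird_field:
  assumes f: "bideg P (Suc n) f" and w: "w \<in> hol_poly_fields J k" and Q: "sym_bidegrees Q"
    and PQ: "\<And>a b. a + b = n \<Longrightarrow> P (Suc a) b \<Longrightarrow> Q (a + k) b" "\<And>a b. a + b = n \<Longrightarrow> P a (Suc b) \<Longrightarrow> Q a (b + k)"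
  shows "bideg Q (n + k) (\<lambda>X. dird f X (w X))"
proof -
  let ?A = "{a. a \<le> Suc n \<and> P a (Suc n - a)}"
  define e where "e = bihom_parts J (Suc n) f"
  have e: "weight J (Suc n) (2 * int a - int (Suc n)) (e a)" if "a \<in> ?A" for a
    using that bihom_parts_works(1)[OF bideg_hom_poly[OF f]] by (simp add: e_def)
  have d: "e a differentiable (at X)" if "a \<in> ?A" for a X
    by (rule hom_poly_differentiable[OF weight_hom_poly[OF e[OF that]]])
  have f_eq: "f = (\<lambda>X. \<Sum>a\<in>?A. Re (e a X))"
    unfolding e_def by (rule ext) (rule bideg_expand[OF f])
  have df: "dird f X v = (\<Sum>a\<in>?A. Re (dird (e a) X v))" for X v
    unfolding f_eq
    by (subst dird_sum) (auto intro!: dird_bounded_linear(2)[OF bounded_linear_Re] sum.cong dird_bounded_linear(1)[OF bounded_linear_Re] simp del: Re_sum intro: d)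
  have "bideg Q (n + k) (\<lambda>X. \<Sum>a\<in>?A. Re (dird (e a) X (w X)))"
  proof (rule bideg_sum)
    fix a assume a: "a \<in> ?A"
    define E where "E s X = (dird (e a) X (w X) - of_int s * \<i> * dird (e a) X (J (w X))) / 2" for s X
    have wE: "weight J (n + k) (2 * int a - int (Suc n) + s * (int k - 1)) (E s)" if "s = 1 \<or> s = -1" for s
      unfolding E_def[abs_def] by (rule weight_dird_field[OF e[OF a] w that])
    have "bideg Q (n + k) (\<lambda>X. Re (E 1 X))"
    proof (cases a)
      case 0
      then have "E 1 X = 0" for X
        using weight_extreme_dird[OF e[OF a], of 1 X "w X"] by (simp add: E_def)
      then show ?thesis by (simp add: bideg_zero)
    next
      case (Suc a')
      then have "a' \<le> n" "P (Suc a') (n - a')" using a by auto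
      with PQ(1)[of a' "n - a'"] have q: "Q (a' + k) (n - a')" by simp
      show ?thesis
        by (rule bideg_Re[OF Q wE, where a="a' + k" and b="n - a'"]) (use q \<open>a' \<le> n\<close> Suc in auto)
    qed
    moreover have "bideg Q (n + k) (\<lambda>X. Re (E (-1) X))"
    proof (cases "a = Suc n")
      case True
      then have "E (-1) X = 0" for X
        using weight_extreme_dird[OF e[OF a], of "-1" X "w X"] by (simp add: E_def)
      then show ?thesis by (simp add: bideg_zero)
    next
      case False
      then have an: "a \<le> n" "P a (Suc (n - a))" using a by (auto simp: Suc_diff_le)
      with PQ(2)[of a "n - a"] have q: "Q a (n - a + k)" by simp
      show ?thesis
        by (rule bideg_Re[OF Q wE, where a=a and b="n - a + k"]) (use q an in auto)
    qed
    moreover have "Re (dird (e a) X (w X)) = Re (E 1 X) + Re (E (-1) X)" for X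
      by (simp add: E_def field_simps)
    ultimately show "bideg Q (n + k) (\<lambda>X. Re (dird (e a) X (w X)))"
      using bideg_add[of Q "n + k" "\<lambda>X. Re (E 1 X)" "\<lambda>X. Re (E (-1) X)"] by simp
  qed
  then show ?thesis by (simp only: df)
qed

text \<open>A test in real terms: if the rotation turns \<open>A\<close> and \<open>B\<close> into
  multiples of each other in this way, then \<open>A + \<i> B\<close> is an eigenfunction with
  eigenvalue \<open>b - a\<close>, and \<open>A\<close> is its real part.\<close>

lemma bideg_of_rotation:
  assumes A: "hom_poly n A" and B: "hom_poly n B"
    and dA: "\<And>X. dird A X (J X) = of_int (int a - int b) * B X"
    and dB: "\<And>X. dird B X (J X) = - of_int (int a - int b) * A X"
    and P: "sym_bidegrees P" "a + b = n" "P a b"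
  shows "bideg P n A"
proof -
  let ?e = "\<lambda>X. complex_of_real (A X) + \<i> * complex_of_real (B X)"
  have hp: "hom_poly n ?e"
    by (intro hom_poly.add hom_poly_linear_image[OF A, of complex_of_real]
        hom_poly_linear_image[OF B, of "\<lambda>x. \<i> * complex_of_real x"])
      (auto intro!: bounded_linear.linear bounded_linear_of_real bounded_linear_const_mult)
  have d: "A differentiable (at X)" "B differentiable (at X)" for X
    using A B hom_poly_differentiable by blast+
  have bl: "bounded_linear (\<lambda>x. \<i> * complex_of_real x)"
    by (rule bounded_linear_const_mult[OF bounded_linear_of_real])
  have "dird ?e X (J X) = complex_of_real (dird A X (J X)) + \<i> * complex_of_real (dird B X (J X))" for X
    using dird_bounded_linear[OF bounded_linear_of_real[where 'a=complex] d(1)] dird_bounded_linear[OF bl d(2)]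
    by (simp add: dird_add)
  then have "weight J n (int b - int a) ?e"
    using hp by (simp add: weight_def dA dB algebra_simps)
  moreover have "P b a" using P by (simp add: sym_bidegrees_def)
  ultimately have "bideg P n (\<lambda>X. Re (?e X))"
    using P by (intro bideg_Re[where a=b and b=a]) auto
  then show ?thesis by simp
qed

lemma dird_bilinear_field:
  assumes b: "bilinear (b :: 'a \<Rightarrow> 'a \<Rightarrow> real)" and w: "w \<in> hol_poly_fields J k" and h: "linear h"
  shows "dird (\<lambda>X. b (w X) (h X)) X u = b (w X) (h u) + b (dird w X u) (h X)"
proof -
  have bl: "bounded_linear h" using h linear_conv_bounded_linear by blast
  then have "h differentiable (at X)" "dird h X u = h u"
    by (auto intro!: bounded_linear_imp_differentiable dird_eqI bounded_linear_imp_has_derivative)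
  then show ?thesis
    using dird_bilinear(1)[OF bilinear_imp_bounded[OF b] hol_differentiable[OF w]] by simp
qed

lemma bilinear_minus: "bilinear (b :: 'a \<Rightarrow> 'a \<Rightarrow> real) \<Longrightarrow> b (- u) v = - b u v" "bilinear b \<Longrightarrow> b u (- v) = - b u v"
  by (simp_all add: bilinear_lneg bilinear_rneg)

lemma hom_poly_bilinear_field:
  assumes b: "bilinear (b :: 'a \<Rightarrow> 'a \<Rightarrow> real)" and w: "w \<in> hol_poly_fields J k" and h: "linear h"
  shows "hom_poly (Suc k) (\<lambda>X. b (w X) (h X))"
  using hom_poly_bilinear[OF b hol_hom_poly[OF w] hom_poly_linear[OF h]] by simp

text \<open>A \<open>J\<close>-invariant form is complex linear in one argument and antilinear in
  the other up to taking real parts, so the linear factor \<open>X\<close> and the field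
  \<open>w\<close> count with opposite type.\<close>

lemma bideg_closure_hermitian:
  assumes b: "bilinear (b :: 'a \<Rightarrow> 'a \<Rightarrow> real)" "\<And>u v. b (J u) (J v) = b u v"
    and w: "w \<in> hol_poly_fields J k" and P: "sym_bidegrees P" "P 1 k"
  shows "bideg P (Suc k) (\<lambda>X. b (w X) X)"
proof (rule bideg_of_rotation[where B="\<lambda>X. b (w X) (J X)" and a=1 and b=k])
  have 1: "b (J u) v = - b u (J v)" for u v
    using b(2)[of u "J v"] by (simp add: bilinear_minus[OF b(1)])
  show "dird (\<lambda>X. b (w X) X) X (J X) = of_int (int 1 - int k) * b (w X) (J X)" for X
    using dird_bilinear_field[OF b(1) w linear_ident]
    by (simp add: hol_rot[OF w] bilinear_lmul[OF b(1)] 1 algebra_simps)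
  show "dird (\<lambda>X. b (w X) (J X)) X (J X) = - of_int (int 1 - int k) * b (w X) X" for X
    using dird_bilinear_field[OF b(1) w linJ]
    by (simp add: hol_rot[OF w] bilinear_lmul[OF b(1)] b(2) bilinear_minus[OF b(1)] algebra_simps)
qed (use hom_poly_bilinear_field[OF b(1) w] linear_ident linJ P in auto)

text \<open>A form that changes sign under \<open>J\<close> is the real part of a complex bilinear
  one, so the factors \<open>X\<close> and \<open>w\<close> have equal type and the result is the
  real part of a holomorphic polynomial.\<close>

lemma bideg_closure_antihermitian:
  assumes b: "bilinear (b :: 'a \<Rightarrow> 'a \<Rightarrow> real)" "\<And>u v. b (J u) (J v) = - b u v"
    and w: "w \<in> hol_poly_fields J k" and P: "sym_bidegrees P" "P (Suc k) 0"
  shows "bideg P (Suc k) (\<lambda>X. b (w X) X)"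
proof (rule bideg_of_rotation[where B="\<lambda>X. b (w X) (J X)" and a="Suc k" and b=0])
  have 1: "b (J u) v = b u (J v)" for u v
    using b(2)[of u "J v"] by (simp add: bilinear_minus[OF b(1)])
  show "dird (\<lambda>X. b (w X) X) X (J X) = of_int (int (Suc k) - int 0) * b (w X) (J X)" for X
    using dird_bilinear_field[OF b(1) w linear_ident]
    by (simp add: hol_rot[OF w] bilinear_lmul[OF b(1)] 1 algebra_simps)
  show "dird (\<lambda>X. b (w X) (J X)) X (J X) = - of_int (int (Suc k) - int 0) * b (w X) X" for X
    using dird_bilinear_field[OF b(1) w linJ]
    by (simp add: hol_rot[OF w] bilinear_lmul[OF b(1)] b(2) bilinear_minus[OF b(1)] algebra_simps)
qed (use hom_poly_bilinear_field[OF b(1) w] linear_ident linJ P in auto)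

lemma bideg_linear_hol:
  assumes l: "linear (l :: 'a \<Rightarrow> real)" and w: "w \<in> hol_poly_fields J k" and P: "sym_bidegrees P" "P k 0"
  shows "bideg P k (\<lambda>X. l (w X))"
proof (rule bideg_of_rotation[where B="\<lambda>X. l (J (w X))" and a=k and b=0])
  have bl: "bounded_linear l" using l linear_conv_bounded_linear by blast
  show "dird (\<lambda>X. l (w X)) X (J X) = of_int (int k - int 0) * l (J (w X))" for X
    by (simp add: dird_bounded_linear(1)[OF bl hol_differentiable[OF w]] hol_rot[OF w] linear_scale[OF l])
  show "dird (\<lambda>X. l (J (w X))) X (J X) = - of_int (int k - int 0) * l (w X)" for X
    using dird_bounded_linear(1)[OF bl hol_differentiable[OF hol_J[OF w]]] hol_rot[OF hol_J[OF w]]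
    by (simp add: linear_scale[OF l] linear_neg[OF l])
qed (use hom_poly_linear_image[OF hol_hom_poly[OF w] l] hom_poly_linear_image[OF hol_hom_poly[OF hol_J[OF w]] l] P in auto)

text \<open>Euler's relation turns pluriharmonicity into the statement that two rotation derivatives
  multiply \<open>f\<close> by \<open>- n * n\<close>. So \<open>f\<close> and \<open>1 / n\<close>
  times its rotation derivative form a rotating pair, the latter being a harmonic conjugate up to
  sign.\<close>

lemma bideg_pluriharmonic:
  assumes f: "hom_poly n (f :: 'a \<Rightarrow> real)"
    and ph: "\<And>X. dird (\<lambda>Y. dird f Y (J X)) X (J X) = - dird (\<lambda>Y. dird f Y X) X X"
    and P: "sym_bidegrees P" "P n 0"
  shows "bideg P n f"
proof (cases n)
  case 0
  have "bideg P n (\<lambda>X. f X)"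
    by (rule bideg_of_rotation[where B="\<lambda>X. 0" and a=n and b=0])
      (use f P 0 dird_hom_poly_0[of f] in auto)
  then show ?thesis by simp
next
  case (Suc m)
  have Jd: "J differentiable (at X)" "dird J X u = J u" for X u
    using blJ by (auto intro!: bounded_linear_imp_differentiable dird_eqI bounded_linear_imp_has_derivative)
  have d: "f differentiable (at X)" for X by (rule hom_poly_differentiable[OF f])
  have hp: "hom_poly n (\<lambda>X. dird f X (J X))" by (rule hom_poly_dird_linear_field[OF f linJ])
  show ?thesis
  proof (rule bideg_of_rotation[where B="\<lambda>X. (1 / real n) *\<^sub>R dird f X (J X)" and a=n and b=0])
    show "hom_poly n (\<lambda>X. (1 / real n) *\<^sub>R dird f X (J X))"
      by (rule hom_poly_scaleR[OF hp])
    show "dird f X (J X) = of_int (int n - int 0) * ((1 / real n) *\<^sub>R dird f X (J X))" for X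
      using Suc by (simp del: of_nat_Suc)
    fix X
    have "dird (\<lambda>X. dird f X (J X)) X (J X) = - dird (\<lambda>Y. dird f Y X) X X - dird f X X"
      using dird_dird_field[OF hom_poly_smooth_at[OF f] Jd(1), of X "J X"] ph[of X]
      by (simp add: Jd(2) dird_uminus[OF d])
    also have "dird (\<lambda>Y. dird f Y X) X X = real m * (real n * f X)"
      using dird_euler[OF hom_poly_dird[of m f X], of X] dird_euler[OF f, of X] f Suc by simp
    also have "- (real m * (real n * f X)) - dird f X X = - (real n * real n * f X)"
      using dird_euler[OF f, of X] Suc by (simp add: algebra_simps)
    finally have "dird (\<lambda>X. (1 / real n) *\<^sub>R dird f X (J X)) X (J X) = (1 / real n) *\<^sub>R (- (real n * real n * f X))"
      by (simp only: dird_bounded_linear(1)[OF bounded_linear_scaleR_right hom_poly_differentiable[OF hp]])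
    then show "dird (\<lambda>X. (1 / real n) *\<^sub>R dird f X (J X)) X (J X) = - of_int (int n - int 0) * f X"
      using Suc by (simp del: of_nat_Suc)
  qed (use f P in auto)
qed

end

section \<open>The closure isomorphism\<close>

context cstruct
begin

text \<open>For holomorphic \<open>w\<close> of degree \<open>n\<close> and hermitian \<open>b\<close>, the rotation \<open>X \<mapsto> J X\<close> turns
  \<open>\<eta>(X) = b(w X, X)\<close> into \<open>(1 - n) b(w X, J X)\<close>. Combining the derivatives of both cancels the terms
  with derivatives of \<open>w\<close> and leaves \<open>b(w X, u)\<close>.\<close>

definition recover :: "nat \<Rightarrow> ('a \<Rightarrow> real) \<Rightarrow> 'a \<Rightarrow> 'a \<Rightarrow> real"
  where "recover n \<eta> X u = (dird \<eta> X u + (1 / (real n - 1)) * dird (\<lambda>X. dird \<eta> X (J X)) X (J u)) / 2"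

lemma closure_recover:
  assumes b: "bilinear (b :: 'a \<Rightarrow> 'a \<Rightarrow> real)" "\<And>u v. b (J u) (J v) = b u v"
    and w: "w \<in> hol_poly_fields J n" and n: "2 \<le> n"
  shows "b (w X) u = recover n (\<lambda>X. b (w X) X) X u"
proof -
  have 1: "b (J u) v = - b u (J v)" for u v
    using b(2)[of u "J v"] by (simp add: bilinear_minus[OF b(1)])
  have A: "dird (\<lambda>X. b (w X) X) X u = b (w X) u + b (dird w X u) X" for X u
    using dird_bilinear_field[OF b(1) w linear_ident] by simp
  have rot: "dird (\<lambda>X. b (w X) X) X (J X) = (1 - real n) *\<^sub>R b (w X) (J X)" for X
    by (simp add: A hol_rot[OF w] bilinear_lmul[OF b(1)] 1 algebra_simps)
  have "dird (\<lambda>X. b (w X) (J X)) X (J u) = - b (w X) u + b (dird w X u) X"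
    using dird_bilinear_field[OF b(1) w linJ, of X "J u"]
    by (simp add: hol_dird[OF w] b(2) bilinear_minus[OF b(1)])
  moreover have "(\<lambda>X. b (w X) (J X)) differentiable (at X)"
    by (rule hom_poly_differentiable[OF hom_poly_bilinear_field[OF b(1) w linJ]])
  ultimately have "dird (\<lambda>X. dird (\<lambda>X. b (w X) X) X (J X)) X (J u) = (1 - real n) * (- b (w X) u + b (dird w X u) X)"
    using dird_bounded_linear(1)[OF bounded_linear_scaleR_right, of "\<lambda>X. b (w X) (J X)" X "1 - real n" "J u"]
    by (simp only: rot) simp
  then show ?thesis
    using n by (simp add: recover_def A) (simp add: field_simps)
qed

text \<open>A parameter derivative of the closures \<open>b (w X) X\<close>, known for all
  \<open>X\<close>, thereby yields one of \<open>b (w X) u\<close> with an arbitrary second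
  argument.\<close>

lemma recover_values:
  "\<exists>cs::(real \<times> 'a) list. \<forall>\<eta>. hom_poly (Suc n) \<eta> \<longrightarrow> recover m \<eta> X u = (\<Sum>(c, w)\<leftarrow>cs. c * \<eta> w)"
proof (rule hom_poly_functional)
  fix f h :: "'a \<Rightarrow> real"
  assume f: "hom_poly (Suc n) f" and h: "hom_poly (Suc n) h"
  note d = hom_poly_differentiable[OF f] hom_poly_differentiable[OF h]
    hom_poly_differentiable[OF hom_poly_dird_linear_field[OF f linJ]] hom_poly_differentiable[OF hom_poly_dird_linear_field[OF h linJ]]
  show "recover m (\<lambda>v. f v + h v) X u = recover m f X u + recover m h X u"
    unfolding recover_def by (simp add: dird_add d algebra_simps add_divide_distrib)
next
  fix c and f :: "'a \<Rightarrow> real"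
  assume f: "hom_poly (Suc n) f"
  have "dird (\<lambda>v. c * h v) X v = c * dird h X v" if "h differentiable (at X)" for h :: "'a \<Rightarrow> real" and X v
    using dird_bounded_linear(1)[OF bounded_linear_mult_right that] .
  then show "recover m (\<lambda>v. c * f v) X u = c * recover m f X u"
    unfolding recover_def
    by (simp add: hom_poly_differentiable[OF f] hom_poly_differentiable[OF hom_poly_dird_linear_field[OF f linJ]] algebra_simps)
qed

end

lemma sym_some1: "sym_bidegrees some1" and sym_ge22: "sym_bidegrees ge22"
  and sym_critical: "sym_bidegrees critical"
  by (auto simp: sym_bidegrees_def some1_def ge22_def critical_def)

locale hermitian = cstruct +
  fixes g :: "'a \<Rightarrow> 'a \<Rightarrow> real"
  assumes bil: "bilinear g" and gsym: "g u v = g v u" and gpos: "u \<noteq> 0 \<Longrightarrow> 0 < g u u"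
    and gJ: "g (J u) (J v) = g u v"
begin

lemma g_eqI: "(\<And>u. g w u = g v u) \<Longrightarrow> w = v"
  using gpos[of "w - v"] by (metis bilinear_lsub[OF bil] diff_self eq_iff_diff_eq_0 less_irrefl)

lemma riesz:
  assumes "linear (l :: 'a \<Rightarrow> real)"
  shows "\<exists>w. \<forall>u. g w u = l u"
proof -
  define G where "G w = (\<Sum>i\<in>Basis. g w i *\<^sub>R i)" for w
  have lin: "linear G"
    unfolding G_def by (rule linearI) (simp_all add: bilinear_ladd[OF bil] bilinear_lmul[OF bil]
      scaleR_add_left sum.distrib scaleR_sum_right)
  have Gi: "G w \<bullet> i = g w i" if "i \<in> Basis" for w i
    using that by (simp add: G_def inner_sum_left inner_Basis if_distrib sum.delta cong: if_cong)
  have gl: "linear (g w)" for w using bil by (simp add: bilinear_def)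
  have eq: "g w u = l' u" if "linear l'" "\<And>i. i \<in> Basis \<Longrightarrow> g w i = l' i" for w u and l' :: "'a \<Rightarrow> real"
  proof -
    have "g w u = (\<Sum>i\<in>Basis. (u \<bullet> i) *\<^sub>R g w i)" by (rule linear_basis_expansion[OF gl])
    also have "\<dots> = (\<Sum>i\<in>Basis. (u \<bullet> i) *\<^sub>R l' i)" using that(2) by simp
    also have "\<dots> = l' u" by (rule linear_basis_expansion[OF that(1), symmetric])
    finally show ?thesis .
  qed
  have "inj G"
  proof (rule injI)
    fix w v assume "G w = G v"
    then have "g w i = g v i" if "i \<in> Basis" for i using Gi[OF that] by metis
    then have "g w u = g v u" for u by (rule eq[OF gl, of w v])
    then show "w = v" by (rule g_eqI)
  qed
  then have "surj G" using linear_injective_imp_surjective[OF lin] by blast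
  then obtain w where w: "G w = (\<Sum>i\<in>Basis. l i *\<^sub>R i)" by (metis surjD)
  have "g w i = l i" if "i \<in> Basis" for i
    using Gi[OF that, of w] that by (simp add: w inner_sum_left inner_Basis if_distrib sum.delta cong: if_cong)
  then show ?thesis using eq[OF assms] by blast
qed

lemma closure_inj:
  assumes "w \<in> hol_poly_fields J n" "v \<in> hol_poly_fields J n" "2 \<le> n" "\<And>X. g (w X) X = g (v X) X"
  shows "w = v"
proof (rule ext, rule g_eqI)
  fix X u
  have "(\<lambda>X. g (w X) X) = (\<lambda>X. g (v X) X)" using assms(4) by auto
  then show "g (w X) u = g (v X) u"
    using closure_recover[OF bil gJ assms(1,3)] closure_recover[OF bil gJ assms(2,3)] by metis
qed

text \<open>Write \<open>\<eta>\<close> as the real part of some \<open>e\<close> of bidegree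
  \<open>(n, 1)\<close>. Polarizing its single antiholomorphic factor gives functions
  \<open>D v\<close>, holomorphic of degree \<open>n\<close>, and the field is defined by duality
  through \<open>g (w X) v = Re (D v X)\<close>. Euler's relation and the eigenvalue equation give
  \<open>D X X = e X\<close>.\<close>

lemma closure_surj:
  assumes \<eta>: "bideg some1 (Suc n) \<eta>" and n: "2 \<le> n"
  shows "\<exists>w\<in>hol_poly_fields J n. \<forall>X. g (w X) X = \<eta> X"
proof -
  define p where "p = bihom_parts J (Suc n) \<eta>"
  have p: "weight J (Suc n) (2 * int a - int (Suc n)) (p a)" if "a \<le> Suc n" for a
    using bihom_parts_works(1)[OF bideg_hom_poly[OF \<eta>] that] by (simp add: p_def)
  \<comment> \<open>The component of bidegree \<open>(1, n)\<close> is conjugated so that both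
    summands have the eigenvalue \<open>n - 1\<close>; the real part is unchanged.\<close>
  define e where "e X = p n X + cnj (p 1 X)" for X
  have we: "weight J (Suc n) (int n - 1) e"
  proof -
    have "weight J (Suc n) (int n - 1) (p n)" using p[of n] by (simp add: algebra_simps)
    moreover have "weight J (Suc n) (int n - 1) (\<lambda>X. cnj (p 1 X))" using weight_cnj[OF p[of 1]] n by (simp add: algebra_simps)
    ultimately show ?thesis unfolding e_def[abs_def] by (rule weight_add)
  qed
  have Re_e: "Re (e X) = \<eta> X" for X
  proof -
    have "{a. a \<le> Suc n \<and> some1 a (Suc n - a)} = {1, n}" using n by (auto simp: some1_def)
    then have "\<eta> X = (\<Sum>a\<in>{1, n}. Re (p a X))" using bideg_expand[OF \<eta>, of X] by (simp add: p_def)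
    then show ?thesis using n by (simp add: e_def)
  qed
  have d: "e differentiable (at X)" for X by (rule hom_poly_differentiable[OF weight_hom_poly[OF we]])
  \<comment> \<open>Derivative of \<open>e\<close> along the (0,1)-part of the constant vector
    \<open>v\<close>.\<close>
  define D where "D v X = (dird e X v - of_int (-1) * \<i> * dird e X (J v)) / 2" for v X
  have wD: "weight J n (int n) (D v)" for v
    using weight_dird_field[OF we hol_const, of "-1" v] unfolding D_def[abs_def] by simp
  have dD: "D v differentiable (at X)" for v X by (rule hom_poly_differentiable[OF weight_hom_poly[OF wD]])
  have DX: "D X X = e X" for X
  proof -
    have "dird e X (J X) = \<i> * (of_nat n - 1) * e X" using we by (simp add: weight_def)
    moreover have "dird e X X = (of_nat n + 1) * e X"
      using dird_euler[OF weight_hom_poly[OF we], of X] by (simp add: scaleR_conv_of_real algebra_simps)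
    ultimately show ?thesis unfolding D_def by (simp only:) (simp add: algebra_simps)
  qed
  have lD: "linear (\<lambda>v. Re (D v X))" for X
    using linear_dird[OF d[of X]] by (auto intro!: linearI simp: D_def linear_add linear_scale field_simps)
  have DJ: "D (J v) X = - \<i> * D v X" for v X
    by (simp add: D_def dird_uminus[OF d] field_simps)
  have Dhol: "dird (D v) X (J u) = \<i> * dird (D v) X u" for v X u
  proof -
    obtain m where m: "n = Suc m" using n by (cases n) auto
    have "dird (D v) X u - of_int (-1) * \<i> * dird (D v) X (J u) = 0"
      by (rule weight_extreme_dird[of m "int n"]) (use wD[of v] m in auto)
    then have "\<i> * (dird (D v) X u + \<i> * dird (D v) X (J u)) = 0" by simp
    then show ?thesis by (simp add: algebra_simps)
  qed
  have "\<forall>i. \<exists>w. \<forall>u. g w u = u \<bullet> i"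
    by (intro allI riesz bounded_linear.linear[OF bounded_linear_inner_left])
  then obtain r where r: "\<And>i u. g (r i) u = u \<bullet> i" by metis
  define w where "w X = (\<Sum>i\<in>Basis. Re (D i X) *\<^sub>R r i)" for X
  have gw: "g (w X) v = Re (D v X)" for X v
  proof -
    have "g (w X) v = (\<Sum>i\<in>Basis. (v \<bullet> i) * Re (D i X))"
    proof -
      have "linear (\<lambda>w. g w v)" using bil by (simp add: bilinear_def)
      then have "g (w X) v = (\<Sum>i\<in>Basis. g (Re (D i X) *\<^sub>R r i) v)"
        unfolding w_def by (rule linear_sum)
      then show ?thesis by (simp add: bilinear_lmul[OF bil] r mult.commute)
    qed
    also have "\<dots> = Re (D v X)" using linear_basis_expansion[OF lD, of v] by simp
    finally show ?thesis .
  qed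
  have hpw: "hom_poly n w"
  proof -
    have "hom_poly n (\<lambda>X. Re (D i X))" for i
      by (rule hom_poly_linear_image[OF weight_hom_poly[OF wD] bounded_linear.linear[OF bounded_linear_Re]])
    then have "hom_poly n (\<lambda>X. Re (D i X) *\<^sub>R r i)" for i
      by (rule hom_poly_linear_image) (rule bounded_linear.linear[OF bounded_linear_scaleR_left])
    then show ?thesis unfolding w_def[abs_def] by (intro hom_poly_sum)
  qed
  have dw: "g (dird w X u) v = Re (dird (D v) X u)" for X u v
  proof -
    have blv: "bounded_linear (\<lambda>w. g w v)"
      using bil by (simp add: bilinear_def linear_conv_bounded_linear)
    have "g (dird w X u) v = dird (\<lambda>X. g (w X) v) X u"
      by (rule dird_bounded_linear(1)[OF blv hom_poly_differentiable[OF hpw], symmetric])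
    also have "\<dots> = Re (dird (D v) X u)"
      unfolding gw by (rule dird_bounded_linear(1)[OF bounded_linear_Re dD])
    finally show ?thesis .
  qed
  have "dird w X (J u) = J (dird w X u)" for X u
  proof (rule g_eqI)
    fix v
    have "dird (D (J v)) X u = - \<i> * dird (D v) X u"
      using dird_bounded_linear(1)[OF bounded_linear_mult_right dD, of "- \<i>" v X u] by (simp add: DJ[abs_def])
    then have "g (dird w X (J u)) v = - Re (dird (D (J v)) X u)"
      by (simp add: dw Dhol)
    also have "\<dots> = g (J (dird w X u)) v"
      using gJ[of "dird w X u" "J v"] dw[of X u "J v"] gJ[of "J (dird w X u)" v] by (simp add: bilinear_minus[OF bil])
    finally show "g (dird w X (J u)) v = g (J (dird w X u)) v" .
  qed
  then have "w \<in> hol_poly_fields J n" using hpw by (simp add: hol_poly_fields_def)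
  moreover have "g (w X) X = \<eta> X" for X by (simp only: gw DX Re_e)
  ultimately show ?thesis by blast
qed

lemma closure_inverse_works:
  assumes "\<And>n. bideg some1 n (\<eta> n)"
  shows "closure_inverse g J \<eta> n \<in> hol_poly_fields J n"
    and "2 \<le> n \<Longrightarrow> g (closure_inverse g J \<eta> n X) X = \<eta> (Suc n) X"
proof -
  let ?f = "\<lambda>w X. g (w X) X" and ?H = "hol_poly_fields J n"
  have *: "the_inv_into ?H ?f (\<eta> (Suc n)) \<in> ?H \<and> ?f (the_inv_into ?H ?f (\<eta> (Suc n))) = \<eta> (Suc n)" if n: "2 \<le> n"
  proof -
    have inj: "inj_on ?f ?H"
      by (rule inj_onI) (meson closure_inj n fun_cong)
    obtain w where w: "w \<in> ?H" "\<forall>X. g (w X) X = \<eta> (Suc n) X" using closure_surj[OF assms[of "Suc n"] n] by blast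
    have eq: "\<eta> (Suc n) = ?f w" by (rule ext) (simp add: w(2))
    have "the_inv_into ?H ?f (?f w) = w" by (rule the_inv_into_f_f[OF inj w(1)])
    then show ?thesis unfolding eq using w(1) by simp
  qed
  show "closure_inverse g J \<eta> n \<in> ?H"
    using * hol_zero by (simp add: closure_inverse_def)
  show "g (closure_inverse g J \<eta> n X) X = \<eta> (Suc n) X" if "2 \<le> n"
    using *[OF that] that by (simp add: closure_inverse_def fun_eq_iff)
qed

lemma bideg_empty:
  assumes f: "bideg P n f" and P: "\<And>a b. a + b = n \<Longrightarrow> \<not> P a b"
  shows "f X = 0"
proof -
  have "bideg_proj P n f X = 0" by (rule bideg_proj_disjoint[OF f]) (erule P)
  then show ?thesis using bideg_proj_id[OF f, of X] by simp
qed

lemma bideg_contract: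
  assumes "bideg P (Suc n) (\<eta> (Suc n))" "sym_bidegrees Q"
    "\<And>a b. a + b = n \<Longrightarrow> P (Suc a) b \<Longrightarrow> Q a b" "\<And>a b. a + b = n \<Longrightarrow> P a (Suc b) \<Longrightarrow> Q a b"
  shows "bideg Q n (contract Z \<eta> n)"
proof -
  have "bideg Q (n + 0) (\<lambda>X. dird (\<eta> (Suc n)) X Z)"
    by (rule bideg_dird_field[OF assms(1) hol_const assms(2)]) (use assms(3,4) in auto)
  moreover have "contract Z \<eta> n = (\<lambda>X. dird (\<eta> (Suc n)) X Z)"
    by (rule ext) (simp add: contract_def)
  ultimately show ?thesis by simp
qed

section \<open>The critical part and the vector field that it determines\<close>

context
  fixes F :: "('a, real) formal_series"
  assumes F: "\<And>n. bideg ge22 n (F n)"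
begin

text \<open>With \<open>F\<close> the series \<open>\<theta>free\<close> of the theorem, these three
  are its \<open>\<theta>crit\<close>, \<open>pr1\<close> and \<open>V\<close>.\<close>

definition crit :: "('a, real) formal_series" where "crit n = bideg_proj critical n (F n)"
definition dcrit1 :: "'a \<Rightarrow> ('a, real) formal_series" where "dcrit1 Z n = bideg_proj some1 n (contract Z crit n)"
definition closure_field :: "'a \<Rightarrow> ('a, 'a) formal_series" where "closure_field Z = closure_inverse g J (dcrit1 Z)"

lemma bideg_crit: "bideg critical n (crit n)"
  unfolding crit_def by (rule bideg_prj[OF sym_critical bideg_hom_poly[OF F]])

lemma bideg_contract_crit: "bideg (\<lambda>a b. some1 a b \<or> ge22 a b) n (contract Z crit n)"
  by (rule bideg_contract[where \<eta>=crit and P=critical, OF bideg_crit]) (auto simp: sym_bidegrees_def some1_def ge22_def critical_def)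

lemma contract_crit_split: "contract Z crit n X = dcrit1 Z n X + bideg_proj ge22 n (contract Z crit n) X"
  unfolding dcrit1_def by (rule bideg_proj_split[OF bideg_contract_crit]) (auto simp: some1_def ge22_def)

lemma bideg_dcrit1: "bideg some1 n (dcrit1 Z n)"
  unfolding dcrit1_def by (rule bideg_prj[OF sym_some1 bideg_hom_poly[OF bideg_contract_crit]])

lemma closure_field_hol: "closure_field Z n \<in> hol_poly_fields J n"
  unfolding closure_field_def by (rule closure_inverse_works(1)[OF bideg_dcrit1])

lemma closure_field_closure: "2 \<le> n \<Longrightarrow> g (closure_field Z n X) X = dcrit1 Z (Suc n) X"
  unfolding closure_field_def by (rule closure_inverse_works(2)[OF bideg_dcrit1])

lemma closure_field_low: "n < 2 \<Longrightarrow> closure_field Z n X = 0"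
  by (simp add: closure_field_def closure_inverse_def)

text \<open>Critical components start in degree 4, so their contraction starts in degree 3. This
  makes the value 0 that \<open>closure_inverse\<close> takes in low degrees the right one.\<close>

lemma dcrit1_low: "n < 3 \<Longrightarrow> dcrit1 Z n X = 0"
proof -
  assume "n < 3"
  then have "crit (Suc n) = (\<lambda>_. 0)"
    by (intro ext bideg_empty[OF bideg_crit]) (auto simp: critical_def)
  then have "contract Z crit n = (\<lambda>_. 0)" by (rule_tac ext) (simp add: contract_def)
  then show "dcrit1 Z n X = 0" using bideg_proj_id[OF bideg_zero] by (simp add: dcrit1_def)
qed

lemma closure_series_field: "closure_series g (closure_field Z) = dcrit1 Z"
proof (intro ext)
  fix n X
  show "closure_series g (closure_field Z) n X = dcrit1 Z n X"
  proof (cases "n < 3")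
    case True
    then show ?thesis
      by (cases n) (simp_all add: closure_series_def dcrit1_low closure_field_low bilinear_lzero[OF bil])
  next
    case False
    then obtain m where "n = Suc m" "2 \<le> m" by (cases n) auto
    then show ?thesis by (simp add: closure_series_def closure_field_closure)
  qed
qed

text \<open>A component with both degrees at least 3 keeps both at least 2 after one derivative, so
  only the critical part can reach bidegree 1. Hence the contraction of the whole free part may be
  used in place of that of its critical part.\<close>

lemma bideg_proj_some1_contract: "bideg_proj some1 n (contract Z F n) X = dcrit1 Z n X"
proof -
  define ge33 where "ge33 = (\<lambda>(a::nat) (b::nat). 3 \<le> a \<and> 3 \<le> b)"
  have s33: "sym_bidegrees ge33" by (auto simp: sym_bidegrees_def ge33_def)
  define R where "R n = bideg_proj ge33 n (F n)" for n
  have R: "bideg ge33 n (R n)" for n unfolding R_def by (rule bideg_prj[OF s33 bideg_hom_poly[OF F]])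
  have F_eq: "F n = (\<lambda>X. crit n X + R n X)" for n
  proof
    fix X show "F n X = crit n X + R n X"
      unfolding crit_def R_def
      by (rule bideg_proj_split[OF bideg_mono[OF F]]) (auto simp: critical_def ge22_def ge33_def)
  qed
  have cR: "bideg ge22 n (contract Z R n)"
    by (rule bideg_contract[where \<eta>=R and P=ge33, OF R sym_ge22]) (auto simp: ge22_def ge33_def)
  have "contract Z F n = (\<lambda>X. contract Z crit n X + contract Z R n X)"
    using hom_poly_differentiable[OF bideg_hom_poly[OF bideg_crit]] hom_poly_differentiable[OF bideg_hom_poly[OF R]]
    by (rule_tac ext) (simp add: contract_def F_eq[of "Suc n"] dird_add)
  then have "bideg_proj some1 n (contract Z F n) X = bideg_proj some1 n (contract Z crit n) X + bideg_proj some1 n (contract Z R n) X"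
    using bideg_proj_add[OF bideg_hom_poly[OF bideg_contract_crit] bideg_hom_poly[OF cR]] by simp
  also have "bideg_proj some1 n (contract Z R n) X = 0"
    by (rule bideg_proj_disjoint[OF cR]) (auto simp: some1_def ge22_def)
  finally show ?thesis by (simp add: dcrit1_def)
qed

lemma contract_linear: "linear (\<lambda>Z. contract Z F n X)"
  unfolding contract_def by (rule linear_dird[OF hom_poly_differentiable[OF bideg_hom_poly[OF F]]])

lemma hom_poly_contract: "hom_poly n (contract Z F n)"
proof -
  have "contract Z F n = (\<lambda>X. dird (F (Suc n)) X Z)" by (rule ext) (simp add: contract_def)
  then show ?thesis using hom_poly_dird[OF bideg_hom_poly[OF F]] by simp
qed

text \<open>Linearity of the contraction passes through the inverse of the closure by injectivity.
  It is required because the field will be a derivative in the direction \<open>Z\<close>.\<close>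

lemma closure_field_linear: "linear (\<lambda>Z. closure_field Z n X)"
proof (cases "n < 2")
  case True
  then show ?thesis by (simp add: closure_field_low linear_zero)
next
  case False
  then have n: "2 \<le> n" by simp
  have e: "dcrit1 Z m = bideg_proj some1 m (contract Z F m)" for Z m by (rule ext) (simp add: bideg_proj_some1_contract)
  show ?thesis
  proof (rule linearI)
    fix Y Z
    have "closure_field (Y + Z) n = (\<lambda>X. closure_field Y n X + closure_field Z n X)"
    proof (rule closure_inj[OF closure_field_hol hol_add[OF closure_field_hol closure_field_hol] n])
      fix X
      have "contract (Y + Z) F (Suc n) = (\<lambda>X. contract Y F (Suc n) X + contract Z F (Suc n) X)"
        using linear_add[OF contract_linear] by auto
      then have "dcrit1 (Y + Z) (Suc n) X = dcrit1 Y (Suc n) X + dcrit1 Z (Suc n) X"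
        by (simp add: e bideg_proj_add hom_poly_contract)
      then show "g (closure_field (Y + Z) n X) X = g (closure_field Y n X + closure_field Z n X) X"
        by (simp add: closure_field_closure[OF n] bilinear_ladd[OF bil])
    qed
    then show "closure_field (Y + Z) n X = closure_field Y n X + closure_field Z n X" by simp
  next
    fix c Z
    have "closure_field (c *\<^sub>R Z) n = (\<lambda>X. c *\<^sub>R closure_field Z n X)"
    proof (rule closure_inj[OF closure_field_hol hol_scale[OF closure_field_hol] n])
      fix X
      have "contract (c *\<^sub>R Z) F (Suc n) = (\<lambda>X. c * contract Z F (Suc n) X)"
        using linear_scale[OF contract_linear] by auto
      then have "dcrit1 (c *\<^sub>R Z) (Suc n) X = c * dcrit1 Z (Suc n) X"
        by (simp add: e bideg_proj_scale hom_poly_contract)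
      then show "g (closure_field (c *\<^sub>R Z) n X) X = g (c *\<^sub>R closure_field Z n X) X"
        by (simp add: closure_field_closure[OF n] bilinear_lmul[OF bil])
    qed
    then show "closure_field (c *\<^sub>R Z) n X = c *\<^sub>R closure_field Z n X" by simp
  qed
qed

end

end

section \<open>Taylor coefficients of compositions\<close>

lemma smooth_at_dird_curve:
  fixes F :: "'a::euclidean_space \<Rightarrow> 'b::real_normed_vector"
  assumes "smooth_at (c 0) F" "smooth_at (0::real) c"
  shows "smooth_at 0 (\<lambda>t. dird F (c t) v)"
  by (rule smooth_at_compose[where f="\<lambda>y. dird F y v"]) (use assms in \<open>auto intro: smooth_at_dird\<close>)

lemma tc_dird_expansion:
  fixes F :: "'a::euclidean_space \<Rightarrow> 'b::real_normed_vector"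
  assumes "smooth_at (c 0) F" "smooth_at (0::real) c"
  shows "tc m (\<lambda>t. dird F (c t) v) = (\<Sum>i\<in>Basis. (v \<bullet> i) *\<^sub>R tc m (\<lambda>t. dird F (c t) i))"
proof -
  have "tc m (\<lambda>t. dird F (c t) v) = tc m (\<lambda>t. \<Sum>i\<in>Basis. (v \<bullet> i) *\<^sub>R dird F (c t) i)"
  proof (rule tc_cong)
    show "\<forall>\<^sub>F t in nhds 0. dird F (c t) v = (\<Sum>i\<in>Basis. (v \<bullet> i) *\<^sub>R dird F (c t) i)"
      using smooth_at_compose_eventually[OF assms(2) smooth_at_eventually[OF assms(1)]]
      by eventually_elim (intro dird_basis_expansion smooth_at_differentiable)
  qed
  then show ?thesis
    by (simp add: tc_sum tc_bounded_linear[OF bounded_linear_scaleR_right] smooth_at_dird_curve[OF assms]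
      smooth_at_bounded_linear[OF bounded_linear_scaleR_right])
qed

lemma tc_dird_commute:
  fixes F :: "'a::euclidean_space \<Rightarrow> 'b::real_normed_vector"
  assumes "smooth_at (c 0) F" "smooth_at (0::real) c"
  shows "tc m (\<lambda>t. dird (\<lambda>y. dird F y u) (c t) v) = tc m (\<lambda>t. dird (\<lambda>y. dird F y v) (c t) u)"
proof (rule tc_cong)
  show "\<forall>\<^sub>F t in nhds 0. dird (\<lambda>y. dird F y u) (c t) v = dird (\<lambda>y. dird F y v) (c t) u"
    using smooth_at_compose_eventually[OF assms(2) smooth_at_eventually[OF assms(1)]]
    by eventually_elim (rule smooth_at_dird_commute)
qed

text \<open>Only the coefficients of \<open>c x\<close> of order at most \<open>n\<close>, each for
  itself, are assumed differentiable at \<open>x0\<close>; there is no smoothness in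
  \<open>x\<close> and \<open>t\<close> jointly. Nevertheless the derivative is the one obtained by
  differentiating under the coefficient. The recursion \<open>tc_compose_Suc\<close> reduces this to
  lower order.\<close>

lemma tc_compose_has_derivative:
  fixes F :: "'a::euclidean_space \<Rightarrow> 'b::real_normed_vector" and c :: "'x::real_normed_vector \<Rightarrow> real \<Rightarrow> 'a"
  assumes N: "open N" "x0 \<in> N" and c: "\<And>x. x \<in> N \<Longrightarrow> smooth_at 0 (c x)" and F: "\<And>x. x \<in> N \<Longrightarrow> smooth_at (c x 0) F"
    and d: "\<And>k. k \<le> n \<Longrightarrow> ((\<lambda>x. tc k (c x)) has_derivative d k) (at x0)"
  shows "((\<lambda>x. tc n (\<lambda>t. F (c x t))) has_derivative (\<lambda>Z. \<Sum>k\<le>n. tc (n - k) (\<lambda>t. dird F (c x0 t) (d k Z)))) (at x0)"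
  using F d
proof (induction n arbitrary: F rule: less_induct)
  case (less n)
  have F0: "smooth_at (c x0 0) F" and c0: "smooth_at 0 (c x0)" using less.prems(1) c N by auto
  show ?case
  proof (cases n)
    case 0
    have "((\<lambda>x. c x 0) has_derivative d 0) (at x0)" using less.prems(2)[of 0] by simp
    from has_derivative_compose[OF this] smooth_at_has_derivative[OF F0] 0 show ?thesis by simp
  next
    case (Suc m)
    define T where "T i j = tc j (\<lambda>t. dird F (c x0 t) i)" for i j
    define q where "q i j = tc j (c x0) \<bullet> i" for i j
    define r where "r = (\<lambda>j k v i. tc j (\<lambda>t. dird (\<lambda>y. dird F y v) (c x0 t) i))"
    define IHd where "IHd i j Z = (\<Sum>k\<le>j. tc (j - k) (\<lambda>t. dird (\<lambda>y. dird F y i) (c x0 t) (d k Z)))" for i j Z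
    have IH: "((\<lambda>x. tc j (\<lambda>t. dird F (c x t) i)) has_derivative IHd i j) (at x0)" if "j \<le> m" for i j
      unfolding IHd_def[abs_def]
      by (rule less.IH[where F="\<lambda>y. dird F y i"]) (use that Suc less.prems in \<open>auto intro: smooth_at_dird\<close>)
    have ev: "\<forall>\<^sub>F x in nhds x0. x \<in> N" using N by (rule eventually_nhds_in_open)
    have dq: "((\<lambda>x. real (n - j) * (tc (n - j) (c x) \<bullet> i)) has_derivative (\<lambda>Z. real (n - j) * (d (n - j) Z \<bullet> i))) (at x0)" for i j
      by (intro has_derivative_mult_right has_derivative_inner_left less.prems(2)) simp
    have "((\<lambda>x. \<Sum>i\<in>Basis. \<Sum>j\<le>m. (real (n - j) * (tc (n - j) (c x) \<bullet> i)) *\<^sub>R tc j (\<lambda>t. dird F (c x t) i)) has_derivative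
       (\<lambda>Z. \<Sum>i\<in>Basis. \<Sum>j\<le>m. (real (n - j) * q i (n - j)) *\<^sub>R IHd i j Z + (real (n - j) * (d (n - j) Z \<bullet> i)) *\<^sub>R T i j)) (at x0)"
      unfolding q_def T_def by (intro has_derivative_sum has_derivative_scaleR dq IH) auto
    then have "((\<lambda>x. real n *\<^sub>R tc n (\<lambda>t. F (c x t))) has_derivative
       (\<lambda>Z. \<Sum>i\<in>Basis. \<Sum>j\<le>m. (real (n - j) * q i (n - j)) *\<^sub>R IHd i j Z + (real (n - j) * (d (n - j) Z \<bullet> i)) *\<^sub>R T i j)) (at x0)"
    proof (rule has_derivative_cong_nhds, use ev in eventually_elim)
      case (elim x)
      show ?case unfolding Suc using tc_compose_Suc[OF less.prems(1) c, OF elim elim, of m] by simp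
    qed
    from has_derivative_scaleR_right[OF this, of "1 / real n"]
    have main: "((\<lambda>x. tc n (\<lambda>t. F (c x t))) has_derivative
       (\<lambda>Z. (1 / real n) *\<^sub>R (\<Sum>i\<in>Basis. \<Sum>j\<le>m. (real (n - j) * q i (n - j)) *\<^sub>R IHd i j Z + (real (n - j) * (d (n - j) Z \<bullet> i)) *\<^sub>R T i j))) (at x0)"
      using Suc by (simp del: of_nat_Suc)
    \<comment> \<open>The contributions are sorted by the varied coefficient \<open>d k Z\<close>:
      varying the partial derivatives of \<open>F\<close> along the curve gives
      \<open>(n - k) G k\<close>, varying the coefficients of the curve gives
      \<open>k G k\<close>.\<close>
    have "(\<Sum>i\<in>Basis. \<Sum>j\<le>m. (real (n - j) * q i (n - j)) *\<^sub>R IHd i j Z + (real (n - j) * (d (n - j) Z \<bullet> i)) *\<^sub>R T i j)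
        = real n *\<^sub>R (\<Sum>k\<le>n. tc (n - k) (\<lambda>t. dird F (c x0 t) (d k Z)))" for Z
    proof -
      define v where "v k = d k Z" for k
      define G where "G k = tc (n - k) (\<lambda>t. dird F (c x0 t) (v k))" for k
      have sG: "smooth_at (c x0 0) (\<lambda>y. dird F y (v k))" for k by (rule smooth_at_dird[OF F0])
      have 1: "real (n - k) *\<^sub>R G k = (\<Sum>i\<in>Basis. \<Sum>j\<le>m - k. (real (n - k - j) * q i (n - k - j)) *\<^sub>R tc j (\<lambda>t. dird (\<lambda>y. dird F y i) (c x0 t) (v k)))"
        if "k \<le> m" for k
      proof -
        have nk: "n - k = Suc (m - k)" using that Suc by simp
        show ?thesis
          unfolding G_def nk tc_compose_Suc[where F="\<lambda>y. dird F y (v k)", OF sG c0] q_def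
          by (intro sum.cong[OF refl]) (simp add: tc_dird_commute[OF F0 c0, of _ "v k"])
      qed
      have "(\<Sum>i\<in>Basis. \<Sum>j\<le>m. (real (n - j) * q i (n - j)) *\<^sub>R IHd i j Z) = (\<Sum>k\<le>m. real (n - k) *\<^sub>R G k)"
      proof -
        define S where "S i k j = (real (n - k - j) * q i (n - k - j)) *\<^sub>R tc j (\<lambda>t. dird (\<lambda>y. dird F y i) (c x0 t) (v k))" for i k j
        have "(\<Sum>i\<in>Basis. \<Sum>j\<le>m. (real (n - j) * q i (n - j)) *\<^sub>R IHd i j Z) = (\<Sum>i\<in>Basis. \<Sum>j\<le>m. \<Sum>k\<le>j. S i k (j - k))"
          unfolding IHd_def scaleR_sum_right S_def v_def by (intro sum.cong[OF refl]) auto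
        also have "\<dots> = (\<Sum>i\<in>Basis. \<Sum>k\<le>m. \<Sum>j\<le>m - k. S i k j)"
        proof (rule sum.cong[OF refl])
          fix i
          show "(\<Sum>j\<le>m. \<Sum>k\<le>j. S i k (j - k)) = (\<Sum>k\<le>m. \<Sum>j\<le>m - k. S i k j)"
            unfolding sum.Sigma[OF finite_atMost ballI[OF finite_atMost]]
            by (rule sum.reindex_bij_witness[of _ "\<lambda>(k, j). (j + k, k)" "\<lambda>(j, k). (k, j - k)"]) auto
        qed
        also have "\<dots> = (\<Sum>k\<le>m. \<Sum>i\<in>Basis. \<Sum>j\<le>m - k. S i k j)" by (rule sum.swap)
        also have "\<dots> = (\<Sum>k\<le>m. real (n - k) *\<^sub>R G k)"
          by (intro sum.cong[OF refl]) (simp add: 1 S_def)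
        finally show ?thesis .
      qed
      moreover have "(\<Sum>k\<le>m. real (n - k) *\<^sub>R G k) = (\<Sum>k\<le>n. real (n - k) *\<^sub>R G k)"
        by (simp add: Suc)
      moreover have "(\<Sum>i\<in>Basis. \<Sum>j\<le>m. (real (n - j) * (d (n - j) Z \<bullet> i)) *\<^sub>R T i j) = (\<Sum>k\<le>n. real k *\<^sub>R G k)"
      proof -
        have "(\<Sum>k\<le>n. real k *\<^sub>R G k) = (\<Sum>k\<in>{1..n}. real k *\<^sub>R G k)"
          by (rule sum.mono_neutral_right) auto
        also have "\<dots> = (\<Sum>j\<le>m. real (n - j) *\<^sub>R G (n - j))"
          by (rule sum.reindex_bij_witness[of _ "\<lambda>j. n - j" "\<lambda>k. n - k"]) (use Suc in auto)
        also have "\<dots> = (\<Sum>j\<le>m. \<Sum>i\<in>Basis. (real (n - j) * (d (n - j) Z \<bullet> i)) *\<^sub>R T i j)"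
        proof (rule sum.cong[OF refl])
          fix j assume "j \<in> {..m}"
          then have "n - (n - j) = j" using Suc by auto
          then have "G (n - j) = tc j (\<lambda>t. dird F (c x0 t) (v (n - j)))" by (simp add: G_def)
          also have "\<dots> = (\<Sum>i\<in>Basis. (v (n - j) \<bullet> i) *\<^sub>R T i j)"
            unfolding T_def by (rule tc_dird_expansion[OF F0 c0])
          finally show "real (n - j) *\<^sub>R G (n - j) = (\<Sum>i\<in>Basis. (real (n - j) * (d (n - j) Z \<bullet> i)) *\<^sub>R T i j)"
            by (simp add: scaleR_sum_right v_def)
        qed
        also have "\<dots> = (\<Sum>i\<in>Basis. \<Sum>j\<le>m. (real (n - j) * (d (n - j) Z \<bullet> i)) *\<^sub>R T i j)" by (rule sum.swap)
        finally show ?thesis by simp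
      qed
      moreover have "(\<Sum>k\<le>n. real (n - k) *\<^sub>R G k) + (\<Sum>k\<le>n. real k *\<^sub>R G k) = real n *\<^sub>R (\<Sum>k\<le>n. G k)"
        unfolding sum.distrib[symmetric] scaleR_sum_right
        by (intro sum.cong[OF refl]) (simp add: scaleR_add_left[symmetric] of_nat_diff)
      ultimately show ?thesis unfolding sum.distrib G_def v_def by simp
    qed
    with main show ?thesis using Suc by (simp del: of_nat_Suc)
  qed
qed

lemma tc_compose_agree:
  fixes F :: "'a::euclidean_space \<Rightarrow> 'b::real_normed_vector"
  assumes c: "smooth_at (0::real) c" "smooth_at 0 c'" and F: "smooth_at (c 0) F"
    and eq: "\<And>k. k \<le> n \<Longrightarrow> tc k c = tc k c'"
  shows "tc n (\<lambda>t. F (c t)) = tc n (\<lambda>t. F (c' t))"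
  using F eq
proof (induction n arbitrary: F rule: less_induct)
  case (less n)
  have c0: "c 0 = c' 0" using less.prems(2)[of 0] by simp
  show ?case
  proof (cases n)
    case 0
    then show ?thesis by (simp add: c0)
  next
    case (Suc m)
    have "tc j (\<lambda>t. dird F (c t) i) = tc j (\<lambda>t. dird F (c' t) i)" if "j \<le> m" for i j
      by (rule less.IH[where F="\<lambda>y. dird F y i"]) (use that Suc less.prems in \<open>auto intro: smooth_at_dird\<close>)
    then have "real n *\<^sub>R tc n (\<lambda>t. F (c t)) = real n *\<^sub>R tc n (\<lambda>t. F (c' t))"
      unfolding Suc tc_compose_Suc[OF less.prems(1) c(1)] tc_compose_Suc[OF less.prems(1)[unfolded c0] c(2)]
      using less.prems(2) Suc by (intro sum.cong[OF refl]) auto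
    then show ?thesis using Suc by (simp del: of_nat_Suc)
  qed
qed

text \<open>In the recursion the coefficient of order \<open>n\<close> occurs only in the terms with
  \<open>j = 0\<close>, linearly and multiplied by first derivatives of \<open>F\<close> at
  \<open>c 0\<close>; all other terms agree.\<close>

lemma tc_compose_agree_below:
  fixes F :: "'a::euclidean_space \<Rightarrow> 'b::real_normed_vector"
  assumes c: "smooth_at (0::real) c" "smooth_at 0 c'" and F: "smooth_at (c 0) F"
    and eq: "\<And>k. k < n \<Longrightarrow> tc k c = tc k c'" and n: "0 < n"
  shows "tc n (\<lambda>t. F (c t)) = tc n (\<lambda>t. F (c' t)) + dird F (c 0) (tc n c - tc n c')"
proof -
  have c0: "c 0 = c' 0" using eq[of 0] n by simp
  obtain m where m: "n = Suc m" using n by (cases n) auto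
  have ag: "tc j (\<lambda>t. dird F (c t) i) = tc j (\<lambda>t. dird F (c' t) i)" if "j \<le> m" for i j
    by (rule tc_compose_agree[where F="\<lambda>y. dird F y i", OF c]) (use that m F eq in \<open>auto intro: smooth_at_dird\<close>)
  have "real n *\<^sub>R tc n (\<lambda>t. F (c t)) - real n *\<^sub>R tc n (\<lambda>t. F (c' t)) =
    (\<Sum>i\<in>Basis. \<Sum>j\<le>m. (real (n - j) * ((tc (n - j) c - tc (n - j) c') \<bullet> i)) *\<^sub>R tc j (\<lambda>t. dird F (c t) i))"
    unfolding m tc_compose_Suc[OF F c(1)] tc_compose_Suc[OF F[unfolded c0] c(2)] sum_subtractf[symmetric]
    by (intro sum.cong[OF refl]) (simp add: ag algebra_simps)
  also have "\<dots> = (\<Sum>i\<in>Basis. \<Sum>j\<in>{0}. (real (n - j) * ((tc (n - j) c - tc (n - j) c') \<bullet> i)) *\<^sub>R tc j (\<lambda>t. dird F (c t) i))"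
    by (intro sum.cong[OF refl] sum.mono_neutral_right) (use eq m in auto)
  also have "\<dots> = real n *\<^sub>R dird F (c 0) (tc n c - tc n c')"
    using dird_basis_expansion[OF smooth_at_differentiable[OF F], of "tc n c - tc n c'"] by (simp add: scaleR_sum_right)
  finally have "real n *\<^sub>R tc n (\<lambda>t. F (c t)) = real n *\<^sub>R (tc n (\<lambda>t. F (c' t)) + dird F (c 0) (tc n c - tc n c'))"
    by (simp add: algebra_simps)
  then show ?thesis using n by simp
qed

lemma tc_1_compose:
  fixes F :: "'a::euclidean_space \<Rightarrow> 'b::real_normed_vector"
  assumes "smooth_at (0::real) c" "smooth_at (c 0) F"
  shows "tc 1 (\<lambda>t. F (c t)) = dird F (c 0) (tc 1 c)"
  using tc_compose_agree_below[OF assms(1) smooth_at_const assms(2), of 1 "c 0"] by (simp add: tc_const)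

lemma dird_dird_basis:
  fixes F :: "'a::euclidean_space \<Rightarrow> 'b::real_normed_vector"
  assumes "smooth_at x F"
  shows "(\<Sum>i\<in>Basis. (v \<bullet> i) *\<^sub>R dird (\<lambda>y. dird F y i) x u) = dird (\<lambda>y. dird F y v) x u"
proof -
  have "(\<Sum>i\<in>Basis. (v \<bullet> i) *\<^sub>R dird (\<lambda>y. dird F y u) x i) = dird (\<lambda>y. dird F y u) x v"
    by (rule dird_basis_expansion[symmetric]) (rule smooth_at_differentiable[OF smooth_at_dird[OF assms]])
  then show ?thesis by (simp only: smooth_at_dird_commute[OF assms, of u])
qed

text \<open>Separates the two top coefficients of \<open>c\<close>, about which nothing is known yet when the normal
  coordinates are determined degree by degree.\<close>

lemma tc_compose_agree_below2:
  fixes F :: "'a::euclidean_space \<Rightarrow> 'b::real_normed_vector"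
  assumes c: "smooth_at (0::real) c" "smooth_at 0 c'" and F: "smooth_at (c 0) F"
    and eq: "\<And>k. k < b \<Longrightarrow> tc k c = tc k c'" and b: "2 \<le> b"
  shows "tc (Suc b) (\<lambda>t. F (c t)) = tc (Suc b) (\<lambda>t. F (c' t)) + dird F (c 0) (tc (Suc b) c - tc (Suc b) c')
    + dird (\<lambda>y. dird F y (tc 1 c)) (c 0) (tc b c - tc b c')"
proof -
  define \<Delta> where "\<Delta> k = tc k c - tc k c'" for k
  have c0: "c 0 = c' 0" using eq[of 0] b by simp
  have sFi: "smooth_at (c 0) (\<lambda>y. dird F y i)" for i by (rule smooth_at_dird[OF F])
  have ag: "tc j (\<lambda>t. dird F (c t) i) = tc j (\<lambda>t. dird F (c' t) i)" if "j < b" for i j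
    by (rule tc_compose_agree[where F="\<lambda>y. dird F y i", OF c sFi]) (use that eq in auto)
  have agb: "tc b (\<lambda>t. dird F (c t) i) = tc b (\<lambda>t. dird F (c' t) i) + dird (\<lambda>y. dird F y i) (c 0) (\<Delta> b)" for i
    unfolding \<Delta>_def by (rule tc_compose_agree_below[where F="\<lambda>y. dird F y i", OF c sFi]) (use eq b in auto)
  have t1: "tc 1 (\<lambda>t. dird F (c t) i) = dird (\<lambda>y. dird F y i) (c 0) (tc 1 c)" for i
    by (rule tc_1_compose[where F="\<lambda>y. dird F y i", OF c(1) sFi])
  let ?n = "Suc b"
  \<comment> \<open>The surviving differences: \<open>j = 0\<close> carries the one of order
    \<open>Suc b\<close>; the one of order \<open>b\<close> appears with \<open>j = 1\<close> as a
    coefficient of the curve and with \<open>j = b\<close> inside a derivative of \<open>F\<close>.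
    These cases are distinct since \<open>2 \<le> b\<close>. By symmetry of second derivatives the
    last two combine with total weight \<open>b + 1\<close>.\<close>
  define S where "S i j = (if j = 0 then (real ?n * (\<Delta> ?n \<bullet> i)) *\<^sub>R dird F (c 0) i
      else if j = 1 then (real b * (\<Delta> b \<bullet> i)) *\<^sub>R dird (\<lambda>y. dird F y i) (c 0) (tc 1 c)
      else if j = b then (tc 1 c \<bullet> i) *\<^sub>R dird (\<lambda>y. dird F y i) (c 0) (\<Delta> b) else 0)" for i j
  have "real ?n *\<^sub>R tc ?n (\<lambda>t. F (c t)) - real ?n *\<^sub>R tc ?n (\<lambda>t. F (c' t)) = (\<Sum>i\<in>Basis. \<Sum>j\<le>b. S i j)"
    unfolding tc_compose_Suc[OF F c(1)] tc_compose_Suc[OF F[unfolded c0] c(2)] sum_subtractf[symmetric]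
  proof (intro sum.cong[OF refl])
    fix i :: 'a and j assume "j \<in> {..b}"
    then consider "j = 0" | "j = 1" | "j = b" "j \<noteq> 0" "j \<noteq> 1" | "j \<noteq> 0" "j \<noteq> 1" "j < b" by fastforce
    then show "(real (?n - j) * (tc (?n - j) c \<bullet> i)) *\<^sub>R tc j (\<lambda>t. dird F (c t) i) -
      (real (?n - j) * (tc (?n - j) c' \<bullet> i)) *\<^sub>R tc j (\<lambda>t. dird F (c' t) i) = S i j"
    proof cases
      case 1
      then show ?thesis by (simp add: S_def \<Delta>_def c0 algebra_simps)
    next
      case 2
      have "tc 1 (\<lambda>t. dird F (c' t) i) = dird (\<lambda>y. dird F y i) (c 0) (tc 1 c)"
        using ag[of 1 i] t1 b by simp
      then show ?thesis using 2 t1[of i] by (simp add: S_def \<Delta>_def algebra_simps)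
    next
      case 3
      have "tc 1 c' = tc 1 c" using eq[of 1] b by simp
      then show ?thesis using 3 agb[of i] by (simp add: S_def algebra_simps)
    next
      case 4
      then have "tc (?n - j) c = tc (?n - j) c'" by (intro eq) auto
      then show ?thesis using 4 ag[of j i] by (simp add: S_def)
    qed
  qed
  also have "\<dots> = (\<Sum>i\<in>Basis. \<Sum>j\<in>{0, 1, b}. S i j)"
    by (intro sum.cong[OF refl] sum.mono_neutral_right) (use b in \<open>auto simp: S_def\<close>)
  also have "\<dots> = (\<Sum>i\<in>Basis. S i 0 + S i 1 + S i b)"
    using b by (intro sum.cong[OF refl]) simp
  also have "\<dots> = (\<Sum>i\<in>Basis. real ?n *\<^sub>R ((\<Delta> ?n \<bullet> i) *\<^sub>R dird F (c 0) i)) +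
     (\<Sum>i\<in>Basis. real b *\<^sub>R ((\<Delta> b \<bullet> i) *\<^sub>R dird (\<lambda>y. dird F y i) (c 0) (tc 1 c))) +
     (\<Sum>i\<in>Basis. (tc 1 c \<bullet> i) *\<^sub>R dird (\<lambda>y. dird F y i) (c 0) (\<Delta> b))"
    using b by (simp add: S_def sum.distrib)
  also have "\<dots> = real ?n *\<^sub>R dird F (c 0) (\<Delta> ?n) + real b *\<^sub>R dird (\<lambda>y. dird F y (\<Delta> b)) (c 0) (tc 1 c)
     + dird (\<lambda>y. dird F y (tc 1 c)) (c 0) (\<Delta> b)"
    unfolding scaleR_sum_right[symmetric] dird_dird_basis[OF F]
    by (simp only: dird_basis_expansion[OF smooth_at_differentiable[OF F], symmetric])
  also have "\<dots> = real ?n *\<^sub>R (dird F (c 0) (\<Delta> ?n) + dird (\<lambda>y. dird F y (tc 1 c)) (c 0) (\<Delta> b))"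
    by (simp add: smooth_at_dird_commute[OF F, of "\<Delta> b"] algebra_simps)
  finally have "real ?n *\<^sub>R tc ?n (\<lambda>t. F (c t)) = real ?n *\<^sub>R (tc ?n (\<lambda>t. F (c' t)) +
      (dird F (c 0) (\<Delta> ?n) + dird (\<lambda>y. dird F y (tc 1 c)) (c 0) (\<Delta> b)))"
    by (simp add: algebra_simps)
  then show ?thesis by (simp add: \<Delta>_def add.assoc del: of_nat_Suc)
qed

section \<open>Families of normalized potentials\<close>

lemma has_derivative_at_0_iff:
  fixes w :: "'a::real_normed_vector \<Rightarrow> 'b::real_normed_vector"
  assumes "w 0 = 0"
  shows "(w has_derivative L) (at 0) \<longleftrightarrow> bounded_linear L \<and> ((\<lambda>x. norm (w x - L x) / norm x) \<longlongrightarrow> 0) (at 0)"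
  using assms by (simp add: has_derivative_at)

lemma bilinear_expand_left:
  fixes b :: "'a::euclidean_space \<Rightarrow> 'a \<Rightarrow> real"
  assumes "bilinear b"
  shows "b v u = (\<Sum>j\<in>Basis. (v \<bullet> j) * b j u)"
proof -
  have "linear (\<lambda>v. b v u)" using assms by (simp add: bilinear_def)
  from linear_basis_expansion[OF this, of v] show ?thesis by simp
qed

text \<open>The forms \<open>h x\<close> are merely continuous at 0. This suffices because
  \<open>w 0 = 0\<close>: replacing \<open>h x\<close> by \<open>h 0\<close> costs a small factor
  times a quantity of order \<open>norm x\<close>. Nondegeneracy of \<open>h 0\<close> gives a lower
  bound that persists for nearby \<open>x\<close> and transfers the estimate to \<open>w\<close>
  itself.\<close>

lemma metric_solve_has_derivative:
  fixes h :: "'a::euclidean_space \<Rightarrow> 'a \<Rightarrow> 'a \<Rightarrow> real" and w L :: "'a \<Rightarrow> 'a"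
  assumes h: "\<And>x. x \<in> N \<Longrightarrow> bilinear (h x)" and N: "open N" "0 \<in> N"
    and nondeg: "\<And>v. (\<And>u. h 0 v u = 0) \<Longrightarrow> v = 0"
    and cont: "\<And>u v. ((\<lambda>x. h x u v) \<longlongrightarrow> h 0 u v) (at 0)"
    and w0: "w 0 = 0" and L: "linear L"
    and w: "\<And>u. ((\<lambda>x. h x (w x) u) has_derivative (\<lambda>Z. h 0 (L Z) u)) (at 0)"
  shows "(w has_derivative L) (at 0)"
proof -
  have h0: "bilinear (h 0)" using h N by blast
  have blL: "bounded_linear L" using L linear_conv_bounded_linear by blast
  have evN: "\<forall>\<^sub>F x in at 0. x \<in> N" using N eventually_at_in_open' by blast
  define G where "G x v = (\<Sum>i\<in>Basis. h x v i *\<^sub>R i)" for x v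
  have linG: "linear (G x)" if "x \<in> N" for x
    using h[OF that] unfolding G_def by (intro linearI)
      (simp_all add: bilinear_ladd bilinear_lmul scaleR_add_left sum.distrib scaleR_sum_right)
  have "inj (G 0)"
  proof (rule linear_injective_0[OF linG[OF N(2)], THEN iffD2], intro allI impI)
    fix v assume "G 0 v = 0"
    moreover have "G 0 v \<bullet> i = h 0 v i" if "i \<in> Basis" for i
      using that by (simp add: G_def inner_sum_left inner_Basis if_distrib sum.delta cong: if_cong)
    ultimately have z: "h 0 v i = 0" if "i \<in> Basis" for i
      using that by (metis inner_zero_left)
    have "h 0 v u = 0" for u
    proof -
      have "h 0 v u = (\<Sum>i\<in>Basis. (u \<bullet> i) *\<^sub>R h 0 v i)"
        using h0 by (intro linear_basis_expansion) (simp add: bilinear_def)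
      also have "\<dots> = 0" by (simp add: z)
      finally show ?thesis .
    qed
    then show "v = 0" by (rule nondeg)
  qed
  then obtain e where e: "e > 0" "\<And>v. e * norm v \<le> norm (G 0 v)"
    using linear_inj_bounded_below_pos[OF linG[OF N(2)]] by (metis mult.commute)
  have dz: "((\<lambda>x. h x u v - h 0 u v) \<longlongrightarrow> 0) (at 0)" "((\<lambda>x. h 0 u v - h x u v) \<longlongrightarrow> 0) (at 0)" for u v
    using tendsto_diff[OF cont tendsto_const, of u v "h 0 u v"] tendsto_diff[OF tendsto_const cont, of "h 0 u v" u v] by simp_all
  define \<delta> where "\<delta> x = (\<Sum>i\<in>Basis. \<Sum>j\<in>Basis. \<bar>h x j i - h 0 j i\<bar>)" for x
  have "(\<delta> \<longlongrightarrow> (\<Sum>i\<in>(Basis::'a set). \<Sum>j\<in>(Basis::'a set). 0)) (at 0)"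
    unfolding \<delta>_def
    by (intro tendsto_sum tendsto_rabs_zero dz)
  then have "(\<delta> \<longlongrightarrow> 0) (at 0)" by simp
  then have ev\<delta>: "\<forall>\<^sub>F x in at 0. \<delta> x < e / 2"
    using e(1) by (intro order_tendstoD(2)) auto
  \<comment> \<open>Perturbing \<open>G 0\<close> costs at most half of its lower bound
    \<open>e\<close>.\<close>
  have lower: "e / 2 * norm v \<le> (\<Sum>i\<in>Basis. \<bar>h x v i\<bar>)" if "x \<in> N" "\<delta> x < e / 2" for x v
  proof -
    have hv: "h x v i - h 0 v i = (\<Sum>j\<in>Basis. (v \<bullet> j) * (h x j i - h 0 j i))" for i
    proof -
      have "h x v i = (\<Sum>j\<in>Basis. (v \<bullet> j) * h x j i)" "h 0 v i = (\<Sum>j\<in>Basis. (v \<bullet> j) * h 0 j i)"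
        by (rule bilinear_expand_left[OF h[OF that(1)]], rule bilinear_expand_left[OF h0])
      then show ?thesis by (simp add: sum_subtractf right_diff_distrib)
    qed
    have "norm (G x v - G 0 v) \<le> (\<Sum>i\<in>Basis. norm ((h x v i - h 0 v i) *\<^sub>R i))"
      unfolding G_def sum_subtractf[symmetric] scaleR_diff_left[symmetric] by (rule norm_sum)
    also have "\<dots> = (\<Sum>i\<in>Basis. \<bar>h x v i - h 0 v i\<bar>)"
      by (rule sum.cong[OF refl]) simp
    also have "\<dots> \<le> (\<Sum>i\<in>Basis. \<Sum>j\<in>Basis. norm v * \<bar>h x j i - h 0 j i\<bar>)"
      unfolding hv by (intro sum_mono order_trans[OF sum_abs])
        (auto simp: abs_mult intro!: sum_mono mult_right_mono Basis_le_norm)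
    also have "\<dots> = norm v * \<delta> x" by (simp add: \<delta>_def sum_distrib_left)
    also have "\<dots> \<le> norm v * (e / 2)" using that(2) by (intro mult_left_mono) auto
    finally have "norm (G x v - G 0 v) \<le> norm v * (e / 2)" .
    moreover have "norm (G 0 v) \<le> norm (G x v) + norm (G x v - G 0 v)"
      by (metis norm_minus_commute norm_triangle_sub)
    moreover have "norm (G x v) \<le> (\<Sum>i\<in>Basis. \<bar>h x v i\<bar>)"
      unfolding G_def by (rule order_trans[OF norm_sum]) (auto intro!: sum_mono)
    ultimately show ?thesis using e(2)[of v] by (simp add: field_simps)
  qed
  define z where "z x = w x - L x" for x
  \<comment> \<open>The remainder splits into the error of the assumed derivative and
    \<open>h 0 (L x) u - h x (L x) u\<close>, which is small against \<open>norm x\<close> since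
    \<open>L\<close> is bounded.\<close>
  have hz: "((\<lambda>x. \<bar>h x (z x) u\<bar> / norm x) \<longlongrightarrow> 0) (at 0)" for u
  proof -
    have A: "((\<lambda>x. norm (h x (w x) u - h 0 (L x) u) / norm x) \<longlongrightarrow> 0) (at 0)"
      using w[of u] bilinear_lzero[OF h0] by (simp add: has_derivative_at w0)
    have LB: "((\<lambda>x. (\<Sum>i\<in>Basis. onorm L * \<bar>h 0 i u - h x i u\<bar>)) \<longlongrightarrow> (\<Sum>i\<in>(Basis::'a set). onorm L * 0)) (at 0)"
      by (intro tendsto_sum tendsto_mult_left tendsto_rabs_zero dz)
    have "((\<lambda>x. \<bar>h 0 (L x) u - h x (L x) u\<bar> / norm x) \<longlongrightarrow> 0) (at 0)"
    proof (rule tendsto_sandwich[OF _ _ tendsto_const LB[simplified]])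
      show "\<forall>\<^sub>F x in at 0. \<bar>h 0 (L x) u - h x (L x) u\<bar> / norm x \<le> (\<Sum>i\<in>Basis. onorm L * \<bar>h 0 i u - h x i u\<bar>)"
        using evN
      proof eventually_elim
        case (elim x)
        have "h x (L x) u = (\<Sum>j\<in>Basis. (L x \<bullet> j) * h x j u)" "h 0 (L x) u = (\<Sum>j\<in>Basis. (L x \<bullet> j) * h 0 j u)"
          by (rule bilinear_expand_left[OF h[OF elim]], rule bilinear_expand_left[OF h0])
        then have "\<bar>h 0 (L x) u - h x (L x) u\<bar> = \<bar>\<Sum>j\<in>Basis. (L x \<bullet> j) * (h 0 j u - h x j u)\<bar>"
          by (simp add: sum_subtractf right_diff_distrib)
        also have "\<dots> \<le> (\<Sum>j\<in>Basis. norm (L x) * \<bar>h 0 j u - h x j u\<bar>)"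
          by (intro order_trans[OF sum_abs]) (auto simp: abs_mult intro!: sum_mono mult_right_mono Basis_le_norm)
        also have "\<dots> \<le> (\<Sum>j\<in>Basis. (onorm L * norm x) * \<bar>h 0 j u - h x j u\<bar>)"
          by (intro sum_mono mult_right_mono onorm[OF blL]) auto
        also have "\<dots> = (\<Sum>i\<in>Basis. onorm L * \<bar>h 0 i u - h x i u\<bar>) * norm x"
          unfolding sum_distrib_right by (intro sum.cong[OF refl]) simp
        finally show ?case
          by (cases "x = 0") (auto simp: field_simps intro!: sum_nonneg mult_nonneg_nonneg onorm_pos_le[OF blL])
      qed
    qed auto
    from tendsto_add[OF A this]
    have B: "((\<lambda>x. norm (h x (w x) u - h 0 (L x) u) / norm x + \<bar>h 0 (L x) u - h x (L x) u\<bar> / norm x) \<longlongrightarrow> 0) (at 0)"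
      by simp
    show ?thesis
    proof (rule tendsto_sandwich[OF _ _ tendsto_const B])
      show "\<forall>\<^sub>F x in at 0. \<bar>h x (z x) u\<bar> / norm x \<le> norm (h x (w x) u - h 0 (L x) u) / norm x + \<bar>h 0 (L x) u - h x (L x) u\<bar> / norm x"
        using evN
      proof eventually_elim
        case (elim x)
        have "h x (z x) u = (h x (w x) u - h 0 (L x) u) + (h 0 (L x) u - h x (L x) u)"
          by (simp add: z_def bilinear_lsub[OF h[OF elim]])
        then have "\<bar>h x (z x) u\<bar> \<le> norm (h x (w x) u - h 0 (L x) u) + \<bar>h 0 (L x) u - h x (L x) u\<bar>"
          by simp
        then show ?case by (simp add: add_divide_distrib[symmetric] divide_right_mono)
      qed
    qed auto
  qed
  have "((\<lambda>x. (2 / e) * (\<Sum>i\<in>Basis. \<bar>h x (z x) i\<bar> / norm x)) \<longlongrightarrow> (2 / e) * (\<Sum>i\<in>(Basis::'a set). 0)) (at 0)"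
    by (intro tendsto_mult_left tendsto_sum hz)
  then have lim: "((\<lambda>x. (2 / e) * (\<Sum>i\<in>Basis. \<bar>h x (z x) i\<bar> / norm x)) \<longlongrightarrow> 0) (at 0)" by simp
  have "((\<lambda>x. norm (z x) / norm x) \<longlongrightarrow> 0) (at 0)"
  proof (rule tendsto_sandwich[OF _ _ tendsto_const lim])
    show "\<forall>\<^sub>F x in at 0. norm (z x) / norm x \<le> (2 / e) * (\<Sum>i\<in>Basis. \<bar>h x (z x) i\<bar> / norm x)"
      using evN ev\<delta>
    proof eventually_elim
      case (elim x)
      have "norm (z x) \<le> (2 / e) * (\<Sum>i\<in>Basis. \<bar>h x (z x) i\<bar>)"
        using lower[OF elim, of "z x"] e(1) by (simp add: field_simps)
      then have "norm (z x) / norm x \<le> (2 / e) * (\<Sum>i\<in>Basis. \<bar>h x (z x) i\<bar>) / norm x"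
        by (rule divide_right_mono) simp
      then show ?case by (simp add: sum_divide_distrib[symmetric] mult.commute)
    qed
  qed auto
  then show ?thesis using blL by (simp add: has_derivative_at_0_iff[where w=w, OF w0] z_def)
qed

text \<open>\<open>pure\<close> collects the bidegrees of real parts of holomorphic polynomials,
  that is, of pluriharmonic ones; \<open>mixed\<close> is its complement.\<close>

definition pure :: "nat \<Rightarrow> nat \<Rightarrow> bool" where "pure a b \<longleftrightarrow> a = 0 \<or> b = 0"
definition mixed :: "nat \<Rightarrow> nat \<Rightarrow> bool" where "mixed a b \<longleftrightarrow> 1 \<le> a \<and> 1 \<le> b"

lemma sym_pure: "sym_bidegrees pure" and sym_mixed: "sym_bidegrees mixed"
  by (auto simp: sym_bidegrees_def pure_def mixed_def)

text \<open>For a constant complex structure \<open>J\<close>, pluriharmonicity means that this form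
  changes sign when \<open>J\<close> is applied to both arguments. It is used in this real form
  throughout.\<close>

definition hess :: "('a::euclidean_space \<Rightarrow> real) \<Rightarrow> 'a \<Rightarrow> 'a \<Rightarrow> 'a \<Rightarrow> real"
  where "hess f x u v = dird (\<lambda>y. dird f y u) x v"

lemma hess_sym: "smooth_at x f \<Longrightarrow> hess f x u v = hess f x v u"
  unfolding hess_def by (rule smooth_at_dird_commute)

lemma hess_bilinear:
  assumes "smooth_at x f"
  shows "bilinear (hess f x)"
proof -
  have 1: "linear (hess f x u)" for u
    unfolding hess_def[abs_def] by (rule linear_dird[OF smooth_at_differentiable[OF smooth_at_dird[OF assms]]])
  moreover have "(\<lambda>u. hess f x u v) = hess f x v" for v
    using hess_sym[OF assms] by auto
  ultimately show ?thesis by (simp add: bilinear_def)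
qed

lemma taylor_hess:
  assumes f: "smooth_at 0 f"
  shows "hess (taylor f (Suc (Suc m))) X u v = taylor (\<lambda>Y. hess f Y u v) m X"
proof -
  have "(\<lambda>Y. dird (taylor f (Suc (Suc m))) Y u) = taylor (\<lambda>Y. dird f Y u) (Suc m)"
    by (rule ext) (rule dird_taylor[OF f])
  then show ?thesis unfolding hess_def by (simp add: dird_taylor[OF smooth_at_dird[OF f]])
qed

context cstruct
begin

lemma bideg_taylor_pluriharmonic:
  assumes f: "smooth_at 0 f" and ph: "\<forall>\<^sub>F Y in nhds 0. \<forall>u v. hess f Y (J u) (J v) = - hess f Y u v"
    and P: "sym_bidegrees P" "P n 0"
  shows "bideg P n (taylor f n)"
proof (rule bideg_pluriharmonic[OF hom_poly_taylor[OF f] _ P])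
  fix X
  have c: "dird (\<lambda>Y. dird (taylor f n) Y u) X v = 0" if "n < 2" for u v
  proof (cases n)
    case 0
    then show ?thesis using dird_hom_poly_0[OF hom_poly_taylor[OF f, of 0]] by simp
  next
    case (Suc m)
    then have "m = 0" using that by simp
    then show ?thesis
      using dird_hom_poly_0[OF hom_poly_dird[OF hom_poly_taylor[OF f, of "Suc 0"]]] Suc by simp
  qed
  show "dird (\<lambda>Y. dird (taylor f n) Y (J X)) X (J X) = - dird (\<lambda>Y. dird (taylor f n) Y X) X X"
  proof (cases "n < 2")
    case True
    then show ?thesis by (simp only: c)
  next
    case False
    then obtain m where m: "n = Suc (Suc m)" by (metis Suc_leI less_2_cases_iff not_less_eq old.nat.exhaust)
    have sh: "smooth_at 0 (\<lambda>Y. hess f Y X X)" unfolding hess_def by (intro smooth_at_dird f)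
    have "taylor (\<lambda>Y. hess f Y (J X) (J X)) m X = taylor (\<lambda>Y. - hess f Y X X) m X"
      by (rule taylor_cong, use ph in eventually_elim) simp
    also have "\<dots> = - taylor (\<lambda>Y. hess f Y X X) m X"
      by (rule taylor_bounded_linear[OF bounded_linear_minus[OF bounded_linear_ident] sh])
    finally show ?thesis
      using taylor_hess[OF f, of m X] unfolding m hess_def by simp
  qed
qed

lemma taylor_hol:
  assumes w: "smooth_at 0 w" and hol: "\<forall>\<^sub>F Y in nhds 0. \<forall>u. dird w Y (J u) = J (dird w Y u)"
  shows "taylor w n \<in> hol_poly_fields J n"
proof -
  have "dird (taylor w n) X (J u) = J (dird (taylor w n) X u)" for X u
  proof (cases n)
    case 0
    then show ?thesis using dird_hom_poly_0[OF hom_poly_taylor[OF w, of 0]] by simp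
  next
    case (Suc m)
    have "taylor (\<lambda>Y. dird w Y (J u)) m X = taylor (\<lambda>Y. J (dird w Y u)) m X"
      by (rule taylor_cong, use hol in eventually_elim) simp
    then show ?thesis unfolding Suc
      by (simp add: dird_taylor[OF w] taylor_bounded_linear[OF blJ smooth_at_dird[OF w]])
  qed
  then show ?thesis using hom_poly_taylor[OF w] by (simp add: hol_poly_fields_def)
qed

end

lemma bilinear_combine:
  fixes a b :: "'a::euclidean_space \<Rightarrow> 'a \<Rightarrow> real"
  assumes "bilinear a" "bilinear b"
  shows "bilinear (\<lambda>u v. r * a u v + s * b u v)"
  unfolding bilinear_def
  by (intro conjI allI linearI)
    (simp_all add: bilinear_ladd[OF assms(1)] bilinear_ladd[OF assms(2)] bilinear_radd[OF assms(1)] bilinear_radd[OF assms(2)]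
      bilinear_lmul[OF assms(1)] bilinear_lmul[OF assms(2)] bilinear_rmul[OF assms(1)] bilinear_rmul[OF assms(2)] algebra_simps)

lemma has_derivative_sum_list_values:
  fixes E :: "'x::real_normed_vector \<Rightarrow> 'y \<Rightarrow> real"
  assumes "\<And>w. ((\<lambda>x. E x w) has_derivative E' w) (at x0)"
  shows "((\<lambda>x. \<Sum>(c, w)\<leftarrow>cs. c * E x w) has_derivative (\<lambda>Z. \<Sum>(c, w)\<leftarrow>cs. c * E' w Z)) (at x0)"
  unfolding case_prod_unfold by (intro has_derivative_sum_list has_derivative_mult_right assms)

lemma (in cstruct) bilinear_compose_J:
  assumes "bilinear (b :: 'a \<Rightarrow> 'a \<Rightarrow> real)"
  shows "bilinear (\<lambda>u v. b (J u) (J v))"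
  unfolding bilinear_def
  by (intro conjI allI linearI)
    (simp_all add: bilinear_ladd[OF assms] bilinear_radd[OF assms] bilinear_lmul[OF assms] bilinear_rmul[OF assms])

text \<open>The point \<open>x\<close> moves in the normal coordinates centered at \<open>0\<close>, with potential \<open>F\<close>. The normal
  coordinates \<open>\<psi> x\<close>, potential \<open>f x\<close> and metric \<open>h x\<close> at \<open>x\<close> are germs for each \<open>x\<close> separately:
  nothing is assumed on their dependence on \<open>x\<close>.\<close>

locale normal_family = hermitian +
  fixes N :: "'a set" and F :: "'a \<Rightarrow> real" and \<psi> :: "'a \<Rightarrow> 'a \<Rightarrow> 'a" and f :: "'a \<Rightarrow> 'a \<Rightarrow> real"
    and h :: "'a \<Rightarrow> 'a \<Rightarrow> 'a \<Rightarrow> real"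
  assumes N: "open N" "0 \<in> N"
    and F: "x \<in> N \<Longrightarrow> smooth_at x F"
    and \<psi>: "x \<in> N \<Longrightarrow> smooth_at 0 (\<psi> x)" and \<psi>_0: "x \<in> N \<Longrightarrow> \<psi> x 0 = x"
    and \<psi>_1: "x \<in> N \<Longrightarrow> dird (\<psi> x) 0 u = u"
    and \<psi>_hol: "x \<in> N \<Longrightarrow> \<forall>\<^sub>F Y in nhds 0. \<forall>u. dird (\<psi> x) Y (J u) = J (dird (\<psi> x) Y u)"
    and f: "x \<in> N \<Longrightarrow> smooth_at 0 (f x)"
    and ph: "x \<in> N \<Longrightarrow> \<forall>\<^sub>F Y in nhds 0. \<forall>u v. hess (\<lambda>Y. f x Y - F (\<psi> x Y)) Y (J u) (J v) = - hess (\<lambda>Y. f x Y - F (\<psi> x Y)) Y u v"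
    and h: "x \<in> N \<Longrightarrow> bilinear (h x)" and hsym: "x \<in> N \<Longrightarrow> h x u v = h x v u" and hJ: "x \<in> N \<Longrightarrow> h x (J u) (J v) = h x u v"
    and normal: "x \<in> N \<Longrightarrow> bideg ge22 n (\<lambda>X. taylor (f x) n X - (if n = 2 then h x X X else 0))"
    and base: "\<forall>\<^sub>F Y in nhds 0. \<psi> 0 Y = Y" "\<forall>\<^sub>F Y in nhds 0. f 0 Y = F Y" "h 0 = g"
begin

lemma evN: "\<forall>\<^sub>F x in nhds 0. x \<in> N"
  using N by (rule eventually_nhds_in_open)

lemma smooth_F\<psi>: "x \<in> N \<Longrightarrow> smooth_at 0 (\<lambda>Y. F (\<psi> x Y))"
  by (rule smooth_at_compose) (auto simp: \<psi>_0 F \<psi>)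

lemma taylor_\<psi>_hol: "x \<in> N \<Longrightarrow> taylor (\<psi> x) n \<in> hol_poly_fields J n"
  by (rule taylor_hol[OF \<psi> \<psi>_hol])

lemma taylor_\<psi>_0: "x \<in> N \<Longrightarrow> taylor (\<psi> x) 0 Y = x"
  by (simp add: \<psi>_0)

lemma taylor_\<psi>_1: "x \<in> N \<Longrightarrow> taylor (\<psi> x) (Suc 0) Y = Y"
  using taylor_Suc[OF \<psi>, of x 0 Y] by (simp add: \<psi>_1)

lemma taylor_\<psi>_base: "taylor (\<psi> 0) n Y = (if n = 1 then Y else 0)"
proof -
  have "taylor (\<psi> 0) n Y = taylor (\<lambda>Y. Y) n Y" by (rule taylor_cong[OF base(1)])
  then show ?thesis using taylor_hom_poly[OF hom_poly_linear[OF linear_ident]] by metis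
qed

lemma bideg_pure_diff:
  assumes "x \<in> N"
  shows "bideg pure n (\<lambda>X. taylor (f x) n X - taylor (\<lambda>Y. F (\<psi> x Y)) n X)"
proof -
  have "bideg pure n (taylor (\<lambda>Y. f x Y - F (\<psi> x Y)) n)"
    by (rule bideg_taylor_pluriharmonic[OF smooth_at_diff[OF f smooth_F\<psi>] ph sym_pure])
      (use assms in \<open>auto simp: pure_def\<close>)
  then show ?thesis by (simp add: taylor_diff[OF f smooth_F\<psi>, OF assms assms, abs_def])
qed

definition \<theta>f :: "('a, real) formal_series"
  where "\<theta>f = (\<lambda>n X. taylor F n X - (if n = 2 then g X X else 0))"

abbreviation "Vf \<equiv> closure_field \<theta>f"

lemma bideg_\<theta>f: "bideg ge22 n (\<theta>f n)"
proof -
  have "taylor (f 0) n X = taylor F n X" for n X by (rule taylor_cong[OF base(2)])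
  then show ?thesis using normal[OF N(2), of n] by (simp add: \<theta>f_def base(3) cong: if_cong)
qed

lemma ge22_low: "bideg ge22 n e \<Longrightarrow> n < 4 \<Longrightarrow> e X = 0"
  by (rule bideg_empty) (auto simp: ge22_def)

lemma taylor_F: "taylor F n X = \<theta>f n X + (if n = 2 then g X X else 0)"
  by (simp add: \<theta>f_def)

lemma taylor_f_low: "x \<in> N \<Longrightarrow> n < 2 \<Longrightarrow> taylor (f x) n X = 0"
  using ge22_low[OF normal, of x n X] by simp

lemma taylor_f_2: "x \<in> N \<Longrightarrow> taylor (f x) 2 X = h x X X"
  using ge22_low[OF normal, of x 2 X] by simp

lemma taylor_f_ge22: "x \<in> N \<Longrightarrow> 3 \<le> n \<Longrightarrow> bideg ge22 n (taylor (f x) n)"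
  using normal[of x n] by simp

lemma bideg_antihess:
  assumes x: "x \<in> N" and w: "w \<in> hol_poly_fields J k"
  shows "bideg pure (Suc k) (\<lambda>X. hess F x (w X) X - hess F x (J (w X)) (J X))"
proof -
  note B = hess_bilinear[OF F[OF x]]
  note BJ = bilinear_compose_J[OF B]
  have "bideg pure (Suc k) (\<lambda>X. 1 * hess F x (w X) X + (-1) * hess F x (J (w X)) (J X))"
    by (rule bideg_closure_antihermitian[where b="\<lambda>u v. 1 * hess F x u v + (-1) * hess F x (J u) (J v)", OF bilinear_combine[OF B BJ] _ w sym_pure])
      (auto simp: pure_def bilinear_minus[OF B])
  then show ?thesis by simp
qed

text \<open>The degree 2 parts of the normal potential and of \<open>F \<circ> \<psi> x\<close>
  agree modulo pure bidegrees. The first is \<open>h x X X\<close>; the second is half the Hessian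
  of \<open>F\<close> plus \<open>dF\<close> of a holomorphic quadratic term, which is pure. So
  \<open>h x\<close> is half the hermitian part of the Hessian, and this is where regularity of
  \<open>h\<close> in \<open>x\<close> comes from.\<close>

lemma h_eq_hess:
  assumes x: "x \<in> N"
  shows "h x u v = (hess F x u v + hess F x (J u) (J v)) / 4"
proof -
  note B = hess_bilinear[OF F[OF x]]
  note BJ = bilinear_compose_J[OF B]
  \<comment> \<open>The difference of the two sides. As a hermitian form it has bidegree
    \<open>(1, 1)\<close>, while the comparison shows it to be pure, so it vanishes.\<close>
  define b where "b u v = 1 * h x u v + (-1/4) * (1 * hess F x u v + 1 * hess F x (J u) (J v))" for u v
  have bb: "bilinear b"
    unfolding b_def[abs_def] by (intro bilinear_combine h[OF x] B BJ)
  have bJ: "b (J u) (J v) = b u v" for u v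
    by (simp add: b_def hJ[OF x] bilinear_minus[OF B])
  have bsym: "b u v = b v u" for u v
    using hess_sym[OF F[OF x]] hsym[OF x, of u v] by (simp add: b_def)
  \<comment> \<open>Against the line \<open>x + t X\<close> the curve along the ray deviates first
    in order 2, where the deviation enters only through \<open>dF\<close>.\<close>
  have C: "taylor (\<lambda>Y. F (\<psi> x Y)) 2 X = hess F x X X / 2 + dird F x (taylor (\<psi> x) 2 X)" for X
  proof -
    let ?c = "\<lambda>t. \<psi> x (t *\<^sub>R X)" and ?c' = "\<lambda>t::real. x + t *\<^sub>R X"
    have sm: "smooth_at 0 ?c" "smooth_at 0 ?c'"
      by (auto intro: smooth_at_on_ray[OF \<psi>[OF x]] smooth_at_line)
    have tc': "tc k ?c' = (if k = 0 then x else if k = 1 then X else 0)" for k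
      using tc_power[of k 1 X] tc_add[OF smooth_at_const smooth_at_ray, of k x X]
      by (simp add: tc_const)
    have "tc k ?c = tc k ?c'" if "k < 2" for k
      using that taylor_\<psi>_0[OF x, of X] taylor_\<psi>_1[OF x, of X] unfolding tc' taylor_eq_tc
      by (cases k) auto
    from tc_compose_agree_below[where F=F and n=2, OF sm _ this]
    have "tc 2 (\<lambda>t. F (?c t)) = tc 2 (\<lambda>t. F (?c' t)) + dird F (?c 0) (tc 2 ?c - tc 2 ?c')"
      using F[OF x] \<psi>_0[OF x] by simp
    moreover have "2 * tc 2 (\<lambda>t. F (?c' t)) = hess F x X X"
    proof -
      have "real (Suc 1) *\<^sub>R tc (Suc 1) (\<lambda>t. F (?c' t)) = tc 1 (\<lambda>t. dird F (?c' t) X)"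
      proof (rule tc_Suc_derivative)
        have "\<forall>\<^sub>F t in nhds 0. smooth_at (?c' t) F"
          using smooth_at_compose_eventually[OF sm(2)] smooth_at_eventually[OF F[OF x]] by simp
        then show "\<forall>\<^sub>F t in nhds 0. ((\<lambda>t. F (?c' t)) has_vector_derivative dird F (?c' t) X) (at t)"
          by eventually_elim (rule has_vector_derivative_line[OF smooth_at_differentiable])
      qed
      also have "\<dots> = hess F x X X"
        using tc_1_compose[OF sm(2), of "\<lambda>y. dird F y X"] smooth_at_dird[OF F[OF x]]
        unfolding tc' hess_def by simp
      finally show ?thesis by (simp add: numeral_2_eq_2)
    qed
    ultimately show ?thesis by (simp add: taylor_eq_tc tc' \<psi>_0[OF x])
  qed
  have "bideg pure 2 (\<lambda>X. (taylor (f x) 2 X - taylor (\<lambda>Y. F (\<psi> x Y)) 2 X) + dird F x (taylor (\<psi> x) 2 X)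
     + (1/4) * (hess F x X X - hess F x (J X) (J X)))"
  proof (intro bideg_add bideg_scale)
    show "bideg pure 2 (\<lambda>X. taylor (f x) 2 X - taylor (\<lambda>Y. F (\<psi> x Y)) 2 X)"
      by (rule bideg_pure_diff[OF x])
    show "bideg pure 2 (\<lambda>X. dird F x (taylor (\<psi> x) 2 X))"
      by (rule bideg_linear_hol[OF linear_dird[OF smooth_at_differentiable[OF F[OF x]]] taylor_\<psi>_hol[OF x] sym_pure])
        (simp add: pure_def)
    show "bideg pure 2 (\<lambda>X. hess F x X X - hess F x (J X) (J X))"
      using bideg_antihess[OF x hol_ident] by (simp add: numeral_2_eq_2)
  qed
  also have "(\<lambda>X. (taylor (f x) 2 X - taylor (\<lambda>Y. F (\<psi> x Y)) 2 X) + dird F x (taylor (\<psi> x) 2 X)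
     + (1/4) * (hess F x X X - hess F x (J X) (J X))) = (\<lambda>X. b X X)"
    by (rule ext) (simp add: C taylor_f_2[OF x] b_def field_simps)
  finally have "bideg pure 2 (\<lambda>X. b X X)" .
  moreover have "bideg mixed 2 (\<lambda>X. b X X)"
    using bideg_closure_hermitian[OF bb bJ hol_ident sym_mixed] by (simp add: mixed_def numeral_2_eq_2)
  ultimately have b0: "b X X = 0" for X
    by (rule bideg_disjoint_zero) (auto simp: pure_def mixed_def)
  have "b u v = 0"
    using b0[of "u + v"] b0[of u] b0[of v] bsym[of u v] by (simp add: bilinear_ladd[OF bb] bilinear_radd[OF bb])
  then show ?thesis by (simp add: b_def)
qed

lemma h_tendsto: "((\<lambda>x. h x u v) \<longlongrightarrow> h 0 u v) (at 0)"
proof -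
  have "isCont (\<lambda>x. hess F x u v) 0" for u v
    unfolding hess_def by (intro smooth_at_isCont smooth_at_dird F N)
  then have "((\<lambda>x. (hess F x u v + hess F x (J u) (J v)) / 4) \<longlongrightarrow> (hess F 0 u v + hess F 0 (J u) (J v)) / 4) (at 0)"
    by (auto intro!: tendsto_intros simp: isCont_def)
  moreover have "\<forall>\<^sub>F x in at 0. (hess F x u v + hess F x (J u) (J v)) / 4 = h x u v"
    using eventually_at_in_open'[OF N] by eventually_elim (simp add: h_eq_hess)
  ultimately have "((\<lambda>x. h x u v) \<longlongrightarrow> (hess F 0 u v + hess F 0 (J u) (J v)) / 4) (at 0)"
    by (rule Lim_transform_eventually)
  then show ?thesis by (simp only: h_eq_hess[OF N(2)])
qed

text \<open>The component of degree \<open>k\<close> of the extended field as claimed by the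
  theorem, and hence the candidate for the derivative of \<open>taylor (\<psi> x) k Y\<close> in
  direction \<open>Z\<close>. In degree 1 it is zero, matching the normalization of
  \<open>\<psi> x\<close> to first derivative \<open>id\<close>.\<close>

definition dpsi :: "nat \<Rightarrow> 'a \<Rightarrow> 'a \<Rightarrow> 'a"
  where "dpsi k Z Y = (if k = 0 then Z else (- 1 / 2) *\<^sub>R Vf Z k Y)"

lemma dpsi_1: "dpsi (Suc 0) Z Y = 0"
  by (simp add: dpsi_def closure_field_low[OF bideg_\<theta>f])

lemma Vf_linear: "linear (\<lambda>Z. Vf Z n X)"
  by (rule closure_field_linear[OF bideg_\<theta>f])

lemma low_has_derivative: "k < 2 \<Longrightarrow> ((\<lambda>x. taylor (\<psi> x) k Y) has_derivative (\<lambda>Z. dpsi k Z Y)) (at 0)"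
proof -
  assume "k < 2"
  then consider "k = 0" | "k = 1" by linarith
  then show ?thesis
  proof cases
    case 1
    have "((\<lambda>x. taylor (\<psi> x) 0 Y) has_derivative (\<lambda>Z. Z)) (at 0)"
      by (rule has_derivative_cong_nhds[OF has_derivative_ident], use evN in eventually_elim) (simp add: \<psi>_0)
    then show ?thesis using 1 by (simp add: dpsi_def)
  next
    case 2
    have "((\<lambda>x. taylor (\<psi> x) (Suc 0) Y) has_derivative (\<lambda>Z. 0)) (at 0)"
      by (rule has_derivative_cong_nhds[OF has_derivative_const[of Y]], use evN in eventually_elim) (simp add: taylor_\<psi>_1)
    then show ?thesis using 2 by (simp add: dpsi_1)
  qed
qed

lemma dird_taylor_F:
  "dird (taylor F m) Y w = dird (\<theta>f m) Y w + (if m = 2 then 2 * g Y w else 0)"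
proof -
  have dg: "((\<lambda>X. g X X) has_derivative (\<lambda>w. g Y w + g w Y)) (at Y)"
    by (rule bounded_bilinear.FDERIV[OF bilinear_imp_bounded[OF bil] has_derivative_ident has_derivative_ident])
  have d\<theta>: "\<theta>f m differentiable (at Y)" by (rule hom_poly_differentiable[OF bideg_hom_poly[OF bideg_\<theta>f]])
  show ?thesis
  proof (cases "m = 2")
    case True
    have "taylor F m = (\<lambda>X. \<theta>f m X + g X X)" using True by (simp add: taylor_F fun_eq_iff)
    moreover have "(\<lambda>X. g X X) differentiable (at Y)" using dg by (auto simp: differentiable_def)
    ultimately show ?thesis using True dird_add[OF d\<theta>, of "\<lambda>X. g X X" w] dird_eqI[OF dg, of w] gsym[of w Y] by simp
  next
    case False
    have "taylor F m = \<theta>f m" using False by (simp add: taylor_F fun_eq_iff)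
    then show ?thesis using False by simp
  qed
qed

text \<open>The part of the derivative of the degree \<open>n\<close> component of
  \<open>F \<circ> \<psi> x\<close> that comes from varying the coefficients of degrees 2 to
  \<open>m\<close> and letting them act on the free part. For \<open>m = n\<close> it is the
  derivation term of the theorem; in the induction step only the lower coefficients are
  available.\<close>

definition Rem :: "nat \<Rightarrow> nat \<Rightarrow> 'a \<Rightarrow> 'a \<Rightarrow> real"
  where "Rem m n Z Y = (\<Sum>k\<in>{2..m}. dird (\<theta>f (Suc (n - k))) Y (dpsi k Z Y))"

lemma dpsi_hol: "2 \<le> k \<Longrightarrow> dpsi k Z \<in> hol_poly_fields J k"
  using hol_scale[OF closure_field_hol[OF bideg_\<theta>f, of Z k], of "- 1 / 2"] by (simp add: dpsi_def[abs_def])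

text \<open>A holomorphic field of degree at least 2 cannot lower either degree of a component, so
  both stay at least 2 and \<open>Rem\<close> is invisible to the projection onto bidegree
  1.\<close>

lemma bideg_Rem: "m \<le> n \<Longrightarrow> bideg ge22 n (Rem m n Z)"
  unfolding Rem_def[abs_def]
proof (rule bideg_sum)
  fix k assume "m \<le> n" "k \<in> {2..m}"
  then have k: "2 \<le> k" "k \<le> n" by auto
  have "bideg ge22 (n - k + k) (\<lambda>X. dird (\<theta>f (Suc (n - k))) X (dpsi k Z X))"
    by (rule bideg_dird_field[OF bideg_\<theta>f dpsi_hol[OF k(1)] sym_ge22]) (use k in \<open>auto simp: ge22_def\<close>)
  then show "bideg ge22 n (\<lambda>X. dird (\<theta>f (Suc (n - k))) X (dpsi k Z X))" using k by simp
qed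

text \<open>The quadratic part \<open>g X X\<close> of \<open>F\<close> meets only the coefficient
  of degree \<open>n - 1\<close>. There its derivative contributes a factor 2, which cancels the
  \<open>1/2\<close> in \<open>dpsi\<close> and leaves the closure of the field, equal to
  \<open>dcrit1\<close> by construction.\<close>

lemma sum_dird_taylor_F:
  assumes "1 \<le> m" "m \<le> n" "2 \<le> n"
  shows "(\<Sum>k\<le>m. dird (taylor F (Suc (n - k))) Y (dpsi k Z Y)) =
    contract Z \<theta>f n Y + Rem m n Z Y - (if n - 1 \<le> m then dcrit1 \<theta>f Z n Y else 0)"
proof -
  have "(\<Sum>k\<le>m. dird (taylor F (Suc (n - k))) Y (dpsi k Z Y)) =
     (\<Sum>k\<le>m. dird (\<theta>f (Suc (n - k))) Y (dpsi k Z Y)) + (\<Sum>k\<le>m. if k = n - 1 then 2 * g Y (dpsi k Z Y) else 0)"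
    unfolding dird_taylor_F sum.distrib using assms by (intro arg_cong2[where f="(+)"] sum.cong refl) auto
  also have "(\<Sum>k\<le>m. dird (\<theta>f (Suc (n - k))) Y (dpsi k Z Y)) = contract Z \<theta>f n Y + Rem m n Z Y"
  proof -
    have "{..m} = insert 0 (insert 1 {2..m})" using assms by auto
    then have "(\<Sum>k\<le>m. dird (\<theta>f (Suc (n - k))) Y (dpsi k Z Y)) =
       dird (\<theta>f (Suc n)) Y (dpsi 0 Z Y) + (dird (\<theta>f (Suc (n - 1))) Y (dpsi 1 Z Y) + Rem m n Z Y)"
      by (simp add: Rem_def)
    moreover have "dird (\<theta>f (Suc (n - 1))) Y (dpsi 1 Z Y) = 0"
      using linear_0[OF linear_dird[OF hom_poly_differentiable[OF bideg_hom_poly[OF bideg_\<theta>f]]]] by (simp add: dpsi_1)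
    ultimately show ?thesis by (simp add: contract_def dpsi_def)
  qed
  also have "(\<Sum>k\<le>m. if k = n - 1 then 2 * g Y (dpsi k Z Y) else 0) = - (if n - 1 \<le> m then dcrit1 \<theta>f Z n Y else 0)"
  proof (cases "n - 1 \<le> m")
    case True
    have "2 * g Y (dpsi (n - 1) Z Y) = - dcrit1 \<theta>f Z n Y"
    proof (cases "n = 2")
      case True
      then show ?thesis by (simp add: dpsi_1 bilinear_rzero[OF bil] dcrit1_low[OF bideg_\<theta>f])
    next
      case False
      then have "2 \<le> n - 1" "Suc (n - 1) = n" using assms by auto
      then have "g (Vf Z (n - 1) Y) Y = dcrit1 \<theta>f Z n Y"
        using closure_field_closure[OF bideg_\<theta>f, of "n - 1" Z Y] by simp
      moreover have "dpsi (n - 1) Z Y = (- 1 / 2) *\<^sub>R Vf Z (n - 1) Y"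
        using \<open>2 \<le> n - 1\<close> by (auto simp: dpsi_def)
      ultimately show ?thesis
        using gsym[of Y "Vf Z (n - 1) Y"] by (simp add: bilinear_rmul[OF bil] bilinear_minus[OF bil])
    qed
    then show ?thesis using True by (simp add: sum.delta)
  qed (auto intro!: sum.neutral)
  finally show ?thesis by simp
qed

lemma contract_\<theta>f_split: "contract Z \<theta>f n X = dcrit1 \<theta>f Z n X + bideg_proj ge22 n (contract Z \<theta>f n) X"
proof -
  have "bideg (\<lambda>a b. some1 a b \<or> ge22 a b) n (contract Z \<theta>f n)"
    by (rule bideg_contract[where \<eta>=\<theta>f and P=ge22, OF bideg_\<theta>f]) (auto simp: sym_bidegrees_def some1_def ge22_def)
  then have "contract Z \<theta>f n X = bideg_proj some1 n (contract Z \<theta>f n) X + bideg_proj ge22 n (contract Z \<theta>f n) X"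
    by (rule bideg_proj_split) (auto simp: some1_def ge22_def)
  then show ?thesis by (simp add: bideg_proj_some1_contract[OF bideg_\<theta>f])
qed

lemma tc_dird_ray: "tc m (\<lambda>t. dird F (t *\<^sub>R Y) u) = dird (taylor F (Suc m)) Y u"
  using dird_taylor[OF F[OF N(2)], of m Y u] by (simp add: taylor_eq_tc)

end

section \<open>Derivatives of the normal coordinates and of the normal potential in the base
  point\<close>

context normal_family
begin

text \<open>The truncation below degree \<open>b\<close> involves only coefficients already
  controlled when degree \<open>b\<close> is treated. The two unknown ones are split off: that of
  degree \<open>b\<close> appears through the Hessian, that of degree \<open>Suc b\<close> only
  through \<open>dF\<close>.\<close>

lemma tc_compose_\<psi>:
  assumes x: "x \<in> N" and b: "2 \<le> b"
  shows "taylor (\<lambda>Y. F (\<psi> x Y)) (Suc b) Y =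
    tc (Suc b) (\<lambda>t. F (\<Sum>k\<le>b - 1. t ^ k *\<^sub>R taylor (\<psi> x) k Y)) + dird F x (taylor (\<psi> x) (Suc b) Y)
      + hess F x Y (taylor (\<psi> x) b Y)"
proof -
  let ?c = "\<lambda>t. \<psi> x (t *\<^sub>R Y)" and ?c' = "\<lambda>t. \<Sum>k\<le>b - 1. t ^ k *\<^sub>R taylor (\<psi> x) k Y"
  have c: "smooth_at 0 ?c" "smooth_at 0 ?c'"
    by (auto intro: smooth_at_on_ray[OF \<psi>[OF x]] smooth_at_polynomial)
  have c0: "?c 0 = x" using \<psi>_0[OF x] by simp
  have tcc: "tc k ?c = taylor (\<psi> x) k Y" for k by (simp add: taylor_eq_tc)
  have tcc': "tc k ?c' = (if k \<le> b - 1 then taylor (\<psi> x) k Y else 0)" for k by (rule tc_polynomial)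
  have "tc k ?c = tc k ?c'" if "k < b" for k using that b by (simp only: tcc tcc') auto
  from tc_compose_agree_below2[where F=F, OF c _ this b]
  have "tc (Suc b) (\<lambda>t. F (?c t)) = tc (Suc b) (\<lambda>t. F (?c' t)) + dird F (?c 0) (tc (Suc b) ?c - tc (Suc b) ?c')
    + dird (\<lambda>y. dird F y (tc 1 ?c)) (?c 0) (tc b ?c - tc b ?c')"
    using F[OF x] c0 by simp
  moreover have "tc (Suc b) ?c' = 0" "tc b ?c' = 0" using b by (simp_all only: tcc') auto
  ultimately show ?thesis
    using taylor_\<psi>_1[OF x, of Y] unfolding hess_def c0 tcc by (simp add: taylor_eq_tc[of "\<lambda>Y. F (\<psi> x Y)"])
qed

text \<open>The truncation \<open>E\<close> is differentiable by the induction hypothesis, and its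
  projection onto bidegree 1 equals \<open>- 2 * h x (?H x Y) Y\<close>. So this closure is
  differentiable although \<open>?H\<close> is not yet known to be; \<open>recover\<close> frees the
  second argument, and \<open>metric_solve_has_derivative\<close> then solves for
  \<open>?H\<close>.\<close>

lemma taylor_\<psi>_has_derivative:
  "((\<lambda>x. taylor (\<psi> x) b Y) has_derivative (\<lambda>Z. dpsi b Z Y)) (at 0)"
proof (induction b arbitrary: Y rule: less_induct)
  case (less b)
  show ?case
  proof (cases "b < 2")
    case True
    then show ?thesis by (rule low_has_derivative)
  next
    case False
    then have b: "2 \<le> b" by simp
    define n where "n = Suc b"
    have n: "3 \<le> n" "n - 1 = b" using b by (auto simp: n_def)
    let ?H = "\<lambda>x. taylor (\<psi> x) b"
    define ct where "ct x Y t = (\<Sum>k\<le>b - 1. t ^ k *\<^sub>R taylor (\<psi> x) k Y)" for x Y and t :: real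
    define E where "E x Y = tc n (\<lambda>t. F (ct x Y t))" for x Y
    \<comment> \<open>The derivative of the truncation. Since \<open>n - 1 = b\<close> exceeds the
      truncation degree, the quadratic part of \<open>F\<close> does not contribute and the bidegree
      1 part of the contraction remains uncancelled.\<close>
    define E' where "E' Z Y = contract Z \<theta>f n Y + Rem (b - 1) n Z Y" for Z Y
    have sct: "smooth_at 0 (ct x Y)" for x Y unfolding ct_def by (rule smooth_at_polynomial)
    have tct: "tc k (ct x Y) = (if k \<le> b - 1 then taylor (\<psi> x) k Y else 0)" for k x Y
      unfolding ct_def by (rule tc_polynomial)
    have ct0: "ct x Y 0 = x" if "x \<in> N" for x Y using tct[of 0 x Y] \<psi>_0[OF that] by simp
    have dE: "((\<lambda>x. E x Y) has_derivative (\<lambda>Z. E' Z Y)) (at 0)" for Y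
    proof -
      have "((\<lambda>x. tc n (\<lambda>t. F (ct x Y t))) has_derivative
         (\<lambda>Z. \<Sum>k\<le>n. tc (n - k) (\<lambda>t. dird F (ct 0 Y t) (if k \<le> b - 1 then dpsi k Z Y else 0)))) (at 0)"
      proof (rule tc_compose_has_derivative[where F=F, OF N sct])
        show "x \<in> N \<Longrightarrow> smooth_at (ct x Y 0) F" for x using F ct0 by simp
        show "((\<lambda>x. tc k (ct x Y)) has_derivative (\<lambda>Z. if k \<le> b - 1 then dpsi k Z Y else 0)) (at 0)" for k
          using less.IH[of k Y] b unfolding tct by (cases "k \<le> b - 1") auto
      qed
      moreover have "ct 0 Y = (\<lambda>t. t *\<^sub>R Y)"
      proof
        fix t
        have "ct 0 Y t = (\<Sum>k\<le>b - 1. if k = 1 then t *\<^sub>R Y else 0)"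
          unfolding ct_def by (rule sum.cong[OF refl]) (simp add: taylor_\<psi>_base)
        also have "\<dots> = t *\<^sub>R Y" using b by (subst sum.delta) auto
        finally show "ct 0 Y t = t *\<^sub>R Y" .
      qed
      moreover have "(\<Sum>k\<le>n. dird (taylor F (Suc (n - k))) Y (if k \<le> b - 1 then dpsi k Z Y else 0)) = E' Z Y" for Z
      proof -
        have d0: "dird (taylor F m) Y 0 = 0" for m
          by (rule linear_0[OF linear_dird[OF hom_poly_differentiable[OF hom_poly_taylor[OF F[OF N(2)]]]]])
        have "(\<Sum>k\<le>n. dird (taylor F (Suc (n - k))) Y (if k \<le> b - 1 then dpsi k Z Y else 0)) =
           (\<Sum>k\<le>b - 1. dird (taylor F (Suc (n - k))) Y (if k \<le> b - 1 then dpsi k Z Y else 0))"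
          by (rule sum.mono_neutral_right) (auto simp: d0 n_def)
        also have "\<dots> = (\<Sum>k\<le>b - 1. dird (taylor F (Suc (n - k))) Y (dpsi k Z Y))"
          by (rule sum.cong) auto
        also have "\<dots> = E' Z Y"
          using sum_dird_taylor_F[of "b - 1" n Y Z] b by (simp add: n_def E'_def)
        finally show ?thesis .
      qed
      ultimately show ?thesis by (simp only: E_def tc_dird_ray)
    qed
    have E'_prj: "bideg_proj some1 n (E' Z) Y = g (Vf Z b Y) Y" for Z Y
    proof -
      have "bideg_proj some1 n (E' Z) Y = bideg_proj some1 n (contract Z \<theta>f n) Y + bideg_proj some1 n (Rem (b - 1) n Z) Y"
        unfolding E'_def[abs_def]
        by (rule bideg_proj_add[OF hom_poly_contract[OF bideg_\<theta>f] bideg_hom_poly[OF bideg_Rem]]) (simp add: n_def)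
      also have "bideg_proj some1 n (Rem (b - 1) n Z) Y = 0"
        by (rule bideg_proj_disjoint[OF bideg_Rem]) (auto simp: n_def some1_def ge22_def)
      finally show ?thesis
        using closure_field_closure[OF bideg_\<theta>f b, of Z Y] by (simp add: bideg_proj_some1_contract[OF bideg_\<theta>f] n_def)
    qed
    have E_eq: "E x Y = taylor (\<lambda>Y. F (\<psi> x Y)) n Y - dird F x (taylor (\<psi> x) n Y) - hess F x (?H x Y) Y" if x: "x \<in> N" for x Y
      using tc_compose_\<psi>[OF x b, of Y] hess_sym[OF F[OF x], of Y "?H x Y"]
      unfolding E_def ct_def n_def[symmetric] by simp
    have bideg_lin: "bideg pure n (\<lambda>Y. dird F x (taylor (\<psi> x) n Y))" if x: "x \<in> N" for x
      by (rule bideg_linear_hol[OF linear_dird[OF smooth_at_differentiable[OF F[OF x]]] taylor_\<psi>_hol[OF x] sym_pure])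
        (simp add: pure_def)
    have hpE: "hom_poly n (E x)" if x: "x \<in> N" for x
    proof -
      have "hom_poly n (\<lambda>Y. hess F x (?H x Y) Y)"
        using hom_poly_bilinear_field[OF hess_bilinear[OF F[OF x]] taylor_\<psi>_hol[OF x] linear_ident] by (simp add: n_def)
      then have "hom_poly n (\<lambda>Y. taylor (\<lambda>Y. F (\<psi> x Y)) n Y - dird F x (taylor (\<psi> x) n Y) - hess F x (?H x Y) Y)"
        by (intro hom_poly_diff hom_poly_taylor[OF smooth_F\<psi>[OF x]] bideg_hom_poly[OF bideg_lin[OF x]])
      then show ?thesis using E_eq[OF x] by presburger
    qed
    have bideg_h: "bideg some1 n (\<lambda>Y. h x (?H x Y) Y)" if x: "x \<in> N" for x
      using bideg_closure_hermitian[OF h[OF x] hJ[OF x] taylor_\<psi>_hol[OF x] sym_some1, of b] by (simp add: n_def some1_def)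
    \<comment> \<open>\<open>E x Y + 2 * h x (?H x Y) Y\<close> is assembled from the normal
      potential, of bidegrees at least \<open>(2, 2)\<close>, and from pure terms: the pluriharmonic
      difference, \<open>dF\<close> of a holomorphic polynomial, and the antihermitian part of the
      Hessian. As \<open>3 \<le> n\<close>, none of these has a bidegree 1.\<close>
    have E_prj: "bideg_proj some1 n (E x) Y = - 2 * h x (?H x Y) Y" if x: "x \<in> N" for x Y
    proof -
      let ?P = "\<lambda>a b. pure a b \<or> ge22 a b"
      have sP: "bideg ?P n q" if "bideg pure n q \<or> bideg ge22 n q" for q
        using that by (elim disjE) (erule bideg_mono, simp)+
      have "bideg ?P n (taylor (f x) n)" "bideg ?P n (\<lambda>Y. taylor (f x) n Y - taylor (\<lambda>Y. F (\<psi> x Y)) n Y)"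
        "bideg ?P n (\<lambda>Y. dird F x (taylor (\<psi> x) n Y))" "bideg ?P n (\<lambda>Y. hess F x (?H x Y) Y - hess F x (J (?H x Y)) (J Y))"
        using taylor_f_ge22[OF x n(1)] bideg_pure_diff[OF x, of n] bideg_lin[OF x] bideg_antihess[OF x taylor_\<psi>_hol[OF x, of b]]
        by (rule_tac sP, simp add: n_def)+
      from bideg_diff[OF bideg_diff[OF bideg_diff[OF this(1,2)] this(3)] bideg_scale[OF this(4), of "1/2"]]
      have "bideg ?P n (\<lambda>Y. taylor (f x) n Y - (taylor (f x) n Y - taylor (\<lambda>Y. F (\<psi> x Y)) n Y)
         - dird F x (taylor (\<psi> x) n Y) - (1/2) * (hess F x (?H x Y) Y - hess F x (J (?H x Y)) (J Y)))" .
      also have "(\<lambda>Y. taylor (f x) n Y - (taylor (f x) n Y - taylor (\<lambda>Y. F (\<psi> x Y)) n Y)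
         - dird F x (taylor (\<psi> x) n Y) - (1/2) * (hess F x (?H x Y) Y - hess F x (J (?H x Y)) (J Y)))
         = (\<lambda>Y. E x Y + 2 * h x (?H x Y) Y)"
        by (rule ext) (simp add: E_eq[OF x] h_eq_hess[OF x] field_simps)
      finally have "bideg_proj some1 n (\<lambda>Y. E x Y + 2 * h x (?H x Y) Y) Y = 0"
        by (rule bideg_proj_disjoint) (use n in \<open>auto simp: some1_def ge22_def pure_def\<close>)
      moreover have "bideg_proj some1 n (\<lambda>Y. E x Y + 2 * h x (?H x Y) Y) Y = bideg_proj some1 n (E x) Y + 2 * h x (?H x Y) Y"
        using bideg_proj_add[OF hpE[OF x] bideg_hom_poly[OF bideg_scale[OF bideg_h[OF x], of 2]]] bideg_proj_id[OF bideg_scale[OF bideg_h[OF x], of 2]]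
        by simp
      ultimately show ?thesis by simp
    qed
    have dh: "((\<lambda>x. h x (?H x Y) Y) has_derivative (\<lambda>Z. - (1/2) * g (Vf Z b Y) Y)) (at 0)" for Y
    proof -
      obtain cs :: "(real \<times> 'a) list" where cs: "\<And>q. hom_poly n q \<Longrightarrow> bideg_proj some1 n q Y = (\<Sum>(c, w)\<leftarrow>cs. c * q w)"
        using bideg_proj_values[of n some1 Y] by blast
      have hpE': "hom_poly n (E' Z)" for Z
        unfolding E'_def[abs_def] by (intro hom_poly.add hom_poly_contract[OF bideg_\<theta>f] bideg_hom_poly[OF bideg_Rem]) (simp add: n_def)
      have "((\<lambda>x. - (1/2) * (\<Sum>(c, w)\<leftarrow>cs. c * E x w)) has_derivative (\<lambda>Z. - (1/2) * (\<Sum>(c, w)\<leftarrow>cs. c * E' Z w))) (at 0)"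
        by (intro has_derivative_mult_right has_derivative_sum_list_values dE)
      then have "((\<lambda>x. h x (?H x Y) Y) has_derivative (\<lambda>Z. - (1/2) * (\<Sum>(c, w)\<leftarrow>cs. c * E' Z w))) (at 0)"
      proof (rule has_derivative_cong_nhds, use evN in eventually_elim)
        case (elim x)
        show ?case using cs[OF hpE[OF elim]] E_prj[OF elim, of Y] by simp
      qed
      then show ?thesis by (simp only: cs[OF hpE', symmetric] E'_prj)
    qed
    \<comment> \<open>The same list \<open>cs\<close> recovers the second argument for
      \<open>h x\<close> at every point and for \<open>g\<close> at the center, because it depends
      only on \<open>b\<close>, \<open>Y\<close> and \<open>u\<close>.\<close>
    have dhu: "((\<lambda>x. h x (?H x Y) u) has_derivative (\<lambda>Z. h 0 (dpsi b Z Y) u)) (at 0)" for u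
    proof -
      obtain cs :: "(real \<times> 'a) list" where cs: "\<And>q. hom_poly n q \<Longrightarrow> recover b q Y u = (\<Sum>(c, w)\<leftarrow>cs. c * q w)"
        using recover_values[of b b Y u] unfolding n_def by blast
      have "((\<lambda>x. \<Sum>(c, w)\<leftarrow>cs. c * h x (?H x w) w) has_derivative (\<lambda>Z. \<Sum>(c, w)\<leftarrow>cs. c * (- (1/2) * g (Vf Z b w) w))) (at 0)"
        by (intro has_derivative_sum_list_values dh)
      then have "((\<lambda>x. h x (?H x Y) u) has_derivative (\<lambda>Z. \<Sum>(c, w)\<leftarrow>cs. c * (- (1/2) * g (Vf Z b w) w))) (at 0)"
      proof (rule has_derivative_cong_nhds, use evN in eventually_elim)
        case (elim x)
        show ?case
          using cs[OF bideg_hom_poly[OF bideg_h[OF elim]]] closure_recover[OF h[OF elim] hJ[OF elim] taylor_\<psi>_hol[OF elim] b, of Y u]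
          by simp
      qed
      moreover have "(\<Sum>(c, w)\<leftarrow>cs. c * (- (1/2) * g (Vf Z b w) w)) = h 0 (dpsi b Z Y) u" for Z
      proof -
        have dkw: "dpsi b Z w = (- 1 / 2) *\<^sub>R Vf Z b w" for w using b by (simp add: dpsi_def)
        have "hom_poly n (\<lambda>w. g (dpsi b Z w) w)"
          using hom_poly_bilinear_field[OF bil dpsi_hol[OF b] linear_ident] by (simp add: n_def)
        from cs[OF this] have "g (dpsi b Z Y) u = (\<Sum>(c, w)\<leftarrow>cs. c * g (dpsi b Z w) w)"
          using closure_recover[OF bil gJ dpsi_hol[OF b] b, of Z Y u] by simp
        then show ?thesis by (simp add: base(3) dkw bilinear_lmul[OF bil] bilinear_minus[OF bil])
      qed
      ultimately show ?thesis by simp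
    qed
    show ?thesis
    proof (rule metric_solve_has_derivative[OF h N _ h_tendsto])
      show "v = 0" if "\<And>u. h 0 v u = 0" for v
        using gpos[of v] that[of v] base(3) by auto
      show "taylor (\<psi> 0) b Y = 0" using b by (simp add: taylor_\<psi>_base)
      show "linear (\<lambda>Z. dpsi b Z Y)"
        using linear_compose[OF Vf_linear[of b Y] linear_scaleR[of "- 1 / 2"]] b by (simp add: dpsi_def o_def)
    qed (use dhu in auto)
  qed
qed

text \<open>From degree 2 on the normal potential is the mixed part of
  \<open>F \<circ> \<psi> x\<close>, since their difference is pure and the potential is mixed. With
  the coordinates differentiated, the derivative \<open>D\<close> of
  \<open>F \<circ> \<psi> x\<close> has only bidegrees at least \<open>(2, 2)\<close>, the bidegree
  1 part having cancelled, so the mixed projection leaves it unchanged.\<close>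

theorem taylor_f_has_derivative:
  "((\<lambda>x. taylor (f x) n Y) has_derivative
      (\<lambda>Z. bideg_proj ge22 n (contract Z \<theta>f n) Y - (1/2) * derivation (Vf Z) \<theta>f n Y)) (at 0)"
proof -
  have Rem_derivation: "Rem n n Z Y = - (1/2) * derivation (Vf Z) \<theta>f n Y" for n Z Y
  proof -
    have d: "\<theta>f m differentiable (at Y)" for m by (rule hom_poly_differentiable[OF bideg_hom_poly[OF bideg_\<theta>f]])
    have "derivation (Vf Z) \<theta>f n Y = (\<Sum>k\<in>{2..n}. dird (\<theta>f (Suc n - k)) Y (Vf Z k Y))"
      unfolding derivation_def
    proof (rule sum.mono_neutral_right)
      show "\<forall>k\<in>{..Suc n} - {2..n}. dird (\<theta>f (Suc n - k)) Y (Vf Z k Y) = 0"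
      proof
        \<comment> \<open>For \<open>k < 2\<close> the field vanishes; \<open>k = Suc n\<close>
          differentiates the component of degree 0.\<close>
        fix k assume "k \<in> {..Suc n} - {2..n}"
        then have "k < 2 \<or> k = Suc n" by auto
        then show "dird (\<theta>f (Suc n - k)) Y (Vf Z k Y) = 0"
          using closure_field_low[OF bideg_\<theta>f, of k Z Y] linear_0[OF linear_dird[OF d]] dird_hom_poly_0[OF bideg_hom_poly[OF bideg_\<theta>f[of 0]]]
          by auto
      qed
    qed auto
    moreover have "Rem n n Z Y = (\<Sum>k\<in>{2..n}. - (1/2) * dird (\<theta>f (Suc n - k)) Y (Vf Z k Y))"
      unfolding Rem_def
    proof (rule sum.cong[OF refl])
      fix k assume "k \<in> {2..n}"
      then have "Suc (n - k) = Suc n - k" "dpsi k Z Y = (- 1/2) *\<^sub>R Vf Z k Y" by (auto simp: dpsi_def)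
      then show "dird (\<theta>f (Suc (n - k))) Y (dpsi k Z Y) = - (1/2) * dird (\<theta>f (Suc n - k)) Y (Vf Z k Y)"
        by (simp only: dird_scale[OF d]) simp
    qed
    ultimately show ?thesis by (simp add: sum_distrib_left)
  qed
  define D where "D Z Y = bideg_proj ge22 n (contract Z \<theta>f n) Y + Rem n n Z Y" for Z Y
  have spD: "bideg ge22 n (D Z)" for Z
    unfolding D_def[abs_def] by (intro bideg_add bideg_prj[OF sym_ge22 hom_poly_contract[OF bideg_\<theta>f]] bideg_Rem) simp
  have "((\<lambda>x. taylor (f x) n Y) has_derivative (\<lambda>Z. D Z Y)) (at 0)"
  proof (cases "n < 2")
    case True
    then have "D Z Y = 0" for Z using ge22_low[OF spD] by simp
    moreover have "((\<lambda>x. taylor (f x) n Y) has_derivative (\<lambda>Z. 0)) (at 0)"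
      by (rule has_derivative_cong_nhds[OF has_derivative_const[of 0]], use evN in eventually_elim)
        (simp add: taylor_f_low[OF _ True])
    ultimately show ?thesis by simp
  next
    case False
    then have n: "2 \<le> n" by simp
    have dC: "((\<lambda>x. taylor (\<lambda>Y. F (\<psi> x Y)) n Y) has_derivative (\<lambda>Z. D Z Y)) (at 0)" for Y
    proof -
      have "((\<lambda>x. tc n (\<lambda>t. F (\<psi> x (t *\<^sub>R Y)))) has_derivative
         (\<lambda>Z. \<Sum>k\<le>n. tc (n - k) (\<lambda>t. dird F (\<psi> 0 (t *\<^sub>R Y)) (dpsi k Z Y)))) (at 0)"
      proof (rule tc_compose_has_derivative[where F=F and c="\<lambda>x t. \<psi> x (t *\<^sub>R Y)", OF N])
        show "smooth_at 0 (\<lambda>t. \<psi> x (t *\<^sub>R Y))" if "x \<in> N" for x by (rule smooth_at_on_ray[OF \<psi>[OF that]])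
        show "x \<in> N \<Longrightarrow> smooth_at (\<psi> x (0 *\<^sub>R Y)) F" for x using F \<psi>_0 by simp
        show "((\<lambda>x. tc k (\<lambda>t. \<psi> x (t *\<^sub>R Y))) has_derivative (\<lambda>Z. dpsi k Z Y)) (at 0)" for k
          using taylor_\<psi>_has_derivative[of k Y] by (simp add: taylor_eq_tc)
      qed
      moreover have "tc m (\<lambda>t. dird F (\<psi> 0 (t *\<^sub>R Y)) u) = dird (taylor F (Suc m)) Y u" for m u
      proof -
        have "tc m (\<lambda>t. dird F (\<psi> 0 (t *\<^sub>R Y)) u) = tc m (\<lambda>t. dird F (t *\<^sub>R Y) u)"
          by (rule tc_cong, use eventually_on_ray[OF base(1), of Y] in eventually_elim) simp
        then show ?thesis by (simp only: tc_dird_ray)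
      qed
      moreover have "(\<Sum>k\<le>n. dird (taylor F (Suc (n - k))) Y (dpsi k Z Y)) = D Z Y" for Z
        using sum_dird_taylor_F[of n n Y Z] n contract_\<theta>f_split[of Z n Y] by (simp add: D_def)
      ultimately show ?thesis by (simp add: taylor_eq_tc)
    qed
    obtain cs :: "(real \<times> 'a) list" where cs: "\<And>q. hom_poly n q \<Longrightarrow> bideg_proj mixed n q Y = (\<Sum>(c, w)\<leftarrow>cs. c * q w)"
      using bideg_proj_values[of n mixed Y] by blast
    have spf: "bideg mixed n (taylor (f x) n)" if x: "x \<in> N" for x
    proof (cases "n = 2")
      case True
      have "bideg mixed 2 (\<lambda>X. h x X X)"
        using bideg_closure_hermitian[OF h[OF x] hJ[OF x] hol_ident sym_mixed] by (simp add: mixed_def numeral_2_eq_2)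
      moreover have "taylor (f x) 2 = (\<lambda>X. h x X X)" using taylor_f_2[OF x] by auto
      ultimately show ?thesis using True by simp
    next
      case False
      then show ?thesis using taylor_f_ge22[OF x, of n] n by (auto intro: bideg_mono simp: ge22_def mixed_def)
    qed
    have eq: "taylor (f x) n Y = bideg_proj mixed n (taylor (\<lambda>Y. F (\<psi> x Y)) n) Y" if x: "x \<in> N" for x
    proof -
      have "bideg_proj mixed n (\<lambda>X. taylor (f x) n X - taylor (\<lambda>Y. F (\<psi> x Y)) n X) Y = 0"
        by (rule bideg_proj_disjoint[OF bideg_pure_diff[OF x]]) (auto simp: mixed_def pure_def)
      then show ?thesis
        using bideg_proj_diff[OF bideg_hom_poly[OF spf[OF x]] hom_poly_taylor[OF smooth_F\<psi>[OF x]], of mixed Y] bideg_proj_id[OF spf[OF x], of Y]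
        by simp
    qed
    have "((\<lambda>x. \<Sum>(c, w)\<leftarrow>cs. c * taylor (\<lambda>Y. F (\<psi> x Y)) n w) has_derivative (\<lambda>Z. \<Sum>(c, w)\<leftarrow>cs. c * D Z w)) (at 0)"
      by (intro has_derivative_sum_list_values dC)
    then have "((\<lambda>x. taylor (f x) n Y) has_derivative (\<lambda>Z. \<Sum>(c, w)\<leftarrow>cs. c * D Z w)) (at 0)"
    proof (rule has_derivative_cong_nhds, use evN in eventually_elim)
      case (elim x)
      show ?case using eq[OF elim] cs[OF hom_poly_taylor[OF smooth_F\<psi>[OF elim]]] by simp
    qed
    moreover have "(\<Sum>(c, w)\<leftarrow>cs. c * D Z w) = D Z Y" for Z
    proof -
      have "bideg mixed n (D Z)" by (rule bideg_mono[OF spD]) (auto simp: ge22_def mixed_def)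
      then show ?thesis using cs[OF bideg_hom_poly[OF spD]] bideg_proj_id by metis
    qed
    ultimately show ?thesis by simp
  qed
  then show ?thesis by (simp add: D_def Rem_derivation)
qed

text \<open>The degree 2 component of the normal potential is the metric itself. In degree 2 there
  is no bidegree at least \<open>(2, 2)\<close>, and the derivation term involves components of the
  free part below degree 4, which vanish. Polarization passes from the quadratic to the bilinear
  form.\<close>

lemma h_has_derivative: "((\<lambda>x. h x u v) has_derivative (\<lambda>_. 0)) (at 0)"
proof -
  have "bideg_proj ge22 2 e X = 0" for e X
    by (simp add: bideg_proj_sum ge22_def) (rule sum.neutral, auto)
  moreover have "derivation W \<theta>f 2 X = 0" for W X
  proof -
    have "\<theta>f m = (\<lambda>_. 0)" if "m < 4" for m using ge22_low[OF bideg_\<theta>f that] by auto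
    then show ?thesis unfolding derivation_def by (intro sum.neutral) auto
  qed
  ultimately have "((\<lambda>x. taylor (f x) 2 X) has_derivative (\<lambda>_. 0)) (at 0)" for X
    using taylor_f_has_derivative[of 2 X] by simp
  then have q: "((\<lambda>x. h x X X) has_derivative (\<lambda>_. 0)) (at 0)" for X
    by (rule has_derivative_cong_nhds, use evN in eventually_elim) (simp add: taylor_f_2)
  have "((\<lambda>x. (1/2) * (h x (u + v) (u + v) - h x u u - h x v v)) has_derivative (\<lambda>_. (1/2) * (0 - 0 - 0))) (at 0)"
    by (intro has_derivative_mult_right has_derivative_diff q)
  then have "((\<lambda>x. h x u v) has_derivative (\<lambda>_. (1/2) * (0 - 0 - 0))) (at 0)"
  proof (rule has_derivative_cong_nhds, use evN in eventually_elim)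
    case (elim x)
    show ?case
      using hsym[OF elim, of u v] by (simp add: bilinear_ladd[OF h[OF elim]] bilinear_radd[OF h[OF elim]])
  qed
  then show ?thesis by simp
qed

end

section \<open>Change of coordinates\<close>

lemma isCont_eventually:
  assumes "isCont c x" "\<forall>\<^sub>F y in nhds (c x). P y"
  shows "\<forall>\<^sub>F x in nhds x. P (c x)"
  using eventually_compose_filterlim[OF assms(2)] assms(1)
  by (simp add: continuous_at tendsto_at_iff_tendsto_nhds)

text \<open>Each \<open>\<beta> y v\<close> is differentiable in \<open>y\<close> for fixed
  \<open>v\<close>; expanding the moving argument in \<open>Basis\<close> reduces the claim to the
  product rule.\<close>

lemma has_derivative_linear_family:
  fixes \<beta> :: "'a::euclidean_space \<Rightarrow> 'a \<Rightarrow> 'b::real_normed_vector" and c w :: "'x::real_normed_vector \<Rightarrow> 'a"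
  assumes T: "open T" "c x0 \<in> T" and lin: "\<And>y. y \<in> T \<Longrightarrow> linear (\<beta> y)"
    and d: "\<And>v. (\<lambda>y. \<beta> y v) differentiable (at (c x0))"
    and c: "(c has_derivative c') (at x0)" and w: "(w has_derivative w') (at x0)"
  shows "((\<lambda>x. \<beta> (c x) (w x)) has_derivative (\<lambda>Z. dird (\<lambda>y. \<beta> y (w x0)) (c x0) (c' Z) + \<beta> (c x0) (w' Z))) (at x0)"
proof -
  have ev: "\<forall>\<^sub>F y in nhds (c x0). y \<in> T" using T by (rule eventually_nhds_in_open)
  have "isCont c x0" using c has_derivative_continuous by blast
  then have evc: "\<forall>\<^sub>F x in nhds x0. c x \<in> T"
    using ev by (rule isCont_eventually)
  have dc: "((\<lambda>x. \<beta> (c x) i) has_derivative (\<lambda>Z. dird (\<lambda>y. \<beta> y i) (c x0) (c' Z))) (at x0)" for i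
    using has_derivative_compose[OF c] d[of i] frechet_derivative_works by blast
  have "((\<lambda>x. \<Sum>i\<in>Basis. (w x \<bullet> i) *\<^sub>R \<beta> (c x) i) has_derivative
     (\<lambda>Z. \<Sum>i\<in>Basis. (w x0 \<bullet> i) *\<^sub>R dird (\<lambda>y. \<beta> y i) (c x0) (c' Z) + (w' Z \<bullet> i) *\<^sub>R \<beta> (c x0) i)) (at x0)"
    by (intro has_derivative_sum has_derivative_scaleR dc has_derivative_inner_left w)
  then have 1: "((\<lambda>x. \<beta> (c x) (w x)) has_derivative
     (\<lambda>Z. \<Sum>i\<in>Basis. (w x0 \<bullet> i) *\<^sub>R dird (\<lambda>y. \<beta> y i) (c x0) (c' Z) + (w' Z \<bullet> i) *\<^sub>R \<beta> (c x0) i)) (at x0)"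
  proof (rule has_derivative_cong_nhds, use evc in eventually_elim)
    case (elim x)
    show ?case by (rule linear_basis_expansion[OF lin[OF elim], symmetric])
  qed
  have A: "dird (\<lambda>y. \<beta> y v) (c x0) z = (\<Sum>i\<in>Basis. (v \<bullet> i) *\<^sub>R dird (\<lambda>y. \<beta> y i) (c x0) z)" for v z
  proof (rule dird_eqI)
    have "((\<lambda>y. \<Sum>i\<in>Basis. (v \<bullet> i) *\<^sub>R \<beta> y i) has_derivative (\<lambda>z. \<Sum>i\<in>Basis. (v \<bullet> i) *\<^sub>R dird (\<lambda>y. \<beta> y i) (c x0) z)) (at (c x0))"
      using d by (intro has_derivative_sum has_derivative_scaleR_right) (simp add: frechet_derivative_works)
    then show "((\<lambda>y. \<beta> y v) has_derivative (\<lambda>z. \<Sum>i\<in>Basis. (v \<bullet> i) *\<^sub>R dird (\<lambda>y. \<beta> y i) (c x0) z)) (at (c x0))"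
    proof (rule has_derivative_cong_nhds, use ev in eventually_elim)
      case (elim y)
      show ?case by (rule linear_basis_expansion[OF lin[OF elim], symmetric])
    qed
  qed
  have B: "\<beta> (c x0) z = (\<Sum>i\<in>Basis. (z \<bullet> i) *\<^sub>R \<beta> (c x0) i)" for z
    by (rule linear_basis_expansion[OF lin[OF T(2)]])
  have "(\<Sum>i\<in>Basis. (w x0 \<bullet> i) *\<^sub>R dird (\<lambda>y. \<beta> y i) (c x0) (c' Z) + (w' Z \<bullet> i) *\<^sub>R \<beta> (c x0) i)
    = dird (\<lambda>y. \<beta> y (w x0)) (c x0) (c' Z) + \<beta> (c x0) (w' Z)" for Z
    unfolding A[of "w x0" "c' Z"] B[of "w' Z"] by (rule sum.distrib)
  with 1 show ?thesis by (simp only:)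
qed

text \<open>The imaginary part of the assumption says that the (1,1)-part of the differential of
  \<open>du \<circ> I\<close> vanishes. The holomorphic map \<open>G\<close> pulls this form back to
  \<open>de \<circ> J\<close> with the constant structure \<open>J\<close>, so no derivatives of the
  complex structure remain on the source.\<close>

lemma pluriharmonic_pullback:
  fixes u :: "'a::euclidean_space \<Rightarrow> real" and G :: "'a \<Rightarrow> 'a"
  assumes T: "open T" and u: "smooth_on u T" and I: "\<And>v. smooth_on (\<lambda>x. I x v) T" "\<And>x. x \<in> T \<Longrightarrow> linear (I x)"
    and dd: "\<And>x a b. x \<in> T \<Longrightarrow> del_delbar I u x a b = 0"
    and G: "smooth_at Y G" "G Y \<in> T" and J: "\<And>a. J (J a) = - a"
    and hol: "\<forall>\<^sub>F Y in nhds Y. \<forall>a. dird G Y (J a) = I (G Y) (dird G Y a)"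
  shows "hess (\<lambda>Y. u (G Y)) Y (J a) (J b) = - hess (\<lambda>Y. u (G Y)) Y a b"
proof -
  define e where "e Y = u (G Y)" for Y
  define \<beta> where "\<beta> x v = dird u x (I x v)" for x v
  have su: "smooth_at x u" if "x \<in> T" for x using smooth_on_imp_smooth_at[OF T u that] .
  have s\<beta>: "smooth_at x (\<lambda>x. \<beta> x v)" if "x \<in> T" for x v
    unfolding \<beta>_def by (rule smooth_at_dird_field[OF su[OF that] smooth_on_imp_smooth_at[OF T I(1) that]])
  have lin\<beta>: "linear (\<beta> x)" if "x \<in> T" for x
    using linear_compose[OF I(2)[OF that] linear_dird[OF smooth_at_differentiable[OF su[OF that]]]]
    by (simp add: \<beta>_def[abs_def] o_def)
  define d\<beta> where "d\<beta> x a b = dird (\<lambda>y. \<beta> y b) x a - dird (\<lambda>y. \<beta> y a) x b" for x a b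
  have d\<beta>0: "d\<beta> x a b + d\<beta> x (I x a) (I x b) = 0" if x: "x \<in> T" for x a b
  proof -
    have Im_d: "Im (dird (\<lambda>y. delbar I u y v) x w) = dird (\<lambda>y. \<beta> y v) x w / 2" for v w
    proof -
      have sm: "smooth_at x (\<lambda>y. delbar I u y v)"
      proof -
        have "smooth_at x (\<lambda>y. (1/2) *\<^sub>R complex_of_real (dird u y v) + (1/2) *\<^sub>R (\<i> * complex_of_real (\<beta> y v)))"
          by (intro smooth_at_add smooth_at_bounded_linear[OF bounded_linear_scaleR_right]
              smooth_at_bounded_linear[OF bounded_linear_mult_right] smooth_at_bounded_linear[OF bounded_linear_of_real]
              smooth_at_dird su[OF x] s\<beta>[OF x])
        then show ?thesis by (simp add: delbar_def \<beta>_def scaleR_conv_of_real field_simps)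
      qed
      have "Im (dird (\<lambda>y. delbar I u y v) x w) = dird (\<lambda>y. Im (delbar I u y v)) x w"
        by (rule dird_bounded_linear(1)[OF bounded_linear_Im smooth_at_differentiable[OF sm], symmetric])
      also have "(\<lambda>y. Im (delbar I u y v)) = (\<lambda>y. (1/2) *\<^sub>R \<beta> y v)"
        by (rule ext) (simp add: delbar_def \<beta>_def)
      also have "dird \<dots> x w = (1/2) *\<^sub>R dird (\<lambda>y. \<beta> y v) x w"
        by (rule dird_bounded_linear(1)[OF bounded_linear_scaleR_right smooth_at_differentiable[OF s\<beta>[OF x]]])
      finally show ?thesis by simp
    qed
    have "Im (del_delbar I u x a b) = (d\<beta> x a b + d\<beta> x (I x a) (I x b)) / 4"
      by (simp add: del_delbar_def ext_d_def Im_d d\<beta>_def field_simps)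
    then show ?thesis using dd[OF x] by simp
  qed
  have se: "smooth_at Y e" unfolding e_def by (rule smooth_at_compose[OF su[OF G(2)] G(1)])
  let ?X = "G Y" and ?B = "dird G Y"
  have evT: "\<forall>\<^sub>F Y' in nhds Y. G Y' \<in> T"
    by (rule smooth_at_compose_eventually[OF G(1) eventually_nhds_in_open[OF T G(2)]])
  have hb: "hess e Y (J b) a = dird (\<lambda>y. \<beta> y (?B b)) ?X (?B a) + \<beta> ?X (dird (\<lambda>Y. dird G Y b) Y a)" for a b
  proof -
    have "((\<lambda>Y'. \<beta> (G Y') (dird G Y' b)) has_derivative
       (\<lambda>a. dird (\<lambda>y. \<beta> y (?B b)) ?X (?B a) + \<beta> ?X (dird (\<lambda>Y. dird G Y b) Y a))) (at Y)"
      by (rule has_derivative_linear_family[OF T G(2) lin\<beta> smooth_at_differentiable[OF s\<beta>[OF G(2)]]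
          smooth_at_has_derivative[OF G(1)] smooth_at_has_derivative[OF smooth_at_dird[OF G(1)]]])
    then have "((\<lambda>Y'. dird e Y' (J b)) has_derivative
       (\<lambda>a. dird (\<lambda>y. \<beta> y (?B b)) ?X (?B a) + \<beta> ?X (dird (\<lambda>Y. dird G Y b) Y a))) (at Y)"
    proof (rule has_derivative_cong_nhds, use hol evT smooth_at_eventually[OF G(1)] in eventually_elim)
      case (elim Y')
      show ?case
        unfolding e_def \<beta>_def
        using dird_compose(1)[OF smooth_at_differentiable[OF su[OF elim(2)]] smooth_at_differentiable[OF elim(3)], of "J b"] elim(1)
        by simp
    qed
    from dird_eqI[OF this] show ?thesis by (simp add: hess_def)
  qed
  have J': "?B (J a) = I ?X (?B a)" for a using eventually_nhds_x_imp_x[OF hol] by blast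
  \<comment> \<open>The second derivatives of \<open>G\<close> are symmetric and drop out of the
    antisymmetrization.\<close>
  have diff: "hess e Y (J b) a - hess e Y (J a) b = d\<beta> ?X (?B a) (?B b)" for a b
    using smooth_at_dird_commute[OF G(1), of b a] by (simp add: hb d\<beta>_def)
  have neg: "hess e Y (- a) b = - hess e Y a b" "hess e Y a (- b) = - hess e Y a b" for a b
    by (simp_all add: bilinear_lneg bilinear_rneg hess_bilinear[OF se])
  \<comment> \<open>Add \<open>diff\<close> for \<open>(b, a)\<close> and for
    \<open>(J b, J a)\<close>. The right-hand sides cancel by \<open>d\<beta>0\<close>, and symmetry
    of the Hessian leaves twice the claimed difference.\<close>
  have sw: "hess e Y (J a) b = hess e Y a (J b)" for a b
    using diff[of b a] diff[of "J b" "J a"] d\<beta>0[OF G(2), of "?B a" "?B b"]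
      hess_sym[OF se, of a "J b"] hess_sym[OF se, of "J a" b]
    by (simp add: J' J neg)
  have "hess e Y (J a) (J b) = - hess e Y a b"
    using sw[of a "J b"] by (simp add: J neg)
  then show ?thesis by (simp add: e_def[abs_def])
qed

lemma bideg_linear_subst:
  assumes I: "cstruct I" and J: "cstruct J" and e: "cstruct.bideg I P n e" and A: "linear A"
    and AJ: "\<And>u. A (J u) = I (A u)"
  shows "cstruct.bideg J P n (\<lambda>X. e (A X))"
proof -
  interpret I: cstruct I by fact
  interpret J: cstruct J by fact
  have blA: "bounded_linear A" using A linear_conv_bounded_linear by blast
  have dA: "A differentiable (at X)" "dird A X u = A u" for X u
    using blA by (auto intro!: bounded_linear_imp_differentiable dird_eqI bounded_linear_imp_has_derivative)
  have weight: "weight J n \<mu> (\<lambda>X. p (A X))" if "weight I n \<mu> p" for p \<mu>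
    using that hom_poly_linear_subst[OF weight_hom_poly[OF that] A]
      dird_compose(1)[OF hom_poly_differentiable[OF weight_hom_poly[OF that]] dA(1)]
    by (simp add: weight_def dA AJ)
  have e': "hom_poly n e" by (rule I.bideg_hom_poly[OF e])
  have "bihom_parts J n (\<lambda>X. e (A X)) a = (\<lambda>X. bihom_parts I n e a (A X))" if "a \<le> n" for a
    by (rule J.bihom_parts_eqI[OF weight[OF I.bihom_parts_works(1)[OF e']] I.bihom_parts_works(2)[OF e'] that])
  then show ?thesis
    using e hom_poly_linear_subst[OF e' A] by (simp add: I.bideg_def J.bideg_def)
qed

lemma has_derivative_bilinear_family:
  fixes G :: "'a::euclidean_space \<Rightarrow> 'a \<Rightarrow> 'a \<Rightarrow> real" and c a b :: "'x::real_normed_vector \<Rightarrow> 'a"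
  assumes S: "open S" and G_bilinear: "\<And>y. y \<in> S \<Longrightarrow> bilinear (G y)" and c0: "c x0 \<in> S"
    and d: "\<And>u v. (\<lambda>y. G y u v) differentiable (at (c x0))"
    and c': "(c has_derivative c') (at x0)" and a: "(a has_derivative a') (at x0)" and b: "(b has_derivative b') (at x0)"
  shows "((\<lambda>x. G (c x) (a x) (b x)) has_derivative
    (\<lambda>Z. dird (\<lambda>y. G y (a x0) (b x0)) (c x0) (c' Z) + G (c x0) (a' Z) (b x0) + G (c x0) (a x0) (b' Z))) (at x0)"
proof -
  note c = c0 c'
  have evc: "\<forall>\<^sub>F x in nhds x0. c x \<in> S"
    by (rule isCont_eventually[OF has_derivative_continuous[OF c(2)] eventually_nhds_in_open[OF S c(1)]])
  have lin1: "linear (\<lambda>v. G y v w)" and lin2: "linear (G y w)" if "y \<in> S" for y w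
    using G_bilinear[OF that] by (simp_all add: bilinear_def)
  have 1: "((\<lambda>x. G (c x) (a x) w) has_derivative (\<lambda>Z. dird (\<lambda>y. G y (a x0) w) (c x0) (c' Z) + G (c x0) (a' Z) w)) (at x0)" for w
    by (rule has_derivative_linear_family[where \<beta>="\<lambda>y v. G y v w", OF S c(1) lin1 d c(2) a])
  have "((\<lambda>x. \<Sum>i\<in>Basis. (b x \<bullet> i) *\<^sub>R G (c x) (a x) i) has_derivative
     (\<lambda>Z. \<Sum>i\<in>Basis. (b x0 \<bullet> i) *\<^sub>R (dird (\<lambda>y. G y (a x0) i) (c x0) (c' Z) + G (c x0) (a' Z) i) + (b' Z \<bullet> i) *\<^sub>R G (c x0) (a x0) i)) (at x0)"
    by (intro has_derivative_sum has_derivative_scaleR 1 has_derivative_inner_left b)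
  then have 2: "((\<lambda>x. G (c x) (a x) (b x)) has_derivative
     (\<lambda>Z. \<Sum>i\<in>Basis. (b x0 \<bullet> i) *\<^sub>R (dird (\<lambda>y. G y (a x0) i) (c x0) (c' Z) + G (c x0) (a' Z) i) + (b' Z \<bullet> i) *\<^sub>R G (c x0) (a x0) i)) (at x0)"
  proof (rule has_derivative_cong_nhds, use evc in eventually_elim)
    case (elim x)
    show ?case by (rule linear_basis_expansion[OF lin2[OF elim], symmetric])
  qed
  have dG: "dird (\<lambda>y. G y v w) (c x0) z = (\<Sum>i\<in>Basis. (w \<bullet> i) *\<^sub>R dird (\<lambda>y. G y v i) (c x0) z)" for v w z
  proof (rule dird_eqI)
    have "((\<lambda>y. \<Sum>i\<in>Basis. (w \<bullet> i) *\<^sub>R G y v i) has_derivative (\<lambda>z. \<Sum>i\<in>Basis. (w \<bullet> i) *\<^sub>R dird (\<lambda>y. G y v i) (c x0) z)) (at (c x0))"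
      using d by (intro has_derivative_sum has_derivative_scaleR_right) (simp add: frechet_derivative_works)
    then show "((\<lambda>y. G y v w) has_derivative (\<lambda>z. \<Sum>i\<in>Basis. (w \<bullet> i) *\<^sub>R dird (\<lambda>y. G y v i) (c x0) z)) (at (c x0))"
    proof (rule has_derivative_cong_nhds, use eventually_nhds_in_open[OF S c(1)] in eventually_elim)
      case (elim y)
      show ?case by (rule linear_basis_expansion[OF lin2[OF elim], symmetric])
    qed
  qed
  have "(\<Sum>i\<in>Basis. (b x0 \<bullet> i) *\<^sub>R (dird (\<lambda>y. G y (a x0) i) (c x0) (c' Z) + G (c x0) (a' Z) i) + (b' Z \<bullet> i) *\<^sub>R G (c x0) (a x0) i)
     = dird (\<lambda>y. G y (a x0) (b x0)) (c x0) (c' Z) + G (c x0) (a' Z) (b x0) + G (c x0) (a x0) (b' Z)" for Z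
  proof -
    have "(\<Sum>i\<in>Basis. (b x0 \<bullet> i) *\<^sub>R dird (\<lambda>y. G y (a x0) i) (c x0) (c' Z)) = dird (\<lambda>y. G y (a x0) (b x0)) (c x0) (c' Z)"
      by (rule dG[symmetric])
    moreover have "(\<Sum>i\<in>Basis. (b x0 \<bullet> i) *\<^sub>R G (c x0) (a' Z) i) = G (c x0) (a' Z) (b x0)"
      "(\<Sum>i\<in>Basis. (b' Z \<bullet> i) *\<^sub>R G (c x0) (a x0) i) = G (c x0) (a x0) (b' Z)"
      by (rule linear_basis_expansion[OF lin2[OF c(1)], symmetric])+
    ultimately show ?thesis by (simp only: scaleR_add_right sum.distrib)
  qed
  with 2 show ?thesis by (simp only:)
qed

section \<open>The Levi-Civita connection in a chart\<close>

locale hermitian_chart =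
  fixes S :: "'a::euclidean_space set" and G :: "'a \<Rightarrow> 'a \<Rightarrow> 'a \<Rightarrow> real" and I :: "'a \<Rightarrow> 'a \<Rightarrow> 'a"
  assumes S: "open S" and riem: "riemannian_metric_on S G" and orth: "orthogonal_almost_complex_on S G I"
begin

lemma G_smooth: "smooth_on (\<lambda>x. G x u v) S"
  and G_bilinear: "x \<in> S \<Longrightarrow> bilinear (G x)" and G_sym: "x \<in> S \<Longrightarrow> G x u v = G x v u"
  and G_pos: "x \<in> S \<Longrightarrow> u \<noteq> 0 \<Longrightarrow> 0 < G x u u"
  using riem by (auto simp: riemannian_metric_on_def)

lemma I_smooth: "smooth_on (\<lambda>x. I x u) S"
  and I_linear: "x \<in> S \<Longrightarrow> linear (I x)" and I_I: "x \<in> S \<Longrightarrow> I x (I x u) = - u"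
  and I_G: "x \<in> S \<Longrightarrow> G x (I x u) (I x v) = G x u v"
  using orth by (auto simp: orthogonal_almost_complex_on_def)

lemma cstruct_I: "x \<in> S \<Longrightarrow> cstruct (I x)"
  by (rule cstruct.intro[OF I_linear I_I])

lemma hermitian_G: "x \<in> S \<Longrightarrow> hermitian (I x) (G x)"
  by (intro hermitian.intro cstruct_I hermitian_axioms.intro G_bilinear G_sym G_pos I_G)

lemma G_differentiable: "x \<in> S \<Longrightarrow> (\<lambda>y. G y u v) differentiable (at x)"
  by (rule smooth_on_imp_differentiable[OF G_smooth])

lemmas has_derivative_G = has_derivative_bilinear_family[where G=G, OF S G_bilinear _ G_differentiable]

lemma dird_G_bilinear:
  assumes x: "x \<in> S"
  shows "bilinear (\<lambda>v z. dird (\<lambda>y. G y v z) x u)"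
proof -
  note cong = dird_cong(1)[OF S x]
  have 1: "linear (\<lambda>z. dird (\<lambda>y. G y v z) x u)" for v
  proof (rule linearI)
    fix z w
    have "dird (\<lambda>y. G y v z + G y v w) x = dird (\<lambda>y. G y v (z + w)) x"
      by (rule cong) (auto simp: bilinear_radd[OF G_bilinear] G_differentiable[OF x] intro: differentiable_add)
    then show "dird (\<lambda>y. G y v (z + w)) x u = dird (\<lambda>y. G y v z) x u + dird (\<lambda>y. G y v w) x u"
      by (metis dird_add G_differentiable[OF x])
  next
    fix r z
    have "dird (\<lambda>y. r *\<^sub>R G y v z) x = dird (\<lambda>y. G y v (r *\<^sub>R z)) x"
      by (rule cong) (auto simp: bilinear_rmul[OF G_bilinear] G_differentiable[OF x])
    then show "dird (\<lambda>y. G y v (r *\<^sub>R z)) x u = r *\<^sub>R dird (\<lambda>y. G y v z) x u"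
      by (metis dird_bounded_linear(1)[OF bounded_linear_scaleR_right G_differentiable[OF x]])
  qed
  have sym: "dird (\<lambda>y. G y v z) x = dird (\<lambda>y. G y z v) x" for v z
    by (rule cong) (auto simp: G_differentiable[OF x] intro: G_sym)
  show ?thesis unfolding bilinear_def
  proof (intro conjI allI 1)
    fix z show "linear (\<lambda>v. dird (\<lambda>y. G y v z) x u)" using 1[of z] by (simp only: sym[of _ z])
  qed
qed

text \<open>\<open>christoffel\<close> is a definite description: the Riesz representation provides
  existence, definiteness of the metric uniqueness.\<close>

lemma koszul:
  assumes x: "x \<in> S"
  shows "2 * G x (christoffel G x u v) z = dird (\<lambda>y. G y v z) x u + dird (\<lambda>y. G y u z) x v - dird (\<lambda>y. G y u v) x z"
proof -
  interpret hermitian "I x" "G x" by (rule hermitian_G[OF x])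
  let ?R = "\<lambda>z. dird (\<lambda>y. G y v z) x u + dird (\<lambda>y. G y u z) x v - dird (\<lambda>y. G y u v) x z"
  have "linear (\<lambda>z. (1/2) *\<^sub>R ?R z)"
    using dird_G_bilinear[OF x] linear_dird[OF G_differentiable[OF x]]
    by (intro linear_compose_scale_right linear_compose_sub linear_compose_add) (auto simp: bilinear_def)
  then obtain w where w: "\<forall>z. G x w z = (1/2) *\<^sub>R ?R z" using riesz by blast
  have "\<forall>z. 2 * G x w z = ?R z"
  proof
    fix z show "2 * G x w z = ?R z" using spec[OF w, of z] by simp
  qed
  moreover have "w' = w" if "\<forall>z. 2 * G x w' z = ?R z" for w'
  proof (rule g_eqI)
    fix z show "G x w' z = G x w z" using spec[OF that, of z] spec[OF w, of z] by simp
  qed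
  ultimately have "\<forall>z. 2 * G x (christoffel G x u v) z = ?R z"
    unfolding christoffel_def by (rule theI[where P="\<lambda>w. \<forall>z. 2 * G x w z = ?R z"])
  then show ?thesis by blast
qed

lemma christoffel_eqI:
  assumes x: "x \<in> S"
    and "\<And>z. 2 * G x w z = dird (\<lambda>y. G y v z) x u + dird (\<lambda>y. G y u z) x v - dird (\<lambda>y. G y u v) x z"
  shows "christoffel G x u v = w"
proof -
  interpret hermitian "I x" "G x" by (rule hermitian_G[OF x])
  show ?thesis
  proof (rule g_eqI)
    fix z show "G x (christoffel G x u v) z = G x w z"
      using koszul[OF x, of u v z] assms(2)[of z] by simp
  qed
qed

lemma christoffel_linear:
  assumes x: "x \<in> S"
  shows "linear (christoffel G x u)"
proof (rule linearI)
  note D = dird_G_bilinear[OF x] and B = G_bilinear[OF x]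
  fix v w
  show "christoffel G x u (v + w) = christoffel G x u v + christoffel G x u w"
    using koszul[OF x, of u v] koszul[OF x, of u w]
    by (intro christoffel_eqI[OF x])
      (simp add: bilinear_ladd[OF B] bilinear_ladd[OF D] bilinear_radd[OF D]
        linear_add[OF linear_dird[OF G_differentiable[OF x]]] algebra_simps)
next
  note D = dird_G_bilinear[OF x] and B = G_bilinear[OF x]
  fix r v
  have k: "2 * G x (christoffel G x u v) z * r = (dird (\<lambda>y. G y v z) x u + dird (\<lambda>y. G y u z) x v - dird (\<lambda>y. G y u v) x z) * r" for z
    by (simp only: koszul[OF x, of u v z])
  show "christoffel G x u (r *\<^sub>R v) = r *\<^sub>R christoffel G x u v"
    using k by (intro christoffel_eqI[OF x])
      (simp add: bilinear_lmul[OF B] bilinear_lmul[OF D] bilinear_rmul[OF D]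
        linear_scale[OF linear_dird[OF G_differentiable[OF x]]] algebra_simps)
qed

lemma metric_compatible:
  assumes x: "x \<in> S"
  shows "dird (\<lambda>y. G y v z) x u = G x (christoffel G x u v) z + G x v (christoffel G x u z)"
proof -
  have sym: "dird (\<lambda>y. G y v z) x = dird (\<lambda>y. G y z v) x" for v z
    by (rule dird_cong(1)[OF S x]) (auto simp: G_differentiable[OF x] intro: G_sym)
  show ?thesis
    using koszul[OF x, of u v z] koszul[OF x, of u z v] G_sym[OF x, of v "christoffel G x u z"] sym[of z v]
    by simp
qed

text \<open>Uniqueness of parallel transport without a theorem on linear differential equations: the
  length of a parallel field is constant.\<close>

lemma parallel_field_zero:
  assumes \<epsilon>: "t \<in> {-\<epsilon><..<\<epsilon>}" and c: "\<And>t. t \<in> {-\<epsilon><..<\<epsilon>} \<Longrightarrow> c t \<in> S \<and> (c has_vector_derivative c' t) (at t)"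
    and d: "\<And>t. t \<in> {-\<epsilon><..<\<epsilon>} \<Longrightarrow> (d has_vector_derivative - christoffel G (c t) (c' t) (d t)) (at t)"
    and d0: "d (0::real) = 0"
  shows "d t = 0"
proof -
  define q where "q t = G (c t) (d t) (d t)" for t
  have "(q has_derivative (\<lambda>_. 0)) (at s)" if s: "s \<in> {-\<epsilon><..<\<epsilon>}" for s
  proof -
    let ?\<Gamma> = "christoffel G (c s) (c' s) (d s)"
    have cs: "c s \<in> S" using c[OF s] by blast
    have "(q has_derivative (\<lambda>h. dird (\<lambda>y. G y (d s) (d s)) (c s) (h *\<^sub>R c' s) + G (c s) (h *\<^sub>R - ?\<Gamma>) (d s) + G (c s) (d s) (h *\<^sub>R - ?\<Gamma>))) (at s)"
      unfolding q_def
      by (rule has_derivative_G) (use c[OF s] d[OF s] in \<open>auto simp: has_vector_derivative_def\<close>)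
    moreover have "dird (\<lambda>y. G y (d s) (d s)) (c s) (h *\<^sub>R c' s) + G (c s) (h *\<^sub>R - ?\<Gamma>) (d s) + G (c s) (d s) (h *\<^sub>R - ?\<Gamma>) = 0" for h
      using metric_compatible[OF cs, of "d s" "d s" "c' s"] G_bilinear[OF cs]
      by (simp add: linear_scale[OF linear_dird[OF G_differentiable[OF cs]]] bilinear_lmul bilinear_rmul bilinear_lneg bilinear_rneg algebra_simps)
    ultimately show ?thesis by simp
  qed
  note dq = this
  have "q t = q 0"
  proof (rule has_derivative_zero_unique[of "{-\<epsilon><..<\<epsilon>}" q t 0])
    show "(q has_derivative (\<lambda>h. 0)) (at s within {-\<epsilon><..<\<epsilon>})" if "s \<in> {-\<epsilon><..<\<epsilon>}" for s
      by (rule has_derivative_at_withinI[OF dq[OF that]])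
  qed (use \<epsilon> in auto)
  also have "q 0 = 0" using c[of 0] \<epsilon> by (simp add: q_def d0 bilinear_lzero[OF G_bilinear])
  finally have "G (c t) (d t) (d t) = 0" by (simp add: q_def)
  then show ?thesis using G_pos[of "c t" "d t"] c[OF \<epsilon>] by fastforce
qed

end

section \<open>Kaehler normal coordinates around a moving point\<close>

lemma hess_cong:
  assumes "\<forall>\<^sub>F Y in nhds x. e Y = d Y" "smooth_at x e"
  shows "hess e x u v = hess d x u v"
proof -
  have "\<forall>\<^sub>F Y in nhds x. dird e Y u = dird d Y u"
    using dird_cong_eventually2[OF assms] by eventually_elim simp
  from dird_cong_eventually[OF this smooth_at_differentiable[OF smooth_at_dird[OF assms(2)]]]
  show ?thesis by (simp add: hess_def)
qed

context hermitian_chart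
begin

lemma smooth_at_delbar:
  assumes x: "x \<in> S" and f: "smooth_at x f"
  shows "smooth_at x (\<lambda>y. delbar I f y v)"
proof -
  have "smooth_at x (\<lambda>y. I y v)" by (rule smooth_on_imp_smooth_at[OF S I_smooth x])
  then have "smooth_at x (\<lambda>y. (1/2) *\<^sub>R complex_of_real (dird f y v) + (1/2) *\<^sub>R (\<i> * complex_of_real (dird f y (I y v))))"
    by (intro smooth_at_add smooth_at_bounded_linear[OF bounded_linear_scaleR_right]
      smooth_at_bounded_linear[OF bounded_linear_mult_right] smooth_at_bounded_linear[OF bounded_linear_of_real]
      smooth_at_dird f smooth_at_dird_field)
  then show ?thesis by (simp add: delbar_def scaleR_conv_of_real field_simps)
qed

lemma del_delbar_diff:
  assumes x: "x \<in> S" and f: "smooth_at x f" and h: "smooth_at x h"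
  shows "del_delbar I (\<lambda>y. f y - h y) x a b = del_delbar I f x a b - del_delbar I h x a b"
proof -
  have d: "dird (\<lambda>y. delbar I (\<lambda>y. f y - h y) y v) x w = dird (\<lambda>y. delbar I f y v) x w - dird (\<lambda>y. delbar I h y v) x w" for v w
  proof -
    have "\<forall>\<^sub>F y in nhds x. delbar I (\<lambda>y. f y - h y) y v = delbar I f y v - delbar I h y v"
      using smooth_at_eventually[OF f] smooth_at_eventually[OF h]
      by eventually_elim (simp add: delbar_def dird_diff smooth_at_differentiable field_simps)
    from dird_cong_eventually[OF this smooth_at_differentiable[OF smooth_at_delbar[OF x smooth_at_diff[OF f h]]]]
    show ?thesis
      by (simp add: dird_diff[OF smooth_at_differentiable[OF smooth_at_delbar[OF x f]] smooth_at_differentiable[OF smooth_at_delbar[OF x h]]])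
  qed
  show ?thesis by (simp add: del_delbar_def ext_d_def d field_simps)
qed

end

locale anchored = hermitian_chart "\<phi> ` U" G I
  for \<phi> :: "'m \<Rightarrow> 'a::euclidean_space" and U :: "'m set" and G I +
  fixes q :: 'm and k :: "'a \<Rightarrow> 'm" and B :: "'a set"
  assumes inj: "inj_on \<phi> U" and ha: "holomorphic_anchored (U, \<phi>) I q B k"
begin

definition K :: "'a \<Rightarrow> 'a" where "K = \<phi> \<circ> k"
definition \<kappa> :: "'a \<Rightarrow> 'a" where "\<kappa> = inv_into B K"

lemma zero_B: "0 \<in> B" and k_U: "X \<in> B \<Longrightarrow> k X \<in> U" and k_0: "k 0 = q"
  and K_hol: "X \<in> B \<Longrightarrow> dird K X (I (\<phi> q) u) = I (K X) (dird K X u)"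
  and K_diffeo: "diffeo B K" and dK_0: "(K has_derivative id) (at 0)"
  using ha by (auto simp: holomorphic_anchored_def K_def)

lemma B_open: "open B" and KB_open: "open (K ` B)" and K_inj: "inj_on K B"
  and K_smooth_on: "smooth_on K B" and \<kappa>_smooth_on: "smooth_on \<kappa> (K ` B)"
  using K_diffeo by (auto simp: diffeo_def \<kappa>_def)

lemma q_U: "q \<in> U" using k_U[OF zero_B] k_0 by simp
lemma K_0: "K 0 = \<phi> q" by (simp add: K_def k_0)
lemma K_S: "X \<in> B \<Longrightarrow> K X \<in> \<phi> ` U" using k_U by (simp add: K_def)
lemma q_S: "\<phi> q \<in> \<phi> ` U" using q_U by simp
lemma dird_K_0: "dird K 0 u = u" using dird_eqI[OF dK_0] by simp
lemma K_smooth: "X \<in> B \<Longrightarrow> smooth_at X K" by (rule smooth_on_imp_smooth_at[OF B_open K_smooth_on])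
lemma \<kappa>_smooth: "z \<in> K ` B \<Longrightarrow> smooth_at z \<kappa>" by (rule smooth_on_imp_smooth_at[OF KB_open \<kappa>_smooth_on])
lemma \<kappa>_K: "X \<in> B \<Longrightarrow> \<kappa> (K X) = X" by (simp add: \<kappa>_def K_inj)
lemma K_\<kappa>: "z \<in> K ` B \<Longrightarrow> K (\<kappa> z) = z" by (simp add: \<kappa>_def f_inv_into_f)
lemma \<kappa>_B: "z \<in> K ` B \<Longrightarrow> \<kappa> z \<in> B" by (simp add: \<kappa>_def inv_into_into)
lemma inv_\<phi>_K: "X \<in> B \<Longrightarrow> inv_into U \<phi> (K X) = k X" by (simp add: K_def inj k_U)

lemma dird_\<kappa>_K: "X \<in> B \<Longrightarrow> dird \<kappa> (K X) (dird K X u) = u"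
proof -
  assume X: "X \<in> B"
  have "dird (\<lambda>X. \<kappa> (K X)) X u = dird \<kappa> (K X) (dird K X u)"
    by (rule dird_compose(1)[OF smooth_at_differentiable[OF \<kappa>_smooth[OF imageI[OF X]]] smooth_at_differentiable[OF K_smooth[OF X]]])
  moreover have "dird (\<lambda>X. X) X = dird (\<lambda>X. \<kappa> (K X)) X"
    by (rule dird_cong(1)[OF B_open X]) (auto simp: \<kappa>_K)
  then have "dird (\<lambda>X. \<kappa> (K X)) X u = u" by (metis frechet_derivative_ident)
  ultimately show ?thesis by simp
qed

lemma dird_K_\<kappa>: "z \<in> K ` B \<Longrightarrow> dird K (\<kappa> z) (dird \<kappa> z v) = v"
proof -
  assume z: "z \<in> K ` B"
  have "dird (\<lambda>z. K (\<kappa> z)) z v = dird K (\<kappa> z) (dird \<kappa> z v)"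
    by (rule dird_compose(1)[OF smooth_at_differentiable[OF K_smooth[OF \<kappa>_B[OF z]]] smooth_at_differentiable[OF \<kappa>_smooth[OF z]]])
  moreover have "dird (\<lambda>z. z) z = dird (\<lambda>z. K (\<kappa> z)) z"
    by (rule dird_cong(1)[OF KB_open z]) (auto simp: K_\<kappa>)
  then have "dird (\<lambda>z. K (\<kappa> z)) z v = v" by (metis frechet_derivative_ident)
  ultimately show ?thesis by simp
qed

lemma \<kappa>_hol:
  assumes z: "z \<in> K ` B"
  shows "dird \<kappa> z (I z v) = I (\<phi> q) (dird \<kappa> z v)"
proof -
  have "dird \<kappa> z (I z (dird K (\<kappa> z) (dird \<kappa> z v))) = dird \<kappa> (K (\<kappa> z)) (dird K (\<kappa> z) (I (\<phi> q) (dird \<kappa> z v)))"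
    using K_hol[OF \<kappa>_B[OF z], of "dird \<kappa> z v"] by (simp add: K_\<kappa>[OF z])
  then show ?thesis by (simp add: dird_K_\<kappa>[OF z] dird_\<kappa>_K[OF \<kappa>_B[OF z]])
qed

lemma linear_dird_K: "X \<in> B \<Longrightarrow> linear (dird K X)"
  by (rule linear_dird[OF smooth_at_differentiable[OF K_smooth]])

end

text \<open>Only the domain \<open>B\<close> at the center is fixed here. Domains at the other
  points are chosen one by one from \<open>normal_at\<close>, as their dependence on the point is
  not controlled.\<close>

locale kaehler_normal_chart = anchored \<phi> U G I p "knc p" B
  for \<phi> :: "'m \<Rightarrow> 'a::euclidean_space" and U :: "'m set" and G I and p :: 'm and knc :: "'m \<Rightarrow> 'a \<Rightarrow> 'm" and B +
  fixes \<theta>loc :: "'m \<Rightarrow> 'm \<Rightarrow> real"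
  assumes pot: "local_potential_on (K ` B) G I (\<theta>loc p \<circ> inv_into U \<phi>)"
    and normal_at: "\<And>q. q \<in> U \<Longrightarrow> kaehler_normal (U, \<phi>) G I q (knc q) (\<theta>loc q)"
begin

definition F :: "'a \<Rightarrow> real" where "F = \<theta>loc p \<circ> knc p"
text \<open>Normal coordinates at the moving point, read in those at \<open>p\<close>. The tangent
  space at the moving point is identified with the model space by the chart \<open>\<phi>\<close>;
  inserting \<open>dird K x\<close> passes to the identification by the normal coordinates at
  \<open>p\<close>, which makes the derivative at 0 the identity.\<close>

definition \<psi> :: "'a \<Rightarrow> 'a \<Rightarrow> 'a" where "\<psi> x Y = \<kappa> (\<phi> (knc (knc p x) (dird K x Y)))"
definition f :: "'a \<Rightarrow> 'a \<Rightarrow> real" where "f x Y = \<theta>loc (knc p x) (knc (knc p x) (dird K x Y))"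
definition h :: "'a \<Rightarrow> 'a \<Rightarrow> 'a \<Rightarrow> real" where "h x u v = G (K x) (dird K x u) (dird K x v)"

lemma F_smooth: "x \<in> B \<Longrightarrow> smooth_at x F"
proof -
  have "smooth_on (\<lambda>X. (\<theta>loc p \<circ> inv_into U \<phi>) (K X)) B"
  proof (rule smooth_on_compose[where f="\<theta>loc p \<circ> inv_into U \<phi>" and T="K ` B", OF B_open _ K_smooth_on])
    show "smooth_on (\<theta>loc p \<circ> inv_into U \<phi>) (K ` B)" using pot unfolding local_potential_on_def by blast
  qed simp
  then have "smooth_on F B"
    by (rule smooth_on_cong[OF B_open]) (simp add: F_def inv_\<phi>_K)
  then show "x \<in> B \<Longrightarrow> smooth_at x F" by (rule smooth_on_imp_smooth_at[OF B_open])
qed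

text \<open>All conditions of \<open>normal_family\<close> at the point \<open>x\<close> are shown
  together because they refer to the same auxiliary domain \<open>B'\<close> of the normal
  coordinates there.\<close>

lemma family_at:
  assumes x: "x \<in> B"
  shows "smooth_at 0 (\<psi> x) \<and> \<psi> x 0 = x \<and> (\<forall>u. dird (\<psi> x) 0 u = u) \<and>
    (\<forall>\<^sub>F Y in nhds 0. \<forall>u. dird (\<psi> x) Y (I (\<phi> p) u) = I (\<phi> p) (dird (\<psi> x) Y u)) \<and> smooth_at 0 (f x) \<and>
    (\<forall>\<^sub>F Y in nhds 0. \<forall>u v. hess (\<lambda>Y. f x Y - F (\<psi> x Y)) Y (I (\<phi> p) u) (I (\<phi> p) v) = - hess (\<lambda>Y. f x Y - F (\<psi> x Y)) Y u v) \<and>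
    (\<forall>n. cstruct.bideg (I (\<phi> p)) ge22 n (\<lambda>X. taylor (f x) n X - (if n = 2 then h x X X else 0)))"
proof -
  let ?q = "knc p x" and ?A = "dird K x"
  have qU: "?q \<in> U" by (rule k_U[OF x])
  obtain B' where B': "holomorphic_anchored (U, \<phi>) I ?q B' (knc ?q)"
    "local_potential_on (\<phi> ` knc ?q ` B') G I (\<theta>loc ?q \<circ> inv_into U \<phi>)"
    "only_bidegrees (I (\<phi> ?q)) ge22 (\<lambda>n X. taylor (\<theta>loc ?q \<circ> knc ?q) n X - (if n = 2 then G (\<phi> ?q) X X else 0))"
    using normal_at[OF qU] by (auto simp: kaehler_normal_def)
  interpret Q: anchored \<phi> U G I ?q "knc ?q" B'
    by unfold_locales (fact inj, fact B'(1))
  have Kx: "\<phi> ?q = K x" by (simp add: K_def)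
  have blA: "bounded_linear ?A" using linear_dird_K[OF x] linear_conv_bounded_linear by blast
  have A0: "?A 0 = 0" by (rule linear_0[OF linear_dird_K[OF x]])
  have sA: "smooth_at Y ?A" for Y by (rule smooth_at_linear[OF blA])
  have dA: "dird ?A Y u = ?A u" for Y u by (rule dird_eqI[OF bounded_linear_imp_has_derivative[OF blA]])
  have AI: "?A (I (\<phi> p) u) = I (\<phi> ?q) (?A u)" for u using K_hol[OF x] by (simp add: Kx)
  \<comment> \<open>The reparametrized normal coordinates at the moving point, read in the chart
    \<open>\<phi>\<close>. The two potentials are compared there, where both satisfy the equation of
    a local potential for the same metric.\<close>
  define g where "g Y = Q.K (?A Y)" for Y
  have \<psi>_eq: "\<psi> x = (\<lambda>Y. \<kappa> (g Y))" by (rule ext) (simp add: \<psi>_def g_def Q.K_def)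
  have sg: "smooth_at Y g" if "?A Y \<in> B'" for Y
    unfolding g_def by (rule smooth_at_compose[OF Q.K_smooth[OF that] sA])
  have A0B: "?A 0 \<in> B'" using A0 Q.zero_B by simp
  note sg0 = sg[OF A0B]
  have g0: "g 0 = K x" by (simp add: g_def A0 Q.K_0 Kx)
  have evA: "\<forall>\<^sub>F Y in nhds 0. ?A Y \<in> B'"
    by (rule smooth_at_compose_eventually[OF sA eventually_nhds_in_open[OF Q.B_open A0B]])
  have evg: "\<forall>\<^sub>F Y in nhds 0. g Y \<in> K ` B"
    by (rule smooth_at_compose_eventually[OF sg0 eventually_nhds_in_open[OF KB_open]]) (use g0 x in auto)
  have dg: "dird g Y u = dird Q.K (?A Y) (?A u)" if "?A Y \<in> B'" for Y u
    unfolding g_def using dird_compose(1)[of Q.K ?A Y u] smooth_at_differentiable[OF Q.K_smooth[OF that]] smooth_at_differentiable[OF sA]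
    by (simp add: dA)
  have hol_g: "dird g Y (I (\<phi> p) u) = I (g Y) (dird g Y u)" if "?A Y \<in> B'" for Y u
    using Q.K_hol[OF that] by (simp add: dg[OF that] AI g_def)
  have d\<psi>: "dird (\<psi> x) Y u = dird \<kappa> (g Y) (dird g Y u)" if "?A Y \<in> B'" "g Y \<in> K ` B" for Y u
    unfolding \<psi>_eq by (rule dird_compose(1)[OF smooth_at_differentiable[OF \<kappa>_smooth[OF that(2)]] smooth_at_differentiable[OF sg[OF that(1)]]])
  have g0K: "g 0 \<in> K ` B" using g0 x by simp
  have s\<psi>: "smooth_at 0 (\<psi> x)"
    unfolding \<psi>_eq by (rule smooth_at_compose[OF \<kappa>_smooth[OF g0K] sg0])
  have \<psi>0: "\<psi> x 0 = x" by (simp add: \<psi>_eq g0 \<kappa>_K[OF x])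
  have \<psi>1: "dird (\<psi> x) 0 u = u" for u
    using d\<psi>[OF A0B g0K, of u] dg[OF A0B, of u] by (simp add: A0 Q.dird_K_0 g0 dird_\<kappa>_K[OF x])
  have \<psi>hol: "\<forall>\<^sub>F Y in nhds 0. \<forall>u. dird (\<psi> x) Y (I (\<phi> p) u) = I (\<phi> p) (dird (\<psi> x) Y u)"
    using evA evg by eventually_elim (simp add: d\<psi> hol_g \<kappa>_hol)
  let ?uq = "\<theta>loc ?q \<circ> inv_into U \<phi>" and ?up = "\<theta>loc p \<circ> inv_into U \<phi>"
  have QB: "\<phi> ` knc ?q ` B' = Q.K ` B'" by (simp add: Q.K_def image_comp)
  have suq: "smooth_on ?uq (Q.K ` B')" and sup: "smooth_on ?up (K ` B)"
    using B'(2) pot by (simp_all add: local_potential_on_def QB)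
  have f_eq: "f x Y = ?uq (g Y)" if "?A Y \<in> B'" for Y
    using Q.inv_\<phi>_K[OF that] by (simp add: f_def g_def)
  have gT: "g Y \<in> Q.K ` B'" if "?A Y \<in> B'" for Y using that by (simp add: g_def)
  have suqg: "smooth_at Y (\<lambda>Y. ?uq (g Y))" if "?A Y \<in> B'" for Y
    by (rule smooth_at_compose[OF smooth_on_imp_smooth_at[OF Q.KB_open suq gT[OF that]] sg[OF that]])
  have sf: "smooth_at 0 (f x)"
    by (rule smooth_at_cong[OF suqg[OF A0B]], use evA in eventually_elim) (simp add: f_eq)
  let ?T = "K ` B \<inter> Q.K ` B'"
  define u where "u z = ?uq z - ?up z" for z
  have oT: "open ?T" by (intro open_Int KB_open Q.KB_open)
  have su: "smooth_on u ?T"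
    unfolding u_def by (intro smooth_on_diff oT smooth_on_subset[OF suq] smooth_on_subset[OF sup]) auto
  have TS: "?T \<subseteq> \<phi> ` U" using K_S by auto
  have dd: "del_delbar I u z a b = 0" if z: "z \<in> ?T" for z a b
  proof -
    have "complex_of_real (G z (I z a) b) = (\<i> / 2) * del_delbar I ?uq z a b"
      using B'(2) z unfolding local_potential_on_def QB by blast
    moreover have "complex_of_real (G z (I z a) b) = (\<i> / 2) * del_delbar I ?up z a b"
      using pot z unfolding local_potential_on_def by blast
    ultimately have "del_delbar I ?uq z a b = del_delbar I ?up z a b" by simp
    moreover have "del_delbar I u z a b = del_delbar I ?uq z a b - del_delbar I ?up z a b"
      unfolding u_def using z TS
      by (intro del_delbar_diff smooth_on_imp_smooth_at[OF Q.KB_open suq] smooth_on_imp_smooth_at[OF KB_open sup]) auto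
    ultimately show ?thesis by simp
  qed
  have Ip: "I (\<phi> p) (I (\<phi> p) a) = - a" for a using I_I[OF q_S] .
  define d where "d Y = f x Y - F (\<psi> x Y)" for Y
  have d_eq: "\<forall>\<^sub>F Y in nhds 0. u (g Y) = d Y"
    using evA evg
  proof eventually_elim
    case (elim Y)
    have "F (\<psi> x Y) = ?up (g Y)"
      using inv_\<phi>_K[OF \<kappa>_B[OF elim(2)]] by (simp add: \<psi>_eq F_def K_\<kappa>[OF elim(2)])
    then show ?case by (simp only: d_def u_def f_eq[OF elim(1)])
  qed
  \<comment> \<open>The Hessian at \<open>Y\<close> depends on a neighbourhood of \<open>Y\<close>,
    so the identities are needed in the iterated form, near \<open>Y\<close> for all
    \<open>Y\<close> near 0.\<close>
  have ph: "\<forall>\<^sub>F Y in nhds 0. \<forall>a b. hess d Y (I (\<phi> p) a) (I (\<phi> p) b) = - hess d Y a b"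
    using d_eq[THEN eventually_eventually[THEN iffD2]] evA[THEN eventually_eventually[THEN iffD2]] evg
  proof eventually_elim
    case (elim Y)
    have AY: "?A Y \<in> B'" using elim(2) eventually_nhds_x_imp_x by blast
    have gY: "g Y \<in> ?T" using elim(3) gT[OF AY] by blast
    have sug: "smooth_at Y (\<lambda>Y. u (g Y))"
      by (rule smooth_at_compose[OF smooth_on_imp_smooth_at[OF oT su gY] sg[OF AY]])
    have "hess (\<lambda>Y. u (g Y)) Y (I (\<phi> p) a) (I (\<phi> p) b) = - hess (\<lambda>Y. u (g Y)) Y a b" for a b
    proof (rule pluriharmonic_pullback[OF oT su _ _ dd sg[OF AY] gY Ip])
      show "smooth_on (\<lambda>x. I x v) ?T" for v by (rule smooth_on_subset[OF I_smooth TS])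
      show "z \<in> ?T \<Longrightarrow> linear (I z)" for z using TS by (intro I_linear) auto
      show "\<forall>\<^sub>F Y in nhds Y. \<forall>a. dird g Y (I (\<phi> p) a) = I (g Y) (dird g Y a)"
        using elim(2) by eventually_elim (simp add: hol_g)
    qed
    then show ?case unfolding hess_cong[OF elim(1) sug] by blast
  qed
  have nrm: "cstruct.bideg (I (\<phi> p)) ge22 n (\<lambda>X. taylor (f x) n X - (if n = 2 then h x X X else 0))" for n
  proof -
    have c: "cstruct (I (\<phi> ?q))" "cstruct (I (\<phi> p))" by (rule cstruct_I[OF Q.q_S], rule cstruct_I[OF q_S])
    have "cstruct.bideg (I (\<phi> ?q)) ge22 n (\<lambda>X. taylor (\<theta>loc ?q \<circ> knc ?q) n X - (if n = 2 then G (\<phi> ?q) X X else 0))"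
      using B'(3) by (simp add: cstruct.only_bidegrees_iff_sp[OF c(1)])
    from bideg_linear_subst[OF c this linear_dird_K[OF x] AI]
    have "cstruct.bideg (I (\<phi> p)) ge22 n (\<lambda>X. taylor (\<theta>loc ?q \<circ> knc ?q) n (?A X) - (if n = 2 then G (\<phi> ?q) (?A X) (?A X) else 0))" .
    moreover have "taylor (f x) n X = taylor (\<theta>loc ?q \<circ> knc ?q) n (?A X)" for X
      unfolding f_def[abs_def] by (subst taylor_linear_subst[OF linear_dird_K[OF x], symmetric]) (simp add: o_def)
    ultimately show ?thesis by (simp add: h_def Kx cong: if_cong)
  qed
  show ?thesis using s\<psi> \<psi>0 \<psi>1 \<psi>hol sf ph nrm unfolding d_def by blast
qed

lemma normal_family: "normal_family (I (\<phi> p)) (G (\<phi> p)) B F \<psi> f h"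
proof (intro normal_family.intro hermitian_G[OF q_S] normal_family_axioms.intro)
  have ev: "\<forall>\<^sub>F Y in nhds 0. Y \<in> B" by (rule eventually_nhds_in_open[OF B_open zero_B])
  show "\<forall>\<^sub>F Y in nhds 0. \<psi> 0 Y = Y"
    using ev by eventually_elim (simp add: \<psi>_def k_0 dird_K_0 \<kappa>_K flip: K_def[THEN fun_cong, simplified])
  show "\<forall>\<^sub>F Y in nhds 0. f 0 Y = F Y"
    by (simp add: f_def F_def k_0 dird_K_0)
  show "h 0 = G (\<phi> p)"
    by (intro ext) (simp add: h_def K_0 dird_K_0)
  show "bilinear (h x)" if x: "x \<in> B" for x
    unfolding bilinear_def
  proof (intro conjI allI)
    fix u
    have "linear (G (K x) (dird K x u))" "linear (\<lambda>v. G (K x) v (dird K x u))"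
      using G_bilinear[OF K_S[OF x]] by (simp_all add: bilinear_def)
    from this[THEN linear_compose[OF linear_dird_K[OF x]]]
    show "linear (h x u)" "linear (\<lambda>v. h x v u)" by (simp_all add: h_def[abs_def] o_def)
  qed
  show "h x u v = h x v u" if "x \<in> B" for x u v
    unfolding h_def by (rule G_sym[OF K_S[OF that]])
  show "h x (I (\<phi> p) u) (I (\<phi> p) v) = h x u v" if "x \<in> B" for x u v
    by (simp add: h_def K_hol[OF that] I_G[OF K_S[OF that]])
qed (use B_open zero_B F_smooth family_at in auto)

end

section \<open>Derivatives of the normal coordinates and the normal potential\<close>

context kaehler_normal_chart
begin

sublocale NF: normal_family "I (\<phi> p)" "G (\<phi> p)" B F \<psi> f h
  by (rule normal_family)

abbreviation "y0 \<equiv> \<phi> p"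

lemma y0_KB: "y0 \<in> K ` B"
  using zero_B K_0 by (metis imageI)

lemma \<kappa>_y0: "\<kappa> y0 = 0"
  using \<kappa>_K[OF zero_B] by (simp add: K_0)

lemma dird_\<kappa>_y0: "dird \<kappa> y0 u = u"
  using dird_\<kappa>_K[OF zero_B, of u] by (simp add: K_0 dird_K_0)

lemma \<kappa>_has_derivative: "(\<kappa> has_derivative (\<lambda>Z. Z)) (at y0)"
  using smooth_at_has_derivative[OF \<kappa>_smooth[OF y0_KB]] dird_\<kappa>_y0 by (metis ext)

lemma dird_\<kappa>_has_derivative:
  "((\<lambda>y. dird \<kappa> y u) has_derivative dird (\<lambda>y. dird \<kappa> y u) y0) (at y0)"
  by (rule smooth_at_has_derivative[OF smooth_at_dird[OF \<kappa>_smooth[OF y0_KB]]])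

text \<open>In Kaehler normal coordinates the first derivatives of the metric vanish at the center,
  so the Christoffel symbols of the chart are the second derivatives of \<open>\<kappa>\<close>.\<close>

lemma christoffel_eq: "christoffel G y0 u v = dird (\<lambda>y. dird \<kappa> y v) y0 u"
proof (rule christoffel_eqI[OF q_S])
  define H where "H w u = dird (\<lambda>y. dird \<kappa> y u) y0 w" for w u
  have Hsym: "H w u = H u w" for u w
    unfolding H_def by (rule smooth_at_dird_commute[OF \<kappa>_smooth[OF y0_KB]])
  have ev: "\<forall>\<^sub>F y in nhds y0. y \<in> K ` B" by (rule eventually_nhds_in_open[OF KB_open y0_KB])
  have dh: "(\<lambda>x. h x u v) differentiable (at (\<kappa> y0))" for u v
    using NF.h_has_derivative[of u v] \<kappa>_y0 by (auto simp: differentiable_def)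
  \<comment> \<open>The metric in the chart is \<open>h\<close> pulled back by
    \<open>\<kappa>\<close>. As \<open>h\<close> is stationary at the center, only the derivatives
    of \<open>dird \<kappa>\<close> in its two arguments survive.\<close>
  have dG: "dird (\<lambda>y. G y u v) y0 w = G y0 (H w u) v + G y0 u (H w v)" for u v w
  proof -
    have "((\<lambda>y. h (\<kappa> y) (dird \<kappa> y u) (dird \<kappa> y v)) has_derivative
       (\<lambda>w. dird (\<lambda>x. h x (dird \<kappa> y0 u) (dird \<kappa> y0 v)) (\<kappa> y0) w + h (\<kappa> y0) (H w u) (dird \<kappa> y0 v) + h (\<kappa> y0) (dird \<kappa> y0 u) (H w v))) (at y0)"
      unfolding H_def
      by (rule has_derivative_bilinear_family[OF B_open NF.h _ dh \<kappa>_has_derivative dird_\<kappa>_has_derivative dird_\<kappa>_has_derivative])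
        (simp_all add: \<kappa>_y0 zero_B)
    then have "((\<lambda>y. G y u v) has_derivative
       (\<lambda>w. dird (\<lambda>x. h x (dird \<kappa> y0 u) (dird \<kappa> y0 v)) (\<kappa> y0) w + h (\<kappa> y0) (H w u) (dird \<kappa> y0 v) + h (\<kappa> y0) (dird \<kappa> y0 u) (H w v))) (at y0)"
      by (rule has_derivative_cong_nhds, use ev in eventually_elim) (simp add: h_def K_\<kappa> dird_K_\<kappa>)
    from dird_eqI[OF this, of w] show ?thesis
      using dird_eqI[OF NF.h_has_derivative] by (simp add: \<kappa>_y0 dird_\<kappa>_y0 NF.base(3))
  qed
  fix z
  show "2 * G y0 (dird (\<lambda>y. dird \<kappa> y v) y0 u) z =
     dird (\<lambda>y. G y v z) y0 u + dird (\<lambda>y. G y u z) y0 v - dird (\<lambda>y. G y u v) y0 z"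
    using Hsym[of u v] Hsym[of u z] Hsym[of v z] G_sym[OF q_S, of v "H u z"]
    by (simp add: dG flip: H_def)
qed

lemma taylor_f_eq: "taylor (f x) n Y = taylor (\<theta>loc (knc p x) \<circ> knc (knc p x)) n (dird K x Y)" if "x \<in> B" for x
  unfolding f_def[abs_def] by (subst taylor_linear_subst[OF linear_dird_K[OF that], symmetric]) (simp add: o_def)

lemma taylor_f_0: "taylor (f 0) n = taylor F n"
  by (rule ext) (rule taylor_cong[OF NF.base(2)])

text \<open>In chart coordinates the potential at \<open>y\<close> is
  \<open>taylor (f (\<kappa> y)) n\<close> evaluated at \<open>dird \<kappa> y X\<close>. Besides
  the derivative of the family, the moving argument contributes a Christoffel term, the one
  subtracted again in the covariant derivative.\<close>

lemma normal_potential_has_derivative: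
  "((\<lambda>y. taylor (\<theta>loc (inv_into U \<phi> y) \<circ> knc (inv_into U \<phi> y)) n X) has_derivative
     (\<lambda>Z. NF.bideg_proj ge22 n (contract Z NF.\<theta>f n) X - (1/2) * derivation (NF.closure_field NF.\<theta>f Z) NF.\<theta>f n X
        + dird (taylor F n) X (christoffel G y0 Z X))) (at y0)"
proof -
  define R where "R Z Y = NF.bideg_proj ge22 n (contract Z NF.\<theta>f n) Y - (1/2) * derivation (NF.closure_field NF.\<theta>f Z) NF.\<theta>f n Y" for Z Y
  have "((\<lambda>y. taylor (f (\<kappa> y)) n Y) has_derivative (\<lambda>Z. R Z Y)) (at y0)" for Y
    using has_derivative_compose[OF \<kappa>_has_derivative, of "\<lambda>x. taylor (f x) n Y" "\<lambda>Z. R Z Y"]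
      NF.taylor_f_has_derivative[of n Y] unfolding R_def \<kappa>_y0 by simp
  from has_derivative_hom_poly_family[where P="\<lambda>y. taylor (f (\<kappa> y)) n", OF KB_open y0_KB _ this dird_\<kappa>_has_derivative[of X]]
  have "((\<lambda>y. taylor (f (\<kappa> y)) n (dird \<kappa> y X)) has_derivative
     (\<lambda>Z. R Z (dird \<kappa> y0 X) + dird (taylor (f (\<kappa> y0)) n) (dird \<kappa> y0 X) (dird (\<lambda>y. dird \<kappa> y X) y0 Z))) (at y0)"
    using hom_poly_taylor[OF NF.f[OF \<kappa>_B]] by blast
  then have "((\<lambda>y. taylor (f (\<kappa> y)) n (dird \<kappa> y X)) has_derivative (\<lambda>Z. R Z X + dird (taylor F n) X (christoffel G y0 Z X))) (at y0)"
    by (simp add: dird_\<kappa>_y0 \<kappa>_y0 taylor_f_0 christoffel_eq)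
  then show ?thesis
    unfolding R_def
  proof (rule has_derivative_cong_nhds, use eventually_nhds_in_open[OF KB_open y0_KB] in eventually_elim)
    case (elim y)
    have "inv_into U \<phi> y = knc p (\<kappa> y)" using inv_\<phi>_K[OF \<kappa>_B[OF elim]] by (simp add: K_\<kappa>[OF elim])
    then show ?case by (simp add: taylor_f_eq[OF \<kappa>_B[OF elim]] dird_K_\<kappa>[OF elim])
  qed
qed

text \<open>The transport equation is given for each initial vector separately; homogeneity follows
  from uniqueness of solutions. It is required because Taylor components in \<open>X\<close> are
  computed along rays, whose points are transported one at a time.\<close>

lemma transport_scale:
  assumes ct: "curve_with_transport (U, \<phi>) G p Z \<gamma> PT"
  shows "\<exists>\<epsilon>>0. \<forall>t\<in>{-\<epsilon><..<\<epsilon>}. \<gamma> t \<in> U \<and> isCont (\<phi> \<circ> \<gamma>) t \<and> (\<forall>s X. PT t (s *\<^sub>R X) = s *\<^sub>R PT t X)"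
proof -
  obtain \<epsilon> where e: "\<epsilon> > 0" and U: "\<gamma> ` {-\<epsilon><..<\<epsilon>} \<subseteq> U" and sm: "smooth_on (\<phi> \<circ> \<gamma>) {-\<epsilon><..<\<epsilon>}"
    and PT0: "\<And>X. PT 0 X = X"
    and PT: "\<And>X t. t \<in> {-\<epsilon><..<\<epsilon>} \<Longrightarrow> ((\<lambda>s. PT s X) has_vector_derivative
               - christoffel G (\<phi> (\<gamma> t)) (vector_derivative (\<phi> \<circ> \<gamma>) (at t)) (PT t X)) (at t)"
    using ct by (auto simp: curve_with_transport_def)
  have d: "(\<phi> \<circ> \<gamma>) differentiable (at t)" if "t \<in> {-\<epsilon><..<\<epsilon>}" for t
    by (rule smooth_on_imp_differentiable[OF sm that])
  have S: "(\<phi> \<circ> \<gamma>) t \<in> \<phi> ` U" if "t \<in> {-\<epsilon><..<\<epsilon>}" for t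
    using imageI[OF that, of \<gamma>] U by (metis comp_apply imageI subsetD)
  have "PT t (s *\<^sub>R X) - s *\<^sub>R PT t X = 0" if t: "t \<in> {-\<epsilon><..<\<epsilon>}" for t s X
  proof (rule parallel_field_zero[OF t, where c="\<phi> \<circ> \<gamma>" and c'="\<lambda>t. vector_derivative (\<phi> \<circ> \<gamma>) (at t)"])
    fix r assume r: "r \<in> {-\<epsilon><..<\<epsilon>}"
    show "(\<phi> \<circ> \<gamma>) r \<in> \<phi> ` U \<and> ((\<phi> \<circ> \<gamma>) has_vector_derivative vector_derivative (\<phi> \<circ> \<gamma>) (at r)) (at r)"
      using S[OF r] d[OF r] vector_derivative_works by blast
    let ?\<Gamma> = "christoffel G (\<phi> (\<gamma> r)) (vector_derivative (\<phi> \<circ> \<gamma>) (at r))"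
    have lin: "linear ?\<Gamma>" using christoffel_linear[OF S[OF r]] by simp
    have "((\<lambda>t. PT t (s *\<^sub>R X) - s *\<^sub>R PT t X) has_vector_derivative - ?\<Gamma> (PT r (s *\<^sub>R X)) - s *\<^sub>R (- ?\<Gamma> (PT r X))) (at r)"
      using PT[OF r, of "s *\<^sub>R X"] bounded_linear.has_vector_derivative[OF bounded_linear_scaleR_right PT[OF r, of X], of s]
      by (intro has_vector_derivative_diff) auto
    then show "((\<lambda>t. PT t (s *\<^sub>R X) - s *\<^sub>R PT t X) has_vector_derivative
        - christoffel G ((\<phi> \<circ> \<gamma>) r) (vector_derivative (\<phi> \<circ> \<gamma>) (at r)) (PT r (s *\<^sub>R X) - s *\<^sub>R PT r X)) (at r)"
      by (simp add: linear_diff[OF lin] linear_scale[OF lin])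
  qed (simp add: PT0)
  then show ?thesis
    using e U differentiable_imp_continuous_within[OF d] by (intro exI[of _ \<epsilon>]) auto
qed

text \<open>In terms of the family, the shift along a ray is
  \<open>\<psi> (x t) (s *\<^sub>R v t)\<close>, where \<open>x t\<close> is the coordinate of the
  moving point and \<open>v t\<close> the transported vector in normal coordinates. Since
  \<open>v\<close> is stationary at \<open>t = 0\<close>, only the derivative of the Taylor
  components of \<open>\<psi>\<close> in the base point remains.\<close>

lemma shift_has_derivative:
  assumes ct: "curve_with_transport (U, \<phi>) G p Z \<gamma> PT" and ha': "holomorphic_anchored (U, \<phi>) I p B' (knc p)"
  shows "((\<lambda>t. taylor (knc_shift knc p B' \<gamma> PT t) n X) has_vector_derivative NF.dpsi n Z X) (at 0)"
proof -
  interpret B': anchored \<phi> U G I p "knc p" B' by unfold_locales (fact inj, fact ha')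
  have KK: "B'.K = K" by (simp add: K_def B'.K_def)
  define c where "c = \<phi> \<circ> \<gamma>"
  obtain \<epsilon> where e: "\<epsilon> > 0" and scale: "\<And>t. t \<in> {-\<epsilon><..<\<epsilon>} \<Longrightarrow> \<gamma> t \<in> U \<and> isCont c t \<and> (\<forall>s X. PT t (s *\<^sub>R X) = s *\<^sub>R PT t X)"
    using transport_scale[OF ct] unfolding c_def by blast
  have PT0: "PT 0 X = X" for X using ct by (auto simp: curve_with_transport_def)
  have c0: "c 0 = y0" and c': "(c has_vector_derivative Z) (at 0)"
    using ct by (auto simp: curve_with_transport_def c_def)
  have PT': "((\<lambda>s. PT s X) has_vector_derivative - christoffel G y0 Z X) (at 0)" for X
  proof -
    obtain \<delta> where \<delta>: "\<delta> > 0" "\<And>X t. t \<in> {-\<delta><..<\<delta>} \<Longrightarrow> ((\<lambda>s. PT s X) has_vector_derivative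
        - christoffel G (\<phi> (\<gamma> t)) (vector_derivative (\<phi> \<circ> \<gamma>) (at t)) (PT t X)) (at t)"
      using ct by (auto simp: curve_with_transport_def)
    from \<delta>(2)[of 0 X] show ?thesis
      using \<delta>(1) c0 vector_derivative_at[OF c'] by (simp add: PT0 c_def)
  qed
  define x where "x t = \<kappa> (c t)" for t
  define v where "v t = dird \<kappa> (c t) (PT t X)" for t
  \<comment> \<open>The domains \<open>B\<close> and \<open>B'\<close> may differ; on
    \<open>T\<close> the two inverses of the normal coordinates coincide.\<close>
  define T where "T = K ` (B \<inter> B')"
  have T_eq: "T = {z \<in> K ` B. \<kappa> z \<in> B'}"
    unfolding T_def using \<kappa>_K K_\<kappa> \<kappa>_B by (auto simp: image_iff) 
  have T: "open T" "y0 \<in> T"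
  proof -
    have "open (K ` B \<inter> \<kappa> -` B')"
      by (rule continuous_open_preimage[OF smooth_on_continuous_on[OF \<kappa>_smooth_on] KB_open B'.B_open])
    moreover have "T = K ` B \<inter> \<kappa> -` B'" by (auto simp: T_eq)
    ultimately show "open T" by simp
    show "y0 \<in> T" using y0_KB \<kappa>_y0 B'.zero_B by (simp add: T_eq)
  qed
  have inv': "inv_into B' (knc p) m = \<kappa> (\<phi> m)" if m: "m \<in> U" "\<phi> m \<in> T" for m
  proof -
    obtain X' where X': "X' \<in> B" "X' \<in> B'" "\<phi> m = K X'" using m(2) by (auto simp: T_def)
    have "m = knc p X'" using inj_onD[OF inj, of m "knc p X'"] X' m(1) k_U by (simp add: K_def)
    moreover have "inj_on (knc p) B'" using B'.K_inj by (auto simp: B'.K_def intro: inj_on_imageI2)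
    ultimately show ?thesis using X' by (simp add: \<kappa>_K)
  qed
  have main: "taylor (knc_shift knc p B' \<gamma> PT t) n X = taylor (\<psi> (x t)) n (v t)"
    if t: "t \<in> {-\<epsilon><..<\<epsilon>}" "c t \<in> T" for t
  proof -
    have cKB: "c t \<in> K ` B" using t(2) by (simp add: T_eq)
    have \<gamma>U: "\<gamma> t \<in> U" using scale[OF t(1)] by blast
    obtain B'' where "holomorphic_anchored (U, \<phi>) I (\<gamma> t) B'' (knc (\<gamma> t))"
      using normal_at[OF \<gamma>U] by (auto simp: kaehler_normal_def)
    then interpret Q: anchored \<phi> U G I "\<gamma> t" "knc (\<gamma> t)" B'' by unfold_locales (rule inj)
    have kx: "knc p (x t) = \<gamma> t"
      using inv_\<phi>_K[OF \<kappa>_B[OF cKB]] \<gamma>U by (simp add: x_def K_\<kappa>[OF cKB]) (simp add: c_def inj)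
    have dKv: "dird K (x t) (s *\<^sub>R v t) = s *\<^sub>R PT t X" for s
      using linear_scale[OF linear_dird_K[OF \<kappa>_B[OF cKB]]] dird_K_\<kappa>[OF cKB] by (simp add: x_def v_def)
    have Q0: "Q.K 0 \<in> T" using t(2) by (simp add: Q.K_0 c_def)
    have "\<forall>\<^sub>F Y in nhds 0. Y \<in> B'' \<and> Q.K Y \<in> T"
      using eventually_nhds_in_open[OF Q.B_open Q.zero_B]
        smooth_at_compose_eventually[OF Q.K_smooth[OF Q.zero_B] eventually_nhds_in_open[OF T(1) Q0]]
      by eventually_elim simp
    from eventually_on_ray[OF this, of "PT t X"]
    have "\<forall>\<^sub>F s in nhds 0. knc_shift knc p B' \<gamma> PT t (s *\<^sub>R X) = \<psi> (x t) (s *\<^sub>R v t)"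
    proof eventually_elim
      case (elim s)
      let ?m = "knc (\<gamma> t) (s *\<^sub>R PT t X)"
      have "?m \<in> U" "\<phi> ?m \<in> T" using elim Q.k_U by (auto simp: Q.K_def)
      from inv'[OF this] show ?case
        using scale[OF t(1)] by (simp add: knc_shift_def \<psi>_def kx dKv)
    qed
    then show ?thesis unfolding taylor_eq_tc by (rule tc_cong)
  qed
  have cont: "isCont c 0" using scale[of 0] e by simp
  have ev: "\<forall>\<^sub>F t in nhds 0. t \<in> {-\<epsilon><..<\<epsilon>} \<and> c t \<in> T"
    using eventually_nhds_in_open[of "{-\<epsilon><..<\<epsilon>}" 0] isCont_eventually[OF cont eventually_nhds_in_open[OF T(1)]] T(2) e
    by (auto simp: c0 eventually_conj_iff)
  then obtain Nt where Nt: "open Nt" "0 \<in> Nt" "\<And>t. t \<in> Nt \<Longrightarrow> t \<in> {-\<epsilon><..<\<epsilon>} \<and> c t \<in> T"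
    by (auto simp: eventually_nhds)
  have xB: "x t \<in> B" if "t \<in> Nt" for t
    using Nt(3)[OF that] \<kappa>_B by (simp add: x_def T_eq)
  have cd: "(c has_derivative (\<lambda>s. s *\<^sub>R Z)) (at 0)" using c' by (simp add: has_vector_derivative_def)
  have x0: "x 0 = 0" by (simp add: x_def c0 \<kappa>_y0)
  have xd: "(x has_derivative (\<lambda>s. s *\<^sub>R Z)) (at 0)"
    unfolding x_def using has_derivative_compose[OF cd, of \<kappa>] \<kappa>_has_derivative by (simp add: c0)
  \<comment> \<open>The transport equation contributes the Christoffel term with a minus sign, the
    variation of \<open>dird \<kappa>\<close> the same term with a plus sign.\<close>
  have vd: "(v has_derivative (\<lambda>s. 0)) (at 0)"
  proof -
    have "(v has_derivative (\<lambda>s. dird (\<lambda>y. dird \<kappa> y (PT 0 X)) (c 0) (s *\<^sub>R Z) + dird \<kappa> (c 0) (s *\<^sub>R - christoffel G y0 Z X))) (at 0)"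
      unfolding v_def
    proof (rule has_derivative_linear_family[where \<beta>="dird \<kappa>", OF KB_open _ _ _ cd])
      show "((\<lambda>t. PT t X) has_derivative (\<lambda>s. s *\<^sub>R - christoffel G y0 Z X)) (at 0)"
        using PT'[of X] by (simp only: has_vector_derivative_def)
      show "z \<in> K ` B \<Longrightarrow> linear (dird \<kappa> z)" for z
        by (rule linear_dird[OF smooth_at_differentiable[OF \<kappa>_smooth]])
      show "(\<lambda>y. dird \<kappa> y u) differentiable (at (c 0))" for u
        unfolding c0 by (rule smooth_at_differentiable[OF smooth_at_dird[OF \<kappa>_smooth[OF y0_KB]]])
    qed (simp add: c0 y0_KB)
    moreover have "dird (\<lambda>y. dird \<kappa> y X) y0 (s *\<^sub>R Z) = s *\<^sub>R christoffel G y0 Z X" for s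
      unfolding christoffel_eq
      by (rule linear_scale[OF linear_dird[OF smooth_at_differentiable[OF smooth_at_dird[OF \<kappa>_smooth[OF y0_KB]]]]])
    ultimately show ?thesis by (simp add: c0 PT0 dird_\<kappa>_y0)
  qed
  have P': "((\<lambda>t. taylor (\<psi> (x t)) n w) has_derivative (\<lambda>s. NF.dpsi n (s *\<^sub>R Z) w)) (at 0)" for w
    using has_derivative_compose[OF xd, of "\<lambda>x. taylor (\<psi> x) n w"] NF.taylor_\<psi>_has_derivative[of n w] by (simp add: x0)
  have "((\<lambda>t. taylor (\<psi> (x t)) n (v t)) has_derivative (\<lambda>s. NF.dpsi n (s *\<^sub>R Z) (v 0) + dird (taylor (\<psi> (x 0)) n) (v 0) 0)) (at 0)"
    by (rule has_derivative_hom_poly_family[where P="\<lambda>t. taylor (\<psi> (x t)) n", OF Nt(1,2) hom_poly_taylor[OF NF.\<psi>[OF xB]] P' vd])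
  moreover have "v 0 = X" by (simp add: v_def c0 PT0 dird_\<kappa>_y0)
  moreover have "dird (taylor (\<psi> 0) n) X 0 = 0"
    by (rule linear_0[OF linear_dird[OF hom_poly_differentiable[OF hom_poly_taylor[OF NF.\<psi>[OF zero_B]]]]])
  moreover have "NF.dpsi n (s *\<^sub>R Z) X = s *\<^sub>R NF.dpsi n Z X" for s
    using linear_scale[OF has_derivative_linear[OF NF.taylor_\<psi>_has_derivative[of n X]]] .
  ultimately have "((\<lambda>t. taylor (\<psi> (x t)) n (v t)) has_derivative (\<lambda>s. s *\<^sub>R NF.dpsi n Z X)) (at 0)"
    by (simp add: x0)
  then have "((\<lambda>t. taylor (knc_shift knc p B' \<gamma> PT t) n X) has_derivative (\<lambda>s. s *\<^sub>R NF.dpsi n Z X)) (at 0)"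
    by (rule has_derivative_cong_nhds, use ev in eventually_elim) (simp add: main)
  then show ?thesis by (simp add: has_vector_derivative_def)
qed

end

text \<open>Because the representative is smooth in \<open>(t, X)\<close> jointly, its time
  derivative commutes with Taylor components in \<open>X\<close>, and uniqueness of derivatives
  identifies the result with the componentwise derivative.\<close>

lemma hol_extended_field_taylor:
  assumes W: "hol_extended_field knc p B \<gamma> PT W"
    and d: "((\<lambda>t. taylor (knc_shift knc p B \<gamma> PT t) n X) has_vector_derivative \<zeta>) (at 0)"
  shows "taylor W n X = \<zeta>"
proof -
  obtain F N where N: "open N" "(0, 0) \<in> N" and F: "smooth_on F N"
    and eq: "\<forall>\<^sub>F t in nhds 0. \<forall>\<^sub>F X in nhds 0. F (t, X) = knc_shift knc p B \<gamma> PT t X"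
    and dF: "\<forall>\<^sub>F X in nhds 0. ((\<lambda>t. F (t, X)) has_vector_derivative W X) (at 0)"
    using W by (auto simp: hol_extended_field_def)
  have sF: "smooth_at (0, 0) F" by (rule smooth_on_imp_smooth_at[OF N(1) F N(2)])
  have inc: "((\<lambda>t. (t, 0)) has_derivative (\<lambda>t. (t, 0))) (at (0::real))"
    by (auto intro!: derivative_eq_intros)
  have "((\<lambda>t. tc n (\<lambda>s. F ((t, 0) + s *\<^sub>R (0, X)))) has_derivative (\<lambda>t. tc n (\<lambda>s. dird F ((0, 0) + s *\<^sub>R (0, X)) (t, 0)))) (at 0)"
    using has_derivative_compose[OF inc tc_line_derivative[OF sF, of n "(0, X)"]] by simp
  then have "((\<lambda>t. tc n (\<lambda>s. F (t, s *\<^sub>R X))) has_derivative (\<lambda>t. tc n (\<lambda>s. dird F (0, s *\<^sub>R X) (t, 0)))) (at 0)"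
    by simp
  then have "((\<lambda>t. taylor (knc_shift knc p B \<gamma> PT t) n X) has_derivative (\<lambda>t. tc n (\<lambda>s. dird F (0, s *\<^sub>R X) (t, 0)))) (at 0)"
  proof (rule has_derivative_cong_nhds, use eq in eventually_elim)
    case (elim t)
    from taylor_cong[OF this, of n X] show ?case by (simp add: taylor_eq_tc)
  qed
  from has_derivative_unique[OF this d[unfolded has_vector_derivative_def]]
  have "tc n (\<lambda>s. dird F (0, s *\<^sub>R X) (1, 0)) = \<zeta>" by (metis scaleR_one)
  moreover have "\<forall>\<^sub>F Y in nhds 0. dird F (0, Y) (1, 0) = W Y"
  proof -
    have "\<forall>\<^sub>F Y in nhds 0. smooth_at (0, Y) F"
      by (rule smooth_at_compose_eventually[where g="\<lambda>Y. (0, Y)" and x=0, OF _ smooth_at_eventually])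
        (auto intro!: smooth_at_linear sF bounded_linear_Pair)
    with dF show ?thesis
    proof eventually_elim
      case (elim Y)
      have "((\<lambda>t. F ((0, Y) + t *\<^sub>R (1, 0))) has_vector_derivative dird F ((0, Y) + 0 *\<^sub>R (1, 0)) (1, 0)) (at 0)"
        by (rule has_vector_derivative_line) (use elim in \<open>simp add: smooth_at_differentiable\<close>)
      with elim(1) show ?case by (simp add: vector_derivative_unique_at)
    qed
  qed
  from eventually_on_ray[OF this, of X] have "tc n (\<lambda>s. dird F (0, s *\<^sub>R X) (1, 0)) = tc n (\<lambda>s. W (s *\<^sub>R X))"
    by (rule tc_cong)
  ultimately show ?thesis by (simp add: taylor_eq_tc)
qed

theorem lemma4p11:
  fixes M :: "'m topology"
    and A :: "('m, 'a::euclidean_space) chart set"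
    and g :: "('m, 'a) chart \<Rightarrow> 'a \<Rightarrow> 'a \<Rightarrow> 'a \<Rightarrow> real"
    and J :: "('m, 'a) chart \<Rightarrow> 'a \<Rightarrow> 'a \<Rightarrow> 'a"
    and U :: "'m set" and \<phi> :: "'m \<Rightarrow> 'a" and p :: 'm and Z :: 'a
    and knc :: "'m \<Rightarrow> 'a \<Rightarrow> 'm" and \<theta>loc :: "'m \<Rightarrow> 'm \<Rightarrow> real"
    and \<theta> :: "'m \<Rightarrow> ('a, real) formal_series"
    and \<theta>free \<theta>crit pr1 :: "('a, real) formal_series"
    and V :: "('a, 'a) formal_series"
  assumes "kaehler_manifold M A g J"
    and "real_analytic_metric A g J"
    and "(U, \<phi>) \<in> A" and "p \<in> U"
    and "\<forall>q\<in>U. kaehler_normal (U, \<phi>) (g (U, \<phi>)) (J (U, \<phi>)) q (knc q) (\<theta>loc q)"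
    and "\<theta> = (\<lambda>q. taylor (\<theta>loc q \<circ> knc q))"
    and "\<theta>free = (\<lambda>n X. \<theta> p n X - (if n = 2 then g (U, \<phi>) (\<phi> p) X X else 0))"
    and "\<theta>crit = pr_bidegrees (J (U, \<phi>) (\<phi> p)) critical \<theta>free"
    and "pr1 = pr_bidegrees (J (U, \<phi>) (\<phi> p)) some1 (contract Z \<theta>crit)"
    and "V = closure_inverse (g (U, \<phi>) (\<phi> p)) (J (U, \<phi>) (\<phi> p)) pr1"
  shows "(contract Z \<theta>crit =
      (\<lambda>n X. pr1 n X + pr_bidegrees (J (U, \<phi>) (\<phi> p)) ge22 (contract Z \<theta>crit) n X)) \<and>
    (only_bidegrees (J (U, \<phi>) (\<phi> p)) ge22
      (pr_bidegrees (J (U, \<phi>) (\<phi> p)) ge22 (contract Z \<theta>crit))) \<and>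
    (only_bidegrees (J (U, \<phi>) (\<phi> p)) some1 pr1) \<and>
    (\<forall>n. V n \<in> hol_poly_fields (J (U, \<phi>) (\<phi> p)) n) \<and>
    (closure_series (g (U, \<phi>) (\<phi> p)) V = pr1) \<and>
    (\<forall>B \<gamma> PT. holomorphic_anchored (U, \<phi>) (J (U, \<phi>)) p B (knc p) \<longrightarrow>
      curve_with_transport (U, \<phi>) (g (U, \<phi>)) p Z \<gamma> PT \<longrightarrow>
        hol_extended_series knc p B \<gamma> PT (\<lambda>n X. constant_field Z n X - (1/2) *\<^sub>R V n X) \<and>
        (\<forall>W. hol_extended_field knc p B \<gamma> PT W \<longrightarrow>
           taylor W = (\<lambda>n X. constant_field Z n X - (1/2) *\<^sub>R V n X))) \<and>
    (has_covariant_derivative (U, \<phi>) (g (U, \<phi>)) p Z \<theta>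
      (\<lambda>n X. pr_bidegrees (J (U, \<phi>) (\<phi> p)) ge22 (contract Z \<theta>free) n X
              - (1/2) * derivation V \<theta>free n X))"
proof -
  let ?c = "(U, \<phi>)"
  have sm: "smooth_manifold M A" and riem: "riemannian_metric_on (\<phi> ` U) (g ?c)"
    and orth: "orthogonal_almost_complex_on (\<phi> ` U) (g ?c) (J ?c)"
    using assms(1,3) by (auto simp: kaehler_manifold_def)
  then have oU: "openin M U" and oS: "open (\<phi> ` U)"
    and hm: "homeomorphic_map (subtopology M U) (top_of_set (\<phi> ` U)) \<phi>"
    using assms(3) by (auto simp: smooth_manifold_def)
  have inj: "inj_on \<phi> U"
    using homeomorphic_imp_injective_map[OF hm] openin_subset[OF oU] by (simp add: inf_absorb2)
  obtain B where B: "holomorphic_anchored ?c (J ?c) p B (knc p)"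
    "local_potential_on (\<phi> ` knc p ` B) (g ?c) (J ?c) (\<theta>loc p \<circ> inv_into U \<phi>)"
    using assms(4,5) by (auto simp: kaehler_normal_def)
  interpret anchored \<phi> U "g ?c" "J ?c" p "knc p" B
    by unfold_locales (fact oS riem orth inj B(1))+
  interpret kaehler_normal_chart \<phi> U "g ?c" "J ?c" p knc B \<theta>loc
    by unfold_locales (use B(2) assms(5) in \<open>auto simp: K_def image_comp\<close>)
  note bideg\<theta> = NF.bideg_\<theta>f
  have free: "\<theta>free = NF.\<theta>f"
    unfolding assms(6,7) NF.\<theta>f_def by (simp add: F_def)
  have crit: "\<theta>crit = NF.crit NF.\<theta>f"
    unfolding assms(8) free by (rule ext) (simp add: NF.crit_def[OF bideg\<theta>] NF.pr_bidegrees_eq_prj)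
  have pr1: "pr1 = NF.dcrit1 NF.\<theta>f Z"
    unfolding assms(9) crit by (rule ext) (simp add: NF.dcrit1_def[OF bideg\<theta>] NF.pr_bidegrees_eq_prj)
  have V: "V = NF.closure_field NF.\<theta>f Z"
    unfolding assms(10) pr1 by (simp add: NF.closure_field_def[OF bideg\<theta>])
  \<comment> \<open>In degree 0 the field \<open>V\<close> vanishes and in positive degrees the
    constant field does, so the case distinction in \<open>dpsi\<close> becomes a
    difference.\<close>
  have series: "NF.dpsi n Z X = constant_field Z n X - (1/2) *\<^sub>R V n X" for n X
    using NF.closure_field_low[OF bideg\<theta>, of 0 Z X] by (simp add: NF.dpsi_def constant_field_def V)
  have 1: "contract Z \<theta>crit = (\<lambda>n X. pr1 n X + pr_bidegrees (J ?c (\<phi> p)) ge22 (contract Z \<theta>crit) n X)"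
    unfolding crit pr1 NF.pr_bidegrees_eq_prj by (intro ext) (rule NF.contract_crit_split[OF bideg\<theta>])
  have 2: "only_bidegrees (J ?c (\<phi> p)) ge22 (pr_bidegrees (J ?c (\<phi> p)) ge22 (contract Z \<theta>crit))"
    unfolding crit NF.only_bidegrees_iff_sp NF.pr_bidegrees_eq_prj
    by (intro allI NF.bideg_prj[OF sym_ge22 NF.bideg_hom_poly[OF NF.bideg_contract_crit[OF bideg\<theta>]]])
  have 3: "only_bidegrees (J ?c (\<phi> p)) some1 pr1"
    unfolding pr1 NF.only_bidegrees_iff_sp by (intro allI NF.bideg_dcrit1[OF bideg\<theta>])
  have 4: "\<forall>n. V n \<in> hol_poly_fields (J ?c (\<phi> p)) n"
    unfolding V by (intro allI NF.closure_field_hol[OF bideg\<theta>])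
  have 5: "closure_series (g ?c (\<phi> p)) V = pr1"
    unfolding V pr1 by (rule NF.closure_series_field[OF bideg\<theta>])
  have 6: "hol_extended_series knc p B' \<gamma> PT (\<lambda>n X. constant_field Z n X - (1/2) *\<^sub>R V n X) \<and>
        (\<forall>W. hol_extended_field knc p B' \<gamma> PT W \<longrightarrow> taylor W = (\<lambda>n X. constant_field Z n X - (1/2) *\<^sub>R V n X))"
    if "holomorphic_anchored ?c (J ?c) p B' (knc p)" "curve_with_transport ?c (g ?c) p Z \<gamma> PT" for B' \<gamma> PT
  proof -
    have d: "((\<lambda>t. taylor (knc_shift knc p B' \<gamma> PT t) n X) has_vector_derivative
        constant_field Z n X - (1/2) *\<^sub>R V n X) (at 0)" for n X
      using shift_has_derivative[OF that(2,1), of n X] by (simp only: series)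
    then show ?thesis
      using hol_extended_field_taylor[OF _ d] by (auto simp: hol_extended_series_def fun_eq_iff)
  qed
  have 7: "has_covariant_derivative ?c (g ?c) p Z \<theta>
      (\<lambda>n X. pr_bidegrees (J ?c (\<phi> p)) ge22 (contract Z \<theta>free) n X - (1/2) * derivation V \<theta>free n X)"
    unfolding has_covariant_derivative_def prod.case
  proof (intro allI)
    fix n X
    \<comment> \<open>The last summand is the Christoffel term of the chart, which cancels in the
      covariant derivative.\<close>
    let ?D = "\<lambda>Z. NF.bideg_proj ge22 n (contract Z NF.\<theta>f n) X - (1/2) * derivation (NF.closure_field NF.\<theta>f Z) NF.\<theta>f n X
        + dird (taylor F n) X (christoffel (g ?c) (\<phi> p) Z X)"
    have "((\<lambda>x. \<theta> (inv_into U \<phi> x) n X) has_derivative ?D) (at (\<phi> p))"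
      unfolding assms(6) by (rule normal_potential_has_derivative)
    moreover have "dird (\<theta> p n) X (christoffel (g ?c) (\<phi> p) Z X) = dird (taylor F n) X (christoffel (g ?c) (\<phi> p) Z X)"
      by (simp add: assms(6) F_def)
    ultimately show "\<exists>D. ((\<lambda>x. \<theta> (inv_into U \<phi> x) n X) has_derivative D) (at (\<phi> p)) \<and>
        pr_bidegrees (J ?c (\<phi> p)) ge22 (contract Z \<theta>free) n X - (1/2) * derivation V \<theta>free n X =
        D Z - dird (\<theta> p n) X (christoffel (g ?c) (\<phi> p) Z X)"
      by (intro exI[of _ ?D]) (simp add: free V NF.pr_bidegrees_eq_prj)
  qed
  show ?thesis using 1 2 3 4 5 6 7 by blast
qed

end
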